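(* If $\eta_1<1/2$ and $\eta_2<1/2$, then $$\|H(\cdot)-\widetilde H_{\mathrm{bt}}(\cdot)\|_{\mathrm H}\le\|H(\cdot)-H_{\mathrm{bt}}(\cdot)\|_{\mathrm H}+\epsilon_{\mathrm d,\mathrm H},$$ $$\|H(\cdot)-\widetilde H_{\mathrm{bt}}(\cdot)\|_{\mathcal H_2}\le\|H(\cdot)-H_{\mathrm{bt}}(\cdot)\|_{\mathcal H_2}+\epsilon_{\mathrm d,2},$$ where $$\epsilon_{\mathrm d,\mathrm H}=\sqrt{2\sigma_1^2(\xi_1+\xi_2)+2(\zeta_1+\zeta_2)+(\xi_1+\xi_2)(\zeta_1+\zeta_2)},$$ $$\epsilon_{\mathrm d,2}=\sqrt{\min\{r,m\}}\Big[\sigma_1^2\big(\|\widehat B_1\|_2+\|\widetilde B_1\|_2\big)\|B\|_2\,\epsilon_b+\big(2\|\widehat B_1^{\mathrm T}\|_2\|\widetilde B_1\|_2\,\zeta_1+\|\widetilde B_1^{\mathrm T}\|_2^2\,\zeta_2\big)\Big]^{1/2}.$$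
   Context: **System.** $A\in\mathbb{R}^{n\times n}$, $B\in\mathbb{R}^{n\times m}$, $C\in\mathbb{R}^{n\times p}$ define the system $x'=Ax+Bu$, $y=C^{\mathrm T}x$, assumed stable (all eigenvalues of $A$ have negative real part), controllable and observable, with transfer function $H(s)=C^{\mathrm T}(sI_n-A)^{-1}B$. The Gramians $P,Q\succ0$ solve $AP+PA^{\mathrm T}+BB^{\mathrm T}=0$ and $A^{\mathrm T}Q+QA+CC^{\mathrm T}=0$. **Approximate Gramians.** $\widetilde S\in\mathbb{R}^{n\times\widetilde r_1}$, $\widetilde R\in\mathbb{R}^{n\times\widetilde r_2}$, $\widetilde P=\widetilde S\widetilde S^{\mathrm T}$, $\widetilde Q=\widetilde R\widetilde R^{\mathrm T}$ satisfy $0\preceq\widetilde P\preceq P$, $0\preceq\widetilde Q\preceq Q$, $\|P-\widetilde P\|_2\le\epsilon_1$, $\|Q-\widetilde Q\|_2\le\epsilon_2$. $E\in\mathbb{R}^{n\times p_1}$, $F\in\mathbb{R}^{n\times p_2}$ are such that $P=\widetilde P+EE^{\mathrm T}$, $Q=\widetilde Q+FF^{\mathrm T}$. Put $S=[\widetilde S,E]\in\mathbb{R}^{n\times m_1}$, $R=[\widetilde R,F]\in\mathbb{R}^{n\times m_2}$ ($m_i=\widetilde r_i+p_i$), so $P=SS^{\mathrm T}$, $Q=RR^{\mathrm T}$; it is arranged that $m_1\ge m_2$ (append zero columns to $E$ if needed). $1\le r\le n$ is the reduction order, with $\widetilde r_1,\widetilde r_2\ge r$. Let $G=S^{\mathrm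 T}R$ and $\widetilde G=\begin{bmatrix}\widetilde S^{\mathrm T}\widetilde R&0\\0&0\end{bmatrix}\in\mathbb{R}^{m_1\times m_2}$. **SVD of $G$.** $G=U\Sigma V^{\mathrm T}$ with $U=[U_1,U_2]$, $V=[V_1,V_2]$ orthogonal, $U_1\in\mathbb{R}^{m_1\times r}$, $V_1\in\mathbb{R}^{m_2\times r}$, $\Sigma=\begin{bmatrix}\Sigma_1&0\\0&\Sigma_2\end{bmatrix}\in\mathbb{R}^{m_1\times m_2}$ rectangular diagonal with diagonal entries $\sigma_1\ge\cdots\ge\sigma_{m_2}\ge0$, $\Sigma_1=\mathrm{diag}(\sigma_1,\dots,\sigma_r)$; convention $\sigma_i=0$ for $i>m_2$. **Quantities and standing assumption.** $\varepsilon=\max\{\sqrt{\|P\|_2\epsilon_2},\sqrt{\|Q\|_2\epsilon_1}\}+\sqrt{\epsilon_1\epsilon_2}$, $\delta=\sigma_r-\sigma_{r+1}$, $\underline\delta=\delta-2\varepsilon$, $\underline\sigma_r=\sigma_r-\varepsilon$. It is assumed that $\underline\delta>0$ and $\varepsilon/\underline\delta<1/2$. **Decomposition of $\widetilde G$.** Fix $\Omega\in\mathbb{R}^{(m_2-r)\times r}$, $\Gamma\in\mathbb{R}^{(m_1-r)\times r}$ with $\max\{\|\Omega\|_2,\|\Gamma\|_2\}\le2\varepsilon/\underline\delta$ such that, with $\check U_1=(U_1-U_2\Gamma)(I+\Gamma^{\mathrm T}\Gamma)^{-1/2}$, $\check U_2=(U_1\Gamma^{\mathrm T}+U_2)(I+\Gamma\Gamma^{\mathrm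 T})^{-1/2}$, $\check V_1=(V_1+V_2\Omega)(I+\Omega^{\mathrm T}\Omega)^{-1/2}$, $\check V_2=(-V_1\Omega^{\mathrm T}+V_2)(I+\Omega\Omega^{\mathrm T})^{-1/2}$, one has $\widetilde G=[\check U_1,\check U_2]\begin{bmatrix}\check\Sigma_1&0\\0&\check\Sigma_2\end{bmatrix}[\check V_1,\check V_2]^{\mathrm T}$ with $\check\Sigma_1\in\mathbb{R}^{r\times r}$ (such $\Omega,\Gamma$ exist and $\check\Sigma_1$ is nonsingular under the standing assumption). **Reduced models.** $X_1=SU_1$, $Y_1=RV_1\Sigma_1^{-1}$ (exact balanced truncation) and $\widetilde X_1=[\widetilde S,0_{n\times(m_1-\widetilde r_1)}]\check U_1$, $\widetilde Y_1=[\widetilde R,0_{n\times(m_2-\widetilde r_2)}]\check V_1\check\Sigma_1^{-1}$ (approximate balanced truncation). $\widehat A_{11}=Y_1^{\mathrm T}AX_1$, $\widehat B_1=Y_1^{\mathrm T}B$, $\widehat C_1=X_1^{\mathrm T}C$; $\widetilde A_{11}=\widetilde Y_1^{\mathrm T}A\widetilde X_1$, $\widetilde B_1=\widetilde Y_1^{\mathrm T}B$, $\widetilde C_1=\widetilde X_1^{\mathrm T}C$. Transfer functions: $H_{\mathrm{bt}}(s)=\widehat C_1^{\mathrm T}(sI_r-\widehat A_{11})^{-1}\widehat B_1$ and $\widetilde H_{\mathrm{bt}}(s)=\widetilde C_1^{\mathrm T}(sI_r-\widetilde A_{11})^{-1}\widetilde B_1$. **Error constants.** $\epsilon_x=\sqrt{\epsilon_1}+\sqrt{\|P\|_2}\,\frac{2\varepsilon}{\underline\delta}$;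 $\epsilon_y=\frac{\sqrt{\epsilon_2}}{\sigma_r}+\frac{\sqrt{\|Q\|_2}}{\sigma_r}\Big(1+\frac{\underline\delta}{2\underline\sigma_r}+\frac{2\sigma_1}{\underline\sigma_r}\Big)\frac{2\varepsilon}{\underline\delta}$; $\epsilon_a=\sqrt{\|P\|_2}\,\epsilon_y+\frac{\sqrt{\|Q\|_2}}{\sigma_r}\epsilon_x$; $\epsilon_b=\epsilon_y$; $\epsilon_c=\epsilon_x$; $\epsilon_{b2}=\sqrt{\|Q\|_2}\big(\frac1{\underline\sigma_r}+\frac1{\sigma_r}\big)\epsilon_y$; $\epsilon_{c2}=2\sqrt{\|P\|_2}\,\epsilon_x$. $K_1=\int_0^\infty e^{\widehat A_{11}t}e^{\widehat A_{11}^{\mathrm T}t}dt$, $K_2=\int_0^\infty e^{\widehat A_{11}^{\mathrm T}t}e^{\widehat A_{11}t}dt$ (well defined since $\widehat A_{11}$ is stable); $\eta_i=\|A\|_2\|K_i\|_2\epsilon_a$, $i=1,2$. $\xi_1=\frac{\|K_1\|_2}{1-\eta_1}\big(\|\widehat B_1\|_2\|B\|_2\epsilon_b+\|A\|_2\epsilon_a\big)$; $\xi_2=\frac{\|K_1\|_2}{1-2\eta_1}\big(\|BB^{\mathrm T}\|_2\epsilon_{b2}+2\|A\|_2\epsilon_a\big)$; $\zeta_1=\frac{\|K_2\|_2}{1-\eta_2}\big(\|\widehat C_1\|_2\|C\|_2\epsilon_c+\|A\|_2\epsilon_a\big)$; $\zeta_2=\frac{\|K_2\|_2}{1-2\eta_2}\big(\|CC^{\mathrm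 T}\|_2\epsilon_{c2}+2\|A\|_2\epsilon_a\big)$. **Norms.** For a transfer function $\mathsf C^{\mathrm T}(sI-\mathsf A)^{-1}\mathsf B$ with $\mathsf A$ stable and Gramians $\mathsf P,\mathsf Q$ solving $\mathsf A\mathsf P+\mathsf P\mathsf A^{\mathrm T}+\mathsf B\mathsf B^{\mathrm T}=0$, $\mathsf A^{\mathrm T}\mathsf Q+\mathsf Q\mathsf A+\mathsf C\mathsf C^{\mathrm T}=0$, the Hankel norm is $\|\cdot\|_{\mathrm H}=\sqrt{\lambda_{\max}(\mathsf P\mathsf Q)}$, which equals the $\mathcal L_2$-induced norm of the Hankel operator $\mathcal L_2(-\infty,0]\to\mathcal L_2[0,\infty)$, $u\mapsto\int_{-\infty}^0\mathsf C^{\mathrm T}e^{\mathsf A(t-\tau)}\mathsf Bu(\tau)\,d\tau$, and the $\mathcal H_2$-norm is $\|\cdot\|_{\mathcal H_2}=\sqrt{\mathrm{tr}(\mathsf B^{\mathrm T}\mathsf Q\mathsf B)}=\sqrt{\mathrm{tr}(\mathsf C^{\mathrm T}\mathsf P\mathsf C)}$. The difference of two transfer functions with realizations $(\mathsf A_1,\mathsf B_1,\mathsf C_1)$, $(\mathsf A_2,\mathsf B_2,\mathsf C_2)$ is realized by $\mathrm{diag}(\mathsf A_1,\mathsf A_2)$, $\begin{bmatrix}\mathsf B_1\\\mathsf B_2\end{bmatrix}$, $\begin{bmatrix}\mathsf C_1\\-\mathsf C_2\end{bmatrix}$. *)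

theory Defs
  imports "HOL-Analysis.Analysis" "Jordan_Normal_Form.Spectral_Radius"
begin

unbundle no vec_syntax
unbundle no inner_syntax

definition append_cols :: "'a :: zero mat \<Rightarrow> 'a mat \<Rightarrow> 'a mat" (infixr "@\<^sub>c" 65) where
  "A @\<^sub>c B = four_block_mat A B (0\<^sub>m 0 (dim_col A)) (0\<^sub>m 0 (dim_col B))"

definition block_diag :: "'a :: zero mat \<Rightarrow> 'a mat \<Rightarrow> 'a mat" where
  "block_diag A B =
     four_block_mat A (0\<^sub>m (dim_row A) (dim_col B)) (0\<^sub>m (dim_row B) (dim_col A)) B"

text \<open>The diagonal entries are \<open>d 1, d 2, \<dots>\<close>: sequences of singular values are
  indexed from 1, matrices from 0.\<close>

definition rect_diag :: "nat \<Rightarrow> nat \<Rightarrow> (nat \<Rightarrow> real) \<Rightarrow> real mat" where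
  "rect_diag k l d = mat k l (\<lambda>(i, j). if i = j then d (Suc i) else 0)"

definition mat_tr :: "'a :: comm_monoid_add mat \<Rightarrow> 'a" where
  "mat_tr A = (\<Sum>i<dim_row A. A $$ (i, i))"

definition mat_inv :: "'a :: field mat \<Rightarrow> 'a mat" where
  "mat_inv A = the (mat_inverse A)"

definition vec_norm2 :: "real vec \<Rightarrow> real" where
  "vec_norm2 v = sqrt (v \<bullet> v)"

text \<open>The spectral norm. Taking the supremum over the closed unit ball rather than the unit
  sphere gives the value 0 for matrices without columns.\<close>

definition norm2 :: "real mat \<Rightarrow> real" where
  "norm2 A = Sup {vec_norm2 (A *\<^sub>v v) | v. v \<in> carrier_vec (dim_col A) \<and> vec_norm2 v \<le> 1}"

definition orth_mat :: "real mat \<Rightarrow> bool" where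
  "orth_mat U \<longleftrightarrow> square_mat U \<and> U\<^sup>T * U = 1\<^sub>m (dim_row U) \<and> U * U\<^sup>T = 1\<^sub>m (dim_row U)"

definition psd :: "real mat \<Rightarrow> bool" where
  "psd M \<longleftrightarrow> square_mat M \<and> M\<^sup>T = M \<and> (\<forall>v \<in> carrier_vec (dim_row M). 0 \<le> v \<bullet> (M *\<^sub>v v))"

definition pos_def :: "real mat \<Rightarrow> bool" where
  "pos_def M \<longleftrightarrow> square_mat M \<and> M\<^sup>T = M \<and>
     (\<forall>v \<in> carrier_vec (dim_row M). v \<noteq> 0\<^sub>v (dim_row M) \<longrightarrow> 0 < v \<bullet> (M *\<^sub>v v))"

definition psd_sqrt :: "real mat \<Rightarrow> real mat" where
  "psd_sqrt M = (THE X. X \<in> carrier_mat (dim_row M) (dim_row M) \<and> psd X \<and> X * X = M)"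

definition inv_sqrt :: "real mat \<Rightarrow> real mat" where
  "inv_sqrt M = mat_inv (psd_sqrt M)"

definition mat_exp :: "real mat \<Rightarrow> real mat" where
  "mat_exp A = mat (dim_row A) (dim_row A) (\<lambda>ij. \<Sum>k. (A ^\<^sub>m k) $$ ij / fact k)"

definition mat_integral :: "real set \<Rightarrow> nat \<Rightarrow> nat \<Rightarrow> (real \<Rightarrow> real mat) \<Rightarrow> real mat" where
  "mat_integral T k l F = mat k l (\<lambda>ij. integral T (\<lambda>t. F t $$ ij))"

abbreviation cmat :: "real mat \<Rightarrow> complex mat" where
  "cmat \<equiv> map_mat complex_of_real"

definition stable :: "real mat \<Rightarrow> bool" where
  "stable A \<longleftrightarrow> (\<forall>z. eigenvalue (cmat A) z \<longrightarrow> Re z < 0)"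

definition state_trajectory ::
  "real mat \<Rightarrow> real mat \<Rightarrow> real set \<Rightarrow> (real \<Rightarrow> real vec) \<Rightarrow> (real \<Rightarrow> real vec) \<Rightarrow> bool" where
  "state_trajectory A B T u x \<longleftrightarrow>
     (\<forall>t\<in>T. x t \<in> carrier_vec (dim_row A) \<and>
        (\<forall>i<dim_row A. ((\<lambda>s. x s $ i) has_real_derivative (A *\<^sub>v x t + B *\<^sub>v u t) $ i)
          (at t within T)))"

definition controllable :: "real mat \<Rightarrow> real mat \<Rightarrow> bool" where
  "controllable A B \<longleftrightarrow>
     (\<forall>x0 \<in> carrier_vec (dim_row A). \<forall>x1 \<in> carrier_vec (dim_row A). \<exists>T>0. \<exists>u x.
        (\<forall>t\<in>{0..T}. u t \<in> carrier_vec (dim_col B)) \<and>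
        (\<forall>j<dim_col B. continuous_on {0..T} (\<lambda>t. u t $ j)) \<and>
        state_trajectory A B {0..T} u x \<and> x 0 = x0 \<and> x T = x1)"

text \<open>The output is \<open>y = C\<^sup>T x\<close>. By linearity, observability means that no nonzero
  initial state yields the zero output under zero input.\<close>

definition observable :: "real mat \<Rightarrow> real mat \<Rightarrow> bool" where
  "observable A C \<longleftrightarrow>
     (\<forall>x. state_trajectory A (0\<^sub>m (dim_row A) 1) {0..} (\<lambda>_. 0\<^sub>v 1) x \<and>
        (\<forall>t\<ge>0. C\<^sup>T *\<^sub>v x t = 0\<^sub>v (dim_col C)) \<longrightarrow> x 0 = 0\<^sub>v (dim_row A))"

definition lyapunov_eq :: "real mat \<Rightarrow> real mat \<Rightarrow> real mat \<Rightarrow> bool" where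
  "lyapunov_eq A W X \<longleftrightarrow> X \<in> carrier_mat (dim_row A) (dim_row A) \<and>
     A * X + X * A\<^sup>T + W = 0\<^sub>m (dim_row A) (dim_row A)"

text \<open>For stable \<open>A\<close> the Lyapunov equation has exactly one solution.\<close>

definition ctrl_gramian :: "real mat \<Rightarrow> real mat \<Rightarrow> real mat" where
  "ctrl_gramian A B = (THE P. lyapunov_eq A (B * B\<^sup>T) P)"

definition obs_gramian :: "real mat \<Rightarrow> real mat \<Rightarrow> real mat" where
  "obs_gramian A C = (THE Q. lyapunov_eq (A\<^sup>T) (C * C\<^sup>T) Q)"

definition transfer_fun :: "real mat \<Rightarrow> real mat \<Rightarrow> real mat \<Rightarrow> complex \<Rightarrow> complex mat" where
  "transfer_fun A B C s =
     (cmat C)\<^sup>T * mat_inv (s \<cdot>\<^sub>m 1\<^sub>m (dim_row A) - cmat A) * cmat B"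

text \<open>Transfer functions are compared on the closed right half-plane, where those of stable
  systems have no poles; at a pole the value of \<^const>\<open>transfer_fun\<close> is meaningless.\<close>

definition stable_realization ::
  "(complex \<Rightarrow> complex mat) \<Rightarrow> real mat \<Rightarrow> real mat \<Rightarrow> real mat \<Rightarrow> bool" where
  "stable_realization G A B C \<longleftrightarrow>
     square_mat A \<and> 0 < dim_row A \<and> dim_row B = dim_row A \<and> dim_row C = dim_row A \<and> stable A \<and>
     (\<forall>s. 0 \<le> Re s \<longrightarrow> G s = transfer_fun A B C s)"

definition lambda_max :: "real mat \<Rightarrow> real" where
  "lambda_max M = Max {x. eigenvalue M x}"

text \<open>The Hankel and \<open>H\<^sub>2\<close> norms of a transfer function are computed from the Gramians of a
  stable realization, not necessarily minimal; the value does not depend on the realization.\<close>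

definition hankel_norm :: "(complex \<Rightarrow> complex mat) \<Rightarrow> real" where
  "hankel_norm G = (THE h. \<exists>A B C. stable_realization G A B C \<and>
     h = sqrt (lambda_max (ctrl_gramian A B * obs_gramian A C)))"

definition h2_norm :: "(complex \<Rightarrow> complex mat) \<Rightarrow> real" where
  "h2_norm G = (THE h. \<exists>A B C. stable_realization G A B C \<and>
     h = sqrt (mat_tr (B\<^sup>T * obs_gramian A C * B)))"

end

theory Submission
  imports Defs
begin

text \<open>
  All real matrices are embedded in one normed algebra of finitely supported matrices, in which
  \<open>Id_n n * X = X\<close> says that \<open>X\<close> has at most \<open>n\<close> rows.

  The triangle inequality for the two norms, proved on a parallel connection, reduces the claim to
  the difference of the two reduced models. With \<open>\<mu> = \<epsilon> / \<delta> < 1/4\<close>, the rotation matrices \<open>Gamma\<close> and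
  \<open>Omega\<close> are of size \<open>5\<mu>/4\<close>, but the truncation matrices change only by \<open>O(\<mu>\<^sup>2)\<close>: the invertibility
  of \<open>Sc1\<close> forces the projections onto the discarded columns \<open>E\<close> and \<open>F\<close> to annihilate \<open>Uc1\<close> and
  \<open>Vc1\<close>, so that the residual of the singular subspace equations contains a discarded factor twice.
  Writing the Gramians of the two reduced models as \<open>S\<^sub>1 S\<^sub>1\<^sup>T\<close> and \<open>S\<^sub>2 S\<^sub>2\<^sup>T\<close> and their cross Gramian as
  \<open>S\<^sub>1 S\<^sub>2\<^sup>T\<close>, the matrix \<open>(S\<^sub>2 - S\<^sub>1) (S\<^sub>2 - S\<^sub>1)\<^sup>T\<close> solves a Lyapunov equation with small right-hand side
  and is bounded by a multiple of \<open>K\<^sub>i\<close>. The quadratic gain in \<open>\<mu>\<close> is what makes the constants \<open>\<zeta>\<^sub>i\<close>,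
  which contain no factor \<open>\<sigma>\<^sub>1\<^sup>2\<close>, large enough.
\<close>

section \<open>Finitely supported matrices and their operator norm\<close>

typedef fsmat = "{f :: nat \<Rightarrow> nat \<Rightarrow> real. \<exists>N. \<forall>i j. f i j \<noteq> 0 \<longrightarrow> i < N \<and> j < N}"
  morphisms ent Abs_fsmat
  by (intro exI[of _ "\<lambda>_ _. 0"] CollectI exI[of _ 0]) simp

setup_lifting type_definition_fsmat

lemma fsmat_eqI: "(\<And>i j. ent A i j = ent B i j) \<Longrightarrow> A = B"
  by transfer auto

definition bounded_by :: "nat \<Rightarrow> fsmat \<Rightarrow> bool" where
  "bounded_by N A \<longleftrightarrow> (\<forall>i j. ent A i j \<noteq> 0 \<longrightarrow> i < N \<and> j < N)"

lemma ex_bounded_by: "\<exists>N. bounded_by N A"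
  unfolding bounded_by_def by transfer simp

lemma bounded_by_mono: "bounded_by N A \<Longrightarrow> N \<le> M \<Longrightarrow> bounded_by M A"
  unfolding bounded_by_def by (blast intro: less_le_trans)

lemma ex_bounded_by2: "\<exists>N. bounded_by N A \<and> bounded_by N B"
proof -
  obtain N M where "bounded_by N A" "bounded_by M B" using ex_bounded_by by metis
  then have "bounded_by (max N M) A \<and> bounded_by (max N M) B"
    by (auto intro: bounded_by_mono)
  then show ?thesis ..
qed

lemma ex_bounded_by3: "\<exists>N. bounded_by N A \<and> bounded_by N B \<and> bounded_by N C"
proof -
  obtain N M where "bounded_by N A \<and> bounded_by N B" "bounded_by M C"
    using ex_bounded_by ex_bounded_by2 by metis
  then have "bounded_by (max N M) A \<and> bounded_by (max N M) B \<and> bounded_by (max N M) C"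
    by (auto intro: bounded_by_mono)
  then show ?thesis ..
qed

instantiation fsmat :: ab_group_add
begin
lift_definition zero_fsmat :: fsmat is "\<lambda>_ _. 0" by simp
lift_definition plus_fsmat :: "fsmat \<Rightarrow> fsmat \<Rightarrow> fsmat" is "\<lambda>f g i j. f i j + g i j"
proof -
  fix f g :: "nat \<Rightarrow> nat \<Rightarrow> real"
  assume "\<exists>N. \<forall>i j. f i j \<noteq> 0 \<longrightarrow> i < N \<and> j < N" "\<exists>N. \<forall>i j. g i j \<noteq> 0 \<longrightarrow> i < N \<and> j < N"
  then obtain N M where N: "\<And>i j. f i j \<noteq> 0 \<Longrightarrow> i < N \<and> j < N" "\<And>i j. g i j \<noteq> 0 \<Longrightarrow> i < M \<and> j < M"
    by blast
  have "i < max N M \<and> j < max N M" if "f i j + g i j \<noteq> 0" for i j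
  proof (cases "f i j = 0")
    case True
    then have "g i j \<noteq> 0" using that by simp
    then show ?thesis using N(2) by (simp add: less_max_iff_disj)
  next
    case False
    then show ?thesis using N(1) by (simp add: less_max_iff_disj)
  qed
  then show "\<exists>N. \<forall>i j. f i j + g i j \<noteq> 0 \<longrightarrow> i < N \<and> j < N" by blast
qed
lift_definition uminus_fsmat :: "fsmat \<Rightarrow> fsmat" is "\<lambda>f i j. - f i j" by simp
definition minus_fsmat :: "fsmat \<Rightarrow> fsmat \<Rightarrow> fsmat" where "minus_fsmat A B = A + (- B)"
instance
proof
  fix A B C :: fsmat
  show "A + B + C = A + (B + C)" "A + B = B + A" "0 + A = A" "- A + A = 0" "A - B = A + - B"
    by (rule fsmat_eqI; simp add: plus_fsmat.rep_eq zero_fsmat.rep_eq uminus_fsmat.rep_eq minus_fsmat_def)+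
qed
end

instantiation fsmat :: real_vector
begin
lift_definition scaleR_fsmat :: "real \<Rightarrow> fsmat \<Rightarrow> fsmat" is "\<lambda>c f i j. c * f i j"
  unfolding mult_eq_0_iff de_Morgan_disj by blast
instance
proof
  fix A B :: fsmat and a b :: real
  show "a *\<^sub>R (A + B) = a *\<^sub>R A + a *\<^sub>R B" "(a + b) *\<^sub>R A = a *\<^sub>R A + b *\<^sub>R A"
    "a *\<^sub>R b *\<^sub>R A = (a * b) *\<^sub>R A" "1 *\<^sub>R A = A"
    by (rule fsmat_eqI; simp add: plus_fsmat.rep_eq scaleR_fsmat.rep_eq ring_distribs mult.assoc)+
qed
end

lemma ent_simps [simp]:
  "ent 0 i j = 0" "ent (A + B) i j = ent A i j + ent B i j" "ent (- A) i j = - ent A i j"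
  "ent (A - B) i j = ent A i j - ent B i j" "ent (c *\<^sub>R A) i j = c * ent A i j"
proof -
  show "ent (A - B) i j = ent A i j - ent B i j"
    unfolding minus_fsmat_def plus_fsmat.rep_eq uminus_fsmat.rep_eq by (rule diff_conv_add_uminus[symmetric])
qed (simp_all add: zero_fsmat.rep_eq plus_fsmat.rep_eq uminus_fsmat.rep_eq scaleR_fsmat.rep_eq)

lemma ent_sum [simp]: "ent (sum f S) i j = (\<Sum>x\<in>S. ent (f x) i j)"
  by (induction S rule: infinite_finite_induct) auto

lemma bounded_by_scaleR: "bounded_by N A \<Longrightarrow> bounded_by N (c *\<^sub>R A)"
  unfolding bounded_by_def ent_simps mult_eq_0_iff by blast

lemma bounded_by_add:
  assumes "bounded_by N A" "bounded_by N B" shows "bounded_by N (A + B)"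
  unfolding bounded_by_def
proof (intro allI impI)
  fix i j assume "ent (A + B) i j \<noteq> 0"
  then have "ent A i j \<noteq> 0 \<or> ent B i j \<noteq> 0" by auto
  then show "i < N \<and> j < N" using assms unfolding bounded_by_def by blast
qed

lemma bounded_byD1: "bounded_by N A \<Longrightarrow> \<not> i < N \<Longrightarrow> ent A i j = 0"
  and bounded_byD2: "bounded_by N A \<Longrightarrow> \<not> j < N \<Longrightarrow> ent A i j = 0"
  unfolding bounded_by_def by blast+

lift_definition tp :: "fsmat \<Rightarrow> fsmat" is "\<lambda>f i j. f j i" by blast

instantiation fsmat :: times
begin
lift_definition times_fsmat :: "fsmat \<Rightarrow> fsmat \<Rightarrow> fsmat" is
  "\<lambda>f g i j. \<Sum>k | f i k \<noteq> 0. f i k * g k j"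
proof -
  fix f g :: "nat \<Rightarrow> nat \<Rightarrow> real"
  assume "\<exists>N. \<forall>i j. f i j \<noteq> 0 \<longrightarrow> i < N \<and> j < N" "\<exists>N. \<forall>i j. g i j \<noteq> 0 \<longrightarrow> i < N \<and> j < N"
  then obtain N M where N: "\<And>i j. f i j \<noteq> 0 \<Longrightarrow> i < N" "\<And>i j. g i j \<noteq> 0 \<Longrightarrow> j < M" by blast
  have "i < max N M \<and> j < max N M" if "(\<Sum>k | f i k \<noteq> 0. f i k * g k j) \<noteq> 0" for i j
  proof -
    obtain k where "f i k * g k j \<noteq> 0" using \<open>_ \<noteq> 0\<close> by (meson sum.neutral)
    then show ?thesis using N by (metis less_max_iff_disj mult_eq_0_iff)
  qed
  then show "\<exists>N. \<forall>i j. (\<Sum>k | f i k \<noteq> 0. f i k * g k j) \<noteq> 0 \<longrightarrow> i < N \<and> j < N" by blast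
qed
instance ..
end

lemma ent_times:
  assumes "bounded_by N A \<or> bounded_by N B"
  shows "ent (A * B) i j = (\<Sum>k<N. ent A i k * ent B k j)"
proof -
  obtain M where M: "bounded_by M A" using ex_bounded_by by blast
  have fin: "finite {k. ent A i k \<noteq> 0}"
    by (rule finite_subset[OF _ finite_lessThan[of M]]) (use bounded_byD2[OF M] in blast)
  have "ent (A * B) i j = (\<Sum>k | ent A i k \<noteq> 0. ent A i k * ent B k j)"
    by transfer simp
  also have "\<dots> = (\<Sum>k \<in> {k. ent A i k \<noteq> 0} \<union> {..<N}. ent A i k * ent B k j)"
    by (rule sum.mono_neutral_left) (simp_all add: fin)
  also have "\<dots> = (\<Sum>k<N. ent A i k * ent B k j)"
  proof (rule sum.mono_neutral_right)
    show "\<forall>k\<in>{k. ent A i k \<noteq> 0} \<union> {..<N} - {..<N}. ent A i k * ent B k j = 0"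
      using assms by (metis DiffD2 bounded_byD1 bounded_byD2 lessThan_iff mult_eq_0_iff)
  qed (simp_all add: fin)
  finally show ?thesis .
qed

lemma ent_tp [simp]: "ent (tp A) i j = ent A j i"
  by transfer simp

lemma bounded_by_tp [simp]: "bounded_by N (tp A) \<longleftrightarrow> bounded_by N A"
  unfolding bounded_by_def by (simp, blast)

lemma bounded_by_times:
  assumes "bounded_by N A" "bounded_by N B" shows "bounded_by N (A * B)"
  unfolding bounded_by_def
proof (intro allI impI)
  fix i j assume "ent (A * B) i j \<noteq> 0"
  then have "(\<Sum>k<N. ent A i k * ent B k j) \<noteq> 0" using ent_times[of N A B] assms by simp
  then obtain k where "ent A i k * ent B k j \<noteq> 0" by (meson sum.neutral)
  then have "ent A i k \<noteq> 0" "ent B k j \<noteq> 0" by auto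
  then show "i < N \<and> j < N" using assms unfolding bounded_by_def by blast
qed

instance fsmat :: ring
proof
  fix A B C :: fsmat
  obtain N where N: "bounded_by N A" "bounded_by N B" "bounded_by N C" using ex_bounded_by3 by blast
  show "A * B * C = A * (B * C)"
  proof (rule fsmat_eqI)
    fix i j
    have "ent (A * B * C) i j = (\<Sum>l<N. (\<Sum>k<N. ent A i k * ent B k l) * ent C l j)"
      by (simp add: ent_times[of N] N bounded_by_times)
    also have "\<dots> = (\<Sum>k<N. ent A i k * (\<Sum>l<N. ent B k l * ent C l j))"
      by (simp add: sum_distrib_left sum_distrib_right mult.assoc) (rule sum.swap)
    also have "\<dots> = ent (A * (B * C)) i j" by (simp add: ent_times[of N] N bounded_by_times)
    finally show "ent (A * B * C) i j = ent (A * (B * C)) i j" .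
  qed
  show "(A + B) * C = A * C + B * C"
    by (rule fsmat_eqI) (simp add: ent_times[of N] N ring_distribs sum.distrib)
  show "A * (B + C) = A * B + A * C"
    by (rule fsmat_eqI) (simp add: ent_times[of N] N ring_distribs sum.distrib)
qed

lemma tp_simps [simp]:
  "tp (tp A) = A" "tp 0 = 0" "tp (A + B) = tp A + tp B" "tp (A - B) = tp A - tp B"
  "tp (- A) = - tp A" "tp (c *\<^sub>R A) = c *\<^sub>R tp A"
       by (rule fsmat_eqI; simp)+

lemma tp_mult [simp]: "tp (A * B) = tp B * tp A"
proof -
  obtain N where N: "bounded_by N A" "bounded_by N B" using ex_bounded_by2 by blast
  then show ?thesis by (intro fsmat_eqI) (simp add: ent_times[of N] mult.commute)
qed

instantiation fsmat :: "{dist_norm, sgn_div_norm, uniformity_dist, open_uniformity}"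
begin
definition norm_fsmat :: "fsmat \<Rightarrow> real" where
  "norm_fsmat A = sqrt (\<Sum>p | ent A (fst p) (snd p) \<noteq> 0. (ent A (fst p) (snd p))\<^sup>2)"
definition dist_fsmat :: "fsmat \<Rightarrow> fsmat \<Rightarrow> real" where "dist_fsmat A B = norm (A - B)"
definition sgn_fsmat :: "fsmat \<Rightarrow> fsmat" where "sgn_fsmat A = A /\<^sub>R norm A"
definition uniformity_fsmat :: "(fsmat \<times> fsmat) filter" where
  "uniformity_fsmat = (INF e\<in>{0 <..}. principal {(x, y). dist x y < e})"
definition open_fsmat :: "fsmat set \<Rightarrow> bool" where
  "open_fsmat U \<longleftrightarrow> (\<forall>x\<in>U. eventually (\<lambda>(x', y). x' = x \<longrightarrow> y \<in> U) uniformity)"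
instance
  by standard (simp_all add: dist_fsmat_def sgn_fsmat_def uniformity_fsmat_def open_fsmat_def)
end

instantiation fsmat :: real_inner
begin
definition inner_fsmat :: "fsmat \<Rightarrow> fsmat \<Rightarrow> real" where
  "inner_fsmat A B = (\<Sum>p | ent A (fst p) (snd p) \<noteq> 0. ent A (fst p) (snd p) * ent B (fst p) (snd p))"

lemma inner_fsmat:
  assumes "bounded_by N A \<or> bounded_by N B"
  shows "inner A B = (\<Sum>i<N. \<Sum>j<N. ent A i j * ent B i j)"
proof -
  define K where "K = {p. ent A (fst p) (snd p) \<noteq> 0}"
  define T where "T = {..<N} \<times> {..<N}"
  let ?g = "\<lambda>p. ent A (fst p) (snd p) * ent B (fst p) (snd p)"
  obtain M where M: "bounded_by M A" using ex_bounded_by by blast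
  have "K \<subseteq> {..<M} \<times> {..<M}"
    using M[unfolded bounded_by_def] by (simp add: K_def subset_iff)
  then have fin: "finite K" by (rule finite_subset) simp
  have finT: "finite T" unfolding T_def by simp
  have T0: "?g p = 0" if "p \<notin> T" for p
    using assms that unfolding T_def
    by (metis bounded_byD1 bounded_byD2 lessThan_iff mult_eq_0_iff mem_Times_iff)
  have "inner A B = sum ?g K" unfolding inner_fsmat_def K_def ..
  also have "\<dots> = sum ?g (K \<union> T)"
  proof (rule sum.mono_neutral_left)
    show "\<forall>p\<in>K \<union> T - K. ?g p = 0" unfolding K_def by simp
  qed (simp_all add: fin finT)
  also have "\<dots> = sum ?g T"
    by (rule sum.mono_neutral_right) (simp_all add: fin finT T0)
  finally show ?thesis by (simp add: sum.cartesian_product case_prod_beta T_def)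
qed

instance
proof
  fix A B C :: fsmat and r :: real
  obtain N where N: "bounded_by N A" "bounded_by N B" "bounded_by N C" using ex_bounded_by3 by blast
  have sm: "bounded_by N (A + B)" "bounded_by N (r *\<^sub>R A)"
    using N by (auto intro: bounded_by_scaleR bounded_by_add)
  note [simp] = inner_fsmat[of N] N sm
  show "inner A B = inner B A" by (simp add: mult.commute)
  show "inner (A + B) C = inner A C + inner B C" by (simp add: ring_distribs sum.distrib)
  show "inner (r *\<^sub>R A) B = r * inner A B" by (simp add: sum_distrib_left mult.assoc)
  show "0 \<le> inner A A" by (simp add: sum_nonneg)
  show "(inner A A = 0) = (A = 0)"
  proof
    assume "inner A A = 0"
    then have z: "\<forall>i<N. \<forall>j<N. ent A i j = 0" by (simp add: sum_nonneg_eq_0_iff sum_nonneg)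
    show "A = 0"
    proof (rule fsmat_eqI)
      fix i j show "ent A i j = ent 0 i j"
        unfolding ent_simps(1) using z bounded_byD1[OF N(1), of i j] bounded_byD2[OF N(1), of j i] by blast
    qed
  next
    assume "A = 0"
    show "inner A A = 0" unfolding \<open>A = 0\<close> inner_fsmat_def by (simp only: ent_simps(1) mult_zero_left sum.neutral_const)
  qed
  show "norm A = sqrt (inner A A)"
    by (simp only: inner_fsmat_def norm_fsmat_def power2_eq_square)
qed
end

lemma norm_fsmat_sq: "bounded_by N A \<Longrightarrow> (norm A)\<^sup>2 = (\<Sum>i<N. \<Sum>j<N. (ent A i j)\<^sup>2)"
  unfolding power2_norm_eq_inner by (simp add: inner_fsmat[of N] power2_eq_square)

instance fsmat :: real_normed_algebra
proof
  fix A B :: fsmat and a :: real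
  obtain N where N: "bounded_by N A" "bounded_by N B" using ex_bounded_by2 by blast
  have sm: "bounded_by N (a *\<^sub>R A)" "bounded_by N (a *\<^sub>R B)"
    using N by (auto intro: bounded_by_scaleR)
  show "a *\<^sub>R A * B = a *\<^sub>R (A * B)"
    by (rule fsmat_eqI) (simp add: ent_times[of N] N sm sum_distrib_left mult.assoc)
  show "A * a *\<^sub>R B = a *\<^sub>R (A * B)"
    by (rule fsmat_eqI) (simp add: ent_times[of N] N sm sum_distrib_left mult.left_commute)
  have 1: "(norm (A * B))\<^sup>2 = (\<Sum>i<N. \<Sum>j<N. (\<Sum>k<N. ent A i k * ent B k j)\<^sup>2)"
    by (simp only: norm_fsmat_sq[OF bounded_by_times[OF N]] ent_times[OF disjI1, OF N(1)])
  have 2: "(\<Sum>i<N. \<Sum>j<N. (\<Sum>k<N. ent A i k * ent B k j)\<^sup>2)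
      \<le> (\<Sum>i<N. \<Sum>j<N. (\<Sum>k<N. (ent A i k)\<^sup>2) * (\<Sum>k<N. (ent B k j)\<^sup>2))"
    by (intro sum_mono Cauchy_Schwarz_ineq_sum)
  have 3: "(\<Sum>i<N. \<Sum>j<N. (\<Sum>k<N. (ent A i k)\<^sup>2) * (\<Sum>k<N. (ent B k j)\<^sup>2))
      = (norm A)\<^sup>2 * (norm B)\<^sup>2"
    unfolding norm_fsmat_sq[OF N(1)] norm_fsmat_sq[OF N(2)]
    by (subst sum.swap[of "\<lambda>k j. (ent B k j)\<^sup>2"]) (rule sum_product[symmetric])
  have "(norm (A * B))\<^sup>2 \<le> (norm A * norm B)\<^sup>2"
    using 1 2 3 unfolding power_mult_distrib by linarith
  then show "norm (A * B) \<le> norm A * norm B"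
    by (rule power2_le_imp_le) simp
qed

lemma inner_left_mult: "inner (A * X) Y = inner X (tp A * Y)"
proof -
  obtain N where N: "bounded_by N A" "bounded_by N X" "bounded_by N Y" using ex_bounded_by3 by blast
  have "inner (A * X) Y = (\<Sum>i<N. \<Sum>j<N. \<Sum>k<N. ent A i k * ent X k j * ent Y i j)"
    by (simp add: inner_fsmat[of N] N bounded_by_times ent_times[of N] sum_distrib_right)
  also have "\<dots> = (\<Sum>i<N. \<Sum>k<N. \<Sum>j<N. ent A i k * ent X k j * ent Y i j)"
    by (rule sum.cong[OF refl]) (rule sum.swap)
  also have "\<dots> = (\<Sum>k<N. \<Sum>i<N. \<Sum>j<N. ent A i k * ent X k j * ent Y i j)"
    by (rule sum.swap)
  also have "\<dots> = (\<Sum>k<N. \<Sum>j<N. \<Sum>i<N. ent A i k * ent X k j * ent Y i j)"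
    by (rule sum.cong[OF refl]) (rule sum.swap)
  also have "\<dots> = inner X (tp A * Y)"
    by (simp add: inner_fsmat[of N] N bounded_by_times ent_times[of N] sum_distrib_left mult.assoc mult.left_commute mult.commute)
  finally show ?thesis .
qed

lemma inner_tp: "inner (tp X) (tp Y) = inner X Y"
proof -
  obtain N where N: "bounded_by N X" "bounded_by N Y" using ex_bounded_by2 by blast
  show ?thesis by (simp add: inner_fsmat[of N] N) (rule sum.swap)
qed

lemma norm_tp [simp]: "norm (tp X) = norm X"
  by (simp only: norm_eq_sqrt_inner inner_tp)

definition opn :: "fsmat \<Rightarrow> real" where "opn A = onorm ((*) A)"

lemma opn_ge_0 [simp]: "0 \<le> opn A"
  unfolding opn_def by (rule onorm_pos_le[OF bounded_linear_mult_right])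

lemma norm_mult_opn: "norm (A * X) \<le> opn A * norm X"
  unfolding opn_def by (rule onorm[OF bounded_linear_mult_right])

lemma opn_leI: "0 \<le> c \<Longrightarrow> (\<And>X. norm (A * X) \<le> c * norm X) \<Longrightarrow> opn A \<le> c"
  unfolding opn_def by (rule onorm_bound)

lemma opn_triangle: "opn (A + B) \<le> opn A + opn B"
proof (rule opn_leI)
  fix X
  have "norm ((A + B) * X) \<le> norm (A * X) + norm (B * X)"
    by (simp add: distrib_right norm_triangle_ineq)
  also have "\<dots> \<le> opn A * norm X + opn B * norm X" by (intro add_mono norm_mult_opn)
  finally show "norm ((A + B) * X) \<le> (opn A + opn B) * norm X" by (simp add: distrib_right)
qed simp

lemma opn_mult: "opn (A * B) \<le> opn A * opn B"
proof (rule opn_leI)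
  fix X
  have "norm (A * B * X) \<le> opn A * norm (B * X)" by (simp add: norm_mult_opn mult.assoc)
  also have "\<dots> \<le> opn A * (opn B * norm X)" by (intro mult_left_mono norm_mult_opn) simp
  finally show "norm (A * B * X) \<le> (opn A * opn B) * norm X" by (simp add: mult.assoc)
qed simp

lemma opn_0 [simp]: "opn 0 = 0"
  by (rule antisym, rule opn_leI) auto

lemma opn_minus [simp]: "opn (- A) = opn A"
  by (simp add: opn_def onorm_def)

lemma opn_minus_commute: "opn (A - B) = opn (B - A)"
  using opn_minus[of "A - B"] by simp

lemma opn_diff_triangle: "opn (A - B) \<le> opn A + opn B"
  using opn_triangle[of A "- B"] by simp

lemma opn_mult_le: "opn A \<le> a \<Longrightarrow> opn B \<le> b \<Longrightarrow> opn (A * B) \<le> a * b"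
  by (meson mult_mono opn_ge_0 opn_mult order_trans)

lemma opn_add_le: "opn A \<le> a \<Longrightarrow> opn B \<le> b \<Longrightarrow> opn (A + B) \<le> a + b"
  using opn_triangle[of A B] by linarith

lemma opn_diff_le: "opn A \<le> a \<Longrightarrow> opn B \<le> b \<Longrightarrow> opn (A - B) \<le> a + b"
  using opn_diff_triangle[of A B] by linarith

lemma opn_tp_le: "opn (tp A) \<le> opn A"
proof (rule opn_leI)
  fix X
  have "(norm (tp A * X))\<^sup>2 = inner X (A * (tp A * X))"
    by (simp only: power2_norm_eq_inner inner_left_mult tp_simps)
  also have "\<dots> \<le> norm X * (opn A * norm (tp A * X))"
    by (meson mult_left_mono norm_cauchy_schwarz norm_ge_zero norm_mult_opn order_trans)
  finally have "norm (tp A * X) * norm (tp A * X) \<le> (opn A * norm X) * norm (tp A * X)"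
    by (simp add: power2_eq_square mult.assoc mult.left_commute mult.commute)
  then show "norm (tp A * X) \<le> opn A * norm X"
    by (cases "norm (tp A * X) = 0") (simp_all add: mult_le_cancel_right)
qed simp

lemma opn_tp [simp]: "opn (tp A) = opn A"
  using opn_tp_le[of A] opn_tp_le[of "tp A"] by simp

lemma opn_mult_tp: "opn (A * tp A) = (opn A)\<^sup>2"
proof (rule antisym)
  show "opn (A * tp A) \<le> (opn A)\<^sup>2" using opn_mult[of A "tp A"] by (simp add: power2_eq_square)
  have "opn (tp A) \<le> sqrt (opn (A * tp A))"
  proof (rule opn_leI)
    fix X
    have "(norm (tp A * X))\<^sup>2 = inner X (A * tp A * X)"
      by (simp only: power2_norm_eq_inner inner_left_mult mult.assoc tp_simps)
    also have "\<dots> \<le> norm X * (opn (A * tp A) * norm X)"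
      by (meson mult_left_mono norm_cauchy_schwarz norm_ge_zero norm_mult_opn order_trans)
    also have "\<dots> = (sqrt (opn (A * tp A)) * norm X)\<^sup>2"
      by (simp add: power_mult_distrib power2_eq_square)
    finally show "norm (tp A * X) \<le> sqrt (opn (A * tp A)) * norm X"
      by (rule power2_le_imp_le) simp
  qed simp
  then show "(opn A)\<^sup>2 \<le> opn (A * tp A)"
    by (simp add: sqrt_ge_absD)
qed

lift_definition Id_n :: "nat \<Rightarrow> fsmat" is "\<lambda>n i j. if i = j \<and> i < n then 1 else 0"
proof -
  fix n :: nat
  show "\<exists>N. \<forall>i j. (if i = j \<and> i < n then 1 else (0 :: real)) \<noteq> 0 \<longrightarrow> i < N \<and> j < N"
    by (rule exI[of _ n]) simp
qed

lemma ent_Id [simp]: "ent (Id_n n) i j = (if i = j \<and> i < n then 1 else 0)"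
  by transfer simp

lemma bounded_by_Id: "bounded_by n (Id_n n)"
  unfolding bounded_by_def by (simp split: if_splits)

lemma ent_Id_mult [simp]: "ent (Id_n n * A) i j = (if i < n then ent A i j else 0)"
proof -
  have "ent (Id_n n * A) i j = (\<Sum>k<n. if k = i then ent A i j else 0)"
    unfolding ent_times[OF disjI1, OF bounded_by_Id] by (rule sum.cong) auto
  then show ?thesis by simp
qed

lemma ent_mult_Id [simp]: "ent (A * Id_n n) i j = (if j < n then ent A i j else 0)"
proof -
  have "ent (A * Id_n n) i j = (\<Sum>k<n. if k = j then ent A i j else 0)"
    unfolding ent_times[OF disjI2, OF bounded_by_Id] by (rule sum.cong) auto
  then show ?thesis by simp
qed

lemma tp_Id [simp]: "tp (Id_n n) = Id_n n"
  by (rule fsmat_eqI) auto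

lemma Id_mult_Id [simp]: "Id_n n * Id_n n = Id_n n"
  by (rule fsmat_eqI) auto

lemma norm_Id: "norm (Id_n n) = sqrt n"
proof -
  have "(norm (Id_n n))\<^sup>2 = n"
  proof -
    have "(\<Sum>j<n. (ent (Id_n n) i j)\<^sup>2) = (\<Sum>j<n. if j = i then 1 else 0)" if "i < n" for i
      using that by (intro sum.cong) auto
    then show ?thesis by (simp add: norm_fsmat_sq[OF bounded_by_Id])
  qed
  then show ?thesis by (metis norm_ge_zero real_sqrt_unique)
qed

lemma norm_isometry: "tp U * U = Id_n k \<Longrightarrow> Id_n k * X = X \<Longrightarrow> norm (U * X) = norm X"
  by (simp only: norm_eq_sqrt_inner inner_left_mult mult.assoc[symmetric])

lemma norm_Id_mult_le: "norm (Id_n k * X) \<le> norm X"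
proof -
  have "(norm (Id_n k * X))\<^sup>2 = inner X (Id_n k * X)"
    by (metis Id_mult_Id inner_left_mult mult.assoc power2_norm_eq_inner tp_Id)
  also have "\<dots> \<le> norm X * norm (Id_n k * X)" by (rule norm_cauchy_schwarz)
  finally show ?thesis
    unfolding power2_eq_square by (cases "norm (Id_n k * X) = 0") (simp_all add: mult_le_cancel_right)
qed

lemma opn_isometry_le: assumes "tp U * U = Id_n k" "U * Id_n k = U" shows "opn U \<le> 1"
proof (rule opn_leI)
  fix X
  have "norm (U * X) = norm (U * (Id_n k * X))" using assms(2) by (simp add: mult.assoc[symmetric])
  also have "\<dots> = norm (Id_n k * X)" using assms(1) by (rule norm_isometry) (simp add: mult.assoc[symmetric])
  also have "\<dots> \<le> 1 * norm X" using norm_Id_mult_le by simp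
  finally show "norm (U * X) \<le> 1 * norm X" .
qed simp

lemma opn_Id_le: "opn (Id_n k) \<le> 1"
  by (rule opn_isometry_le[of _ k]) auto

lemma norm_le_min:
  assumes "Id_n r * Y = Y" "Y * Id_n m = Y"
  shows "norm Y \<le> sqrt (min r m) * opn Y"
proof -
  have "norm Y \<le> opn Y * sqrt m" using norm_mult_opn[of Y "Id_n m"] assms(2) by (simp add: norm_Id)
  moreover have "norm Y \<le> opn Y * sqrt r"
    using norm_mult_opn[of "tp Y" "Id_n r"] assms(1) by (metis norm_Id norm_tp opn_tp tp_Id tp_mult)
  ultimately show ?thesis by (simp add: min_def mult.commute)
qed

section \<open>Embedding of rectangular matrices\<close>

lemma ent_Abs:
  assumes "\<And>i j. f i j \<noteq> 0 \<Longrightarrow> i < N \<and> j < N"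
  shows "ent (Abs_fsmat f) = f"
  by (rule Abs_fsmat_inverse) (use assms in blast)

definition fs :: "real mat \<Rightarrow> fsmat" where
  "fs A = Abs_fsmat (\<lambda>i j. if i < dim_row A \<and> j < dim_col A then A $$ (i, j) else 0)"

lemma ent_fs [simp]: "ent (fs A) i j = (if i < dim_row A \<and> j < dim_col A then A $$ (i, j) else 0)"
proof -
  let ?f = "\<lambda>i j. if i < dim_row A \<and> j < dim_col A then A $$ (i, j) else 0"
  have "i < dim_row A + dim_col A \<and> j < dim_row A + dim_col A" if "?f i j \<noteq> 0" for i j
  proof -
    have "i < dim_row A \<and> j < dim_col A" using that by presburger
    then show ?thesis by linarith
  qed
  then show ?thesis unfolding fs_def by (subst ent_Abs) blast+
qed

lemma fs_inject: "A \<in> carrier_mat n m \<Longrightarrow> B \<in> carrier_mat n m \<Longrightarrow> fs A = fs B \<Longrightarrow> A = B"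
proof (rule eq_matI)
  assume A: "A \<in> carrier_mat n m" and B: "B \<in> carrier_mat n m" and "fs A = fs B"
  show "A $$ (i, j) = B $$ (i, j)" if "i < dim_row B" "j < dim_col B" for i j
    using arg_cong[OF \<open>fs A = fs B\<close>, of "\<lambda>X. ent X i j"] that A B by simp
qed simp_all

lemma bounded_by_fs: "dim_row A \<le> N \<Longrightarrow> dim_col A \<le> N \<Longrightarrow> bounded_by N (fs A)"
  unfolding bounded_by_def by simp

lemma fs_mult: assumes "dim_col A = dim_row B" shows "fs (A * B) = fs A * fs B"
proof (rule fsmat_eqI)
  fix i j
  define N where "N = dim_row A + dim_col A"
  have "ent (fs A * fs B) i j = (\<Sum>k<N. ent (fs A) i k * ent (fs B) k j)"
    by (rule ent_times) (simp add: bounded_by_fs N_def)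
  also have "\<dots> = (\<Sum>k\<in>{0..<dim_col A}. ent (fs A) i k * ent (fs B) k j)"
    by (rule sum.mono_neutral_right) (auto simp: N_def)
  also have "\<dots> = ent (fs (A * B)) i j"
    using assms by (auto simp: scalar_prod_def intro!: sum.cong)
  finally show "ent (fs (A * B)) i j = ent (fs A * fs B) i j" by simp
qed

lemma fs_transpose [simp]: "fs A\<^sup>T = tp (fs A)"
  by (rule fsmat_eqI) simp

lemma fs_add: "dim_row A = dim_row B \<Longrightarrow> dim_col A = dim_col B \<Longrightarrow> fs (A + B) = fs A + fs B"
  by (rule fsmat_eqI) simp

lemma fs_minus: "dim_row A = dim_row B \<Longrightarrow> dim_col A = dim_col B \<Longrightarrow> fs (A - B) = fs A - fs B"
  by (rule fsmat_eqI) simp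

lemma fs_uminus [simp]: "fs (- A) = - fs A"
  by (rule fsmat_eqI) simp

lemma fs_smult [simp]: "fs (c \<cdot>\<^sub>m A) = c *\<^sub>R fs A"
  by (rule fsmat_eqI) simp

lemma fs_zero [simp]: "fs (0\<^sub>m n m) = 0"
  by (rule fsmat_eqI) simp

lemma fs_one [simp]: "fs (1\<^sub>m n) = Id_n n"
  by (rule fsmat_eqI) simp

lemma Id_fs [simp]: "dim_row A \<le> n \<Longrightarrow> Id_n n * fs A = fs A"
  by (rule fsmat_eqI) simp

lemma fs_Id [simp]: "dim_col A \<le> n \<Longrightarrow> fs A * Id_n n = fs A"
  by (rule fsmat_eqI) simp

lemma Id_mult_Id_le: "n \<le> m \<Longrightarrow> Id_n n * Id_n m = Id_n n" "n \<le> m \<Longrightarrow> Id_n m * Id_n n = Id_n n"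
  by (rule fsmat_eqI; auto)+

definition to_mat :: "nat \<Rightarrow> nat \<Rightarrow> fsmat \<Rightarrow> real mat" where
  "to_mat n m X = mat n m (\<lambda>(i, j). ent X i j)"

lemma to_mat_carrier [simp]: "to_mat n m X \<in> carrier_mat n m" "dim_row (to_mat n m X) = n" "dim_col (to_mat n m X) = m"
  by (simp_all add: to_mat_def)

lemma fs_to_mat: assumes "Id_n n * X = X" "X * Id_n m = X" shows "fs (to_mat n m X) = X"
proof (rule fsmat_eqI)
  fix i j
  have e: "Id_n n * X * Id_n m = X" by (simp add: assms)
  show "ent (fs (to_mat n m X)) i j = ent X i j"
  proof (cases "i < n \<and> j < m")
    case False
    then have "ent (Id_n n * X * Id_n m) i j = 0" by auto
    then show ?thesis using False unfolding e by (auto simp: to_mat_def)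
  qed (simp add: to_mat_def)
qed

lemma to_mat_fs: "A \<in> carrier_mat n m \<Longrightarrow> to_mat n m (fs A) = A"
  by (rule eq_matI) (auto simp: to_mat_def)

lift_definition Sh :: "nat \<Rightarrow> nat \<Rightarrow> fsmat" is "\<lambda>k l i j. if i = k + j \<and> j < l then 1 else 0"
proof -
  fix k l :: nat
  show "\<exists>N. \<forall>i j. (if i = k + j \<and> j < l then 1 else (0 :: real)) \<noteq> 0 \<longrightarrow> i < N \<and> j < N"
    by (rule exI[of _ "k + l"]) simp
qed

lemma ent_Sh [simp]: "ent (Sh k l) i j = (if i = k + j \<and> j < l then 1 else 0)"
  by transfer simp

lemma bounded_by_Sh: "bounded_by (k + l) (Sh k l)"
  unfolding bounded_by_def by (simp split: if_splits)

lemma ent_mult_tp_Sh [simp]: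
  "ent (A * tp (Sh k l)) i j = (if k \<le> j \<and> j < k + l then ent A i (j - k) else 0)"
proof -
  have "ent (A * tp (Sh k l)) i j = (\<Sum>c<k + l. ent A i c * ent (tp (Sh k l)) c j)"
    by (rule ent_times) (simp add: bounded_by_Sh)
  also have "\<dots> = (\<Sum>c<k + l. if c = j - k then (if k \<le> j \<and> j < k + l then ent A i (j - k) else 0) else 0)"
    by (rule sum.cong) auto
  finally show ?thesis by (cases "k \<le> j \<and> j < k + l") auto
qed

lemma ent_tp_Sh_mult [simp]:
  "ent (tp (Sh k l) * A) i j = (if i < l then ent A (k + i) j else 0)"
proof -
  have "ent (tp (Sh k l) * A) i j = (\<Sum>c<k + l. ent (tp (Sh k l)) i c * ent A c j)"
    by (rule ent_times) (simp add: bounded_by_Sh)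
  also have "\<dots> = (\<Sum>c<k + l. if c = k + i then (if i < l then ent A (k + i) j else 0) else 0)"
    by (rule sum.cong) auto
  finally show ?thesis by simp
qed

lemma ent_Sh_mult [simp]:
  "ent (Sh k l * A) i j = (if k \<le> i \<and> i < k + l then ent A (i - k) j else 0)"
  using ent_mult_tp_Sh[of "tp A" k l j i] by (metis ent_tp tp_mult tp_simps(1))

lemma ent_mult_Sh [simp]:
  "ent (A * Sh k l) i j = (if j < l then ent A i (k + j) else 0)"
  using ent_tp_Sh_mult[of k l "tp A" j i] by (metis ent_tp tp_mult tp_simps(1))

lemma tp_Sh_Sh [simp]: "tp (Sh k l) * Sh k l = Id_n l"
  by (rule fsmat_eqI) auto

lemma Sh_tp_Sh [simp]: "Sh k l * tp (Sh k l) = Id_n (k + l) - Id_n k"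
  by (rule fsmat_eqI) auto

lemma Id_Sh [simp]: "Id_n k * Sh k l = 0" "tp (Sh k l) * Id_n k = 0"
  "k + l \<le> n \<Longrightarrow> Id_n n * Sh k l = Sh k l" "k + l \<le> n \<Longrightarrow> tp (Sh k l) * Id_n n = tp (Sh k l)"
  "l \<le> n \<Longrightarrow> Sh k l * Id_n n = Sh k l" "l \<le> n \<Longrightarrow> Id_n n * tp (Sh k l) = tp (Sh k l)"
  by (rule fsmat_eqI; auto)+

lemma fs_Sh: "dim_row A \<le> k \<Longrightarrow> tp (Sh k l) * fs A = 0" "dim_col A \<le> k \<Longrightarrow> fs A * Sh k l = 0"
  by (rule fsmat_eqI, simp)+

lemma fs_append_cols:
  assumes "dim_row A = dim_row B" shows "fs (A @\<^sub>c B) = fs A + fs B * tp (Sh (dim_col A) (dim_col B))"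
proof (rule fsmat_eqI)
  fix i j
  show "ent (fs (A @\<^sub>c B)) i j = ent (fs A + fs B * tp (Sh (dim_col A) (dim_col B))) i j"
    by (cases "j < dim_col A"; cases "j < dim_col A + dim_col B"; cases "i < dim_row B")
      (simp_all add: append_cols_def assms)
qed

lemma fs_four_block:
  assumes "dim_row B = dim_row A" "dim_row D = dim_row C" "dim_col C = dim_col A" "dim_col D = dim_col B"
  shows "fs (four_block_mat A B C D) = fs A + fs B * tp (Sh (dim_col A) (dim_col B))
    + Sh (dim_row A) (dim_row C) * fs C + Sh (dim_row A) (dim_row C) * fs D * tp (Sh (dim_col A) (dim_col B))"
proof (rule fsmat_eqI)
  fix i j
  show "ent (fs (four_block_mat A B C D)) i j = ent (fs A + fs B * tp (Sh (dim_col A) (dim_col B))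
    + Sh (dim_row A) (dim_row C) * fs C + Sh (dim_row A) (dim_row C) * fs D * tp (Sh (dim_col A) (dim_col B))) i j"
    by (cases "j < dim_col A"; cases "j < dim_col A + dim_col B"; cases "i < dim_row A"; cases "i < dim_row A + dim_row C")
      (simp_all add: assms less_diff_conv2 not_less add.commute)
qed

lemma fs_block_diag:
  "fs (block_diag A B) = fs A + Sh (dim_row A) (dim_row B) * fs B * tp (Sh (dim_col A) (dim_col B))"
  unfolding block_diag_def by (subst fs_four_block) simp_all

lemma ent_fs_mult:
  "ent (fs A * X) i j = (if i < dim_row A then (A *\<^sub>v vec (dim_col A) (\<lambda>k. ent X k j)) $ i else 0)"
proof -
  have "ent (fs A * X) i j = (\<Sum>k<dim_row A + dim_col A. ent (fs A) i k * ent X k j)"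
    by (rule ent_times) (simp add: bounded_by_fs)
  also have "\<dots> = (\<Sum>k\<in>{0..<dim_col A}. ent (fs A) i k * ent X k j)"
    by (rule sum.mono_neutral_right) auto
  also have "\<dots> = (if i < dim_row A then (A *\<^sub>v vec (dim_col A) (\<lambda>k. ent X k j)) $ i else 0)"
    by (auto simp: scalar_prod_def intro!: sum.cong)
  finally show ?thesis .
qed

lemma vec_norm2_fs: "vec_norm2 v = norm (fs (mat_of_cols (dim_vec v) [v]))"
proof -
  have 1: "v \<bullet> v = (\<Sum>i<dim_vec v. (v $ i)\<^sup>2)"
    by (simp add: scalar_prod_def power2_eq_square atLeast0LessThan)
  have 2: "(\<Sum>j<Suc (dim_vec v). (ent (fs (mat_of_cols (dim_vec v) [v])) i j)\<^sup>2) = (v $ i)\<^sup>2"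
    if "i < dim_vec v" for i
  proof -
    have "(\<Sum>j<Suc (dim_vec v). (ent (fs (mat_of_cols (dim_vec v) [v])) i j)\<^sup>2)
        = (\<Sum>j<Suc (dim_vec v). if j = 0 then (v $ i)\<^sup>2 else 0)"
      by (rule sum.cong) (use that in \<open>auto simp: mat_of_cols_def\<close>)
    then show ?thesis by (simp only: sum.delta finite_lessThan lessThan_iff) simp
  qed
  have "(norm (fs (mat_of_cols (dim_vec v) [v])))\<^sup>2
      = (\<Sum>i<Suc (dim_vec v). \<Sum>j<Suc (dim_vec v). (ent (fs (mat_of_cols (dim_vec v) [v])) i j)\<^sup>2)"
    by (rule norm_fsmat_sq, rule bounded_by_fs) simp_all
  also have "\<dots> = (\<Sum>i<dim_vec v. \<Sum>j<Suc (dim_vec v). (ent (fs (mat_of_cols (dim_vec v) [v])) i j)\<^sup>2)"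
    by (rule sum.mono_neutral_right) auto
  also have "\<dots> = (\<Sum>i<dim_vec v. (v $ i)\<^sup>2)"
    by (rule sum.cong) (use 2 in auto)
  finally show ?thesis unfolding vec_norm2_def 1 by (metis norm_ge_zero real_sqrt_abs abs_of_nonneg)
qed

lemma fs_mat_of_cols_mult:
  assumes "v \<in> carrier_vec (dim_col A)"
  shows "fs (mat_of_cols (dim_row A) [A *\<^sub>v v]) = fs A * fs (mat_of_cols (dim_vec v) [v])"
proof -
  have "A * mat_of_cols (dim_vec v) [v] = mat_of_cols (dim_row A) [A *\<^sub>v v]"
    by (rule eq_matI) (use assms in \<open>auto simp: mat_of_cols_def intro!: arg_cong[of _ _ "(\<bullet>) _"] eq_vecI\<close>)
  then show ?thesis using assms by (metis fs_mult carrier_vecD mat_of_cols_carrier(2))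
qed

lemma vec_norm2_mult_le:
  assumes "v \<in> carrier_vec (dim_col A)" shows "vec_norm2 (A *\<^sub>v v) \<le> opn (fs A) * vec_norm2 v"
proof -
  have "vec_norm2 (A *\<^sub>v v) = norm (fs A * fs (mat_of_cols (dim_vec v) [v]))"
    unfolding vec_norm2_fs by (simp add: fs_mat_of_cols_mult[OF assms, symmetric])
  then show ?thesis by (simp add: vec_norm2_fs norm_mult_opn)
qed

lemma vec_norm2_ge_0 [simp]: "0 \<le> vec_norm2 v"
  by (simp add: vec_norm2_fs)

lemma vec_norm2_smult: "vec_norm2 (c \<cdot>\<^sub>v v) = \<bar>c\<bar> * vec_norm2 v"
  by (simp add: vec_norm2_def real_sqrt_mult)

lemma norm2_upper:
  assumes "v \<in> carrier_vec (dim_col A)" shows "vec_norm2 (A *\<^sub>v v) \<le> norm2 A * vec_norm2 v"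
proof -
  let ?S = "{vec_norm2 (A *\<^sub>v v) | v. v \<in> carrier_vec (dim_col A) \<and> vec_norm2 v \<le> 1}"
  have bdd: "bdd_above ?S"
  proof (rule bdd_aboveI[of _ "opn (fs A)"])
    fix x assume "x \<in> ?S"
    then obtain v where v: "x = vec_norm2 (A *\<^sub>v v)" "v \<in> carrier_vec (dim_col A)" "vec_norm2 v \<le> 1" by blast
    have "x \<le> opn (fs A) * vec_norm2 v" unfolding v(1) by (rule vec_norm2_mult_le[OF v(2)])
    also have "\<dots> \<le> opn (fs A) * 1" by (rule mult_left_mono[OF v(3)]) simp
    finally show "x \<le> opn (fs A)" by simp
  qed
  show ?thesis
  proof (cases "vec_norm2 v = 0")
    case True
    then show ?thesis using vec_norm2_mult_le[OF assms] by simp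
  next
    case False
    then have pos: "vec_norm2 v > 0" by (simp add: less_le)
    let ?w = "(1 / vec_norm2 v) \<cdot>\<^sub>v v"
    have "vec_norm2 (A *\<^sub>v ?w) \<le> norm2 A"
      unfolding norm2_def
    proof (rule cSup_upper[OF _ bdd], rule CollectI, intro exI conjI)
      show "?w \<in> carrier_vec (dim_col A)" using assms by simp
      show "vec_norm2 ?w \<le> 1" using pos by (simp add: vec_norm2_smult)
    qed simp
    moreover have "A *\<^sub>v ?w = (1 / vec_norm2 v) \<cdot>\<^sub>v (A *\<^sub>v v)"
      by (rule mult_mat_vec[OF _ assms, of _ "dim_row A"]) simp
    ultimately show ?thesis using pos by (simp add: vec_norm2_smult field_simps)
  qed
qed

lemma norm2_ge_0: "0 \<le> norm2 A"
proof -
  have "vec_norm2 (A *\<^sub>v 0\<^sub>v (dim_col A)) \<le> norm2 A"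
    unfolding norm2_def
  proof (rule cSup_upper)
    show "bdd_above {vec_norm2 (A *\<^sub>v v) | v. v \<in> carrier_vec (dim_col A) \<and> vec_norm2 v \<le> 1}"
    proof (rule bdd_aboveI[of _ "opn (fs A)"])
      fix x assume "x \<in> {vec_norm2 (A *\<^sub>v v) | v. v \<in> carrier_vec (dim_col A) \<and> vec_norm2 v \<le> 1}"
      then obtain v where v: "x = vec_norm2 (A *\<^sub>v v)" "v \<in> carrier_vec (dim_col A)" "vec_norm2 v \<le> 1" by blast
      have "x \<le> opn (fs A) * vec_norm2 v" unfolding v(1) by (rule vec_norm2_mult_le[OF v(2)])
      also have "\<dots> \<le> opn (fs A) * 1" by (rule mult_left_mono[OF v(3)]) simp
      finally show "x \<le> opn (fs A)" by simp
    qed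
  next
    have "vec_norm2 (0\<^sub>v (dim_col A)) = 0" by (simp add: vec_norm2_def)
    then show "vec_norm2 (A *\<^sub>v 0\<^sub>v (dim_col A)) \<in> {vec_norm2 (A *\<^sub>v v) | v. v \<in> carrier_vec (dim_col A) \<and> vec_norm2 v \<le> 1}"
      by (intro CollectI exI[of _ "0\<^sub>v (dim_col A)"]) simp
  qed
  then show ?thesis using order_trans vec_norm2_ge_0 by blast
qed

text \<open>Columnwise, the Frobenius bound for \<open>A * X\<close> follows from the spectral bound.\<close>

lemma norm2_eq_opn: "norm2 A = opn (fs A)"
proof (rule antisym)
  have "x \<le> opn (fs A)" if "x \<in> {vec_norm2 (A *\<^sub>v v) | v. v \<in> carrier_vec (dim_col A) \<and> vec_norm2 v \<le> 1}" (is "x \<in> ?S") for x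
  proof -
    have x: "x \<in> ?S" by fact
    obtain v where v: "x = vec_norm2 (A *\<^sub>v v)" "v \<in> carrier_vec (dim_col A)" "vec_norm2 v \<le> 1" using x by blast
    have "x \<le> opn (fs A) * vec_norm2 v" unfolding v(1) by (rule vec_norm2_mult_le[OF v(2)])
    also have "\<dots> \<le> opn (fs A) * 1" by (rule mult_left_mono[OF v(3)]) simp
    finally show "x \<le> opn (fs A)" by simp
  qed
  moreover have "vec_norm2 (0\<^sub>v (dim_col A)) \<le> 1" by (simp add: vec_norm2_def)
  then have "{vec_norm2 (A *\<^sub>v v) | v. v \<in> carrier_vec (dim_col A) \<and> vec_norm2 v \<le> 1} \<noteq> {}"
    using zero_carrier_vec by blast
  ultimately show "norm2 A \<le> opn (fs A)" unfolding norm2_def by (rule cSup_least[rotated])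
  show "opn (fs A) \<le> norm2 A"
  proof (rule opn_leI[OF norm2_ge_0])
    fix X
    obtain M where M: "bounded_by M X" using ex_bounded_by by blast
    define N where "N = M + dim_row A + dim_col A"
    have N: "bounded_by N X" "bounded_by N (fs A)"
      using bounded_by_mono[OF M] by (simp_all add: N_def bounded_by_fs)
    let ?v = "\<lambda>j. vec (dim_col A) (\<lambda>i. ent X i j)"
    have col: "(\<Sum>i<N. (ent (fs A * X) i j)\<^sup>2) \<le> (norm2 A)\<^sup>2 * (\<Sum>i<N. (ent X i j)\<^sup>2)" for j
    proof -
      have "(\<Sum>i<N. (ent (fs A * X) i j)\<^sup>2) = (\<Sum>i\<in>{0..<dim_row A}. ((A *\<^sub>v ?v j) $ i)\<^sup>2)"
        unfolding ent_fs_mult by (rule sum.mono_neutral_cong_right) (auto simp: N_def)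
      also have "\<dots> = (vec_norm2 (A *\<^sub>v ?v j))\<^sup>2"
        by (simp add: vec_norm2_def scalar_prod_def power2_eq_square sum_nonneg)
      also have "\<dots> \<le> (norm2 A * vec_norm2 (?v j))\<^sup>2"
        by (rule power_mono, rule norm2_upper) simp_all
      also have "\<dots> = (norm2 A)\<^sup>2 * (\<Sum>i\<in>{0..<dim_col A}. (ent X i j)\<^sup>2)"
        by (simp add: power_mult_distrib vec_norm2_def scalar_prod_def power2_eq_square sum_nonneg)
      also have "\<dots> \<le> (norm2 A)\<^sup>2 * (\<Sum>i<N. (ent X i j)\<^sup>2)"
        by (rule mult_left_mono, rule sum_mono2) (auto simp: N_def)
      finally show ?thesis .
    qed
    have "(norm (fs A * X))\<^sup>2 = (\<Sum>j<N. \<Sum>i<N. (ent (fs A * X) i j)\<^sup>2)"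
      unfolding norm_fsmat_sq[OF bounded_by_times[OF N(2,1)]] by (rule sum.swap)
    also have "\<dots> \<le> (\<Sum>j<N. (norm2 A)\<^sup>2 * (\<Sum>i<N. (ent X i j)\<^sup>2))" by (rule sum_mono) (rule col)
    also have "\<dots> = (norm2 A)\<^sup>2 * (\<Sum>j<N. \<Sum>i<N. (ent X i j)\<^sup>2)" by (rule sum_distrib_left[symmetric])
    also have "\<dots> = (norm2 A * norm X)\<^sup>2"
      unfolding power_mult_distrib norm_fsmat_sq[OF N(1)] by (subst sum.swap) (rule refl)
    finally show "norm (fs A * X) \<le> norm2 A * norm X"
      by (rule power2_le_imp_le) (simp add: norm2_ge_0)
  qed
qed

section \<open>Symmetric matrices\<close>

lemma eigenvalue_cmat_iff:
  assumes A: "A \<in> carrier_mat n n"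
  shows "eigenvalue (cmat A) z \<longleftrightarrow> (\<exists>X Y. Id_n n * X = X \<and> Id_n n * Y = Y \<and> (X \<noteq> 0 \<or> Y \<noteq> 0) \<and>
    fs A * X = Re z *\<^sub>R X - Im z *\<^sub>R Y \<and> fs A * Y = Re z *\<^sub>R Y + Im z *\<^sub>R X)"
proof
  have comp: "(cmat A *\<^sub>v v) $ i = Complex ((A *\<^sub>v vec n (\<lambda>k. Re (v $ k))) $ i) ((A *\<^sub>v vec n (\<lambda>k. Im (v $ k))) $ i)"
    if "v \<in> carrier_vec n" "i < n" for v i
    using that A by (intro complex_eqI) (simp_all add: scalar_prod_def)
  {
    assume "eigenvalue (cmat A) z"
    then obtain v where v: "v \<in> carrier_vec n" "v \<noteq> 0\<^sub>v n" "cmat A *\<^sub>v v = z \<cdot>\<^sub>v v"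
      unfolding eigenvalue_def eigenvector_def using A by auto
    define X where "X = fs (mat n 1 (\<lambda>(i, j). Re (v $ i)))"
    define Y where "Y = fs (mat n 1 (\<lambda>(i, j). Im (v $ i)))"
    have cX: "vec n (\<lambda>k. ent X k j) = (if j = 0 then vec n (\<lambda>k. Re (v $ k)) else 0\<^sub>v n)" for j
      by (rule eq_vecI) (auto simp: X_def)
    have cY: "vec n (\<lambda>k. ent Y k j) = (if j = 0 then vec n (\<lambda>k. Im (v $ k)) else 0\<^sub>v n)" for j
      by (rule eq_vecI) (auto simp: Y_def)
    obtain i where i: "i < n" "v $ i \<noteq> 0" using v(1,2) by (metis carrier_vecD eq_vecI index_zero_vec(1) index_zero_vec(2))
    have "ent X i 0 \<noteq> 0 \<or> ent Y i 0 \<noteq> 0" using i by (simp add: X_def Y_def complex_eq_iff)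
    then have nz: "X \<noteq> 0 \<or> Y \<noteq> 0" by auto
    have "(cmat A *\<^sub>v v) $ i = z * v $ i" if "i < n" for i using v that by simp
    then have c: "(A *\<^sub>v vec n (\<lambda>k. Re (v $ k))) $ i = Re (z * v $ i)" "(A *\<^sub>v vec n (\<lambda>k. Im (v $ k))) $ i = Im (z * v $ i)"
      if "i < n" for i using comp[OF v(1) that] that by (metis complex.sel)+
    have z0: "(A *\<^sub>v 0\<^sub>v n) $ i = 0" if "i < n" for i using A that by simp
    have "fs A * X = Re z *\<^sub>R X - Im z *\<^sub>R Y"
    proof (rule fsmat_eqI)
      fix i j show "ent (fs A * X) i j = ent (Re z *\<^sub>R X - Im z *\<^sub>R Y) i j"
        unfolding ent_fs_mult using A c(1) z0 cX by (simp add: X_def[symmetric]) (auto simp: X_def Y_def)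
    qed
    moreover have "fs A * Y = Re z *\<^sub>R Y + Im z *\<^sub>R X"
    proof (rule fsmat_eqI)
      fix i j show "ent (fs A * Y) i j = ent (Re z *\<^sub>R Y + Im z *\<^sub>R X) i j"
        unfolding ent_fs_mult using A c(2) z0 cY by (simp add: Y_def[symmetric]) (auto simp: X_def Y_def)
    qed
    moreover have "Id_n n * X = X" "Id_n n * Y = Y" by (simp_all add: X_def Y_def)
    ultimately show "\<exists>X Y. Id_n n * X = X \<and> Id_n n * Y = Y \<and> (X \<noteq> 0 \<or> Y \<noteq> 0) \<and>
      fs A * X = Re z *\<^sub>R X - Im z *\<^sub>R Y \<and> fs A * Y = Re z *\<^sub>R Y + Im z *\<^sub>R X" using nz by blast
  }
  {
    assume "\<exists>X Y. Id_n n * X = X \<and> Id_n n * Y = Y \<and> (X \<noteq> 0 \<or> Y \<noteq> 0) \<and>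
      fs A * X = Re z *\<^sub>R X - Im z *\<^sub>R Y \<and> fs A * Y = Re z *\<^sub>R Y + Im z *\<^sub>R X"
    then obtain X Y where XY: "Id_n n * X = X" "Id_n n * Y = Y" "X \<noteq> 0 \<or> Y \<noteq> 0"
      "fs A * X = Re z *\<^sub>R X - Im z *\<^sub>R Y" "fs A * Y = Re z *\<^sub>R Y + Im z *\<^sub>R X" by blast
    obtain i j where ij: "ent X i j \<noteq> 0 \<or> ent Y i j \<noteq> 0"
      using XY(3) fsmat_eqI[of X 0] fsmat_eqI[of Y 0] by (metis ent_simps(1))
    have "ent (Id_n n * X) i j \<noteq> 0 \<or> ent (Id_n n * Y) i j \<noteq> 0" using ij XY(1,2) by simp
    then have i: "i < n" unfolding ent_Id_mult by presburger
    define v where "v = vec n (\<lambda>i. Complex (ent X i j) (ent Y i j))"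
    have v: "v \<in> carrier_vec n" by (simp add: v_def)
    have "v $ i \<noteq> 0" using i ij by (simp add: v_def complex_eq_iff)
    then have "v \<noteq> 0\<^sub>v n" using i by auto
    moreover have "cmat A *\<^sub>v v = z \<cdot>\<^sub>v v"
    proof (rule eq_vecI)
      fix i assume "i < dim_vec (z \<cdot>\<^sub>v v)"
      then have i: "i < n" by (simp add: v_def)
      have r: "vec n (\<lambda>k. Re (v $ k)) = vec n (\<lambda>k. ent X k j)" "vec n (\<lambda>k. Im (v $ k)) = vec n (\<lambda>k. ent Y k j)"
        by (auto simp: v_def)
      have "(A *\<^sub>v vec n (\<lambda>k. ent X k j)) $ i = Re z * ent X i j - Im z * ent Y i j"
        using arg_cong[OF XY(4), of "\<lambda>Z. ent Z i j"] i A unfolding ent_fs_mult by simp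
      moreover have "(A *\<^sub>v vec n (\<lambda>k. ent Y k j)) $ i = Re z * ent Y i j + Im z * ent X i j"
        using arg_cong[OF XY(5), of "\<lambda>Z. ent Z i j"] i A unfolding ent_fs_mult by simp
      ultimately have "(cmat A *\<^sub>v v) $ i = z * v $ i"
        unfolding comp[OF v i] r using i by (simp add: v_def complex_eq_iff)
      then show "(cmat A *\<^sub>v v) $ i = (z \<cdot>\<^sub>v v) $ i" using i by (simp add: v_def)
    qed (use A in \<open>simp add: v_def\<close>)
    ultimately show "eigenvalue (cmat A) z"
      unfolding eigenvalue_def eigenvector_def using A v by auto
  }
qed

lemma eigenvalue_iff:
  assumes A: "A \<in> carrier_mat n n"
  shows "eigenvalue A x \<longleftrightarrow> (\<exists>X. Id_n n * X = X \<and> X \<noteq> 0 \<and> fs A * X = x *\<^sub>R X)"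
proof
  assume "eigenvalue A x"
  then obtain v where v: "v \<in> carrier_vec n" "v \<noteq> 0\<^sub>v n" "A *\<^sub>v v = x \<cdot>\<^sub>v v"
    unfolding eigenvalue_def eigenvector_def using A by auto
  define X where "X = fs (mat_of_cols n [v])"
  obtain i where i: "i < n" "v $ i \<noteq> 0" using v(1,2) by (metis carrier_vecD eq_vecI index_zero_vec(1) index_zero_vec(2))
  have "ent X i 0 \<noteq> 0" using i by (simp add: X_def mat_of_cols_def)
  then have "X \<noteq> 0" by auto
  moreover have "fs A * X = fs (mat_of_cols n [A *\<^sub>v v])"
    using fs_mat_of_cols_mult[of v A] v A by (simp add: X_def)
  moreover have "fs (mat_of_cols n [A *\<^sub>v v]) = x *\<^sub>R X"
    unfolding v(3) X_def by (rule fsmat_eqI) (use v(1) in \<open>auto simp: mat_of_cols_def\<close>)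
  moreover have "Id_n n * X = X" by (simp add: X_def)
  ultimately show "\<exists>X. Id_n n * X = X \<and> X \<noteq> 0 \<and> fs A * X = x *\<^sub>R X" by auto
next
  assume "\<exists>X. Id_n n * X = X \<and> X \<noteq> 0 \<and> fs A * X = x *\<^sub>R X"
  then obtain X where X: "Id_n n * X = X" "X \<noteq> 0" "fs A * X = x *\<^sub>R X" by blast
  obtain i j where ij: "ent X i j \<noteq> 0"
    using X(2) fsmat_eqI[of X 0] by (metis ent_simps(1))
  have "ent (Id_n n * X) i j \<noteq> 0" using ij X(1) by simp
  then have i: "i < n" unfolding ent_Id_mult by presburger
  define v where "v = vec n (\<lambda>i. ent X i j)"
  have v: "v \<in> carrier_vec n" by (simp add: v_def)
  have "v $ i \<noteq> 0" using i ij by (simp add: v_def)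
  then have "v \<noteq> 0\<^sub>v n" using i by auto
  moreover have "A *\<^sub>v v = x \<cdot>\<^sub>v v"
  proof (rule eq_vecI)
    fix i assume "i < dim_vec (x \<cdot>\<^sub>v v)"
    then have i: "i < n" by (simp add: v_def)
    have "(A *\<^sub>v vec n (\<lambda>k. ent X k j)) $ i = x * ent X i j"
      using arg_cong[OF X(3), of "\<lambda>Z. ent Z i j"] i A unfolding ent_fs_mult by simp
    then show "(A *\<^sub>v v) $ i = (x \<cdot>\<^sub>v v) $ i" using i by (simp add: v_def)
  qed (use A in \<open>simp add: v_def\<close>)
  ultimately show "eigenvalue A x"
    unfolding eigenvalue_def eigenvector_def using A v by auto
qed

lemma symmetric_eigenvector:
  assumes "tp M = M" "Id_n n * M = M" "n > 0"
  obtains x X where "X \<noteq> 0" "Id_n n * X = X" "M * X = x *\<^sub>R X"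
proof -
  have MI: "M * Id_n n = M" using assms by (metis tp_Id tp_mult)
  define A where "A = to_mat n n M"
  have A: "A \<in> carrier_mat n n" "fs A = M" using fs_to_mat[OF assms(2) MI] by (simp_all add: A_def)
  have cA: "cmat A \<in> carrier_mat n n" using A by simp
  obtain z where "eigenvalue (cmat A) z"
    using spectrum_non_empty[OF cA assms(3)] unfolding spectrum_def by blast
  then obtain X Y where XY: "Id_n n * X = X" "Id_n n * Y = Y" "X \<noteq> 0 \<or> Y \<noteq> 0"
      "M * X = Re z *\<^sub>R X - Im z *\<^sub>R Y" "M * Y = Re z *\<^sub>R Y + Im z *\<^sub>R X"
    unfolding eigenvalue_cmat_iff[OF A(1)] A(2) by blast
  have "inner (M * X) Y = inner X (M * Y)" by (simp add: inner_left_mult assms(1))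
  then have "Im z * (inner X X + inner Y Y) = 0"
    unfolding XY(4,5) by (simp add: inner_diff_left inner_add_right inner_commute algebra_simps del: dot_square_norm)
  moreover have "inner X X + inner Y Y > 0"
    using XY(3) by (metis add_nonneg_pos add_pos_nonneg inner_ge_zero inner_gt_zero_iff)
  ultimately have "Im z = 0" by simp
  then show ?thesis using XY that[of X "Re z"] that[of Y "Re z"] by auto
qed

definition E1 :: fsmat where "E1 = Id_n 1"

lemma E1_simps [simp]: "tp E1 = E1" "E1 * E1 = E1" "ent E1 i j = (if i = 0 \<and> j = 0 then 1 else 0)"
  by (auto simp: E1_def)

lemma ent_mult_E1 [simp]: "ent (A * E1) i j = (if j = 0 then ent A i j else 0)"
  by (simp add: E1_def)

definition ev :: "nat \<Rightarrow> fsmat" where "ev j = Sh j 1"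

lemma ent_ev [simp]: "ent (ev k) i j = (if i = k \<and> j = 0 then 1 else 0)"
  by (auto simp: ev_def)

lemma ev_simps [simp]: "ev j * E1 = ev j" "tp (ev j) * ev j = E1" "Id_n j * ev j = 0" "j < n \<Longrightarrow> Id_n n * ev j = ev j"
  "tp (ev j) * Id_n j = 0" "ev j * tp (ev j) = Id_n (Suc j) - Id_n j"
  by (simp_all add: ev_def E1_def)

lemma ent_mult_ev [simp]: "ent (A * ev k) i j = (if j = 0 then ent A i k else 0)"
  by (simp add: ev_def)

lemma tp_mult_column:
  assumes "u * E1 = u" "v * E1 = v" shows "tp u * v = inner u v *\<^sub>R E1"
proof (rule fsmat_eqI)
  fix i j
  obtain N where N: "bounded_by N u" "bounded_by N v" using ex_bounded_by2 by blast
  have z: "ent u k i = 0" "ent v k i = 0" if "i \<noteq> 0" for k i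
    using arg_cong[OF assms(1), of "\<lambda>X. ent X k i"] arg_cong[OF assms(2), of "\<lambda>X. ent X k i"] that by simp_all
  have M: "bounded_by (Suc N) u" "bounded_by (Suc N) v" using N bounded_by_mono by auto
  have "(\<Sum>j<Suc N. ent u i j * ent v i j) = ent u i 0 * ent v i 0" for i
  proof -
    have "(\<Sum>j<Suc N. ent u i j * ent v i j) = (\<Sum>j<Suc N. if j = 0 then ent u i 0 * ent v i 0 else 0)"
      by (rule sum.cong) (auto simp: z)
    then show ?thesis by (simp only: sum.delta finite_lessThan lessThan_iff zero_less_Suc if_True)
  qed
  then have in_eq: "inner u v = (\<Sum>i<Suc N. ent u i 0 * ent v i 0)"
    using inner_fsmat[OF disjI1, OF M(1), of v] by simp
  have ent_eq: "ent (tp u * v) i j = (\<Sum>k<Suc N. ent u k i * ent v k j)"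
    by (subst ent_times[of "Suc N"]) (simp_all add: M)
  have zero: "(\<Sum>k<Suc N. ent u k i * ent v k j) = 0" if "i \<noteq> 0 \<or> j \<noteq> 0"
    by (rule sum.neutral) (use that z in auto)
  show "ent (tp u * v) i j = ent (inner u v *\<^sub>R E1) i j"
  proof (cases "i = 0 \<and> j = 0")
    case True
    then have ij: "i = 0" "j = 0" by simp_all
    show ?thesis using ent_eq unfolding ent_simps(5) E1_simps(3) in_eq ij by simp
  next
    case False
    then show ?thesis
      unfolding ent_eq ent_simps(5) E1_simps(3) using zero by (simp only: if_False mult_zero_right) blast
  qed
qed

lemma unit_eigenvector:
  assumes "tp M = M" "Id_n n * M = M" "n > 0"
  obtains x u where "u * E1 = u" "Id_n n * u = u" "tp u * u = E1" "norm u = 1" "M * u = x *\<^sub>R u"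
proof -
  obtain x X where X: "X \<noteq> 0" "Id_n n * X = X" "M * X = x *\<^sub>R X" by (rule symmetric_eigenvector[OF assms])
  obtain i j where "ent X i j \<noteq> 0" using X(1) fsmat_eqI[of X 0] by (metis ent_simps(1))
  define w where "w = X * ev j"
  have "ent w i 0 = ent X i j" by (simp add: w_def)
  then have w0: "w \<noteq> 0" using \<open>ent X i j \<noteq> 0\<close> by auto
  have w: "w * E1 = w" "Id_n n * w = w" "M * w = x *\<^sub>R w"
    unfolding w_def mult.assoc ev_simps(1) by (simp_all add: mult.assoc[symmetric] X(2,3))
  define u where "u = (1 / norm w) *\<^sub>R w"
  have "norm u = 1" using w0 by (simp add: u_def)
  moreover have u: "u * E1 = u" "Id_n n * u = u" "M * u = x *\<^sub>R u" by (simp_all add: u_def w)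
  moreover have "inner u u = 1" using \<open>norm u = 1\<close> by (simp add: norm_eq_1)
  then have "tp u * u = E1" using tp_mult_column[OF u(1) u(1)] by simp
  ultimately show ?thesis using that by blast
qed

lemma ex_reflection:
  assumes u: "u * E1 = u" "Id_n n * u = u" "norm u = 1" and e: "e * E1 = e" "Id_n n * e = e" "norm e = 1"
  obtains H where "tp H = H" "H * H = Id_n n" "Id_n n * H = H" "H * e = u"
proof (cases "u = e")
  case True
  then show ?thesis using that[of "Id_n n"] u by simp
next
  case False
  define w where "w = u - e"
  define c where "c = 2 / (norm w)\<^sup>2"
  define H where "H = Id_n n - c *\<^sub>R (w * tp w)"
  have w0: "(norm w)\<^sup>2 \<noteq> 0" using False by (simp add: w_def)
  have w: "w * E1 = w" "Id_n n * w = w" using u e by (simp_all add: w_def algebra_simps)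
  have tw: "tp w * Id_n n = tp w" using arg_cong[OF w(2), of tp] by simp
  have Iw: "E1 * tp w = tp w" using arg_cong[OF w(1), of tp] by simp
  have ww: "tp w * w = (norm w)\<^sup>2 *\<^sub>R E1" using tp_mult_column[OF w(1) w(1)] by (simp add: dot_square_norm)
  have ww': "tp w * (w * X) = (norm w)\<^sup>2 *\<^sub>R (E1 * X)" for X
    using ww by (simp add: mult.assoc[symmetric])
  have "inner u u = 1" "inner e e = 1" using u(3) e(3) by (simp_all add: norm_eq_1)
  then have nw: "inner w e = - ((norm w)\<^sup>2) / 2"
    unfolding w_def power2_norm_eq_inner by (simp add: inner_diff_left inner_diff_right inner_commute del: dot_square_norm)
  have we: "tp w * e = inner w e *\<^sub>R E1" by (rule tp_mult_column[OF w(1) e(1)])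
  have "H * e = e - (c * inner w e) *\<^sub>R (w * E1)"
    unfolding H_def by (simp add: left_diff_distrib mult.assoc we e)
  also have "\<dots> = u" using w0 by (simp add: c_def nw w(1)) (simp add: w_def)
  finally have He: "H * e = u" .
  define K where "K = w * tp w"
  have K: "K * K = (norm w)\<^sup>2 *\<^sub>R K" "Id_n n * K = K" "K * Id_n n = K"
    unfolding K_def by (simp_all add: mult.assoc ww' Iw tw) (simp add: w mult.assoc[symmetric])
  have "c * (norm w)\<^sup>2 = 2" using w0 by (simp add: c_def)
  then have "c * (c * (norm w)\<^sup>2) = c + c" by simp
  then have "H * H = Id_n n - c *\<^sub>R K - (c *\<^sub>R K - (c + c) *\<^sub>R K)"
    unfolding H_def K_def[symmetric]
    by (simp only: left_diff_distrib right_diff_distrib K mult_scaleR_left mult_scaleR_right Id_mult_Id scaleR_scaleR scaleR_diff_right)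
  then have "H * H = Id_n n" by (simp only: scaleR_left_distrib) simp
  moreover have "tp H = H" "Id_n n * H = H" unfolding H_def using w
    by (simp_all add: right_diff_distrib mult.assoc[symmetric])
  ultimately show ?thesis using that He by blast
qed

definition Dg :: "nat \<Rightarrow> (nat \<Rightarrow> real) \<Rightarrow> fsmat" where
  "Dg n d = fs (mat n n (\<lambda>(i, j). if i = j then d i else 0))"

lemma ent_Dg [simp]: "ent (Dg n d) i j = (if i = j \<and> i < n then d i else 0)"
  by (simp add: Dg_def)

lemma Id_Dg [simp]: "Id_n n * Dg n d = Dg n d" "Dg n d * Id_n n = Dg n d"
  by (simp_all add: Dg_def)

lemma tp_Dg [simp]: "tp (Dg n d) = Dg n d"
  by (rule fsmat_eqI) auto

lemma Dg_mult: "Dg n d * Dg n d' = Dg n (\<lambda>i. d i * d' i)"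
proof (rule fsmat_eqI)
  fix i j
  have "ent (Dg n d * Dg n d') i j = (\<Sum>k<n. ent (Dg n d) i k * ent (Dg n d') k j)"
    by (rule ent_times) (simp add: Dg_def bounded_by_fs)
  also have "\<dots> = (\<Sum>k<n. if k = i then (if i = j then d i * d' i else 0) else 0)"
    by (rule sum.cong) auto
  finally show "ent (Dg n d * Dg n d') i j = ent (Dg n (\<lambda>i. d i * d' i)) i j" by simp
qed

theorem symmetric_diagonalization:
  assumes "tp M = M" "Id_n n * M = M"
  shows "\<exists>U d. Id_n n * U = U \<and> U * Id_n n = U \<and> tp U * U = Id_n n \<and> U * tp U = Id_n n \<and> M = U * Dg n d * tp U"
  using assms
proof (induction n arbitrary: M)
  case 0
  have z: "Id_n 0 = 0" by (rule fsmat_eqI) simp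
  show ?case by (rule exI[of _ 0]) (use 0 in \<open>simp add: z\<close>)
next
  case (Suc n)
  obtain x u where u: "u * E1 = u" "Id_n (Suc n) * u = u" "norm u = 1" "M * u = x *\<^sub>R u"
    using unit_eigenvector[OF Suc.prems] by (metis zero_less_Suc)
  define e where "e = ev n"
  have e: "e * E1 = e" "Id_n (Suc n) * e = e" "Id_n n * e = 0" "tp e * Id_n n = 0" by (simp_all add: e_def)
  have ee: "tp e * e = E1" by (simp add: e_def)
  have "norm e = 1" using tp_mult_column[OF e(1) e(1)] arg_cong[OF ee, of "\<lambda>X. ent X 0 0"]
    by (simp add: norm_eq_1)
  then obtain H where H: "tp H = H" "H * H = Id_n (Suc n)" "Id_n (Suc n) * H = H" "H * e = u"
    using ex_reflection[OF u(1-3) e(1,2)] by blast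
  have HI: "H * Id_n (Suc n) = H" using H by (metis tp_Id tp_mult)
  have Hu: "H * u = e" using H e by (metis mult.assoc)
  define N where "N = H * M * H"
  have I: "Id_n (Suc n) = Id_n n + e * tp e" by (simp add: e_def)
  have Ne: "N * e = x *\<^sub>R e" unfolding N_def by (simp add: mult.assoc H(4) u(4) Hu)
  have tN: "tp N = N" unfolding N_def by (simp add: mult.assoc H(1) Suc.prems(1))
  have eN: "tp e * N = x *\<^sub>R tp e" using arg_cong[OF Ne, of tp] tN by simp
  have NI: "Id_n (Suc n) * N = N" "N * Id_n (Suc n) = N" unfolding N_def using H(3) HI
    by (simp_all add: mult.assoc[symmetric]) (simp add: mult.assoc)
  define M' where "M' = Id_n n * N * Id_n n"
  have "tp M' = M'" unfolding M'_def by (simp add: tN mult.assoc)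
  moreover have "Id_n n * M' = M'" unfolding M'_def by (simp add: mult.assoc[symmetric])
  ultimately obtain U d where U: "Id_n n * U = U" "U * Id_n n = U" "tp U * U = Id_n n" "U * tp U = Id_n n" "M' = U * Dg n d * tp U"
    using Suc.IH by blast
  have "N = (Id_n n + e * tp e) * N * (Id_n n + e * tp e)" using NI I by (simp add: mult.assoc)
  also have "\<dots> = M' + x *\<^sub>R (e * tp e)"
    unfolding M'_def ring_distribs
    by (simp add: mult.assoc eN e) (simp add: mult.assoc[symmetric] Ne e ee)
  finally have N: "N = M' + x *\<^sub>R (e * tp e)" .
  define U' where "U' = U + e * tp e"
  have z: "U * e = 0" "tp e * U = 0" "tp U * e = 0" "tp e * tp U = 0"
    using U(1,2) e(3,4) by (metis mult.assoc mult_zero_right, metis mult.assoc mult_zero_left,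
      metis tp_mult tp_Id mult.assoc mult_zero_right, metis tp_mult tp_Id mult.assoc mult_zero_left)
  have Ie: "E1 * tp e = tp e" using arg_cong[OF e(1), of tp] by simp
  have z': "U * (e * X) = 0" "tp e * (U * X) = 0" "tp U * (e * X) = 0" "tp e * (tp U * X) = 0"
    "tp e * (e * X) = E1 * X" "e * (E1 * X) = e * X" "Id_n n * (e * X) = 0" for X
    using z ee e(1,3) by (simp_all add: mult.assoc[symmetric])
  have U'1: "tp U' * U' = Id_n (Suc n)" "U' * tp U' = Id_n (Suc n)" "Id_n (Suc n) * U' = U'"
    unfolding U'_def I using U z z' e Ie by (simp_all add: ring_distribs mult.assoc)
  define d' where "d' = d(n := x)"
  have Dg': "Dg (Suc n) d' = Dg n d + x *\<^sub>R (e * tp e)"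
    by (rule fsmat_eqI) (auto simp: e_def d'_def)
  have De: "Dg n d * e = 0" "tp e * Dg n d = 0"
    by (metis Id_Dg(2) e(3) mult.assoc mult_zero_right, metis Id_Dg(1) e(4) mult.assoc mult_zero_left)
  have De': "Dg n d * (e * X) = 0" "tp e * (Dg n d * X) = 0" for X
    using De by (simp_all add: mult.assoc[symmetric])
  have "N = U' * Dg (Suc n) d' * tp U'"
    unfolding N U(5) Dg' U'_def using z z' De De' e ee Ie
    by (simp add: ring_distribs mult.assoc)
  then have "H * N * H = (H * U') * Dg (Suc n) d' * tp (H * U')" by (simp add: mult.assoc H(1))
  moreover have "H * N * H = M"
  proof -
    have "H * N * H = (H * H) * M * (H * H)" unfolding N_def by (simp add: mult.assoc)
    also have "\<dots> = M" unfolding H(2) using Suc.prems by (metis tp_Id tp_mult)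
    finally show ?thesis .
  qed
  moreover have U'2: "U' * Id_n (Suc n) = U'" using U'1 by (metis mult.assoc)
  moreover have "tp (H * U') * (H * U') = tp U' * (H * H) * U'" by (simp add: mult.assoc H(1))
  then have "tp (H * U') * (H * U') = Id_n (Suc n)" using H(2) U'1 by (simp add: mult.assoc)
  moreover have "(H * U') * tp (H * U') = H * (U' * tp U') * H" by (simp add: mult.assoc H(1))
  then have "(H * U') * tp (H * U') = Id_n (Suc n)" using H(2) U'1 HI by simp
  ultimately show ?case using H(3)
    by (intro exI[of _ "H * U'"] exI[of _ d']) (simp add: mult.assoc[symmetric], simp add: mult.assoc)
qed

definition psdq :: "fsmat \<Rightarrow> bool" where "psdq M \<longleftrightarrow> (\<forall>X. 0 \<le> inner X (M * X))"

lemma psdq_mult_tp: "psdq (S * tp S)"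
  unfolding psdq_def using inner_ge_zero inner_left_mult by (metis mult.assoc tp_simps(1))

lemma inner_Dg: "inner X (Dg n d * X) = (\<Sum>i<n. d i * (norm (ev i * tp (ev i) * X))\<^sup>2)"
proof -
  have "Dg n d = (\<Sum>i<n. d i *\<^sub>R (ev i * tp (ev i)))"
  proof (rule fsmat_eqI)
    fix i j
    have "(\<Sum>k<n. ent (d k *\<^sub>R (ev k * tp (ev k))) i j) = (\<Sum>k<n. if k = i then (if i = j then d i else 0) else 0)"
      by (rule sum.cong) auto
    then show "ent (Dg n d) i j = ent (\<Sum>k<n. d k *\<^sub>R (ev k * tp (ev k))) i j" by simp
  qed
  moreover have "inner X (ev i * tp (ev i) * X) = (norm (ev i * tp (ev i) * X))\<^sup>2" for i
  proof -
    let ?E = "ev i * tp (ev i)"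
    have "?E * ?E = ?E" by (simp add: ring_distribs Id_mult_Id_le)
    moreover have "tp ?E = ?E" by simp
    ultimately show ?thesis unfolding power2_norm_eq_inner by (metis inner_left_mult mult.assoc)
  qed
  ultimately show ?thesis by (simp add: sum_distrib_right inner_sum_right)
qed

lemma Dg_cong: "(\<And>i. i < n \<Longrightarrow> d i = d' i) \<Longrightarrow> Dg n d = Dg n d'"
  by (rule fsmat_eqI) auto

lemma psdq_diagonalization:
  assumes "tp M = M" "Id_n n * M = M" "psdq M"
  obtains U d where "Id_n n * U = U" "U * Id_n n = U" "tp U * U = Id_n n" "U * tp U = Id_n n" "M = U * Dg n d * tp U"
    "\<And>i. i < n \<Longrightarrow> 0 \<le> d i"
proof -
  obtain U d where U: "Id_n n * U = U" "U * Id_n n = U" "tp U * U = Id_n n" "U * tp U = Id_n n" "M = U * Dg n d * tp U"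
    using symmetric_diagonalization[OF assms(1,2)] by blast
  have "0 \<le> d i" if "i < n" for i
  proof -
    let ?X = "ev i"
    have "tp U * M * U = Dg n d" unfolding U(5) using U(3) by (simp add: mult.assoc) (simp add: mult.assoc[symmetric])
    then have "inner (U * ?X) (M * (U * ?X)) = inner ?X (Dg n d * ?X)"
      by (simp add: inner_left_mult mult.assoc[symmetric])
    also have "\<dots> = ent (tp ?X * (Dg n d * ?X)) 0 0"
      by (subst tp_mult_column) (simp_all add: mult.assoc)
    also have "\<dots> = ent (Dg n d * ev i) i 0"
      unfolding ev_def ent_tp_Sh_mult by simp
    also have "\<dots> = d i" using that by simp
    finally show ?thesis using assms(3) unfolding psdq_def by metis
  qed
  then show ?thesis using U that by blast
qed

lemma psdq_factor:
  assumes "tp M = M" "Id_n n * M = M" "psdq M"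
  obtains S where "Id_n n * S = S" "S * Id_n n = S" "S * tp S = M"
proof -
  obtain U d where U: "Id_n n * U = U" "U * Id_n n = U" "tp U * U = Id_n n" "M = U * Dg n d * tp U"
    and d: "\<And>i. i < n \<Longrightarrow> 0 \<le> d i" using psdq_diagonalization[OF assms] by metis
  let ?D = "Dg n (\<lambda>i. sqrt (d i))"
  have D: "?D * ?D = Dg n d" unfolding Dg_mult by (rule Dg_cong) (simp add: d)
  have "(U * ?D) * tp (U * ?D) = M" unfolding U(4) D[symmetric] by (simp add: mult.assoc)
  moreover have "Id_n n * (U * ?D) = U * ?D" using U(1) by (simp add: mult.assoc[symmetric])
  moreover have "(U * ?D) * Id_n n = U * ?D" by (simp add: mult.assoc)
  ultimately show ?thesis using that by blast
qed

lemma psdq_inner_eq_0: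
  assumes "tp M = M" "Id_n n * M = M" "psdq M" "inner X (M * X) = 0" shows "M * X = 0"
proof -
  obtain S where S: "S * tp S = M" using psdq_factor[OF assms(1-3)] by blast
  have "inner (tp S * X) (tp S * X) = inner X (M * X)" unfolding S[symmetric] by (simp add: inner_left_mult mult.assoc)
  then have "tp S * X = 0" using assms(4) by (metis inner_eq_zero_iff)
  then show ?thesis unfolding S[symmetric] by (simp add: mult.assoc)
qed

lemma psdq_max_eigenvalue:
  assumes "tp M = M" "Id_n n * M = M" "psdq M" "n > 0"
  obtains x X where "X \<noteq> 0" "Id_n n * X = X" "M * X = x *\<^sub>R X" "0 \<le> x" "\<And>Y. inner Y (M * Y) \<le> x * (norm Y)\<^sup>2"
proof -
  obtain U d where U: "Id_n n * U = U" "U * Id_n n = U" "tp U * U = Id_n n" "U * tp U = Id_n n" "M = U * Dg n d * tp U"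
    and d: "\<And>i. i < n \<Longrightarrow> 0 \<le> d i" using psdq_diagonalization[OF assms(1-3)] by metis
  define x where "x = Max (d ` {..<n})"
  have "x \<in> d ` {..<n}" unfolding x_def by (rule Max_in) (use assms(4) in auto)
  then obtain i where i: "i < n" "d i = x" by auto
  have le: "d j \<le> x" if "j < n" for j unfolding x_def by (rule Max_ge) (use that in auto)
  define X where "X = U * ev i"
  have "tp U * X = ev i" unfolding X_def using U(3) i by (simp add: mult.assoc[symmetric])
  moreover have "ent (ev i) i 0 \<noteq> 0" by simp
  then have "ev i \<noteq> 0" by (metis ent_simps(1))
  ultimately have "X \<noteq> 0" by auto
  moreover have "Id_n n * X = X" unfolding X_def using U(1) by (simp add: mult.assoc[symmetric])
  moreover have "Dg n d * ev i = x *\<^sub>R ev i"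
    by (rule fsmat_eqI) (use i in auto)
  then have "M * X = x *\<^sub>R X" unfolding U(5) using \<open>tp U * X = _\<close> by (simp add: mult.assoc X_def)
  moreover have "0 \<le> x" using d i by auto
  moreover have "inner Y (M * Y) \<le> x * (norm Y)\<^sup>2" for Y
  proof -
    let ?Z = "tp U * Y"
    have "inner Y (M * Y) = inner ?Z (Dg n d * ?Z)" unfolding U(5) by (simp add: inner_left_mult mult.assoc)
    also have "\<dots> \<le> inner ?Z (Dg n (\<lambda>_. x) * ?Z)"
      unfolding inner_Dg by (intro sum_mono mult_right_mono le) auto
    also have "Dg n (\<lambda>_. x) = x *\<^sub>R Id_n n" by (rule fsmat_eqI) auto
    also have "inner ?Z (x *\<^sub>R Id_n n * ?Z) = x * inner ?Z (Id_n n * ?Z)" by simp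
    also have "Id_n n * ?Z = ?Z" using U(2) by (metis mult.assoc tp_Id tp_mult)
    also have "inner ?Z ?Z = (norm ?Z)\<^sup>2" by (rule dot_square_norm)
    finally have 1: "inner Y (M * Y) \<le> x * (norm ?Z)\<^sup>2" .
    have "norm ?Z \<le> opn (tp U) * norm Y" by (rule norm_mult_opn)
    also have "\<dots> \<le> 1 * norm Y" by (rule mult_right_mono) (simp_all add: opn_isometry_le[OF U(3,2)])
    finally have "x * (norm ?Z)\<^sup>2 \<le> x * (norm Y)\<^sup>2" using \<open>0 \<le> x\<close> by (simp add: mult_left_mono power_mono)
    then show ?thesis using 1 by linarith
  qed
  ultimately show ?thesis using that by blast
qed

lemma psdq_sqrt_unique:
  assumes X: "tp X = X" "Id_n n * X = X" "psdq X" and Y: "tp Y = Y" "Id_n n * Y = Y" "psdq Y" and "X * X = Y * Y"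
  shows "X = Y"
proof -
  define D where "D = X - Y"
  have "X * D + D * Y = 0" using assms(7) by (simp add: D_def algebra_simps)
  then have "inner D (X * D) + inner D (D * Y) = 0" by (metis inner_add_right inner_zero_right)
  moreover have "inner D (D * Y) = inner (tp D) (Y * tp D)"
    using inner_tp[of D "D * Y"] Y(1) by simp
  moreover have "0 \<le> inner D (X * D)" "0 \<le> inner (tp D) (Y * tp D)" using X(3) Y(3) unfolding psdq_def by blast+
  ultimately have "X * D = 0" "Y * tp D = 0"
    using psdq_inner_eq_0[OF X, of D] psdq_inner_eq_0[OF Y, of "tp D"] by linarith+
  moreover have "tp D = D" by (simp add: D_def X Y)
  ultimately have "D * D = 0" by (simp add: D_def left_diff_distrib)
  then have "inner D D = 0" using inner_left_mult[of D "Id_n n" D] \<open>tp D = D\<close>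
    by (metis D_def X(1,2) Y(1,2) inner_zero_right right_diff_distrib tp_Id tp_mult)
  then show ?thesis by (simp add: D_def)
qed

lemma psdq_fs:
  assumes "psd M" shows "psdq (fs M)"
  unfolding psdq_def
proof
  fix X
  let ?n = "dim_row M"
  have sq: "dim_col M = ?n" using assms by (simp add: psd_def)
  obtain K where K: "bounded_by K X" using ex_bounded_by by blast
  define N where "N = K + ?n"
  have N: "bounded_by N X" using bounded_by_mono[OF K] by (simp add: N_def)
  let ?v = "\<lambda>j. vec ?n (\<lambda>k. ent X k j)"
  have "inner X (fs M * X) = (\<Sum>i<N. \<Sum>j<N. ent X i j * ent (fs M * X) i j)" by (rule inner_fsmat) (simp add: N)
  also have "\<dots> = (\<Sum>j<N. \<Sum>i<N. ent X i j * ent (fs M * X) i j)" by (rule sum.swap)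
  also have "\<dots> = (\<Sum>j<N. ?v j \<bullet> (M *\<^sub>v ?v j))"
  proof (rule sum.cong[OF refl])
    fix j
    have "(\<Sum>i<N. ent X i j * ent (fs M * X) i j) = (\<Sum>i\<in>{0..<?n}. ent X i j * (M *\<^sub>v ?v j) $ i)"
      unfolding ent_fs_mult sq by (rule sum.mono_neutral_cong_right) (auto simp: N_def)
    then show "(\<Sum>i<N. ent X i j * ent (fs M * X) i j) = ?v j \<bullet> (M *\<^sub>v ?v j)"
      by (simp add: scalar_prod_def[of "?v j"])
  qed
  also have "\<dots> \<ge> 0" using assms unfolding psd_def by (intro sum_nonneg) simp
  finally show "0 \<le> inner X (fs M * X)" .
qed

lemma psd_of_psdq:
  assumes M: "M \<in> carrier_mat n n" and t: "tp (fs M) = fs M" and p: "psdq (fs M)" shows "psd M"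
  unfolding psd_def
proof (intro conjI ballI)
  show "square_mat M" using M by simp
  show "M\<^sup>T = M" by (rule fs_inject[of _ n n]) (use M t in simp_all)
  fix v :: "real vec" assume "v \<in> carrier_vec (dim_row M)"
  then have v: "v \<in> carrier_vec n" using M by simp
  let ?X = "fs (mat_of_cols n [v])"
  let ?Y = "fs (mat_of_cols n [M *\<^sub>v v])"
  have "0 \<le> inner ?X (fs M * ?X)" using p unfolding psdq_def by blast
  also have "fs M * ?X = ?Y" using fs_mat_of_cols_mult[of v M] v M by simp
  also have "inner ?X ?Y = ent (tp ?X * ?Y) 0 0" by (subst tp_mult_column) (simp_all add: E1_def)
  also have "tp ?X * ?Y = fs ((mat_of_cols n [v])\<^sup>T * mat_of_cols n [M *\<^sub>v v])" by (simp add: fs_mult)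
  also have "ent \<dots> 0 0 = v \<bullet> (M *\<^sub>v v)"
    using v M by (simp add: scalar_prod_def mat_of_cols_def)
  finally show "0 \<le> v \<bullet> (M *\<^sub>v v)" .
qed

section \<open>Square roots, stability and the Cayley transform\<close>

lemma ent_fs_carrier: "A \<in> carrier_mat n m \<Longrightarrow> ent (fs A) i j = (if i < n \<and> j < m then A $$ (i, j) else 0)"
  by auto

lemma Id_fs_carrier: "A \<in> carrier_mat n m \<Longrightarrow> Id_n n * fs A = fs A" "A \<in> carrier_mat n m \<Longrightarrow> fs A * Id_n m = fs A"
  by simp_all

lemma Id_tp_fs [simp]: "dim_col A \<le> n \<Longrightarrow> Id_n n * tp (fs A) = tp (fs A)" "dim_row A \<le> n \<Longrightarrow> tp (fs A) * Id_n n = tp (fs A)"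
  by (rule fsmat_eqI; simp)+

lemma cmat_mult: "dim_col A = dim_row B \<Longrightarrow> cmat (A * B) = cmat A * cmat B"
  by (rule eq_matI) (auto simp: scalar_prod_def)

lemma cmat_pow: "A \<in> carrier_mat n n \<Longrightarrow> cmat (A ^\<^sub>m k) = cmat A ^\<^sub>m k"
proof (induction k)
  case (Suc k)
  then show ?case by (simp add: cmat_mult)
qed (auto intro!: eq_matI)

lemma mat_inv_eqI:
  assumes A: "A \<in> carrier_mat n n" and X: "X \<in> carrier_mat n n" and AX: "A * X = 1\<^sub>m n"
  shows "mat_inv A = X"
proof -
  have XA: "X * A = 1\<^sub>m n" by (rule mat_mult_left_right_inverse[OF A X AX])
  have "A \<in> Units (ring_mat TYPE('a) n ())"
    unfolding Units_def ring_mat_def using A X AX XA by auto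
  then obtain B where B: "mat_inverse A = Some B" using mat_inverse(1)[OF A] by (metis option.exhaust)
  then have B': "A * B = 1\<^sub>m n" "B * A = 1\<^sub>m n" "B \<in> carrier_mat n n" using mat_inverse(2)[OF A] by blast+
  have "B = B * (A * X)" using B' AX by simp
  also have "\<dots> = (B * A) * X" by (rule assoc_mult_mat[symmetric, OF B'(3) A X])
  finally show ?thesis using B' X by (simp add: mat_inv_def B)
qed

lemma ex_positive_sqrt:
  assumes "tp M = M" "Id_n n * M = M" and pos: "\<And>X. (norm (Id_n n * X))\<^sup>2 \<le> inner X (M * X)"
  obtains T c where "tp T = T" "Id_n n * T = T" "psdq T" "T * T = M" "tp c = c" "Id_n n * c = c" "psdq c"
    "c * T = Id_n n" "T * c = Id_n n"
proof -
  have ps: "psdq M" unfolding psdq_def using pos by (meson order_trans zero_le_power2)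
  obtain U d where U: "Id_n n * U = U" "U * Id_n n = U" "tp U * U = Id_n n" "U * tp U = Id_n n" "M = U * Dg n d * tp U"
    and d0: "\<And>i. i < n \<Longrightarrow> 0 \<le> d i" using psdq_diagonalization[OF assms(1,2) ps] by metis
  have d: "0 < d i" if "i < n" for i
  proof (rule ccontr)
    assume "\<not> 0 < d i"
    then have "d i = 0" using d0[OF that] by simp
    then have "Dg n d * ev i = 0" by (intro fsmat_eqI) simp
    moreover have "tp U * (U * ev i) = ev i" using U(3) that by (simp add: mult.assoc[symmetric])
    ultimately have "M * (U * ev i) = 0" unfolding U(5) by (simp add: mult.assoc)
    then have "(norm (Id_n n * (U * ev i)))\<^sup>2 \<le> 0" using pos[of "U * ev i"] by simp
    then have "U * ev i = 0" using U(1) by (simp add: mult.assoc[symmetric])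
    then have "ev i = 0" using \<open>tp U * (U * ev i) = ev i\<close> by simp
    then have "ent (ev i) i 0 = 0" by simp
    then show False by simp
  qed
  define T where "T = U * Dg n (\<lambda>i. sqrt (d i)) * tp U"
  define c where "c = U * Dg n (\<lambda>i. 1 / sqrt (d i)) * tp U"
  have UU: "tp U * (U * X) = Id_n n * X" for X using U(3) by (simp add: mult.assoc[symmetric])
  have DI: "Dg n f * (Id_n n * X) = Dg n f * X" for f X by (simp add: mult.assoc[symmetric])
  have mul: "U * Dg n f * tp U * (U * Dg n g * tp U) = U * Dg n (\<lambda>i. f i * g i) * tp U" for f g
    by (simp add: mult.assoc UU DI) (simp add: mult.assoc[symmetric] Dg_mult[symmetric])
  have one: "U * Dg n (\<lambda>i. 1) * tp U = Id_n n"
  proof -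
    have "Dg n (\<lambda>i. 1) = Id_n n" by (rule fsmat_eqI) auto
    then show ?thesis using U by simp
  qed
  have p: "psdq (U * Dg n f * tp U)" if "\<And>i. i < n \<Longrightarrow> 0 \<le> f i" for f
    unfolding psdq_def
  proof
    fix X
    have "inner X (U * Dg n f * tp U * X) = inner (tp U * X) (Dg n f * (tp U * X))"
      by (simp add: inner_left_mult mult.assoc)
    also have "\<dots> \<ge> 0" unfolding inner_Dg by (intro sum_nonneg mult_nonneg_nonneg) (use that in auto)
    finally show "0 \<le> inner X (U * Dg n f * tp U * X)" .
  qed
  have s: "tp (U * Dg n f * tp U) = U * Dg n f * tp U" "Id_n n * (U * Dg n f * tp U) = U * Dg n f * tp U" for f
    using U(1) by (simp_all add: mult.assoc) (simp add: mult.assoc[symmetric])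
  have "T * T = M" unfolding T_def mul U(5) using d0 by (intro arg_cong2[of _ _ _ _ "(*)"] refl Dg_cong) simp
  moreover have "c * T = Id_n n" "T * c = Id_n n"
    unfolding T_def c_def mul one[symmetric]
    by (intro arg_cong2[of _ _ _ _ "(*)"] refl Dg_cong, use d in force)+
  moreover have "psdq T" "psdq c" unfolding T_def c_def using d0 by (auto intro!: p)
  ultimately show ?thesis using that s T_def c_def by metis
qed

lemma inv_sqrt_one_plus:
  assumes g: "g \<in> carrier_mat k r"
  shows "inv_sqrt (1\<^sub>m r + g\<^sup>T * g) \<in> carrier_mat r r"
    and "\<exists>T. let c = fs (inv_sqrt (1\<^sub>m r + g\<^sup>T * g)) in tp c = c \<and> psdq c \<and> c * T = Id_n r \<and> T * c = Id_n r
      \<and> tp T = T \<and> Id_n r * T = T \<and> T * T = Id_n r + tp (fs g) * fs g"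
proof -
  define M where "M = 1\<^sub>m r + g\<^sup>T * g"
  have M: "M \<in> carrier_mat r r" unfolding M_def using g by auto
  have fM: "fs M = Id_n r + tp (fs g) * fs g" unfolding M_def using g by (simp add: fs_add fs_mult)
  have gI: "fs g * Id_n r = fs g" using g by simp
  have t: "tp (fs M) = fs M" "Id_n r * fs M = fs M" using g by (simp_all add: fM distrib_left mult.assoc[symmetric])
  have "(norm (Id_n r * X))\<^sup>2 \<le> inner X (fs M * X)" for X
  proof -
    have "inner X (Id_n r * X) = (norm (Id_n r * X))\<^sup>2"
      unfolding power2_norm_eq_inner by (metis Id_mult_Id inner_left_mult mult.assoc tp_Id)
    moreover have "inner X (tp (fs g) * fs g * X) = inner (fs g * X) (fs g * X)"
      by (simp only: inner_left_mult mult.assoc)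
    ultimately show ?thesis unfolding fM by (simp add: distrib_right inner_add_right)
  qed
  then obtain T c where T: "tp T = T" "Id_n r * T = T" "psdq T" "T * T = fs M" and c: "tp c = c" "Id_n r * c = c" "psdq c"
    "c * T = Id_n r" "T * c = Id_n r" using ex_positive_sqrt[OF t] by metis
  have TI: "T * Id_n r = T" "c * Id_n r = c" using arg_cong[OF T(2), of tp] T(1) arg_cong[OF c(2), of tp] c(1) by simp_all
  define X where "X = to_mat r r T"
  have X: "X \<in> carrier_mat r r" "fs X = T" using fs_to_mat[OF T(2) TI(1)] by (simp_all add: X_def)
  have XX: "X * X = M" by (rule fs_inject[of _ r r]) (use X M T in \<open>auto simp: fs_mult\<close>)
  have "psd_sqrt M = X"
    unfolding psd_sqrt_def
  proof (rule the_equality)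
    show "X \<in> carrier_mat (dim_row M) (dim_row M) \<and> psd X \<and> X * X = M"
      using X M XX T psd_of_psdq[OF X(1)] by simp
    fix Y assume Y: "Y \<in> carrier_mat (dim_row M) (dim_row M) \<and> psd Y \<and> Y * Y = M"
    then have Y': "Y \<in> carrier_mat r r" "psd Y" "Y * Y = M" using M by auto
    have "fs Y = fs X"
    proof (rule psdq_sqrt_unique)
      show "tp (fs Y) = fs Y" using Y'(2) unfolding psd_def by (metis fs_transpose)
      show "fs Y * fs Y = fs X * fs X" using X T Y' by (metis fs_mult carrier_matD)
    qed (use Y' X T psdq_fs in auto)
    then show "Y = X" by (rule fs_inject[OF Y'(1) X(1)])
  qed
  moreover define Z where "Z = to_mat r r c"
  have Z: "Z \<in> carrier_mat r r" "fs Z = c" using fs_to_mat[OF c(2) TI(2)] by (simp_all add: Z_def)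
  have "X * Z = 1\<^sub>m r" by (rule fs_inject[of _ r r]) (use X Z c in \<open>auto simp: fs_mult\<close>)
  then have "mat_inv X = Z" by (rule mat_inv_eqI[OF X(1) Z(1)])
  ultimately have inv: "inv_sqrt M = Z" unfolding inv_sqrt_def by simp
  then show "inv_sqrt (1\<^sub>m r + g\<^sup>T * g) \<in> carrier_mat r r" using Z M_def by simp
  show "\<exists>T. let c = fs (inv_sqrt (1\<^sub>m r + g\<^sup>T * g)) in tp c = c \<and> psdq c \<and> c * T = Id_n r \<and> T * c = Id_n r
      \<and> tp T = T \<and> Id_n r * T = T \<and> T * T = Id_n r + tp (fs g) * fs g"
    using T c fM Z unfolding M_def[symmetric] inv Let_def by (intro exI[of _ T]) simp
qed

primrec fpow :: "nat \<Rightarrow> fsmat \<Rightarrow> nat \<Rightarrow> fsmat" where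
  "fpow n M 0 = Id_n n" | "fpow n M (Suc k) = fpow n M k * M"

lemma fs_pow: "A \<in> carrier_mat n n \<Longrightarrow> fs (A ^\<^sub>m k) = fpow n (fs A) k"
  by (induction k) (simp_all add: fs_mult)

text \<open>The real form of an eigenvalue \<open>x + iy\<close> with eigenvector \<open>X + iY\<close>.\<close>

definition stb :: "nat \<Rightarrow> fsmat \<Rightarrow> bool" where
  "stb n a \<longleftrightarrow> (\<forall>x y X Y. Id_n n * X = X \<and> Id_n n * Y = Y \<and> (X \<noteq> 0 \<or> Y \<noteq> 0) \<and>
    a * X = x *\<^sub>R X - y *\<^sub>R Y \<and> a * Y = x *\<^sub>R Y + y *\<^sub>R X \<longrightarrow> x < 0)"

lemma stbD: "stb n a \<Longrightarrow> Id_n n * X = X \<Longrightarrow> Id_n n * Y = Y \<Longrightarrow> X \<noteq> 0 \<or> Y \<noteq> 0 \<Longrightarrow>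
    a * X = x *\<^sub>R X - y *\<^sub>R Y \<Longrightarrow> a * Y = x *\<^sub>R Y + y *\<^sub>R X \<Longrightarrow> x < 0"
  unfolding stb_def by blast

lemma stable_iff_stb: "A \<in> carrier_mat n n \<Longrightarrow> stable A \<longleftrightarrow> stb n (fs A)"
  unfolding stable_def stb_def using eigenvalue_cmat_iff[of A n]
  by (metis complex.sel)

lemma stable_transpose: assumes A: "A \<in> carrier_mat n n" and "stable A" shows "stable A\<^sup>T"
proof -
  have c: "cmat A \<in> carrier_mat n n" using A by simp
  have "cmat A\<^sup>T = (cmat A)\<^sup>T" by (rule eq_matI) auto
  then have "char_poly (cmat A\<^sup>T) = char_poly (cmat A)" using char_poly_transpose_mat[OF c] by simp
  then show ?thesis using assms unfolding stable_def
    by (metis eigenvalue_root_char_poly c map_carrier_mat transpose_carrier_mat)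
qed

lemma fs_inverse_of_inj:
  assumes A: "A \<in> carrier_mat n n" and inj: "\<And>X. Id_n n * X = X \<Longrightarrow> fs A * X = 0 \<Longrightarrow> X = 0"
  obtains B where "B \<in> carrier_mat n n" "A * B = 1\<^sub>m n" "B * A = 1\<^sub>m n"
proof -
  have ne: "\<not> eigenvalue A 0" unfolding eigenvalue_iff[OF A] using inj by auto
  have "det A \<noteq> 0"
  proof
    assume "det A = 0"
    then obtain v where v: "v \<in> carrier_vec n" "v \<noteq> 0\<^sub>v n" "A *\<^sub>v v = 0\<^sub>v n"
      using det_0_iff_vec_prod_zero[OF A] by blast
    have "0\<^sub>v n = 0 \<cdot>\<^sub>v v" using v(1) by (intro eq_vecI) auto
    then show False using ne v A unfolding eigenvalue_def eigenvector_def by auto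
  qed
  then have "A \<in> Units (ring_mat TYPE(real) n ())" by (rule det_non_zero_imp_unit[OF A])
  then show ?thesis using that unfolding Units_def ring_mat_def by auto
qed

lemma geometric_power_bound:
  assumes M: "M \<in> carrier_mat n n" and ev: "\<And>z. eigenvalue (cmat M) z \<Longrightarrow> cmod z < 1"
  obtains C \<rho> where "0 \<le> \<rho>" "\<rho> < 1" "0 \<le> C" "\<And>k. norm (fs (M ^\<^sub>m k)) \<le> C * \<rho> ^ k"
proof (cases "n = 0")
  case True
  have "fs (M ^\<^sub>m k) = 0" for k
  proof -
    have "M ^\<^sub>m k \<in> carrier_mat n n" using M by simp
    then show ?thesis using True by (intro fsmat_eqI) (simp only: ent_fs_carrier, simp)
  qed
  then show ?thesis using that[of 0 0] by simp
next
  case False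
  then have n: "n > 0" by simp
  have cM: "cmat M \<in> carrier_mat n n" using M by simp
  let ?s = "spectral_radius (cmat M)"
  have "?s \<in> norm ` spectrum (cmat M)" by (rule spectral_radius_mem_max(1)[OF cM n])
  then have s: "0 \<le> ?s" "?s < 1" using ev unfolding spectrum_def by auto
  define \<rho> where "\<rho> = (1 + ?s) / 2"
  have \<rho>: "0 < \<rho>" "\<rho> < 1" "?s < \<rho>" using s by (simp_all add: \<rho>_def)
  define M' where "M' = (1 / \<rho>) \<cdot>\<^sub>m M"
  have M': "M' \<in> carrier_mat n n" and cM': "cmat M' \<in> carrier_mat n n" using M by (simp_all add: M'_def)
  have "cmod z < 1" if "eigenvalue (cmat M') z" for z
  proof -
    have "eigenvalue (cmat M') z" by fact
    then obtain X Y where XY: "Id_n n * X = X" "Id_n n * Y = Y" "X \<noteq> 0 \<or> Y \<noteq> 0"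
      "fs M' * X = Re z *\<^sub>R X - Im z *\<^sub>R Y" "fs M' * Y = Re z *\<^sub>R Y + Im z *\<^sub>R X"
      unfolding eigenvalue_cmat_iff[OF M'] by blast
    have fm: "fs M = \<rho> *\<^sub>R fs M'" using \<rho> by (simp add: M'_def)
    have "eigenvalue (cmat M) (of_real \<rho> * z)"
      unfolding eigenvalue_cmat_iff[OF M] fm
      using XY(3) by (intro exI[of _ X] exI[of _ Y]) (simp add: XY(1,2,4,5) scaleR_right_diff_distrib scaleR_right_distrib)
    then have "cmod (of_real \<rho> * z) \<le> ?s"
      using spectral_radius_mem_max(2)[OF cM n] unfolding spectrum_def by blast
    then have "\<bar>\<rho>\<bar> * cmod z \<le> ?s" by (simp only: norm_mult norm_of_real)
    then have "\<rho> * cmod z < \<rho> * 1" using \<rho> by linarith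
    then show ?thesis using \<rho> mult_less_cancel_left_pos[of \<rho> "cmod z" 1] by simp
  qed
  moreover have "spectral_radius (cmat M') \<in> norm ` spectrum (cmat M')"
    by (rule spectral_radius_mem_max(1)[OF cM' n])
  ultimately have "spectral_radius (cmat M') < 1" unfolding spectrum_def by auto
  then obtain c where c: "\<And>k. norm_bound (cmat M' ^\<^sub>m k) c"
    using spectral_radius_jnf_norm_bound_less_1_upper_triangular[OF cM'] by blast
  have e: "\<bar>(M' ^\<^sub>m k) $$ (i, j)\<bar> \<le> c" if "i < n" "j < n" for k i j
    using c[of k] that M' unfolding norm_bound_def cmat_pow[OF M', symmetric] by simp
  have c0: "0 \<le> c" using e[of 0 0 0] n by (meson abs_ge_zero order_trans)
  have "norm (fs (M' ^\<^sub>m k)) \<le> n * c" for k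
  proof -
    have P: "M' ^\<^sub>m k \<in> carrier_mat n n" using M' by simp
    have "(norm (fs (M' ^\<^sub>m k)))\<^sup>2 = (\<Sum>i<n. \<Sum>j<n. (ent (fs (M' ^\<^sub>m k)) i j)\<^sup>2)"
      by (rule norm_fsmat_sq, rule bounded_by_fs) (simp_all only: carrier_matD[OF P])
    also have "\<dots> \<le> (\<Sum>i<n. \<Sum>j<n. c\<^sup>2)"
    proof (intro sum_mono)
      fix i j assume "i \<in> {..<n}" "j \<in> {..<n}"
      then have "ent (fs (M' ^\<^sub>m k)) i j = (M' ^\<^sub>m k) $$ (i, j)" "\<bar>(M' ^\<^sub>m k) $$ (i, j)\<bar> \<le> c"
        using e by (simp_all only: ent_fs_carrier[OF P] lessThan_iff simp_thms if_True)
      then show "(ent (fs (M' ^\<^sub>m k)) i j)\<^sup>2 \<le> c\<^sup>2" using c0 by (metis abs_le_square_iff abs_of_nonneg)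
    qed
    also have "\<dots> = (n * c)\<^sup>2" by (simp add: power2_eq_square)
    finally show ?thesis by (rule power2_le_imp_le) (simp add: c0)
  qed
  moreover have "fs (M ^\<^sub>m k) = \<rho> ^ k *\<^sub>R fs (M' ^\<^sub>m k)" for k
  proof -
    have "fs M = \<rho> *\<^sub>R fs M'" using \<rho> by (simp add: M'_def)
    then have "fpow n (fs M) k = \<rho> ^ k *\<^sub>R fpow n (fs M') k" by (induction k) simp_all
    then show ?thesis using fs_pow M M' by metis
  qed
  ultimately have "norm (fs (M ^\<^sub>m k)) \<le> n * c * \<rho> ^ k" for k
    using \<rho> by (simp add: mult.commute mult_left_mono)
  then show ?thesis using that[of \<rho> "n * c"] \<rho> c0 by simp
qed

text \<open>The Cayley transform turns the Lyapunov equation into a discrete one whose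
  solutions are geometric series.\<close>

lemma cayley_transform:
  assumes A: "A \<in> carrier_mat n n" and st: "stable A"
  obtains R M C \<rho> where "Id_n n * R = R" "R * Id_n n = R" "(Id_n n - fs A) * R = Id_n n" "R * (Id_n n - fs A) = Id_n n"
    "M = (Id_n n + fs A) * R" "M = R * (Id_n n + fs A)" "0 \<le> \<rho>" "\<rho> < 1" "0 \<le> C" "\<And>k. norm (fpow n M k) \<le> C * \<rho> ^ k"
proof -
  define a where "a = fs A"
  have a: "Id_n n * a = a" "a * Id_n n = a" using A by (simp_all add: a_def)
  have stb: "stb n a" using st stable_iff_stb[OF A] by (simp add: a_def)
  define L where "L = 1\<^sub>m n - A"
  have L: "L \<in> carrier_mat n n" "fs L = Id_n n - a" using A by (simp_all add: L_def a_def fs_minus minus_carrier_mat)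
  have "X = 0" if X: "Id_n n * X = X" "fs L * X = 0" for X
  proof (rule ccontr)
    assume "X \<noteq> 0"
    have "a * X = 1 *\<^sub>R X - 0 *\<^sub>R 0" using X L by (simp add: left_diff_distrib)
    moreover have "a * 0 = 1 *\<^sub>R 0 + 0 *\<^sub>R X" by simp
    ultimately show False using stb[unfolded stb_def, rule_format, of X 0 1 0] X \<open>X \<noteq> 0\<close> by simp
  qed
  then obtain B where B: "B \<in> carrier_mat n n" "L * B = 1\<^sub>m n" "B * L = 1\<^sub>m n"
    using fs_inverse_of_inj[OF L(1)] by blast
  define R where "R = fs B"
  have R: "Id_n n * R = R" "R * Id_n n = R" "(Id_n n - a) * R = Id_n n" "R * (Id_n n - a) = Id_n n"
    using B L by (simp_all add: R_def fs_mult[symmetric]) (metis L fs_mult carrier_matD fs_one B)+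
  define M where "M = (Id_n n + a) * R"
  define K where "K = Id_n n + a"
  have LK: "(Id_n n - a) * K = K * (Id_n n - a)" and IK: "Id_n n * K = K" unfolding K_def by (simp_all add: ring_distribs a)
  have "K * R = R * (Id_n n - a) * (K * R)" unfolding R(4) by (simp add: mult.assoc[symmetric] IK)
  also have "\<dots> = R * ((Id_n n - a) * K) * R" by (simp only: mult.assoc)
  also have "\<dots> = R * K * ((Id_n n - a) * R)" unfolding LK by (simp only: mult.assoc)
  also have "\<dots> = R * K" unfolding R(3) by (simp add: K_def ring_distribs a R(2) mult.assoc)
  finally have M': "M = R * (Id_n n + a)" unfolding M_def K_def .
  define N where "N = (1\<^sub>m n + A) * B"
  have N: "N \<in> carrier_mat n n" unfolding N_def by (intro mult_carrier_mat[of _ n n] add_carrier_mat A B one_carrier_mat)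
  have N2: "fs N = M" using A B by (simp add: N_def M_def R_def a_def fs_mult fs_add)
  have "cmod z < 1" if "eigenvalue (cmat N) z" for z
  proof -
    have "eigenvalue (cmat N) z" by fact
    then obtain X Y where XY: "Id_n n * X = X" "Id_n n * Y = Y" "X \<noteq> 0 \<or> Y \<noteq> 0"
      "M * X = Re z *\<^sub>R X - Im z *\<^sub>R Y" "M * Y = Re z *\<^sub>R Y + Im z *\<^sub>R X"
      unfolding eigenvalue_cmat_iff[OF N] N2 by blast
    define x y where "x = Re z" and "y = Im z"
    define W V where "W = R * X" and "V = R * Y"
    have IW: "Id_n n * W = W" "Id_n n * V = V" unfolding W_def V_def using R(1) by (simp_all add: mult.assoc[symmetric])
    have "(Id_n n - a) * W = X" "(Id_n n - a) * V = Y"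
      unfolding W_def V_def by (simp_all add: mult.assoc[symmetric] R(3) XY(1,2))
    then have XW: "X = W - a * W" "Y = V - a * V" by (simp_all add: left_diff_distrib IW)
    have MX: "M * X = W + a * W" "M * Y = V + a * V"
      unfolding M_def mult.assoc W_def[symmetric] V_def[symmetric] by (simp_all add: distrib_right IW)
    have E1: "W + a * W = x *\<^sub>R X - y *\<^sub>R Y" unfolding MX(1)[symmetric] XY(4) x_def y_def ..
    have E2: "V + a * V = x *\<^sub>R Y + y *\<^sub>R X" unfolding MX(2)[symmetric] XY(5) x_def y_def ..
    note E1 = E1[unfolded XW] and E2 = E2[unfolded XW]
    define d where "d = (1 + x)\<^sup>2 + y\<^sup>2"
    define P Q' where "P = (1 + x) *\<^sub>R W - y *\<^sub>R V" and "Q' = (1 + x) *\<^sub>R V + y *\<^sub>R W"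
    have WP: "d *\<^sub>R W = (1 + x) *\<^sub>R P + y *\<^sub>R Q'" and VP: "d *\<^sub>R V = (1 + x) *\<^sub>R Q' - y *\<^sub>R P"
      by (rule fsmat_eqI; simp add: d_def P_def Q'_def algebra_simps power2_eq_square)+
    have aP: "a * P = (x - 1) *\<^sub>R W - y *\<^sub>R V" and aQ: "a * Q' = (x - 1) *\<^sub>R V + y *\<^sub>R W"
      using E1 E2 unfolding P_def Q'_def by (simp_all add: algebra_simps)
    have scale: "Z = (1 / d) *\<^sub>R (d *\<^sub>R Z)" if "d \<noteq> 0" for Z :: fsmat using that by simp
    have nz: "d \<noteq> 0"
    proof
      assume "d = 0"
      then have "x = -1" "y = 0" unfolding d_def by (simp_all add: sum_power2_eq_zero_iff)
      then have "W + W = 0" "V + V = 0" using E1 E2 by (simp_all add: algebra_simps)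
      then have "W = 0" "V = 0" by (simp_all add: scaleR_2[symmetric])
      then show False using XW XY(3) by simp
    qed
    have dpos: "0 < d" using nz by (simp add: d_def less_le)
    have PQ: "P \<noteq> 0 \<or> Q' \<noteq> 0"
    proof (rule ccontr)
      assume "\<not> ?thesis"
      then have "d *\<^sub>R W = 0" "d *\<^sub>R V = 0" using WP VP by simp_all
      then show False using nz XW XY(3) by simp
    qed
    have "d *\<^sub>R (a * P) = (x\<^sup>2 + y\<^sup>2 - 1) *\<^sub>R P - (2 * y) *\<^sub>R Q'"
    proof -
      have "d *\<^sub>R (a * P) = (x - 1) *\<^sub>R (d *\<^sub>R W) - y *\<^sub>R (d *\<^sub>R V)" unfolding aP by (simp add: algebra_simps)
      then show ?thesis unfolding WP VP by (simp only:) (rule fsmat_eqI; simp add: algebra_simps power2_eq_square)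
    qed
    then have P: "a * P = ((x\<^sup>2 + y\<^sup>2 - 1) / d) *\<^sub>R P - (2 * y / d) *\<^sub>R Q'"
      by (subst scale[OF nz]) (simp add: scaleR_right_diff_distrib)
    have "d *\<^sub>R (a * Q') = (x\<^sup>2 + y\<^sup>2 - 1) *\<^sub>R Q' + (2 * y) *\<^sub>R P"
    proof -
      have "d *\<^sub>R (a * Q') = (x - 1) *\<^sub>R (d *\<^sub>R V) + y *\<^sub>R (d *\<^sub>R W)" unfolding aQ by (simp add: algebra_simps)
      then show ?thesis unfolding WP VP by (simp only:) (rule fsmat_eqI; simp add: algebra_simps power2_eq_square)
    qed
    then have Q: "a * Q' = ((x\<^sup>2 + y\<^sup>2 - 1) / d) *\<^sub>R Q' + (2 * y / d) *\<^sub>R P"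
      by (subst scale[OF nz]) (simp add: scaleR_right_distrib)
    have I: "Id_n n * P = P" "Id_n n * Q' = Q'" unfolding P_def Q'_def using IW by (simp_all add: algebra_simps)
    have "(x\<^sup>2 + y\<^sup>2 - 1) / d < 0" by (rule stbD[OF stb I PQ P Q])
    then have "x\<^sup>2 + y\<^sup>2 < 1" using dpos by (simp add: divide_less_0_iff)
    then have "(cmod z)\<^sup>2 < 1" by (simp only: cmod_power2 x_def y_def)
    then have "(cmod z)\<^sup>2 < 1\<^sup>2" by (simp only: power_one)
    then show "cmod z < 1" by (rule power_less_imp_less_base) (rule zero_le_one)
  qed
  then obtain C \<rho> where C: "0 \<le> \<rho>" "\<rho> < 1" "0 \<le> C" "\<And>k. norm (fs (N ^\<^sub>m k)) \<le> C * \<rho> ^ k"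
    using geometric_power_bound[OF N] by blast
  have "norm (fpow n M k) \<le> C * \<rho> ^ k" for k using C(4)[of k] unfolding fs_pow[OF N] N2 .
  then show ?thesis using that[of R M \<rho> C] R M_def M' C a_def by blast
qed

section \<open>Lyapunov equations\<close>

locale cayley =
  fixes n :: nat and a R M :: fsmat and C \<rho> :: real
  assumes Ia: "Id_n n * a = a" "a * Id_n n = a"
    and IR: "Id_n n * R = R" "R * Id_n n = R"
    and inv: "(Id_n n - a) * R = Id_n n" "R * (Id_n n - a) = Id_n n"
    and M: "M = (Id_n n + a) * R" "M = R * (Id_n n + a)"
    and \<rho>: "0 \<le> \<rho>" "\<rho> < 1" and C: "0 \<le> C" and pow: "\<And>k. norm (fpow n M k) \<le> C * \<rho> ^ k"
begin

lemma IM: "Id_n n * M = M" "M * Id_n n = M"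
  by (simp add: M(2) mult.assoc[symmetric] IR) (simp add: M(1) mult.assoc IR)

lemma tpI: "tp a * Id_n n = tp a" "Id_n n * tp a = tp a" "tp R * Id_n n = tp R" "Id_n n * tp R = tp R"
  "tp M * Id_n n = tp M" "Id_n n * tp M = tp M"
  using arg_cong[OF Ia(1), of tp] arg_cong[OF Ia(2), of tp] arg_cong[OF IR(1), of tp] arg_cong[OF IR(2), of tp]
    arg_cong[OF IM(1), of tp] arg_cong[OF IM(2), of tp] by (simp_all only: tp_mult tp_Id)

lemma tpinv: "tp R * (Id_n n - tp a) = Id_n n" "(Id_n n - tp a) * tp R = Id_n n"
  using arg_cong[OF inv(1), of tp] arg_cong[OF inv(2), of tp] by (simp_all only: tp_mult tp_Id tp_simps)

lemma tpM: "tp M = tp R * (Id_n n + tp a)" "tp M = (Id_n n + tp a) * tp R"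
  using arg_cong[OF M(1), of tp] arg_cong[OF M(2), of tp] by (simp_all only: tp_mult tp_Id tp_simps)

lemma stein_of_lyapunov:
  assumes X: "Id_n n * X = X" "X * Id_n n = X" and eq: "a * X + X * tp a + N = 0"
  shows "X = M * X * tp M + 2 *\<^sub>R (R * N * tp R)"
proof -
  have 1: "(Id_n n - a) * X * (Id_n n - tp a) = X - a * X - X * tp a + a * X * tp a"
    by (simp add: ring_distribs X mult.assoc)
  have 2: "(Id_n n + a) * X * (Id_n n + tp a) = X + a * X + X * tp a + a * X * tp a"
    by (simp add: ring_distribs X mult.assoc)
  have N: "N = - (a * X + X * tp a)" by (rule minus_unique[OF eq, symmetric])
  have 3: "(Id_n n - a) * X * (Id_n n - tp a) = (Id_n n + a) * X * (Id_n n + tp a) + 2 *\<^sub>R N"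
    unfolding 1 2 N by (simp add: scaleR_2)
  have "X = (R * (Id_n n - a)) * X * ((Id_n n - tp a) * tp R)" unfolding inv tpinv X ..
  also have "\<dots> = R * ((Id_n n - a) * X * (Id_n n - tp a)) * tp R" by (simp only: mult.assoc)
  also have "\<dots> = (R * (Id_n n + a)) * X * ((Id_n n + tp a) * tp R) + 2 *\<^sub>R (R * N * tp R)"
    unfolding 3 by (simp only: distrib_left distrib_right mult.assoc mult_scaleR_left mult_scaleR_right)
  finally show ?thesis unfolding M(2)[symmetric] tpM(2)[symmetric] .
qed

lemma lyapunov_of_stein:
  assumes X: "Id_n n * X = X" "X * Id_n n = X" and N: "Id_n n * N = N" "N * Id_n n = N"
    and eq: "X = M * X * tp M + 2 *\<^sub>R (R * N * tp R)"
  shows "a * X + X * tp a + N = 0"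
proof -
  have LM: "(Id_n n - a) * M = Id_n n + a"
  proof -
    have "(Id_n n - a) * (Id_n n + a) = (Id_n n + a) * (Id_n n - a)" by (simp add: ring_distribs Ia)
    then have "(Id_n n - a) * ((Id_n n + a) * R) = (Id_n n + a) * ((Id_n n - a) * R)" by (simp only: mult.assoc[symmetric])
    then show ?thesis unfolding M(1)[symmetric] inv by (simp add: ring_distribs Ia)
  qed
  have LtM: "tp M * (Id_n n - tp a) = Id_n n + tp a" using arg_cong[OF LM, of tp] by simp
  have 1: "(Id_n n - a) * X * (Id_n n - tp a) = X - a * X - X * tp a + a * X * tp a"
    by (simp add: ring_distribs X mult.assoc)
  have 2: "(Id_n n + a) * X * (Id_n n + tp a) = X + a * X + X * tp a + a * X * tp a"
    by (simp add: ring_distribs X mult.assoc)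
  have "(Id_n n - a) * X * (Id_n n - tp a)
      = ((Id_n n - a) * M) * X * (tp M * (Id_n n - tp a)) + 2 *\<^sub>R (((Id_n n - a) * R) * N * (tp R * (Id_n n - tp a)))"
    by (subst eq) (simp only: distrib_left distrib_right mult.assoc mult_scaleR_left mult_scaleR_right)
  then have "X - a * X - X * tp a + a * X * tp a = X + a * X + X * tp a + a * X * tp a + 2 *\<^sub>R N"
    unfolding LM LtM inv tpinv N 1 2 .
  then have "2 *\<^sub>R (a * X + X * tp a + N) = 0" by (simp add: scaleR_2 algebra_simps)
  then show ?thesis by simp
qed

lemma fpow_Id: "Id_n n * fpow n M k = fpow n M k" "fpow n M k * Id_n n = fpow n M k"
  by (induction k) (simp_all add: mult.assoc[symmetric], simp add: mult.assoc IM)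

lemma fpow_commute: "M * fpow n M k = fpow n M k * M"
  by (induction k) (simp_all add: IM mult.assoc[symmetric])

lemma geometric_tendsto_0: "(\<lambda>k. K * (C * \<rho> ^ k)\<^sup>2) \<longlonglongrightarrow> 0"
proof -
  have z: "(\<lambda>k. \<rho> ^ k) \<longlonglongrightarrow> 0" by (rule LIMSEQ_realpow_zero[OF \<rho>])
  have "(\<lambda>k. K * (C * \<rho> ^ k)\<^sup>2) \<longlonglongrightarrow> K * (C * 0)\<^sup>2"
    by (intro tendsto_mult[OF tendsto_const] tendsto_power z)
  then show ?thesis by simp
qed

lemma norm_congruence_pow_le: "norm (fpow n M k * X * tp (fpow n M k)) \<le> norm X * (C * \<rho> ^ k)\<^sup>2"
proof -
  have "norm (fpow n M k * X * tp (fpow n M k)) \<le> norm (fpow n M k * X) * norm (fpow n M k)"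
    using norm_mult_ineq[of "fpow n M k * X" "tp (fpow n M k)"] by simp
  also have "\<dots> \<le> norm (fpow n M k) * norm X * norm (fpow n M k)"
    by (rule mult_right_mono[OF norm_mult_ineq]) simp
  also have "\<dots> = norm X * (norm (fpow n M k))\<^sup>2" by (simp add: power2_eq_square)
  also have "\<dots> \<le> norm X * (C * \<rho> ^ k)\<^sup>2" by (intro mult_left_mono power_mono pow) simp_all
  finally show ?thesis .
qed

lemma stein_unique: assumes "Id_n n * X = X" "X * Id_n n = X" "X = M * X * tp M" shows "X = 0"
proof -
  have e: "X = fpow n M k * X * tp (fpow n M k)" for k
  proof (induction k)
    case (Suc k)
    have "fpow n M (Suc k) * X * tp (fpow n M (Suc k)) = fpow n M k * (M * X * tp M) * tp (fpow n M k)"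
      by (simp add: mult.assoc)
    also have "\<dots> = X" unfolding assms(3)[symmetric] by (rule Suc[symmetric])
    finally show ?case ..
  qed (simp add: assms(1,2))
  have "norm X \<le> norm X * (C * \<rho> ^ k)\<^sup>2" for k using norm_congruence_pow_le[of k X] e[of k] by simp
  then have "norm X \<le> 0" using geometric_tendsto_0[of "norm X"] by (intro LIMSEQ_le_const) auto
  then show ?thesis by simp
qed

lemma stein_psdq:
  assumes X: "Id_n n * X = X" "X * Id_n n = X" and eq: "X = M * X * tp M + 2 *\<^sub>R (R * N * tp R)" and N: "psdq N"
  shows "psdq X"
  unfolding psdq_def
proof
  fix Y
  have step: "inner (tp M * Z) (X * (tp M * Z)) \<le> inner Z (X * Z)" for Z
  proof -
    have "inner Z (X * Z) = inner Z (M * X * tp M * Z) + 2 * inner Z (R * N * tp R * Z)"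
      by (subst eq) (simp add: distrib_right inner_add_right)
    moreover have "inner Z (M * X * tp M * Z) = inner (tp M * Z) (X * (tp M * Z))"
      "inner Z (R * N * tp R * Z) = inner (tp R * Z) (N * (tp R * Z))"
      by (simp_all only: inner_left_mult mult.assoc tp_simps)
    moreover have "0 \<le> inner (tp R * Z) (N * (tp R * Z))" using N unfolding psdq_def by blast
    ultimately show ?thesis by linarith
  qed
  have it: "inner (tp (fpow n M k) * Y) (X * (tp (fpow n M k) * Y)) \<le> inner Y (X * Y)" for k
  proof (induction k)
    case 0
    have "inner (Id_n n * Y) (X * (Id_n n * Y)) = inner Y (X * Y)"
      unfolding inner_left_mult by (simp add: mult.assoc[symmetric] X)
    then show ?case by simp
  next
    case (Suc k)
    show ?case using step[of "tp (fpow n M k) * Y"] Suc by (simp add: mult.assoc)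
  qed
  have "- (opn X * (norm Y)\<^sup>2 * (C * \<rho> ^ k)\<^sup>2) \<le> inner Y (X * Y)" for k
  proof -
    let ?Z = "tp (fpow n M k) * Y"
    have "\<bar>inner ?Z (X * ?Z)\<bar> \<le> norm ?Z * (opn X * norm ?Z)"
      by (meson Cauchy_Schwarz_ineq2 mult_left_mono norm_ge_zero norm_mult_opn order_trans)
    also have "\<dots> = opn X * (norm ?Z)\<^sup>2" by (simp add: power2_eq_square)
    also have "\<dots> \<le> opn X * ((C * \<rho> ^ k) * norm Y)\<^sup>2"
    proof (intro mult_left_mono power_mono)
      have "norm ?Z \<le> norm (fpow n M k) * norm Y" using norm_mult_ineq[of "tp (fpow n M k)" Y] by simp
      also have "\<dots> \<le> (C * \<rho> ^ k) * norm Y" by (intro mult_right_mono pow) simp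
      finally show "norm ?Z \<le> (C * \<rho> ^ k) * norm Y" .
    qed simp_all
    finally show ?thesis using it[of k] by (simp add: power_mult_distrib algebra_simps)
  qed
  moreover have "(\<lambda>k. - (opn X * (norm Y)\<^sup>2 * (C * \<rho> ^ k)\<^sup>2)) \<longlonglongrightarrow> 0"
    using tendsto_minus[OF geometric_tendsto_0[of "opn X * (norm Y)\<^sup>2"]] by simp
  ultimately show "0 \<le> inner Y (X * Y)" by (intro LIMSEQ_le_const2) auto
qed

lemma stein_exists:
  assumes N: "Id_n n * N = N" "N * Id_n n = N"
  shows "\<exists>X. Id_n n * X = X \<and> X * Id_n n = X \<and> X = M * X * tp M + N"
proof -
  define F where "F k = fpow n M k * N * tp (fpow n M k)" for k
  have F: "norm (F k) \<le> (norm N * C\<^sup>2) * (\<rho>\<^sup>2) ^ k" for k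
    using norm_congruence_pow_le[of k N] unfolding F_def by (simp add: power_mult_distrib power_mult[symmetric] mult.commute mult.left_commute)
  have ent_le: "\<bar>ent A i j\<bar> \<le> norm A" for A i j
  proof -
    obtain K where K: "bounded_by K A" using ex_bounded_by by blast
    define L where "L = K + i + j + 1"
    have L: "bounded_by L A" using bounded_by_mono[OF K] by (simp add: L_def)
    have "(ent A i j)\<^sup>2 \<le> (\<Sum>j<L. (ent A i j)\<^sup>2)"
      by (rule member_le_sum) (simp_all add: L_def)
    also have "\<dots> \<le> (\<Sum>i<L. \<Sum>j<L. (ent A i j)\<^sup>2)"
      by (rule member_le_sum[of i _ "\<lambda>i. \<Sum>j<L. (ent A i j)\<^sup>2"]) (simp_all add: L_def sum_nonneg)
    finally have "(ent A i j)\<^sup>2 \<le> (norm A)\<^sup>2" unfolding norm_fsmat_sq[OF L] .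
    then show ?thesis using power2_le_imp_le[of "\<bar>ent A i j\<bar>" "norm A"] by simp
  qed
  have "summable (\<lambda>k. (\<rho>\<^sup>2) ^ k)" using \<rho> by (intro summable_geometric) (simp add: abs_square_less_1)
  then have sg: "summable (\<lambda>k. (norm N * C\<^sup>2) * (\<rho>\<^sup>2) ^ k)" by (rule summable_mult)
  have sm: "summable (\<lambda>k. ent (F k) i j)" for i j
  proof (rule summable_comparison_test'[OF sg, of 0])
    show "norm (ent (F k) i j) \<le> (norm N * C\<^sup>2) * (\<rho>\<^sup>2) ^ k" for k
      unfolding real_norm_def by (rule order_trans[OF ent_le F])
  qed
  define X where "X = fs (mat n n (\<lambda>(i, j). \<Sum>k. ent (F k) i j))"
  have X: "Id_n n * X = X" "X * Id_n n = X" by (simp_all add: X_def)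
  define S where "S K = (\<Sum>k<K. F k)" for K
  have FI: "Id_n n * F k = F k" "F k * Id_n n = F k" for k
    unfolding F_def by (simp_all add: mult.assoc[symmetric] fpow_Id)
      (metis fpow_Id(1) mult.assoc tp_Id tp_mult)
  have SI: "Id_n n * S k = S k" "S k * Id_n n = S k" for k
    unfolding S_def by (simp_all add: sum_distrib_left sum_distrib_right FI)
  have SX: "S \<longlonglongrightarrow> X"
  proof -
    have D: "bounded_by n (S K - X)" for K
    proof -
      have "S K - X = Id_n n * (S K - X)" "S K - X = (S K - X) * Id_n n" by (simp_all add: ring_distribs SI X)
      then show ?thesis unfolding bounded_by_def by (metis ent_Id_mult ent_mult_Id)
    qed
    have "(\<lambda>K. ent (S K - X) i j) \<longlonglongrightarrow> 0" if "i < n" "j < n" for i j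
    proof -
      have "(\<lambda>K. \<Sum>k<K. ent (F k) i j) \<longlonglongrightarrow> (\<Sum>k. ent (F k) i j)" by (rule summable_LIMSEQ[OF sm])
      then show ?thesis using that by (simp add: S_def X_def LIM_zero_iff)
    qed
    then have "(\<lambda>K. \<Sum>i<n. \<Sum>j<n. (ent (S K - X) i j)\<^sup>2) \<longlonglongrightarrow> (\<Sum>i<n. \<Sum>j<n. 0\<^sup>2)"
      by (intro tendsto_sum tendsto_power) auto
    then have "(\<lambda>K. (norm (S K - X))\<^sup>2) \<longlonglongrightarrow> 0" unfolding norm_fsmat_sq[OF D] by simp
    then have "(\<lambda>K. sqrt ((norm (S K - X))\<^sup>2)) \<longlonglongrightarrow> sqrt 0" by (rule tendsto_real_sqrt)
    then have "(\<lambda>K. norm (S K - X)) \<longlonglongrightarrow> 0" by simp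
    then show ?thesis by (simp add: tendsto_norm_zero_iff LIM_zero_iff)
  qed
  have step: "S (Suc K) = M * S K * tp M + N" for K
  proof -
    have "M * F k * tp M = F (Suc k)" for k
      unfolding F_def fpow.simps fpow_commute[symmetric] by (simp add: mult.assoc)
    then have "M * S K * tp M = (\<Sum>k<K. F (Suc k))" unfolding S_def by (simp add: sum_distrib_left sum_distrib_right)
    moreover have "F 0 = N" by (simp add: F_def N)
    ultimately show ?thesis unfolding S_def sum.lessThan_Suc_shift by (simp add: add.commute)
  qed
  have "(\<lambda>K. M * S K * tp M + N) \<longlonglongrightarrow> M * X * tp M + N" by (intro tendsto_intros SX)
  moreover have "(\<lambda>K. M * S K * tp M + N) \<longlonglongrightarrow> X" unfolding step[symmetric] using SX by (rule LIMSEQ_Suc)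
  ultimately have "X = M * X * tp M + N" using LIMSEQ_unique by blast
  then show ?thesis using X by blast
qed

end

lemma stable_cayley:
  assumes "A \<in> carrier_mat n n" "stable A"
  obtains R M C \<rho> where "cayley n (fs A) R M C \<rho>"
proof -
  show ?thesis
  proof (rule cayley_transform[OF assms])
    fix R M C \<rho>
    assume h: "Id_n n * R = R" "R * Id_n n = R" "(Id_n n - fs A) * R = Id_n n" "R * (Id_n n - fs A) = Id_n n"
      "M = (Id_n n + fs A) * R" "M = R * (Id_n n + fs A)" "0 \<le> \<rho>" "\<rho> < 1" "0 \<le> C" "\<And>k. norm (fpow n M k) \<le> C * \<rho> ^ k"
    have "cayley n (fs A) R M C \<rho>"
      by (rule cayley.intro; (rule h)?) (use assms in simp_all)
    then show ?thesis by (rule that)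
  qed
qed

lemma lyapunov_unique:
  assumes "A \<in> carrier_mat n n" "stable A" and X: "Id_n n * X = X" "X * Id_n n = X" "fs A * X + X * tp (fs A) + N = 0"
    and Y: "Id_n n * Y = Y" "Y * Id_n n = Y" "fs A * Y + Y * tp (fs A) + N = 0"
  shows "X = Y"
proof -
  obtain R M C \<rho> where "cayley n (fs A) R M C \<rho>" by (rule stable_cayley[OF assms(1,2)])
  then interpret cayley n "fs A" R M C \<rho> .
  have D: "Id_n n * (X - Y) = X - Y" "(X - Y) * Id_n n = X - Y" using X Y by (simp_all add: ring_distribs)
  have "fs A * (X - Y) + (X - Y) * tp (fs A) + 0 = (fs A * X + X * tp (fs A) + N) - (fs A * Y + Y * tp (fs A) + N)"
    by (simp add: ring_distribs)
  then have "fs A * (X - Y) + (X - Y) * tp (fs A) + 0 = 0" unfolding X(3) Y(3) by simp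
  from stein_of_lyapunov[OF D this] have "X - Y = M * (X - Y) * tp M" by simp
  from stein_unique[OF D this] show ?thesis by simp
qed

lemma lyapunov_psdq:
  assumes "A \<in> carrier_mat n n" "stable A" and X: "Id_n n * X = X" "X * Id_n n = X" "fs A * X + X * tp (fs A) + N = 0"
    and N: "psdq N"
  shows "psdq X"
proof -
  obtain R M C \<rho> where "cayley n (fs A) R M C \<rho>" by (rule stable_cayley[OF assms(1,2)])
  then interpret cayley n "fs A" R M C \<rho> .
  show ?thesis by (rule stein_psdq[OF X(1,2) stein_of_lyapunov[OF X] N])
qed

lemma lyapunov_exists:
  assumes "A \<in> carrier_mat n n" "stable A" and N: "Id_n n * N = N" "N * Id_n n = N"
  obtains X where "Id_n n * X = X" "X * Id_n n = X" "fs A * X + X * tp (fs A) + N = 0"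
proof -
  obtain R M C \<rho> where "cayley n (fs A) R M C \<rho>" by (rule stable_cayley[OF assms(1,2)])
  then interpret cayley n "fs A" R M C \<rho> .
  let ?N = "2 *\<^sub>R (R * N * tp R)"
  have "Id_n n * ?N = ?N" "?N * Id_n n = ?N" by (simp_all add: mult.assoc tpI) (simp add: mult.assoc[symmetric] IR)
  then obtain X where X: "Id_n n * X = X" "X * Id_n n = X" "X = M * X * tp M + ?N" using stein_exists by blast
  show ?thesis by (rule that[OF X(1,2) lyapunov_of_stein[OF X(1,2) N X(3)]])
qed

lemma ctrl_gramian_eqI:
  assumes A: "A \<in> carrier_mat n n" "stable A" and B: "B \<in> carrier_mat n m"
    and X: "Id_n n * X = X" "X * Id_n n = X" "fs A * X + X * tp (fs A) + fs B * tp (fs B) = 0"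
  shows "ctrl_gramian A B = to_mat n n X" "fs (ctrl_gramian A B) = X"
proof -
  have fX: "fs (to_mat n n X) = X" by (rule fs_to_mat[OF X(1,2)])
  have ly: "lyapunov_eq A (B * B\<^sup>T) P \<longleftrightarrow> P \<in> carrier_mat n n \<and> fs A * fs P + fs P * tp (fs A) + fs B * tp (fs B) = 0" for P
  proof -
    have "A * P + P * A\<^sup>T + B * B\<^sup>T = 0\<^sub>m n n \<longleftrightarrow> fs (A * P + P * A\<^sup>T + B * B\<^sup>T) = fs (0\<^sub>m n n)" if "P \<in> carrier_mat n n"
      using that A B fs_inject[of "A * P + P * A\<^sup>T + B * B\<^sup>T" n n "0\<^sub>m n n"] by auto
    moreover have "fs (A * P + P * A\<^sup>T + B * B\<^sup>T) = fs A * fs P + fs P * tp (fs A) + fs B * tp (fs B)" if "P \<in> carrier_mat n n"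
      using that A B by (simp add: fs_add fs_mult)
    ultimately show ?thesis unfolding lyapunov_eq_def using A by auto
  qed
  show "ctrl_gramian A B = to_mat n n X"
    unfolding ctrl_gramian_def
  proof (rule the_equality)
    show "lyapunov_eq A (B * B\<^sup>T) (to_mat n n X)" unfolding ly fX using X by simp
    fix P assume "lyapunov_eq A (B * B\<^sup>T) P"
    then have P: "P \<in> carrier_mat n n" "fs A * fs P + fs P * tp (fs A) + fs B * tp (fs B) = 0" unfolding ly by auto
    have "fs P = X" by (rule lyapunov_unique[OF A _ _ P(2) X]) (use P in simp_all)
    then show "P = to_mat n n X" using to_mat_fs[OF P(1)] by simp
  qed
  then show "fs (ctrl_gramian A B) = X" using fX by simp
qed

lemma gramian_exists:
  assumes A: "A \<in> carrier_mat n n" "stable A" and b: "Id_n n * b = b"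
  obtains S where "Id_n n * S = S" "S * Id_n n = S" "fs A * (S * tp S) + S * tp S * tp (fs A) + b * tp b = 0"
proof -
  have tb: "tp b * Id_n n = tp b" using arg_cong[OF b, of tp] by (simp only: tp_mult tp_Id)
  have bI: "Id_n n * (b * tp b) = b * tp b" "b * tp b * Id_n n = b * tp b"
    using b tb by (simp_all add: mult.assoc) (simp add: mult.assoc[symmetric])
  obtain X where X: "Id_n n * X = X" "X * Id_n n = X" "fs A * X + X * tp (fs A) + b * tp b = 0"
    by (rule lyapunov_exists[OF A bI])
  have tX: "Id_n n * tp X = tp X" "tp X * Id_n n = tp X" using arg_cong[OF X(2), of tp] arg_cong[OF X(1), of tp] by (simp_all only: tp_mult tp_Id)
  have "tp (fs A * X + X * tp (fs A) + b * tp b) = tp 0" unfolding X(3) ..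
  then have "fs A * tp X + tp X * tp (fs A) + b * tp b = 0" by (simp add: add.commute)
  then have sym: "tp X = X" by (rule lyapunov_unique[OF A tX _ X])
  have "psdq X" by (rule lyapunov_psdq[OF A X psdq_mult_tp])
  then obtain S where "Id_n n * S = S" "S * Id_n n = S" "S * tp S = X" using psdq_factor[OF sym X(1)] by blast
  then show ?thesis using that X by metis
qed

lemma obs_gramian_eq: "obs_gramian A C = ctrl_gramian A\<^sup>T C"
  unfolding obs_gramian_def ctrl_gramian_def ..

lemma opn_factor_cong:
  assumes "S * tp S = S' * tp S'" "R * tp R = R' * tp R'"
  shows "opn (tp R * S) = opn (tp R' * S')"
proof -
  have 1: "opn (tp R * S) = opn (tp R * S')" if "S * tp S = S' * tp S'" for R S S'
  proof -
    have "(opn (tp R * S))\<^sup>2 = opn (tp R * (S * tp S) * R)"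
      unfolding opn_mult_tp[symmetric] by (simp add: mult.assoc)
    also have "\<dots> = (opn (tp R * S'))\<^sup>2" unfolding that opn_mult_tp[symmetric] by (simp add: mult.assoc)
    finally show ?thesis by (simp add: power2_eq_iff_nonneg)
  qed
  have "opn (tp R * S) = opn (tp R * S')" by (rule 1[OF assms(1)])
  also have "\<dots> = opn (tp S' * R)" using opn_tp[of "tp R * S'"] by simp
  also have "\<dots> = opn (tp S' * R')" by (rule 1[OF assms(2)])
  also have "\<dots> = opn (tp R' * S')" using opn_tp[of "tp R' * S'"] by simp
  finally show ?thesis .
qed

lemma opn_eq_0: assumes "opn A = 0" shows "A = 0"
proof -
  obtain N where N: "bounded_by N A" using ex_bounded_by by blast
  have "A * Id_n N = A" by (rule fsmat_eqI) (use bounded_byD2[OF N] in simp)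
  then show ?thesis using norm_mult_opn[of A "Id_n N"] assms by simp
qed

lemma lambda_max_product:
  assumes P: "P \<in> carrier_mat n n" "fs P = S * tp S" and Q: "Q \<in> carrier_mat n n" "fs Q = R * tp R" and n: "n > 0"
    and R: "R * Id_n n = R"
  shows "lambda_max (P * Q) = (opn (tp R * S))\<^sup>2"
  unfolding lambda_max_def
proof (rule Max_eqI)
  define G where "G = tp R * S"
  have PQ: "P * Q \<in> carrier_mat n n" "fs (P * Q) = S * tp S * (R * tp R)" using P Q by (simp_all add: fs_mult)
  show "finite {x. eigenvalue (P * Q) x}" using card_finite_spectrum(1)[OF PQ(1)] unfolding spectrum_def .
  show "x \<le> (opn (tp R * S))\<^sup>2" if "x \<in> {x. eigenvalue (P * Q) x}" for x
  proof (cases "x \<le> 0")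
    case True then show ?thesis by (meson order_trans zero_le_power2)
  next
    case False
    have "eigenvalue (P * Q) x" using \<open>x \<in> _\<close> by simp
    then obtain X where X: "X \<noteq> 0" "S * tp S * (R * tp R) * X = x *\<^sub>R X" unfolding eigenvalue_iff[OF PQ(1)] PQ(2) by blast
    define w where "w = tp R * X"
    have w: "G * (tp G * w) = x *\<^sub>R w"
    proof -
      have "G * (tp G * w) = tp R * (S * tp S * (R * tp R) * X)" unfolding G_def w_def by (simp add: mult.assoc)
      then show ?thesis unfolding X(2) w_def by simp
    qed
    have w0: "w \<noteq> 0"
    proof
      assume "w = 0"
      then have "S * tp S * (R * tp R) * X = 0" unfolding w_def by (simp add: mult.assoc)
      then show False using X False by simp
    qed
    have "x * (norm w)\<^sup>2 = inner w (G * (tp G * w))" unfolding w by (simp add: dot_square_norm)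
    also have "\<dots> = (norm (tp G * w))\<^sup>2" by (simp only: power2_norm_eq_inner inner_left_mult tp_simps)
    also have "\<dots> \<le> (opn (tp G) * norm w)\<^sup>2" by (intro power_mono norm_mult_opn) simp
    finally have "x * (norm w)\<^sup>2 \<le> (opn G)\<^sup>2 * (norm w)\<^sup>2" by (simp add: power_mult_distrib)
    then show ?thesis using w0 unfolding G_def by (simp add: mult_le_cancel_right)
  qed
  have tR: "Id_n n * tp R = tp R" using arg_cong[OF R, of tp] by (simp only: tp_mult tp_Id)
  have GG: "tp (G * tp G) = G * tp G" "Id_n n * (G * tp G) = G * tp G" unfolding G_def by (simp_all add: mult.assoc)
      (simp add: mult.assoc[symmetric] tR)
  obtain x W where W: "W \<noteq> 0" "G * tp G * W = x *\<^sub>R W" "0 \<le> x" and le: "\<And>Y. inner Y (G * tp G * Y) \<le> x * (norm Y)\<^sup>2"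
    by (rule psdq_max_eigenvalue[OF GG psdq_mult_tp n]; rule that; assumption)
  have nn: "inner Y (G * tp G * Y) = (norm (tp G * Y))\<^sup>2" for Y
    by (simp only: power2_norm_eq_inner inner_left_mult tp_simps mult.assoc)
  have "opn (tp G) \<le> sqrt x"
  proof (rule opn_leI)
    show "norm (tp G * Y) \<le> sqrt x * norm Y" for Y
      by (rule power2_le_imp_le) (use le[of Y] W(3) in \<open>simp_all add: nn power_mult_distrib\<close>)
  qed (use W in simp)
  then have 1: "(opn G)\<^sup>2 \<le> x" using W(3) by (simp add: real_le_rsqrt sqrt_le_D) (metis opn_ge_0 power_mono real_sqrt_pow2)
  have "x * (norm W)\<^sup>2 = (norm (tp G * W))\<^sup>2" using nn[of W] unfolding W(2) by (simp add: dot_square_norm)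
  also have "\<dots> \<le> (opn (tp G) * norm W)\<^sup>2" by (intro power_mono norm_mult_opn) simp
  finally have "x * (norm W)\<^sup>2 \<le> (opn G)\<^sup>2 * (norm W)\<^sup>2" by (simp add: power_mult_distrib)
  then have "x \<le> (opn G)\<^sup>2" using W(1) by (simp add: mult_le_cancel_right)
  then have x: "x = (opn G)\<^sup>2" using 1 by simp
  have "eigenvalue (P * Q) x"
  proof (cases "x = 0")
    case True
    then have "opn G = 0" using x by simp
    then have "tp G = 0" using opn_eq_0 opn_tp by metis
    moreover have "fs (P * Q) = S * tp G * tp R" unfolding PQ(2) G_def by (simp add: mult.assoc)
    ultimately have "fs (P * Q) * ev 0 = x *\<^sub>R ev 0" unfolding True by simp
    moreover have "ent (ev 0) 0 0 \<noteq> 0" by simp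
    then have "ev 0 \<noteq> 0" by (metis ent_simps(1))
    ultimately show ?thesis unfolding eigenvalue_iff[OF PQ(1)] using n by (intro exI[of _ "ev 0"]) simp
  next
    case False
    define V where "V = S * (tp G * W)"
    have IS: "Id_n n * (S * tp S) = S * tp S" using P by (metis Id_fs_carrier(1))
    have RV: "tp R * V = x *\<^sub>R W" using W(2) unfolding V_def G_def by (simp add: mult.assoc)
    then have "V \<noteq> 0" using W(1) False by auto
    moreover have "fs (P * Q) * V = S * (tp G * (tp R * V))" unfolding PQ(2) G_def by (simp add: mult.assoc)
    then have "fs (P * Q) * V = x *\<^sub>R V" unfolding RV by (simp add: V_def)
    moreover have "V = S * tp S * (R * W)" unfolding V_def G_def by (simp add: mult.assoc)
    then have "Id_n n * V = V" using IS by (metis mult.assoc)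
    ultimately show ?thesis unfolding eigenvalue_iff[OF PQ(1)] by blast
  qed
  then show "(opn (tp R * S))\<^sup>2 \<in> {x. eigenvalue (P * Q) x}" unfolding x G_def by simp
qed

lemma mat_tr_gramian:
  assumes B: "B \<in> carrier_mat n m" and Q: "Q \<in> carrier_mat n n" "fs Q = R * tp R"
  shows "mat_tr (B\<^sup>T * Q * B) = (norm (tp R * fs B))\<^sup>2"
proof -
  have "mat_tr (B\<^sup>T * Q * B) = (\<Sum>j<m. ent (fs (B\<^sup>T * Q * B)) j j)" using B Q by (simp add: mat_tr_def)
  also have "fs (B\<^sup>T * Q * B) = tp (fs B) * (fs Q * fs B)" using B Q by (simp add: fs_mult mult.assoc)
  also have "(\<Sum>j<m. ent (tp (fs B) * (fs Q * fs B)) j j) = (\<Sum>j<m. \<Sum>i<n + m. ent (fs B) i j * ent (fs Q * fs B) i j)"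
  proof (rule sum.cong[OF refl])
    fix j
    have "bounded_by (n + m) (tp (fs B))" using B by (simp add: bounded_by_fs)
    from ent_times[OF disjI1, OF this] show "ent (tp (fs B) * (fs Q * fs B)) j j = (\<Sum>i<n + m. ent (fs B) i j * ent (fs Q * fs B) i j)"
      by simp
  qed
  also have "\<dots> = (\<Sum>i<n + m. \<Sum>j<m. ent (fs B) i j * ent (fs Q * fs B) i j)" by (rule sum.swap)
  also have "\<dots> = (\<Sum>i<n + m. \<Sum>j<n + m. ent (fs B) i j * ent (fs Q * fs B) i j)"
    by (intro sum.cong[OF refl] sum.mono_neutral_left) (use B in auto)
  also have "\<dots> = inner (fs B) (fs Q * fs B)" by (rule inner_fsmat[symmetric]) (use B in \<open>simp add: bounded_by_fs\<close>)
  also have "\<dots> = (norm (tp R * fs B))\<^sup>2" unfolding Q(2) by (simp only: power2_norm_eq_inner inner_left_mult tp_simps mult.assoc)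
  finally show ?thesis .
qed

section \<open>Transfer functions\<close>

context cayley
begin

text \<open>A vanishing transfer function annihilates the reachable subspace: the resolvent identity
  passes \<open>c\<^sup>T (s - a)\<^sup>-\<^sup>1 Z = 0\<close> on from \<open>Z\<close> to \<open>R * Z\<close>.\<close>

lemma zero_transfer:
  assumes r: "\<And>s. 0 \<le> s \<Longrightarrow> (s *\<^sub>R Id_n n - a) * r s = Id_n n \<and> r s * (s *\<^sub>R Id_n n - a) = Id_n n \<and> Id_n n * r s = r s \<and> r s * Id_n n = r s"
    and zero: "\<And>s. 0 \<le> s \<Longrightarrow> tp c * r s * b = 0" and b: "Id_n n * b = b" and c: "Id_n n * c = c"
    and p: "Id_n n * p = p" "p * Id_n n = p" "a * p + p * tp a + b * tp b = 0"
    and q: "Id_n n * q = q" "tp q = q" "psdq q" "tp a * q + q * a + c * tp c = 0"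
  shows "q * b = 0" "q * p = 0"
proof -
  have r1: "r 1 = R"
  proof -
    have r1: "(Id_n n - a) * r 1 = Id_n n" "Id_n n * r 1 = r 1" using r[of 1] by simp_all
    have "R * ((Id_n n - a) * r 1) = r 1" unfolding mult.assoc[symmetric] inv by (rule r1(2))
    then show ?thesis unfolding r1(1) IR by (rule sym)
  qed
  have res: "r s = R - (s - 1) *\<^sub>R (r s * R)" if "0 \<le> s" for s
  proof -
    have "r s * ((s *\<^sub>R Id_n n - a) - (Id_n n - a)) * R = R - r s"
    proof -
      have "r s * ((s *\<^sub>R Id_n n - a) - (Id_n n - a)) * R = (r s * (s *\<^sub>R Id_n n - a)) * R - r s * ((Id_n n - a) * R)"
        by (simp only: right_diff_distrib left_diff_distrib mult.assoc)
      then show ?thesis using r[OF that] IR by (simp add: inv)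
    qed
    moreover have "r s * ((s *\<^sub>R Id_n n - a) - (Id_n n - a)) * R = (s - 1) *\<^sub>R (r s * R)"
      using r[OF that] by (simp add: ring_distribs scaleR_left_diff_distrib)
    ultimately show ?thesis by (metis add_diff_cancel_left' diff_diff_eq2 diff_add_cancel)
  qed
  have step: "tp c * r s * (R * Z) = 0" if Z: "\<And>s. 0 \<le> s \<Longrightarrow> tp c * r s * Z = 0" and s: "0 \<le> s" for Z s
  proof -
    have off: "tp c * r s * (R * Z) = 0" if "0 \<le> s" "s \<noteq> 1" for s
    proof -
      have "tp c * r s * Z = tp c * R * Z - (s - 1) *\<^sub>R (tp c * r s * (R * Z))"
        by (subst res[OF that(1)]) (simp add: ring_distribs mult.assoc)
      moreover have "tp c * R * Z = 0" using Z[of 1] r1 by simp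
      ultimately show ?thesis using Z[OF that(1)] that(2) by simp
    qed
    have "tp c * R * (R * Z) = 0"
    proof (rule ccontr)
      define w where "w = tp c * R * (R * Z)"
      assume "tp c * R * (R * Z) \<noteq> 0"
      then have w: "norm w > 0" by (simp add: w_def)
      define K where "K = opn (tp c) * (2 * opn R) * norm (R * (R * Z))"
      have K: "0 \<le> K" by (simp add: K_def)
      define t where "t = min (1 / (2 * opn R + 1)) (norm w / (2 * (K + 1)))"
      have t: "0 < t" "t * opn R \<le> 1 / 2" "t * K < norm w"
      proof -
        have "0 \<le> opn R" by simp
        then have "0 < 2 * opn R + 1" by linarith
        then show "0 < t" unfolding t_def using w K by simp
        have "t * opn R \<le> (1 / (2 * opn R + 1)) * opn R" unfolding t_def by (intro mult_right_mono) simp_all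
        also have "\<dots> \<le> 1 / 2" using \<open>0 < 2 * opn R + 1\<close> by (simp add: field_simps)
        finally show "t * opn R \<le> 1 / 2" .
        have "t * K \<le> (norm w / (2 * (K + 1))) * K" unfolding t_def by (intro mult_right_mono K) simp
        also have "\<dots> = norm w * (K / (2 * (K + 1)))" by simp
        also have "\<dots> < norm w * 1" using K by (intro mult_strict_left_mono w) (simp add: divide_less_eq)
        finally show "t * K < norm w" by simp
      qed
      define s where "s = 1 + t"
      have s: "0 \<le> s" "s \<noteq> 1" using t by (simp_all add: s_def)
      have "opn (r s) \<le> opn R + t * (opn (r s) * opn R)"
      proof -
        have "opn (r s) = opn (R - t *\<^sub>R (r s * R))" using res[OF s(1)] by (simp add: s_def)
        also have "\<dots> \<le> opn R + opn ((t *\<^sub>R r s) * R)" using opn_diff_triangle[of R "t *\<^sub>R (r s * R)"] by simp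
        also have "opn ((t *\<^sub>R r s) * R) \<le> t * (opn (r s) * opn R)"
        proof (rule opn_leI)
          fix X
          have "norm (t *\<^sub>R r s * R * X) = t * norm (r s * R * X)" using t(1) by simp
          also have "\<dots> \<le> t * (opn (r s * R) * norm X)" using t(1) by (intro mult_left_mono norm_mult_opn) simp
          also have "\<dots> \<le> t * (opn (r s) * opn R * norm X)" using t(1) by (intro mult_left_mono mult_right_mono opn_mult) simp_all
          finally show "norm (t *\<^sub>R r s * R * X) \<le> t * (opn (r s) * opn R) * norm X" by (simp add: mult.assoc)
        qed (use t(1) in simp)
        finally show ?thesis by simp
      qed
      also have "t * (opn (r s) * opn R) \<le> opn (r s) * (1 / 2)"
        using mult_left_mono[OF t(2), of "opn (r s)"] by (simp add: mult.commute mult.left_commute)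
      finally have rs: "opn (r s) \<le> 2 * opn R" by linarith
      have "tp c * r s * (R * Z) = tp c * R * (R * Z) - (s - 1) *\<^sub>R (tp c * r s * (R * (R * Z)))"
        by (subst res[OF s(1)]) (simp add: ring_distribs mult.assoc)
      then have "w = t *\<^sub>R (tp c * r s * (R * (R * Z)))" using off[OF s] by (simp add: w_def s_def)
      then have "norm w = t * norm (tp c * r s * (R * (R * Z)))" using t(1) by simp
      also have "\<dots> \<le> t * (opn (tp c) * (2 * opn R) * norm (R * (R * Z)))"
      proof -
        have "norm (tp c * r s * (R * (R * Z))) \<le> opn (tp c * r s) * norm (R * (R * Z))" by (rule norm_mult_opn)
        also have "\<dots> \<le> opn (tp c) * (2 * opn R) * norm (R * (R * Z))"
          by (intro mult_right_mono opn_mult_le rs order_refl) simp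
        finally show ?thesis using t(1) by simp
      qed
      finally show False using t(3) unfolding K_def by linarith
    qed
    then show ?thesis using off s r1 by (cases "s = 1") auto
  qed
  define \<Z> where "\<Z> = {Z. Id_n n * Z = Z \<and> (\<forall>s\<ge>0. tp c * r s * Z = 0)}"
  have ZR: "R * Z \<in> \<Z>" if "Z \<in> \<Z>" for Z
    using that step[of Z] IR unfolding \<Z>_def by (simp add: mult.assoc[symmetric])
  have MR: "M = 2 *\<^sub>R R - Id_n n"
  proof -
    have "M + Id_n n = (Id_n n + a) * R + (Id_n n - a) * R" unfolding inv M(1) ..
    also have "\<dots> = 2 *\<^sub>R R" by (simp add: ring_distribs IR scaleR_2)
    finally show ?thesis by (simp add: algebra_simps)
  qed
  have ZM: "M * Z \<in> \<Z>" if "Z \<in> \<Z>" for Z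
    using ZR[OF that] that unfolding \<Z>_def MR by (simp add: ring_distribs mult.assoc)
  have ZMk: "fpow n M k * Z \<in> \<Z>" if "Z \<in> \<Z>" for Z k
  proof (induction k)
    case (Suc k)
    have "fpow n M (Suc k) * Z = M * (fpow n M k * Z)" by (simp only: fpow.simps fpow_commute[symmetric] mult.assoc)
    then show ?case using ZM[OF Suc] by simp
  qed (use that in \<open>simp add: \<Z>_def\<close>)
  have cR: "tp c * R * Z = 0" if "Z \<in> \<Z>" for Z using that r1 unfolding \<Z>_def by force
  have qI: "q * Id_n n = q" using arg_cong[OF q(1), of tp] q(2) by simp
  have dual: "cayley n (tp a) (tp R) (tp M) C \<rho>"
  proof
    fix k show "norm (fpow n (tp M) k) \<le> C * \<rho> ^ k"
    proof -
      have "fpow n (tp M) k = tp (fpow n M k)"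
        by (induction k) (simp_all add: fpow_commute[symmetric])
      then show ?thesis using pow by simp
    qed
  qed (rule tpI tpinv tpM \<rho> C)+
  have "tp a * q + q * tp (tp a) + c * tp c = 0" using q(4) by simp
  from cayley.stein_of_lyapunov[OF dual q(1) qI this]
  have sq: "q = tp M * q * M + 2 *\<^sub>R (tp R * (c * tp c) * R)" by simp
  have qZ: "q * Z = 0" if Z: "Z \<in> \<Z>" for Z
  proof -
    have st: "inner Z (q * Z) = inner (M * Z) (q * (M * Z))" if "Z \<in> \<Z>" for Z
    proof -
      have "q * Z = tp M * q * M * Z + 2 *\<^sub>R (tp R * (c * (tp c * R * Z)))"
        by (subst sq) (simp add: ring_distribs mult.assoc)
      then have "q * Z = tp M * q * M * Z" using cR[OF that] by simp
      then show ?thesis by (simp add: inner_left_mult mult.assoc)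
    qed
    have it: "inner Z (q * Z) = inner (fpow n M k * Z) (q * (fpow n M k * Z))" for k
    proof (induction k)
      case 0 then show ?case using Z by (simp add: \<Z>_def)
    next
      case (Suc k)
      have "fpow n M (Suc k) * Z = M * (fpow n M k * Z)" by (simp only: fpow.simps fpow_commute[symmetric] mult.assoc)
      then show ?case using st[OF ZMk[OF Z, of k]] Suc by simp
    qed
    have "inner Z (q * Z) \<le> opn q * (norm Z)\<^sup>2 * (C * \<rho> ^ k)\<^sup>2" for k
    proof -
      let ?Z = "fpow n M k * Z"
      have "inner ?Z (q * ?Z) \<le> norm ?Z * (opn q * norm ?Z)"
        by (meson norm_cauchy_schwarz mult_left_mono norm_ge_zero norm_mult_opn order_trans)
      also have "\<dots> = opn q * (norm ?Z)\<^sup>2" by (simp add: power2_eq_square)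
      also have "\<dots> \<le> opn q * ((C * \<rho> ^ k) * norm Z)\<^sup>2"
      proof (intro mult_left_mono power_mono)
        have "norm ?Z \<le> norm (fpow n M k) * norm Z" by (rule norm_mult_ineq)
        also have "\<dots> \<le> (C * \<rho> ^ k) * norm Z" by (intro mult_right_mono pow) simp
        finally show "norm ?Z \<le> (C * \<rho> ^ k) * norm Z" .
      qed simp_all
      finally show ?thesis using it[of k] by (simp add: power_mult_distrib mult.commute mult.left_commute)
    qed
    then have "inner Z (q * Z) \<le> 0"
      using geometric_tendsto_0[of "opn q * (norm Z)\<^sup>2"] by (intro LIMSEQ_le_const) auto
    then have "inner Z (q * Z) = 0" using q(3) unfolding psdq_def by (meson order_antisym)
    then show ?thesis by (rule psdq_inner_eq_0[OF q(2,1,3)])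
  qed
  have bZ: "b \<in> \<Z>" using zero b by (simp add: \<Z>_def)
  then show "q * b = 0" by (rule qZ)
  have sp: "p = M * p * tp M + 2 *\<^sub>R (R * (b * tp b) * tp R)" by (rule stein_of_lyapunov[OF p])
  have "q * p = q * fpow n M k * p * tp (fpow n M k)" for k
  proof (induction k)
    case (Suc k)
    have z: "q * (fpow n M k * (R * b)) = 0" by (rule qZ[OF ZMk[OF ZR[OF bZ]]])
    have "q * fpow n M k * p = q * fpow n M k * (M * p * tp M) + 2 *\<^sub>R (q * (fpow n M k * (R * b)) * (tp b * tp R))"
      by (subst sp) (simp add: ring_distribs mult.assoc)
    then have "q * fpow n M k * p = q * fpow n M k * (M * p * tp M)" unfolding z by simp
    then have "q * p = q * fpow n M k * (M * p * tp M) * tp (fpow n M k)" using Suc by simp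
    then show ?case by (simp add: mult.assoc)
  qed (simp add: qI p mult.assoc)
  then have "q * p = q * (fpow n M k * p * tp (fpow n M k))" for k by (simp only: mult.assoc)
  then have "norm (q * p) \<le> norm q * norm (fpow n M k * p * tp (fpow n M k))" for k
    by (metis norm_mult_ineq)
  then have "norm (q * p) \<le> norm q * norm p * (C * \<rho> ^ k)\<^sup>2" for k
    by (meson mult_left_mono norm_congruence_pow_le norm_ge_zero order_trans mult.assoc[symmetric, THEN eq_refl])
  then have "norm (q * p) \<le> 0"
    using geometric_tendsto_0[of "norm q * norm p"] by (intro LIMSEQ_le_const) auto
  then show "q * p = 0" by simp
qed

end

lemma inverse_of_not_eigenvalue:
  fixes A :: "'a :: field mat"
  assumes A: "A \<in> carrier_mat n n" and "\<not> eigenvalue A z"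
  obtains r where "r \<in> carrier_mat n n" "(z \<cdot>\<^sub>m 1\<^sub>m n - A) * r = 1\<^sub>m n" "r * (z \<cdot>\<^sub>m 1\<^sub>m n - A) = 1\<^sub>m n"
proof -
  let ?L = "z \<cdot>\<^sub>m 1\<^sub>m n - A"
  have L: "?L \<in> carrier_mat n n" by (rule minus_carrier_mat[OF A])
  have "det ?L \<noteq> 0"
  proof
    assume "det ?L = 0"
    then obtain v where v: "v \<in> carrier_vec n" "v \<noteq> 0\<^sub>v n" "?L *\<^sub>v v = 0\<^sub>v n"
      using det_0_iff_vec_prod_zero[OF L] by blast
    have "A *\<^sub>v v = z \<cdot>\<^sub>v v"
    proof (rule eq_vecI)
      fix i assume "i < dim_vec (z \<cdot>\<^sub>v v)"
      then have i: "i < n" using v by simp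
      have "(?L *\<^sub>v v) $ i = 0" using v i by simp
      moreover have "(?L *\<^sub>v v) $ i = z * v $ i - (A *\<^sub>v v) $ i"
      proof -
        have "?L *\<^sub>v v = (z \<cdot>\<^sub>m 1\<^sub>m n) *\<^sub>v v - A *\<^sub>v v"
          by (rule minus_mult_distrib_mat_vec[of _ n n]) (use A v in simp_all)
        moreover have "(z \<cdot>\<^sub>m 1\<^sub>m n) *\<^sub>v v = z \<cdot>\<^sub>v v" using v by (intro eq_vecI) auto
        ultimately show ?thesis using i A v by simp
      qed
      ultimately show "(A *\<^sub>v v) $ i = (z \<cdot>\<^sub>v v) $ i" using i v by simp
    qed (use A v in simp)
    then show False using assms v unfolding eigenvalue_def eigenvector_def by auto
  qed
  then have "?L \<in> Units (ring_mat TYPE('a) n ())" by (rule det_non_zero_imp_unit[OF L])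
  then show ?thesis using that unfolding Units_def ring_mat_def by auto
qed

lemma transfer_fun_eq:
  assumes A: "A \<in> carrier_mat n n" and "stable A" "0 \<le> Re s"
  obtains r where "r \<in> carrier_mat n n" "(s \<cdot>\<^sub>m 1\<^sub>m n - cmat A) * r = 1\<^sub>m n" "transfer_fun A B C s = (cmat C)\<^sup>T * r * cmat B"
proof -
  have cA: "cmat A \<in> carrier_mat n n" using A by simp
  have "\<not> eigenvalue (cmat A) s" using assms unfolding stable_def by force
  then obtain r where r: "r \<in> carrier_mat n n" "(s \<cdot>\<^sub>m 1\<^sub>m n - cmat A) * r = 1\<^sub>m n"
    using inverse_of_not_eigenvalue[OF cA] by metis
  have "mat_inv (s \<cdot>\<^sub>m 1\<^sub>m n - cmat A) = r" by (rule mat_inv_eqI[OF minus_carrier_mat[OF cA] r])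
  then show ?thesis using that[OF r] A unfolding transfer_fun_def by simp
qed

lemma transfer_fun_real:
  assumes A: "A \<in> carrier_mat n n" and st: "stable A" and s: "0 \<le> s" and B: "B \<in> carrier_mat n m" and C: "C \<in> carrier_mat n p"
  obtains r where "r \<in> carrier_mat n n" "(s *\<^sub>R Id_n n - fs A) * fs r = Id_n n" "fs r * (s *\<^sub>R Id_n n - fs A) = Id_n n"
    "transfer_fun A B C (complex_of_real s) = cmat (C\<^sup>T * r * B)"
proof -
  have "\<not> eigenvalue A s"
  proof
    assume "eigenvalue A s"
    then obtain X where "Id_n n * X = X" "X \<noteq> 0" "fs A * X = s *\<^sub>R X" unfolding eigenvalue_iff[OF A] by blast
    then have "s < 0" using st stbD[of n "fs A" X 0 s 0] unfolding stable_iff_stb[OF A] by simp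
    then show False using s by simp
  qed
  then obtain r where r: "r \<in> carrier_mat n n" "(s \<cdot>\<^sub>m 1\<^sub>m n - A) * r = 1\<^sub>m n" "r * (s \<cdot>\<^sub>m 1\<^sub>m n - A) = 1\<^sub>m n"
    using inverse_of_not_eigenvalue[OF A] by metis
  have e: "complex_of_real s \<cdot>\<^sub>m 1\<^sub>m n - cmat A = cmat (s \<cdot>\<^sub>m 1\<^sub>m n - A)" using A by (intro eq_matI) auto
  have "mat_inv (complex_of_real s \<cdot>\<^sub>m 1\<^sub>m n - cmat A) = cmat r"
  proof (rule mat_inv_eqI)
    show "(complex_of_real s \<cdot>\<^sub>m 1\<^sub>m n - cmat A) * cmat r = 1\<^sub>m n"
      unfolding e using cmat_mult[of "s \<cdot>\<^sub>m 1\<^sub>m n - A" r] r A by (simp add: of_real_hom.mat_hom_one)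
  qed (use A r in \<open>auto intro: minus_carrier_mat\<close>)
  then have "transfer_fun A B C (complex_of_real s) = (cmat C)\<^sup>T * cmat r * cmat B" using A unfolding transfer_fun_def by simp
  also have "(cmat C)\<^sup>T = cmat C\<^sup>T" by (rule eq_matI) auto
  also have "cmat C\<^sup>T * cmat r * cmat B = cmat (C\<^sup>T * r * B)" using A B C r by (simp add: cmat_mult)
  finally have t: "transfer_fun A B C (complex_of_real s) = cmat (C\<^sup>T * r * B)" .
  let ?L = "s \<cdot>\<^sub>m 1\<^sub>m n - A"
  have f: "fs ?L = s *\<^sub>R Id_n n - fs A" using A by (simp add: fs_minus)
  have "fs (?L * r) = Id_n n" "fs (r * ?L) = Id_n n" by (simp_all only: r(2,3) fs_one)
  moreover have "fs (?L * r) = fs ?L * fs r" "fs (r * ?L) = fs r * fs ?L" using r(1) A by (simp_all add: fs_mult)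
  ultimately have "fs ?L * fs r = Id_n n" "fs r * fs ?L = Id_n n" by simp_all
  then show ?thesis unfolding f by (rule that[OF r(1) _ _ t])
qed

section \<open>Realizations and norms\<close>

lemma fs_append_rows:
  assumes "A \<in> carrier_mat n1 m" "B \<in> carrier_mat n2 m" shows "fs (A @\<^sub>r B) = fs A + Sh n1 n2 * fs B"
  unfolding append_rows_def by (subst fs_four_block) (use assms in simp_all)

lemma block_diag_carrier: "A \<in> carrier_mat n1 m1 \<Longrightarrow> B \<in> carrier_mat n2 m2 \<Longrightarrow> block_diag A B \<in> carrier_mat (n1 + n2) (m1 + m2)"
  unfolding block_diag_def by auto

lemma Id_add_split: "Id_n (k + l) * X = Id_n k * X + Sh k l * (tp (Sh k l) * X)"
  by (rule fsmat_eqI) auto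

lemma stable_block_diag:
  assumes A1: "A1 \<in> carrier_mat n1 n1" "stable A1" and A2: "A2 \<in> carrier_mat n2 n2" "stable A2"
  shows "stable (block_diag A1 A2)"
proof -
  have c: "block_diag A1 A2 \<in> carrier_mat (n1 + n2) (n1 + n2)" by (rule block_diag_carrier[OF A1(1) A2(1)])
  let ?T = "tp (Sh n1 n2)"
  have f: "fs (block_diag A1 A2) = fs A1 + Sh n1 n2 * fs A2 * ?T" using A1 A2 by (simp add: fs_block_diag)
  have t1: "Id_n n1 * fs (block_diag A1 A2) = fs A1 * Id_n n1" unfolding f using A1 by (simp add: distrib_left mult.assoc[symmetric])
  have "?T * fs A1 = 0" using A1 by (intro fs_Sh) simp
  then have t2: "?T * fs (block_diag A1 A2) = fs A2 * ?T" unfolding f using A2 by (simp add: distrib_left mult.assoc[symmetric])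
  show ?thesis
    unfolding stable_iff_stb[OF c] stb_def
  proof (intro allI impI, elim conjE)
    fix x y X Y
    assume h: "Id_n (n1 + n2) * X = X" "Id_n (n1 + n2) * Y = Y" "X \<noteq> 0 \<or> Y \<noteq> 0"
      "fs (block_diag A1 A2) * X = x *\<^sub>R X - y *\<^sub>R Y" "fs (block_diag A1 A2) * Y = x *\<^sub>R Y + y *\<^sub>R X"
    have e1: "fs A1 * (Id_n n1 * X) = x *\<^sub>R (Id_n n1 * X) - y *\<^sub>R (Id_n n1 * Y)"
      "fs A1 * (Id_n n1 * Y) = x *\<^sub>R (Id_n n1 * Y) + y *\<^sub>R (Id_n n1 * X)"
      unfolding mult.assoc[symmetric] t1[symmetric] by (simp_all only: mult.assoc h) (simp_all add: ring_distribs)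
    have e2: "fs A2 * (?T * X) = x *\<^sub>R (?T * X) - y *\<^sub>R (?T * Y)"
      "fs A2 * (?T * Y) = x *\<^sub>R (?T * Y) + y *\<^sub>R (?T * X)"
      unfolding mult.assoc[symmetric] t2[symmetric] by (simp_all only: mult.assoc h) (simp_all add: ring_distribs)
    show "x < 0"
    proof (cases "Id_n n1 * X \<noteq> 0 \<or> Id_n n1 * Y \<noteq> 0")
      case True
      show ?thesis by (rule stbD[OF _ _ _ True e1, of n1]) (use A1 stable_iff_stb in \<open>auto simp: mult.assoc[symmetric]\<close>)
    next
      case False
      then have "X = Sh n1 n2 * (?T * X)" "Y = Sh n1 n2 * (?T * Y)" using Id_add_split[of n1 n2 X] Id_add_split[of n1 n2 Y] h by simp_all
      then have ne: "?T * X \<noteq> 0 \<or> ?T * Y \<noteq> 0" using h(3) by (metis mult_zero_right)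
      show ?thesis by (rule stbD[OF _ _ _ ne e2, of n2]) (use A2 stable_iff_stb in \<open>auto simp: mult.assoc[symmetric]\<close>)
    qed
  qed
qed

lemma transfer_fun_block_diag:
  assumes A1: "A1 \<in> carrier_mat n1 n1" "stable A1" and A2: "A2 \<in> carrier_mat n2 n2" "stable A2" and s: "0 \<le> Re s"
    and B: "B1 \<in> carrier_mat n1 m" "B2 \<in> carrier_mat n2 m" and C: "C1 \<in> carrier_mat n1 p" "C2 \<in> carrier_mat n2 p"
  shows "transfer_fun (block_diag A1 A2) (B1 @\<^sub>r B2) (C1 @\<^sub>r C2) s = transfer_fun A1 B1 C1 s + transfer_fun A2 B2 C2 s"
proof -
  obtain r1 where r1: "r1 \<in> carrier_mat n1 n1" "(s \<cdot>\<^sub>m 1\<^sub>m n1 - cmat A1) * r1 = 1\<^sub>m n1" "transfer_fun A1 B1 C1 s = (cmat C1)\<^sup>T * r1 * cmat B1"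
    by (rule transfer_fun_eq[OF A1 s])
  obtain r2 where r2: "r2 \<in> carrier_mat n2 n2" "(s \<cdot>\<^sub>m 1\<^sub>m n2 - cmat A2) * r2 = 1\<^sub>m n2" "transfer_fun A2 B2 C2 s = (cmat C2)\<^sup>T * r2 * cmat B2"
    by (rule transfer_fun_eq[OF A2 s])
  let ?N = "n1 + n2"
  let ?r = "four_block_mat r1 (0\<^sub>m n1 n2) (0\<^sub>m n2 n1) r2"
  have A: "block_diag A1 A2 \<in> carrier_mat ?N ?N" by (rule block_diag_carrier[OF A1(1) A2(1)])
  have L: "s \<cdot>\<^sub>m 1\<^sub>m ?N - cmat (block_diag A1 A2)
      = four_block_mat (s \<cdot>\<^sub>m 1\<^sub>m n1 - cmat A1) (0\<^sub>m n1 n2) (0\<^sub>m n2 n1) (s \<cdot>\<^sub>m 1\<^sub>m n2 - cmat A2)"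
    by (rule eq_matI) (use A1 A2 in \<open>auto simp: block_diag_def\<close>)
  have c: "s \<cdot>\<^sub>m 1\<^sub>m n1 - cmat A1 \<in> carrier_mat n1 n1" "s \<cdot>\<^sub>m 1\<^sub>m n2 - cmat A2 \<in> carrier_mat n2 n2"
    using A1 A2 by (simp_all add: minus_carrier_mat)
  have "(s \<cdot>\<^sub>m 1\<^sub>m ?N - cmat (block_diag A1 A2)) * ?r = 1\<^sub>m ?N"
    unfolding L
    by (subst mult_four_block_mat[OF c(1) _ _ c(2) r1(1) _ _ r2(1)])
      (use r1 r2 c in \<open>auto simp: four_block_one_mat right_mult_zero_mat left_mult_zero_mat\<close>)
  then have inv: "mat_inv (s \<cdot>\<^sub>m 1\<^sub>m ?N - cmat (block_diag A1 A2)) = ?r"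
    by (intro mat_inv_eqI[of _ ?N]) (use A r1 r2 in \<open>auto intro: minus_carrier_mat\<close>)
  have CT: "(cmat (C1 @\<^sub>r C2))\<^sup>T = four_block_mat (cmat C1)\<^sup>T (cmat C2)\<^sup>T (0\<^sub>m 0 n1) (0\<^sub>m 0 n2)"
    by (rule eq_matI) (use C in \<open>auto simp: append_rows_def\<close>)
  have BB: "cmat (B1 @\<^sub>r B2) = four_block_mat (cmat B1) (0\<^sub>m n1 0) (cmat B2) (0\<^sub>m n2 0)"
    by (rule eq_matI) (use B in \<open>auto simp: append_rows_def\<close>)
  have cT: "(cmat C1)\<^sup>T \<in> carrier_mat p n1" "(cmat C2)\<^sup>T \<in> carrier_mat p n2" using C by simp_all
  have cB: "cmat B1 \<in> carrier_mat n1 m" "cmat B2 \<in> carrier_mat n2 m" using B by simp_all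
  have 1: "(cmat (C1 @\<^sub>r C2))\<^sup>T * ?r = four_block_mat ((cmat C1)\<^sup>T * r1) ((cmat C2)\<^sup>T * r2) (0\<^sub>m 0 n1) (0\<^sub>m 0 n2)"
    unfolding CT by (subst mult_four_block_mat[OF cT _ _ r1(1) _ _ r2(1)]) (use cT r1 r2 in auto)
  have 2: "four_block_mat ((cmat C1)\<^sup>T * r1) ((cmat C2)\<^sup>T * r2) (0\<^sub>m 0 n1) (0\<^sub>m 0 n2) * cmat (B1 @\<^sub>r B2)
      = four_block_mat ((cmat C1)\<^sup>T * r1 * cmat B1 + (cmat C2)\<^sup>T * r2 * cmat B2) (0\<^sub>m p 0) (0\<^sub>m 0 m) (0\<^sub>m 0 0)"
  proof -
    let ?X1 = "(cmat C1)\<^sup>T * r1" and ?X2 = "(cmat C2)\<^sup>T * r2"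
    have X: "?X1 \<in> carrier_mat p n1" "?X2 \<in> carrier_mat p n2" using cT r1 r2 by auto
    have e: "?X1 * 0\<^sub>m n1 0 + ?X2 * 0\<^sub>m n2 0 = 0\<^sub>m p 0" "0\<^sub>m 0 n1 * cmat B1 + 0\<^sub>m 0 n2 * cmat B2 = 0\<^sub>m 0 m"
      "0\<^sub>m 0 n1 * 0\<^sub>m n1 0 + 0\<^sub>m 0 n2 * 0\<^sub>m n2 0 = (0\<^sub>m 0 0 :: complex mat)"
      by (rule eq_matI; use C r1(1) r2(1) B in simp)+
    show ?thesis
      unfolding BB by (subst mult_four_block_mat[OF X zero_carrier_mat[of 0 n1] zero_carrier_mat[of 0 n2] cB(1) zero_carrier_mat[of n1 0] cB(2) zero_carrier_mat[of n2 0]])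
        (simp only: e)
  qed
  have 3: "four_block_mat X (0\<^sub>m p 0) (0\<^sub>m 0 m) (0\<^sub>m 0 0) = X" if "X \<in> carrier_mat p m" for X :: "complex mat"
    by (rule eq_matI) (use that in auto)
  show ?thesis
    unfolding transfer_fun_def[of "block_diag A1 A2"] r1(3) r2(3) carrier_matD(1)[OF A] inv 1 2
    by (rule 3) (use cT cB r1 r2 in auto)
qed

lemma stable_realization_add:
  assumes "stable_realization G1 A1 B1 C1" "stable_realization G2 A2 B2 C2" "dim_col B1 = dim_col B2" "dim_col C1 = dim_col C2"
  shows "stable_realization (\<lambda>s. G1 s + G2 s) (block_diag A1 A2) (B1 @\<^sub>r B2) (C1 @\<^sub>r C2)"
proof -
  define n1 n2 m p where nd: "n1 = dim_row A1" "n2 = dim_row A2" "m = dim_col B2" "p = dim_col C2"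
  have c: "A1 \<in> carrier_mat n1 n1" "A2 \<in> carrier_mat n2 n2" "B1 \<in> carrier_mat n1 m" "B2 \<in> carrier_mat n2 m"
    "C1 \<in> carrier_mat n1 p" "C2 \<in> carrier_mat n2 p" "stable A1" "stable A2" "0 < n1"
    using assms unfolding stable_realization_def nd by auto
  have bd: "block_diag A1 A2 \<in> carrier_mat (n1 + n2) (n1 + n2)" by (rule block_diag_carrier[OF c(1,2)])
  have r: "B1 @\<^sub>r B2 \<in> carrier_mat (n1 + n2) m" "C1 @\<^sub>r C2 \<in> carrier_mat (n1 + n2) p" using c by auto
  have e: "G1 s + G2 s = transfer_fun (block_diag A1 A2) (B1 @\<^sub>r B2) (C1 @\<^sub>r C2) s" if "0 \<le> Re s" for s
    using assms(1,2) that unfolding transfer_fun_block_diag[OF c(1,7,2,8) that c(3-6)] stable_realization_def by simp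
  show ?thesis
    unfolding stable_realization_def
  proof (intro conjI allI impI)
    show "square_mat (block_diag A1 A2)" "0 < dim_row (block_diag A1 A2)"
      "dim_row (B1 @\<^sub>r B2) = dim_row (block_diag A1 A2)" "dim_row (C1 @\<^sub>r C2) = dim_row (block_diag A1 A2)"
      unfolding carrier_matD[OF bd] carrier_matD[OF r(1)] carrier_matD[OF r(2)] square_mat.simps using c(9) by simp_all
  qed (rule stable_block_diag[OF c(1,7,2,8)], erule e)
qed

lemma stable_realization_uminus:
  assumes "stable_realization G A B C" shows "stable_realization (\<lambda>s. - G s) A B (- C)"
proof -
  define n m p where nd: "n = dim_row A" "m = dim_col B" "p = dim_col C"
  have c: "A \<in> carrier_mat n n" "B \<in> carrier_mat n m" "C \<in> carrier_mat n p" "stable A"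
    using assms unfolding stable_realization_def nd by auto
  have "transfer_fun A B (- C) s = - transfer_fun A B C s" if s: "0 \<le> Re s" for s
  proof -
    obtain r where r: "r \<in> carrier_mat n n" "(s \<cdot>\<^sub>m 1\<^sub>m n - cmat A) * r = 1\<^sub>m n" "transfer_fun A B C s = (cmat C)\<^sup>T * r * cmat B"
      by (rule transfer_fun_eq[OF c(1,4) s])
    have "mat_inv (s \<cdot>\<^sub>m 1\<^sub>m n - cmat A) = r" by (rule mat_inv_eqI[OF _ r(1,2)]) (use c in \<open>simp add: minus_carrier_mat\<close>)
    then have t: "transfer_fun A B (- C) s = (cmat (- C))\<^sup>T * r * cmat B" unfolding transfer_fun_def nd(1)[symmetric] by simp
    have u: "(cmat (- C))\<^sup>T = - (cmat C)\<^sup>T" by (rule eq_matI) simp_all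
    have v: "- (cmat C)\<^sup>T * r = - ((cmat C)\<^sup>T * r)" by (rule uminus_mult_left_mat) (use c(3) r(1) in simp)
    have w: "- ((cmat C)\<^sup>T * r) * cmat B = - ((cmat C)\<^sup>T * r * cmat B)" by (rule uminus_mult_left_mat) (use c(2) r(1) in simp)
    show ?thesis unfolding t u v w r(3) ..
  qed
  moreover have "G s = transfer_fun A B C s" if "0 \<le> Re s" for s using assms that unfolding stable_realization_def by simp
  ultimately have tf: "- G s = transfer_fun A B (- C) s" if "0 \<le> Re s" for s using that by simp
  show ?thesis
    unfolding stable_realization_def
  proof (intro conjI allI impI)
    show "square_mat A" "0 < dim_row A" "dim_row B = dim_row A" "dim_row (- C) = dim_row A" "stable A"
      using assms unfolding stable_realization_def by simp_all
  qed (erule tf)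
qed

definition gfac :: "nat \<Rightarrow> fsmat \<Rightarrow> fsmat \<Rightarrow> fsmat \<Rightarrow> bool" where
  "gfac n a b S \<longleftrightarrow> Id_n n * S = S \<and> a * (S * tp S) + S * tp S * tp a + b * tp b = 0"

lemma gfac_exists:
  assumes "A \<in> carrier_mat n n" "stable A" "Id_n n * b = b" obtains S where "gfac n (fs A) b S" "S * Id_n n = S"
  by (rule gramian_exists[OF assms]) (use that gfac_def in blast)

lemma gfac_Id: "Id_n n * S = S \<Longrightarrow> Id_n n * (S * tp S) = S * tp S" "Id_n n * S = S \<Longrightarrow> S * tp S * Id_n n = S * tp S"
proof -
  assume S: "Id_n n * S = S"
  show "Id_n n * (S * tp S) = S * tp S" by (simp add: mult.assoc[symmetric] S)
  show "S * tp S * Id_n n = S * tp S" using arg_cong[OF S, of tp] by (simp add: mult.assoc)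
qed

lemma gfac_unique:
  assumes "A \<in> carrier_mat n n" "stable A" "gfac n (fs A) b S" "gfac n (fs A) b S'" shows "S * tp S = S' * tp S'"
proof -
  have s: "Id_n n * S = S" "fs A * (S * tp S) + S * tp S * tp (fs A) + b * tp b = 0" using assms(3) by (simp_all add: gfac_def)
  have s': "Id_n n * S' = S'" "fs A * (S' * tp S') + S' * tp S' * tp (fs A) + b * tp b = 0" using assms(4) by (simp_all add: gfac_def)
  show ?thesis by (rule lyapunov_unique[OF assms(1,2) gfac_Id[OF s(1)] s(2) gfac_Id[OF s'(1)] s'(2)])
qed

lemma gramian_values:
  assumes A: "A \<in> carrier_mat n n" "stable A" and B: "B \<in> carrier_mat n m" and C: "C \<in> carrier_mat n p" and n: "n > 0"
    and S: "gfac n (fs A) (fs B) S" and R: "gfac n (tp (fs A)) (fs C) R"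
  shows "sqrt (lambda_max (ctrl_gramian A B * obs_gramian A C)) = opn (tp R * S)"
    "sqrt (mat_tr (B\<^sup>T * obs_gramian A C * B)) = norm (tp R * fs B)"
proof -
  have At: "A\<^sup>T \<in> carrier_mat n n" "stable A\<^sup>T" using A stable_transpose by simp_all
  have S': "Id_n n * S = S" "fs A * (S * tp S) + S * tp S * tp (fs A) + fs B * tp (fs B) = 0" using S by (simp_all add: gfac_def)
  have R': "Id_n n * R = R" "fs A\<^sup>T * (R * tp R) + R * tp R * tp (fs A\<^sup>T) + fs C * tp (fs C) = 0" using R by (simp_all add: gfac_def)
  note P = ctrl_gramian_eqI[OF A B gfac_Id[OF S'(1)] S'(2)]
  note Q = ctrl_gramian_eqI[OF At C gfac_Id[OF R'(1)] R'(2), folded obs_gramian_eq]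
  have cP: "ctrl_gramian A B \<in> carrier_mat n n" and cQ: "obs_gramian A C \<in> carrier_mat n n" unfolding P(1) Q(1) by simp_all
  obtain R0 where R0: "gfac n (fs A\<^sup>T) (fs C) R0" "R0 * Id_n n = R0"
    by (rule gfac_exists[OF At Id_fs_carrier(1)[OF C]])
  have e: "R0 * tp R0 = R * tp R" by (rule gfac_unique[OF At R0(1)]) (use R in simp)
  have "lambda_max (ctrl_gramian A B * obs_gramian A C) = (opn (tp R0 * S))\<^sup>2"
    by (rule lambda_max_product[OF cP P(2) cQ _ n R0(2)]) (simp add: Q(2) e)
  also have "opn (tp R0 * S) = opn (tp R * S)" by (rule opn_factor_cong[OF refl e])
  finally show "sqrt (lambda_max (ctrl_gramian A B * obs_gramian A C)) = opn (tp R * S)" by simp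
  show "sqrt (mat_tr (B\<^sup>T * obs_gramian A C * B)) = norm (tp R * fs B)"
    unfolding mat_tr_gramian[OF B cQ Q(2)] by simp
qed

lemma lyapunov_intertwine:
  assumes "ae * X + X * tp ae + be * tp be = 0" "T1 * ae = a1 * T1" "T2 * ae = a2 * T2"
  shows "a1 * (T1 * X * tp T2) + T1 * X * tp T2 * tp a2 + T1 * be * tp (T2 * be) = 0"
proof -
  have "T1 * (ae * X + X * tp ae + be * tp be) * tp T2
      = (T1 * ae) * X * tp T2 + T1 * X * tp (T2 * ae) + T1 * be * tp (T2 * be)"
    by (simp add: ring_distribs mult.assoc)
  then show ?thesis unfolding assms by (simp add: mult.assoc)
qed

lemma gfac_block_diag:
  assumes A1: "A1 \<in> carrier_mat n1 n1" and A2: "A2 \<in> carrier_mat n2 n2"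
    and B: "B1 \<in> carrier_mat n1 m" "B2 \<in> carrier_mat n2 m"
    and S: "gfac (n1 + n2) (fs (block_diag A1 A2)) (fs (B1 @\<^sub>r B2)) S"
  shows "\<exists>S1 S2. S = S1 + Sh n1 n2 * S2 \<and> gfac n1 (fs A1) (fs B1) S1 \<and> gfac n2 (fs A2) (fs B2) S2 \<and>
    fs A1 * (S1 * tp S2) + S1 * tp S2 * tp (fs A2) + fs B1 * tp (fs B2) = 0"
proof -
  let ?T = "tp (Sh n1 n2)"
  have f: "fs (block_diag A1 A2) = fs A1 + Sh n1 n2 * fs A2 * ?T" using A1 A2 by (simp add: fs_block_diag)
  have g: "fs (B1 @\<^sub>r B2) = fs B1 + Sh n1 n2 * fs B2" by (rule fs_append_rows[OF B])
  have t1: "Id_n n1 * fs (block_diag A1 A2) = fs A1 * Id_n n1" "Id_n n1 * fs (B1 @\<^sub>r B2) = fs B1"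
    unfolding f g using A1 B by (simp_all add: distrib_left mult.assoc[symmetric])
  have "?T * fs A1 = 0" "?T * fs B1 = 0" using A1 B by (simp_all add: fs_Sh)
  then have t2: "?T * fs (block_diag A1 A2) = fs A2 * ?T" "?T * fs (B1 @\<^sub>r B2) = fs B2"
    unfolding f g using A2 B by (simp_all add: distrib_left mult.assoc[symmetric])
  have SI: "Id_n (n1 + n2) * S = S" and ly: "fs (block_diag A1 A2) * (S * tp S) + S * tp S * tp (fs (block_diag A1 A2))
      + fs (B1 @\<^sub>r B2) * tp (fs (B1 @\<^sub>r B2)) = 0" using S by (simp_all add: gfac_def)
  define S1 S2 where "S1 = Id_n n1 * S" and "S2 = ?T * S"
  have "S = S1 + Sh n1 n2 * S2" using Id_add_split[of n1 n2 S] SI by (simp add: S1_def S2_def)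
  moreover have "gfac n1 (fs A1) (fs B1) S1"
    using lyapunov_intertwine[OF ly t1(1) t1(1)] unfolding gfac_def S1_def t1(2) by (simp add: mult.assoc[symmetric])
  moreover have "gfac n2 (fs A2) (fs B2) S2"
    using lyapunov_intertwine[OF ly t2(1) t2(1)] unfolding gfac_def S2_def t2(2) by (simp add: mult.assoc[symmetric])
  moreover have "fs A1 * (S1 * tp S2) + S1 * tp S2 * tp (fs A2) + fs B1 * tp (fs B2) = 0"
    using lyapunov_intertwine[OF ly t1(1) t2(1)] unfolding S1_def S2_def t1(2) t2(2) by (simp add: mult.assoc)
  ultimately show ?thesis by blast
qed

lemma block_diag_transpose: "A1 \<in> carrier_mat n1 n1 \<Longrightarrow> A2 \<in> carrier_mat n2 n2 \<Longrightarrow> block_diag A1\<^sup>T A2\<^sup>T = (block_diag A1 A2)\<^sup>T"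
  by (rule eq_matI) (auto simp: block_diag_def)

text \<open>In \<open>S1 + Sh n1 n2 * S2\<close> the rows of \<open>S2\<close> are stacked below the \<open>n1\<close> rows of \<open>S1\<close>.\<close>

lemma parallel_factors:
  assumes A1: "A1 \<in> carrier_mat n1 n1" "stable A1" and A2: "A2 \<in> carrier_mat n2 n2" "stable A2"
    and B: "B1 \<in> carrier_mat n1 m" "B2 \<in> carrier_mat n2 m" and C: "C1 \<in> carrier_mat n1 p" "C2 \<in> carrier_mat n2 p"
  obtains S1 S2 R1 R2 where
    "gfac (n1 + n2) (fs (block_diag A1 A2)) (fs (B1 @\<^sub>r B2)) (S1 + Sh n1 n2 * S2)"
    "gfac (n1 + n2) (tp (fs (block_diag A1 A2))) (fs (C1 @\<^sub>r C2)) (R1 + Sh n1 n2 * R2)"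
    "gfac n1 (fs A1) (fs B1) S1" "gfac n2 (fs A2) (fs B2) S2"
    "fs A1 * (S1 * tp S2) + S1 * tp S2 * tp (fs A2) + fs B1 * tp (fs B2) = 0"
    "gfac n1 (tp (fs A1)) (fs C1) R1" "gfac n2 (tp (fs A2)) (fs C2) R2"
    "tp (fs A1) * (R1 * tp R2) + R1 * tp R2 * fs A2 + fs C1 * tp (fs C2) = 0"
    "tp (R1 + Sh n1 n2 * R2) * (S1 + Sh n1 n2 * S2) = tp R1 * S1 + tp R2 * S2"
    "tp (R1 + Sh n1 n2 * R2) * fs (B1 @\<^sub>r B2) = tp R1 * fs B1 + tp R2 * fs B2"
proof -
  let ?A = "block_diag A1 A2" and ?N = "n1 + n2"
  have A: "?A \<in> carrier_mat ?N ?N" "stable ?A" using block_diag_carrier[OF A1(1) A2(1)] stable_block_diag[OF A1 A2] by auto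
  have At: "?A\<^sup>T \<in> carrier_mat ?N ?N" "stable ?A\<^sup>T" using A stable_transpose by simp_all
  have cB: "B1 @\<^sub>r B2 \<in> carrier_mat ?N m" and cC: "C1 @\<^sub>r C2 \<in> carrier_mat ?N p" using B C by auto
  obtain S where S: "gfac ?N (fs ?A) (fs (B1 @\<^sub>r B2)) S" "S * Id_n ?N = S" by (rule gfac_exists[OF A Id_fs_carrier(1)[OF cB]])
  obtain R where R: "gfac ?N (fs ?A\<^sup>T) (fs (C1 @\<^sub>r C2)) R" "R * Id_n ?N = R" by (rule gfac_exists[OF At Id_fs_carrier(1)[OF cC]])
  obtain S1 S2 where S12: "S = S1 + Sh n1 n2 * S2" "gfac n1 (fs A1) (fs B1) S1" "gfac n2 (fs A2) (fs B2) S2"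
    "fs A1 * (S1 * tp S2) + S1 * tp S2 * tp (fs A2) + fs B1 * tp (fs B2) = 0"
    using gfac_block_diag[OF A1(1) A2(1) B S(1)] by blast
  have A1t: "A1\<^sup>T \<in> carrier_mat n1 n1" and A2t: "A2\<^sup>T \<in> carrier_mat n2 n2" using A1 A2 by simp_all
  obtain R1 R2 where R12: "R = R1 + Sh n1 n2 * R2" "gfac n1 (fs A1\<^sup>T) (fs C1) R1" "gfac n2 (fs A2\<^sup>T) (fs C2) R2"
    "fs A1\<^sup>T * (R1 * tp R2) + R1 * tp R2 * tp (fs A2\<^sup>T) + fs C1 * tp (fs C2) = 0"
    using gfac_block_diag[OF A1t A2t C R(1)[folded block_diag_transpose[OF A1(1) A2(1)]]] by blast
  have I: "Id_n n1 * S1 = S1" "Id_n n2 * S2 = S2" "Id_n n1 * R1 = R1" "Id_n n2 * R2 = R2" "Id_n n1 * fs B1 = fs B1" "Id_n n2 * fs B2 = fs B2"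
    using S12 R12 B by (simp_all add: gfac_def)
  have tR1: "tp R1 * Id_n n1 = tp R1" using arg_cong[OF I(3), of tp] by (simp only: tp_mult tp_Id)
  have prod: "tp (R1 + Sh n1 n2 * R2) * (X1 + Sh n1 n2 * X2) = tp R1 * X1 + tp R2 * X2"
    if "Id_n n1 * X1 = X1" "Id_n n2 * X2 = X2" for X1 X2
  proof -
    have "tp R1 * (Sh n1 n2 * X2) = tp R1 * (Id_n n1 * Sh n1 n2) * X2" unfolding mult.assoc[symmetric] tR1 ..
    then have z1: "tp R1 * (Sh n1 n2 * X2) = 0" by simp
    have "tp (Sh n1 n2) * X1 = (tp (Sh n1 n2) * Id_n n1) * X1" unfolding mult.assoc that(1) ..
    then have z2: "tp (Sh n1 n2) * X1 = 0" by simp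
    have z3: "tp (Sh n1 n2) * (Sh n1 n2 * X2) = X2" unfolding mult.assoc[symmetric] tp_Sh_Sh by (rule that(2))
    show ?thesis by (simp add: ring_distribs mult.assoc z1 z2 z3)
  qed
  show ?thesis
    by (rule that[OF _ _ S12(2-4) _ _ _ prod[OF I(1,2)]])
      (use S S12 R R12 prod[OF I(5,6)] fs_append_rows[OF B] in simp_all)
qed

lemma gfac_uminus [simp]: "gfac n a (- b) S \<longleftrightarrow> gfac n a b S"
  by (simp add: gfac_def)

lemma gramian_values_zero:
  assumes cA: "A \<in> carrier_mat n n" "stable A" and cB: "B \<in> carrier_mat n m" and cC: "C \<in> carrier_mat n p"
    and zero: "\<And>s. 0 \<le> s \<Longrightarrow> transfer_fun A B C (complex_of_real s) = 0\<^sub>m p m"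
    and S: "gfac n (fs A) (fs B) S" and R: "gfac n (tp (fs A)) (fs C) R"
  shows "tp R * S = 0" "tp R * fs B = 0"
proof -
  obtain R0 M K \<rho> where "cayley n (fs A) R0 M K \<rho>" by (rule stable_cayley[OF cA])
  then interpret cayley n "fs A" R0 M K \<rho> .
  have "\<exists>r. (s *\<^sub>R Id_n n - fs A) * r = Id_n n \<and> r * (s *\<^sub>R Id_n n - fs A) = Id_n n \<and> Id_n n * r = r \<and> r * Id_n n = r
      \<and> tp (fs C) * r * fs B = 0" if s: "0 \<le> s" for s
  proof -
    obtain r where r: "r \<in> carrier_mat n n" "(s *\<^sub>R Id_n n - fs A) * fs r = Id_n n" "fs r * (s *\<^sub>R Id_n n - fs A) = Id_n n"
      "transfer_fun A B C (complex_of_real s) = cmat (C\<^sup>T * r * B)" by (rule transfer_fun_real[OF cA s cB cC])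
    have "C\<^sup>T * r * B = 0\<^sub>m p m"
    proof (rule eq_matI)
      fix i j assume "i < dim_row (0\<^sub>m p m :: real mat)" "j < dim_col (0\<^sub>m p m :: real mat)"
      then have ij: "i < p" "j < m" by simp_all
      have "cmat (C\<^sup>T * r * B) = 0\<^sub>m p m" by (rule trans[OF r(4)[symmetric] zero[OF s]])
      then have "cmat (C\<^sup>T * r * B) $$ (i, j) = 0" using ij by (simp only: index_zero_mat)
      moreover have "i < dim_row (C\<^sup>T * r * B)" "j < dim_col (C\<^sup>T * r * B)" using ij cB cC by simp_all
      ultimately show "(C\<^sup>T * r * B) $$ (i, j) = 0\<^sub>m p m $$ (i, j)" using ij by (simp only: index_map_mat index_zero_mat of_real_eq_0_iff)
    qed (use cB cC in simp_all)
    then have "fs (C\<^sup>T * r * B) = 0" by simp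
    moreover have "fs (C\<^sup>T * r * B) = tp (fs C) * fs r * fs B" using cB cC r(1) by (simp add: fs_mult mult.assoc)
    ultimately show ?thesis using r by (intro exI[of _ "fs r"]) simp
  qed
  then obtain r where r: "\<And>s. 0 \<le> s \<Longrightarrow> (s *\<^sub>R Id_n n - fs A) * r s = Id_n n \<and> r s * (s *\<^sub>R Id_n n - fs A) = Id_n n \<and> Id_n n * r s = r s \<and> r s * Id_n n = r s
      \<and> tp (fs C) * r s * fs B = 0" by metis
  have S': "Id_n n * S = S" "fs A * (S * tp S) + S * tp S * tp (fs A) + fs B * tp (fs B) = 0" using S by (simp_all add: gfac_def)
  have R': "Id_n n * R = R" "tp (fs A) * (R * tp R) + R * tp R * fs A + fs C * tp (fs C) = 0" using R by (simp_all add: gfac_def)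
  have r1: "\<And>s. 0 \<le> s \<Longrightarrow> (s *\<^sub>R Id_n n - fs A) * r s = Id_n n \<and> r s * (s *\<^sub>R Id_n n - fs A) = Id_n n \<and> Id_n n * r s = r s \<and> r s * Id_n n = r s"
    and r2: "\<And>s. 0 \<le> s \<Longrightarrow> tp (fs C) * r s * fs B = 0" using r by simp_all
  have tR: "tp (R * tp R) = R * tp R" by simp
  note z = zero_transfer[OF r1 r2 Id_fs_carrier(1)[OF cB] Id_fs_carrier(1)[OF cC] gfac_Id[OF S'(1)] S'(2) gfac_Id(1)[OF R'(1)] tR psdq_mult_tp R'(2)]
  have tr: "tp R * X = 0" if "R * tp R * X = 0" for X
  proof -
    have "inner (tp R * X) (tp R * X) = inner X (R * tp R * X)" by (simp only: inner_left_mult mult.assoc tp_simps)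
    then show ?thesis unfolding that by simp
  qed
  show "tp R * fs B = 0" by (rule tr[OF z(1)])
  define Y where "Y = R * tp R * S"
  have "Y * tp Y = R * tp R * (S * tp S) * (R * tp R)" unfolding Y_def by (simp add: mult.assoc)
  then have "opn Y = 0" using opn_mult_tp[of Y] z(2) by simp
  then have "Y = 0" by (rule opn_eq_0)
  then show "tp R * S = 0" unfolding Y_def by (rule tr)
qed

lemma realization_values_unique:
  assumes r1: "stable_realization G A1 B1 C1" and r2: "stable_realization G A2 B2 C2"
  shows "sqrt (lambda_max (ctrl_gramian A1 B1 * obs_gramian A1 C1)) = sqrt (lambda_max (ctrl_gramian A2 B2 * obs_gramian A2 C2))"
    "sqrt (mat_tr (B1\<^sup>T * obs_gramian A1 C1 * B1)) = sqrt (mat_tr (B2\<^sup>T * obs_gramian A2 C2 * B2))"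
proof -
  define n1 n2 m p where nd: "n1 = dim_row A1" "n2 = dim_row A2" "m = dim_col B2" "p = dim_col C2"
  have "G 0 = transfer_fun A1 B1 C1 0" "G 0 = transfer_fun A2 B2 C2 0" using r1 r2 unfolding stable_realization_def nd by auto
  then have "dim_row (transfer_fun A1 B1 C1 0) = dim_row (transfer_fun A2 B2 C2 0)" "dim_col (transfer_fun A1 B1 C1 0) = dim_col (transfer_fun A2 B2 C2 0)" by simp_all
  then have d: "dim_col C1 = p" "dim_col B1 = m" unfolding transfer_fun_def nd by simp_all
  have c: "A1 \<in> carrier_mat n1 n1" "A2 \<in> carrier_mat n2 n2" "B1 \<in> carrier_mat n1 m" "B2 \<in> carrier_mat n2 m"
    "C1 \<in> carrier_mat n1 p" "C2 \<in> carrier_mat n2 p" "stable A1" "stable A2" and n: "0 < n1" "0 < n2"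
    using r1 r2 d unfolding stable_realization_def nd by auto
  have c6: "- C2 \<in> carrier_mat n2 p" using c(6) by simp
  obtain S1 S2 R1 R2 where f:
    "gfac (n1 + n2) (fs (block_diag A1 A2)) (fs (B1 @\<^sub>r B2)) (S1 + Sh n1 n2 * S2)"
    "gfac (n1 + n2) (tp (fs (block_diag A1 A2))) (fs (C1 @\<^sub>r - C2)) (R1 + Sh n1 n2 * R2)"
    "gfac n1 (fs A1) (fs B1) S1" "gfac n2 (fs A2) (fs B2) S2"
    "fs A1 * (S1 * tp S2) + S1 * tp S2 * tp (fs A2) + fs B1 * tp (fs B2) = 0"
    "gfac n1 (tp (fs A1)) (fs C1) R1" "gfac n2 (tp (fs A2)) (fs (- C2)) R2"
    "tp (fs A1) * (R1 * tp R2) + R1 * tp R2 * fs A2 + fs C1 * tp (fs (- C2)) = 0"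
    "tp (R1 + Sh n1 n2 * R2) * (S1 + Sh n1 n2 * S2) = tp R1 * S1 + tp R2 * S2"
    "tp (R1 + Sh n1 n2 * R2) * fs (B1 @\<^sub>r B2) = tp R1 * fs B1 + tp R2 * fs B2"
    by (rule parallel_factors[OF c(1,7,2,8,3,4,5) c6])
  have sr: "stable_realization (\<lambda>s. G s + - G s) (block_diag A1 A2) (B1 @\<^sub>r B2) (C1 @\<^sub>r - C2)"
    by (rule stable_realization_add[OF r1 stable_realization_uminus[OF r2]]) (simp_all add: d nd)
  have "transfer_fun (block_diag A1 A2) (B1 @\<^sub>r B2) (C1 @\<^sub>r - C2) (complex_of_real s) = 0\<^sub>m p m" if "0 \<le> s" for s
  proof -
    have G: "G (complex_of_real s) = transfer_fun A2 B2 C2 (complex_of_real s)" using r2 that unfolding stable_realization_def by simp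
    then have "G (complex_of_real s) \<in> carrier_mat p m" unfolding transfer_fun_def nd by (intro carrier_matI) simp_all
    then have "G (complex_of_real s) + - G (complex_of_real s) = 0\<^sub>m p m" by (intro eq_matI) auto
    then show ?thesis using sr that unfolding stable_realization_def by simp
  qed
  note z = gramian_values_zero[OF _ _ _ _ this f(1,2)]
  have bd: "block_diag A1 A2 \<in> carrier_mat (n1 + n2) (n1 + n2)" "stable (block_diag A1 A2)"
    using block_diag_carrier[OF c(1,2)] stable_block_diag[OF c(1,7,2,8)] by auto
  have rows: "B1 @\<^sub>r B2 \<in> carrier_mat (n1 + n2) m" "C1 @\<^sub>r - C2 \<in> carrier_mat (n1 + n2) p" using c c6 by auto
  have z1: "tp R1 * S1 = - (tp R2 * S2)" using z(1)[OF bd rows] f(9) by (simp add: eq_neg_iff_add_eq_0)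
  have z2: "tp R1 * fs B1 = - (tp R2 * fs B2)" using z(2)[OF bd rows] f(10) by (simp add: eq_neg_iff_add_eq_0)
  have f6: "gfac n2 (tp (fs A2)) (fs C2) R2" using f(7) by simp
  show "sqrt (lambda_max (ctrl_gramian A1 B1 * obs_gramian A1 C1)) = sqrt (lambda_max (ctrl_gramian A2 B2 * obs_gramian A2 C2))"
    "sqrt (mat_tr (B1\<^sup>T * obs_gramian A1 C1 * B1)) = sqrt (mat_tr (B2\<^sup>T * obs_gramian A2 C2 * B2))"
    unfolding gramian_values[OF c(1,7,3,5) n(1) f(3,6)] gramian_values[OF c(2,8,4,6) n(2) f(4) f6] z1 z2 by simp_all
qed

lemma norms_of_realization:
  assumes r: "stable_realization G A B C"
  shows "hankel_norm G = sqrt (lambda_max (ctrl_gramian A B * obs_gramian A C))"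
    "h2_norm G = sqrt (mat_tr (B\<^sup>T * obs_gramian A C * B))"
  unfolding hankel_norm_def h2_norm_def
  by (rule the_equality; use r realization_values_unique in metis)+

lemma norms_of_factors:
  assumes r: "stable_realization G A B C" and n: "A \<in> carrier_mat n n"
    and S: "gfac n (fs A) (fs B) S" and R: "gfac n (tp (fs A)) (fs C) R"
  shows "hankel_norm G = opn (tp R * S)" "h2_norm G = norm (tp R * fs B)"
proof -
  define m p where nd: "m = dim_col B" "p = dim_col C"
  have c: "B \<in> carrier_mat n m" "C \<in> carrier_mat n p" "stable A" "0 < n"
    using r n unfolding stable_realization_def nd by auto
  show "hankel_norm G = opn (tp R * S)" "h2_norm G = norm (tp R * fs B)"
    unfolding norms_of_realization[OF r] by (rule gramian_values[OF n c(3,1,2,4) S R])+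
qed

lemma norms_triangle:
  assumes r1: "stable_realization G1 A1 B1 C1" and r2: "stable_realization G2 A2 B2 C2"
    and d: "dim_col B1 = dim_col B2" "dim_col C1 = dim_col C2"
  shows "hankel_norm (\<lambda>s. G1 s + G2 s) \<le> hankel_norm G1 + hankel_norm G2"
    "h2_norm (\<lambda>s. G1 s + G2 s) \<le> h2_norm G1 + h2_norm G2"
proof -
  define n1 n2 m p where nd: "n1 = dim_row A1" "n2 = dim_row A2" "m = dim_col B2" "p = dim_col C2"
  have c: "A1 \<in> carrier_mat n1 n1" "A2 \<in> carrier_mat n2 n2" "B1 \<in> carrier_mat n1 m" "B2 \<in> carrier_mat n2 m"
    "C1 \<in> carrier_mat n1 p" "C2 \<in> carrier_mat n2 p" "stable A1" "stable A2" and n: "0 < n1" "0 < n2"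
    using r1 r2 d unfolding stable_realization_def nd by auto
  obtain S1 S2 R1 R2 where f:
    "gfac (n1 + n2) (fs (block_diag A1 A2)) (fs (B1 @\<^sub>r B2)) (S1 + Sh n1 n2 * S2)"
    "gfac (n1 + n2) (tp (fs (block_diag A1 A2))) (fs (C1 @\<^sub>r C2)) (R1 + Sh n1 n2 * R2)"
    "gfac n1 (fs A1) (fs B1) S1" "gfac n2 (fs A2) (fs B2) S2"
    "fs A1 * (S1 * tp S2) + S1 * tp S2 * tp (fs A2) + fs B1 * tp (fs B2) = 0"
    "gfac n1 (tp (fs A1)) (fs C1) R1" "gfac n2 (tp (fs A2)) (fs C2) R2"
    "tp (fs A1) * (R1 * tp R2) + R1 * tp R2 * fs A2 + fs C1 * tp (fs C2) = 0"
    "tp (R1 + Sh n1 n2 * R2) * (S1 + Sh n1 n2 * S2) = tp R1 * S1 + tp R2 * S2"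
    "tp (R1 + Sh n1 n2 * R2) * fs (B1 @\<^sub>r B2) = tp R1 * fs B1 + tp R2 * fs B2"
    by (rule parallel_factors[OF c(1,7,2,8,3-6)])
  note nm = norms_of_factors[OF stable_realization_add[OF r1 r2 d] block_diag_carrier[OF c(1,2)] f(1,2)]
  show "hankel_norm (\<lambda>s. G1 s + G2 s) \<le> hankel_norm G1 + hankel_norm G2"
    unfolding nm f(9) norms_of_factors[OF r1 c(1) f(3,6)] norms_of_factors[OF r2 c(2) f(4,7)] by (rule opn_triangle)
  show "h2_norm (\<lambda>s. G1 s + G2 s) \<le> h2_norm G1 + h2_norm G2"
    unfolding nm f(10) norms_of_factors[OF r1 c(1) f(3,6)] norms_of_factors[OF r2 c(2) f(4,7)] by (rule norm_triangle_ineq)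
qed

section \<open>The matrix exponential and its Gramian\<close>

lemma abs_ent_le_norm: "\<bar>ent A i j\<bar> \<le> norm A"
proof -
  obtain K where K: "bounded_by K A" using ex_bounded_by by blast
  define L where "L = K + i + j + 1"
  have L: "bounded_by L A" using bounded_by_mono[OF K] by (simp add: L_def)
  have "(ent A i j)\<^sup>2 \<le> (\<Sum>j<L. (ent A i j)\<^sup>2)"
    by (rule member_le_sum) (simp_all add: L_def)
  also have "\<dots> \<le> (\<Sum>i<L. \<Sum>j<L. (ent A i j)\<^sup>2)"
    by (rule member_le_sum[of i _ "\<lambda>i. \<Sum>j<L. (ent A i j)\<^sup>2"]) (simp_all add: L_def sum_nonneg)
  finally have "(ent A i j)\<^sup>2 \<le> (norm A)\<^sup>2" unfolding norm_fsmat_sq[OF L] .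
  then show ?thesis using power2_le_imp_le[of "\<bar>ent A i j\<bar>" "norm A"] by simp
qed

lemma fpow_tp: assumes "Id_n n * a = a" "a * Id_n n = a" shows "fpow n (tp a) k = tp (fpow n a k)"
proof -
  have c: "a * fpow n a k = fpow n a k * a" for k
    by (induction k) (simp_all add: assms mult.assoc[symmetric])
  have "tp (fpow n a k) * tp a = tp a * tp (fpow n a k)" for k using arg_cong[OF c[of k], of tp] by simp
  then show ?thesis by (induction k) simp_all
qed

lemma norm_fpow_le: "norm (fpow n a k) \<le> norm (Id_n n) * norm a ^ k"
proof (induction k)
  case (Suc k)
  have "norm (fpow n a (Suc k)) \<le> norm (fpow n a k) * norm a" by (simp add: norm_mult_ineq)
  also have "\<dots> \<le> norm (Id_n n) * norm a ^ k * norm a" by (rule mult_right_mono[OF Suc]) simp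
  finally show ?case by (simp only: power_Suc2 mult.assoc)
qed simp

definition fexp :: "nat \<Rightarrow> fsmat \<Rightarrow> real \<Rightarrow> fsmat" where
  "fexp n a t = fs (mat n n (\<lambda>(i, j). \<Sum>k. ent (fpow n a k) i j / fact k * t ^ k))"

lemma ent_fexp: "ent (fexp n a t) i j = (if i < n \<and> j < n then (\<Sum>k. ent (fpow n a k) i j / fact k * t ^ k) else 0)"
  by (simp add: fexp_def)

lemma fexp_Id [simp]: "Id_n n * fexp n a t = fexp n a t" "fexp n a t * Id_n n = fexp n a t"
  by (simp_all add: fexp_def)

lemma mat_exp_carrier [simp]: "mat_exp A \<in> carrier_mat (dim_row A) (dim_row A)"
  by (simp add: mat_exp_def)

lemma fs_mat_exp:
  assumes A: "A \<in> carrier_mat n n" shows "fs (mat_exp (t \<cdot>\<^sub>m A)) = fexp n (fs A) t"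
proof -
  have tA: "t \<cdot>\<^sub>m A \<in> carrier_mat n n" using A by simp
  have p: "fpow n (t *\<^sub>R fs A) k = t ^ k *\<^sub>R fpow n (fs A) k" for k by (induction k) simp_all
  have e: "((t \<cdot>\<^sub>m A) ^\<^sub>m k) $$ (i, j) = t ^ k * ent (fpow n (fs A) k) i j" if "i < n" "j < n" for i j k
  proof -
    have P: "(t \<cdot>\<^sub>m A) ^\<^sub>m k \<in> carrier_mat n n" using tA by simp
    have "ent (fs ((t \<cdot>\<^sub>m A) ^\<^sub>m k)) i j = t ^ k * ent (fpow n (fs A) k) i j"
      unfolding fs_pow[OF tA] by (simp add: p)
    then show ?thesis unfolding ent_fs_carrier[OF P] using that by simp
  qed
  have me: "mat_exp (t \<cdot>\<^sub>m A) = mat n n (\<lambda>ij. \<Sum>k. ((t \<cdot>\<^sub>m A) ^\<^sub>m k) $$ ij / fact k)"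
    unfolding mat_exp_def carrier_matD[OF tA] ..
  show ?thesis
    unfolding me
  proof (rule fsmat_eqI)
    fix i j
    show "ent (fs (mat n n (\<lambda>ij. \<Sum>k. ((t \<cdot>\<^sub>m A) ^\<^sub>m k) $$ ij / fact k))) i j = ent (fexp n (fs A) t) i j"
    proof (cases "i < n \<and> j < n")
      case True
      then show ?thesis by (simp add: ent_fexp e mult.commute)
    next
      case False
      then show ?thesis by (auto simp: ent_fexp)
    qed
  qed
qed

lemma fexp_tp: assumes "Id_n n * a = a" "a * Id_n n = a" shows "fexp n (tp a) t = tp (fexp n a t)"
  by (rule fsmat_eqI) (auto simp: ent_fexp fpow_tp[OF assms])

lemma summable_fexp: "summable (\<lambda>k. ent (fpow n a k) i j / fact k * t ^ k)"
proof (rule summable_comparison_test'[of "\<lambda>k. norm (Id_n n) * (inverse (fact k) * (norm a * \<bar>t\<bar>) ^ k)" 0])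
  show "summable (\<lambda>k. norm (Id_n n) * (inverse (fact k) * (norm a * \<bar>t\<bar>) ^ k))"
    by (intro summable_mult summable_exp)
  fix k
  have "\<bar>ent (fpow n a k) i j\<bar> \<le> norm (Id_n n) * norm a ^ k"
    by (rule order_trans[OF abs_ent_le_norm norm_fpow_le])
  then have "\<bar>ent (fpow n a k) i j\<bar> * (inverse (fact k) * \<bar>t\<bar> ^ k) \<le> norm (Id_n n) * norm a ^ k * (inverse (fact k) * \<bar>t\<bar> ^ k)"
    by (rule mult_right_mono) simp
  then show "norm (ent (fpow n a k) i j / fact k * t ^ k) \<le> norm (Id_n n) * (inverse (fact k) * (norm a * \<bar>t\<bar>) ^ k)"
    by (simp add: abs_mult power_abs power_mult_distrib divide_inverse mult.assoc mult.left_commute)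
qed

lemma fexp_0: "fexp n a 0 = Id_n n"
proof (rule fsmat_eqI)
  fix i j
  show "ent (fexp n a 0) i j = ent (Id_n n) i j" unfolding ent_fexp powser_zero by simp
qed

lemma ent_fexp_deriv:
  assumes a: "Id_n n * a = a" "a * Id_n n = a"
  shows "((\<lambda>t. ent (fexp n a t) i j) has_real_derivative ent (fexp n a t * a) i j) (at t)"
proof (cases "i < n \<and> j < n")
  case False
  have "Id_n n * (fexp n a t * a) * Id_n n = fexp n a t * a"
    unfolding mult.assoc a by (simp only: mult.assoc[symmetric] fexp_Id)
  then have "ent (fexp n a t * a) i j = ent (Id_n n * (fexp n a t * a) * Id_n n) i j" by simp
  also have "\<dots> = 0" using False by auto
  finally show ?thesis using False by (auto simp: ent_fexp)
next
  case True
  define c where "c k = ent (fpow n a k) i j / fact k" for k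
  have sm: "summable (\<lambda>k. c k * y ^ k)" for y unfolding c_def by (rule summable_fexp)
  have d: "((\<lambda>t. \<Sum>k. c k * t ^ k) has_real_derivative (\<Sum>k. diffs c k * t ^ k)) (at t)"
    by (rule termdiffs_strong_converges_everywhere[OF sm])
  have dk: "diffs c k * t ^ k = (\<Sum>l<n. (ent (fpow n a k) i l / fact k * t ^ k) * ent a l j)" for k
  proof -
    have "ent (fpow n a k * a) i j = ent (fpow n a k * (Id_n n * a)) i j" unfolding a(1) ..
    also have "\<dots> = ent ((fpow n a k * Id_n n) * a) i j" by (simp only: mult.assoc)
    also have "\<dots> = (\<Sum>l<n. ent (fpow n a k) i l * ent a l j)"
    proof -
      obtain N where N: "bounded_by N a" using ex_bounded_by by blast
      have "bounded_by (N + n) a" using bounded_by_mono[OF N] by simp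
      then have "ent ((fpow n a k * Id_n n) * a) i j = (\<Sum>l<N + n. ent (fpow n a k * Id_n n) i l * ent a l j)"
        by (intro ent_times) simp
      also have "\<dots> = (\<Sum>l<n. ent (fpow n a k) i l * ent a l j)"
        by (rule sum.mono_neutral_cong_right) auto
      finally show ?thesis .
    qed
    finally have "ent (fpow n a (Suc k)) i j = (\<Sum>l<n. ent (fpow n a k) i l * ent a l j)" by simp
    note s = this
    have r: "of_nat (Suc k) * (x / fact (Suc k)) = x / fact k" for x :: real
      by (simp add: fact_Suc del: of_nat_Suc)
    show ?thesis
      unfolding diffs_def c_def s r by (simp only: sum_divide_distrib sum_distrib_right) (rule sum.cong[OF refl], simp)
  qed
  have "(\<Sum>k. diffs c k * t ^ k) = (\<Sum>l<n. \<Sum>k. (ent (fpow n a k) i l / fact k * t ^ k) * ent a l j)"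
    unfolding dk by (rule suminf_sum) (intro summable_mult2 summable_fexp)
  also have "\<dots> = (\<Sum>l<n. ent (fexp n a t) i l * ent a l j)"
  proof (rule sum.cong[OF refl])
    fix l assume "l \<in> {..<n}"
    then show "(\<Sum>k. (ent (fpow n a k) i l / fact k * t ^ k) * ent a l j) = ent (fexp n a t) i l * ent a l j"
      unfolding ent_fexp using True by (simp only: lessThan_iff simp_thms if_True suminf_mult2[OF summable_fexp])
  qed
  also have "\<dots> = ent (fexp n a t * a) i j"
    by (rule ent_times[symmetric]) (simp add: fexp_def bounded_by_fs)
  finally show ?thesis using d True by (simp add: ent_fexp c_def)
qed

lemma ent_fsmat_expand:
  assumes "Id_n n * Z = Z" "Z * Id_n n = Z"
  shows "Z = (\<Sum>i<n. \<Sum>j<n. ent Z i j *\<^sub>R (ev i * tp (ev j)))"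
proof (rule fsmat_eqI)
  fix k l
  have u: "ent (ev i * tp (ev j)) k l = (if k = i \<and> l = j then 1 else 0)" for i j
    using ent_mult_tp_Sh[of "ev i" j 1 k l] unfolding ev_def[of j, symmetric] by auto
  have "ent (\<Sum>i<n. \<Sum>j<n. ent Z i j *\<^sub>R (ev i * tp (ev j))) k l
      = (\<Sum>i<n. \<Sum>j<n. if j = l then (if i = k then ent Z k l else 0) else 0)"
    unfolding ent_sum by (intro sum.cong refl) (auto simp: u)
  also have "\<dots> = (if k < n \<and> l < n then ent Z k l else 0)"
    by (cases "l < n") simp_all
  also have "\<dots> = ent (Id_n n * Z * Id_n n) k l" by simp
  finally show "ent Z k l = ent (\<Sum>i<n. \<Sum>j<n. ent Z i j *\<^sub>R (ev i * tp (ev j))) k l" unfolding assms ..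
qed

lemma fexp_deriv:
  assumes a: "Id_n n * a = a" "a * Id_n n = a"
  shows "(fexp n a has_vector_derivative fexp n a t * a) (at t)"
proof -
  have I: "Id_n n * (fexp n a t * a) = fexp n a t * a" "fexp n a t * a * Id_n n = fexp n a t * a"
    by (simp add: mult.assoc[symmetric]) (simp add: mult.assoc a)
  have e: "fexp n a = (\<lambda>t. \<Sum>i<n. \<Sum>j<n. ent (fexp n a t) i j *\<^sub>R (ev i * tp (ev j)))"
    by (rule ext) (rule ent_fsmat_expand; rule fexp_Id)
  have d: "((\<lambda>t. ent (fexp n a t) i j *\<^sub>R (ev i * tp (ev j))) has_vector_derivative ent (fexp n a t * a) i j *\<^sub>R (ev i * tp (ev j))) (at t)" for i j
    by (rule has_vector_derivative_eq_rhs[OF has_vector_derivative_scaleR[OF ent_fexp_deriv[OF a] has_vector_derivative_const]]) simp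
  have "((\<lambda>t. \<Sum>i<n. \<Sum>j<n. ent (fexp n a t) i j *\<^sub>R (ev i * tp (ev j))) has_vector_derivative
      (\<Sum>i<n. \<Sum>j<n. ent (fexp n a t * a) i j *\<^sub>R (ev i * tp (ev j)))) (at t)"
    by (intro has_vector_derivative_sum d)
  then show ?thesis unfolding e[symmetric] ent_fsmat_expand[OF I, symmetric] .
qed

lemma bounded_linear_tp: "bounded_linear tp"
  by (rule bounded_linear_intro[where K = 1]) simp_all

lemma fexp_congruence_deriv:
  assumes a: "Id_n n * a = a" "a * Id_n n = a" and X: "a * X + X * tp a = - Id_n n"
  shows "((\<lambda>t. inner Y (fexp n a t * X * tp (fexp n a t) * Y)) has_real_derivative - ((norm (tp (fexp n a t) * Y))\<^sup>2)) (at t)"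
proof -
  let ?E = "fexp n a"
  have dE: "(?E has_vector_derivative ?E t * a) (at t)" by (rule fexp_deriv[OF a])
  have dT: "((\<lambda>t. tp (?E t)) has_vector_derivative tp (?E t * a)) (at t)"
    by (rule bounded_linear.has_vector_derivative[OF bounded_linear_tp dE])
  have "((\<lambda>t. ?E t * X * tp (?E t)) has_vector_derivative ?E t * X * tp (?E t * a) + (?E t * 0 + ?E t * a * X) * tp (?E t)) (at t)"
    by (rule has_vector_derivative_mult[OF has_vector_derivative_mult[OF dE has_vector_derivative_const] dT])
  moreover have "?E t * X * tp (?E t * a) + (?E t * 0 + ?E t * a * X) * tp (?E t) = - (?E t * tp (?E t))"
  proof -
    have "?E t * X * tp (?E t * a) + (?E t * 0 + ?E t * a * X) * tp (?E t) = ?E t * (a * X + X * tp a) * tp (?E t)"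
      by (simp add: ring_distribs mult.assoc)
    then show ?thesis unfolding X by (simp add: mult.assoc[symmetric])
  qed
  ultimately have d: "((\<lambda>t. ?E t * X * tp (?E t)) has_vector_derivative - (?E t * tp (?E t))) (at t)" by simp
  have bl: "bounded_linear (\<lambda>Z. inner Y (Z * Y))"
    by (rule bounded_linear_compose[OF bounded_linear_inner_right bounded_linear_mult_left])
  have "((\<lambda>t. inner Y (?E t * X * tp (?E t) * Y)) has_vector_derivative inner Y (- (?E t * tp (?E t)) * Y)) (at t)"
    by (rule bounded_linear.has_vector_derivative[OF bl d])
  moreover have "inner Y (- (?E t * tp (?E t)) * Y) = - ((norm (tp (?E t) * Y))\<^sup>2)"
  proof -
    have "inner (tp (?E t) * Y) (tp (?E t) * Y) = inner Y (?E t * tp (?E t) * Y)"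
      by (simp only: inner_left_mult mult.assoc tp_simps)
    then show ?thesis unfolding power2_norm_eq_inner by simp
  qed
  ultimately show ?thesis unfolding has_real_derivative_iff_has_vector_derivative by simp
qed

lemma fexp_congruence_tendsto_0:
  assumes a: "Id_n n * a = a" "a * Id_n n = a" and X: "a * X + X * tp a = - Id_n n" "psdq X"
  shows "((\<lambda>t. inner Y (fexp n a t * X * tp (fexp n a t) * Y)) \<longlongrightarrow> 0) at_top"
proof -
  define u where "u t = inner Y (fexp n a t * X * tp (fexp n a t) * Y)" for t
  define v where "v t = (norm (tp (fexp n a t) * Y))\<^sup>2" for t
  define \<kappa> where "\<kappa> = opn X + 1"
  have \<kappa>: "\<kappa> > 0" unfolding \<kappa>_def using opn_ge_0[of X] by linarith
  have ue: "u t = inner (tp (fexp n a t) * Y) (X * (tp (fexp n a t) * Y))" for t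
    unfolding u_def by (simp only: inner_left_mult mult.assoc tp_simps)
  have u0: "0 \<le> u t" for t unfolding ue using X(2) unfolding psdq_def by blast
  have uv: "u t \<le> \<kappa> * v t" for t
  proof -
    let ?Z = "tp (fexp n a t) * Y"
    have "u t \<le> norm ?Z * (opn X * norm ?Z)"
      unfolding ue by (meson norm_cauchy_schwarz mult_left_mono norm_ge_zero norm_mult_opn order_trans)
    also have "\<dots> = opn X * v t" by (simp add: v_def power2_eq_square)
    also have "\<dots> \<le> \<kappa> * v t" unfolding \<kappa>_def v_def by (intro mult_right_mono) simp_all
    finally show ?thesis .
  qed
  have du: "(u has_real_derivative - v t) (at t)" for t
    unfolding u_def v_def by (rule fexp_congruence_deriv[OF a X(1)])
  have "u t * exp (t / \<kappa>) \<le> u 0 * exp (0 / \<kappa>)" if "0 \<le> t" for t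
  proof (rule DERIV_nonpos_imp_nonincreasing[OF that])
    fix x
    have de: "((\<lambda>t. exp (t / \<kappa>)) has_real_derivative exp (x / \<kappa>) / \<kappa>) (at x)"
      using \<kappa> by (auto intro!: derivative_eq_intros)
    have "((\<lambda>t. u t * exp (t / \<kappa>)) has_real_derivative (- v x * exp (x / \<kappa>) + exp (x / \<kappa>) / \<kappa> * u x)) (at x)"
      by (rule DERIV_mult[OF du de])
    moreover have "- v x * exp (x / \<kappa>) + exp (x / \<kappa>) / \<kappa> * u x = exp (x / \<kappa>) * (u x / \<kappa> - v x)"
      by (simp add: algebra_simps)
    moreover have "u x / \<kappa> - v x \<le> 0" using uv[of x] \<kappa> by (simp add: divide_le_eq mult.commute)
    ultimately show "\<exists>y. ((\<lambda>t. u t * exp (t / \<kappa>)) has_real_derivative y) (at x) \<and> y \<le> 0"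
      by (metis exp_ge_zero mult_nonneg_nonpos)
  qed
  then have le: "u t \<le> u 0 * exp (- t / \<kappa>)" if "0 \<le> t" for t
    using that by (simp add: exp_minus field_simps)
  have "((\<lambda>t. u 0 * exp (- t / \<kappa>)) \<longlongrightarrow> 0) at_top"
  proof -
    have "0 < 1 / \<kappa>" using \<kappa> by simp
    from filterlim_tendsto_pos_mult_at_top[OF tendsto_const this filterlim_ident]
    have "filterlim (\<lambda>t. t / \<kappa>) at_top at_top" using \<kappa> by simp
    then have "((\<lambda>t. exp (- (t / \<kappa>))) \<longlongrightarrow> 0) at_top"
      by (intro filterlim_compose[OF exp_at_bot] filterlim_compose[OF filterlim_uminus_at_bot_at_top])
    then have "((\<lambda>t. u 0 * exp (- (t / \<kappa>))) \<longlongrightarrow> u 0 * 0) at_top" by (rule tendsto_mult_left)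
    then show ?thesis by simp
  qed
  note z = this
  have "(u \<longlongrightarrow> 0) at_top"
  proof (rule tendsto_sandwich[OF _ _ tendsto_const z])
    show "\<forall>\<^sub>F t in at_top. 0 \<le> u t" using u0 by simp
    show "\<forall>\<^sub>F t in at_top. u t \<le> u 0 * exp (- t / \<kappa>)" unfolding eventually_at_top_linorder using le by blast
  qed
  then show ?thesis unfolding u_def .
qed

lemma has_integral_fexp_square:
  assumes a: "Id_n n * a = a" "a * Id_n n = a" and X: "a * X + X * tp a = - Id_n n" "psdq X" "X * Id_n n = X" "Id_n n * X = X"
  shows "((\<lambda>t. (norm (tp (fexp n a t) * Y))\<^sup>2) has_integral inner Y (X * Y)) {0..}"
proof -
  define u where "u t = inner Y (fexp n a t * X * tp (fexp n a t) * Y)" for t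
  define v where "v t = (norm (tp (fexp n a t) * Y))\<^sup>2" for t
  have du: "(u has_real_derivative - v t) (at t)" for t
    unfolding u_def v_def by (rule fexp_congruence_deriv[OF a X(1)])
  have I: "(v has_integral (u 0 - u K)) {0..K}" if "0 \<le> K" for K
  proof -
    have "((\<lambda>t. - v t) has_integral (u K - u 0)) {0..K}"
      by (rule fundamental_theorem_of_calculus[OF that])
        (use du has_real_derivative_iff_has_vector_derivative has_vector_derivative_at_within in blast)
    from has_integral_neg[OF this] show ?thesis by simp
  qed
  define f where "f k t = (if t \<in> {0..real k} then v t else 0)" for k t
  have If: "(f k has_integral (u 0 - u (real k))) {0..}" for k
    unfolding f_def by (subst has_integral_restrict) (use I in auto)
  have lim: "(\<lambda>k. u 0 - u (real k)) \<longlonglongrightarrow> u 0 - 0"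
    unfolding u_def
    by (intro tendsto_diff tendsto_const filterlim_compose[OF fexp_congruence_tendsto_0[OF a X(1,2)] filterlim_real_sequentially])
  have int: "integral {0..} (f k) = u 0 - u (real k)" for k using If by (rule integral_unique)
  have "v integrable_on {0..} \<and> (\<lambda>k. integral {0..} (f k)) \<longlonglongrightarrow> integral {0..} v"
  proof (rule monotone_convergence_increasing)
    show "f k integrable_on {0..}" for k using If by blast
    show "f k x \<le> f (Suc k) x" for k x unfolding f_def v_def by auto
    show "(\<lambda>k. f k x) \<longlonglongrightarrow> v x" if "x \<in> {0..}" for x
    proof (rule tendsto_eventually)
      obtain N where N: "x \<le> real N" using real_arch_simple by blast
      show "\<forall>\<^sub>F k in sequentially. f k x = v x"
        unfolding eventually_sequentially f_def using that N by (intro exI[of _ N]) auto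
    qed
    show "bounded (range (\<lambda>k. integral {0..} (f k)))"
      unfolding int using lim by (rule convergent_imp_bounded)
  qed
  then have "v integrable_on {0..}" "(\<lambda>k. u 0 - u (real k)) \<longlonglongrightarrow> integral {0..} v" unfolding int by auto
  then have "(v has_integral u 0) {0..}" using LIMSEQ_unique[OF lim] by (metis diff_zero has_integral_integral)
  moreover have "u 0 = inner Y (X * Y)" unfolding u_def fexp_0 by (simp add: X)
  ultimately show ?thesis unfolding v_def by simp
qed

lemma inner_ev: "inner (ev i) (Z * ev j) = ent Z i j"
proof -
  have "inner (ev i) (Z * ev j) *\<^sub>R E1 = tp (ev i) * (Z * ev j)" by (rule tp_mult_column[symmetric]) (simp_all add: mult.assoc)
  then have "ent (inner (ev i) (Z * ev j) *\<^sub>R E1) 0 0 = ent (tp (ev i) * (Z * ev j)) 0 0" by (rule arg_cong)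
  then show ?thesis unfolding ev_def[of i] by simp
qed

theorem gramian_integral:
  assumes A: "A \<in> carrier_mat n n" "stable A"
  defines "K \<equiv> mat_integral {0..} n n (\<lambda>t. mat_exp (t \<cdot>\<^sub>m A) * mat_exp (t \<cdot>\<^sub>m A\<^sup>T))"
  shows "fs A * fs K + fs K * tp (fs A) = - Id_n n" "psdq (fs K)" "tp (fs K) = fs K" "K \<in> carrier_mat n n"
proof -
  let ?a = "fs A"
  have a: "Id_n n * ?a = ?a" "?a * Id_n n = ?a" using A by simp_all
  obtain S where S: "Id_n n * S = S" "S * Id_n n = S" "?a * (S * tp S) + S * tp S * tp ?a + Id_n n * tp (Id_n n) = 0"
    by (rule gramian_exists[OF A Id_mult_Id])
  define X where "X = S * tp S"
  have X0: "Id_n n * X = X" unfolding X_def by (simp add: mult.assoc[symmetric] S(1))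
  have X1: "X * Id_n n = X" using arg_cong[OF X0, of tp] by (simp add: X_def)
  have "?a * X + X * tp ?a + Id_n n = 0" using S(3) by (simp add: X_def)
  then have X: "?a * X + X * tp ?a = - Id_n n" by (simp add: eq_neg_iff_add_eq_0)
  have pX: "psdq X" "tp X = X" unfolding X_def by (rule psdq_mult_tp) simp
  have ij: "integral {0..} (\<lambda>t. (mat_exp (t \<cdot>\<^sub>m A) * mat_exp (t \<cdot>\<^sub>m A\<^sup>T)) $$ (i, j)) = ent X i j" if "i < n" "j < n" for i j
  proof -
    have e: "(mat_exp (t \<cdot>\<^sub>m A) * mat_exp (t \<cdot>\<^sub>m A\<^sup>T)) $$ (i, j)
      = ((norm (tp (fexp n ?a t) * (ev i + ev j)))\<^sup>2 - (norm (tp (fexp n ?a t) * (ev i - ev j)))\<^sup>2) / 4" for t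
    proof -
      let ?E = "fexp n ?a t"
      let ?M = "mat_exp (t \<cdot>\<^sub>m A) * mat_exp (t \<cdot>\<^sub>m A\<^sup>T)"
      have c: "mat_exp (t \<cdot>\<^sub>m A) \<in> carrier_mat n n" "mat_exp (t \<cdot>\<^sub>m A\<^sup>T) \<in> carrier_mat n n"
        using mat_exp_carrier[of "t \<cdot>\<^sub>m A"] mat_exp_carrier[of "t \<cdot>\<^sub>m A\<^sup>T"] A by simp_all
      have At: "A\<^sup>T \<in> carrier_mat n n" using A by simp
      have fM: "fs ?M = ?E * tp ?E"
        using fs_mult[of "mat_exp (t \<cdot>\<^sub>m A)" "mat_exp (t \<cdot>\<^sub>m A\<^sup>T)"] c fs_mat_exp[OF A(1), of t] fs_mat_exp[OF At, of t] fexp_tp[OF a, of t] by simp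
      have cM: "?M \<in> carrier_mat n n" using c by simp
      have "?M $$ (i, j) = ent (fs ?M) i j" unfolding ent_fs_carrier[OF cM] using that by simp
      also have "\<dots> = inner (ev i) (?E * tp ?E * ev j)" unfolding fM inner_ev ..
      also have "\<dots> = inner (tp ?E * ev i) (tp ?E * ev j)" by (simp only: inner_left_mult mult.assoc tp_simps)
      also have "\<dots> = ((norm (tp ?E * ev i + tp ?E * ev j))\<^sup>2 - (norm (tp ?E * ev i - tp ?E * ev j))\<^sup>2) / 4"
        unfolding power2_norm_eq_inner by (simp add: inner_add_left inner_add_right inner_diff_left inner_diff_right inner_commute del: dot_square_norm)
      finally show ?thesis by (simp only: distrib_left right_diff_distrib)
    qed
    have h: "((\<lambda>t. ((norm (tp (fexp n ?a t) * (ev i + ev j)))\<^sup>2 - (norm (tp (fexp n ?a t) * (ev i - ev j)))\<^sup>2) / 4)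
      has_integral (inner (ev i + ev j) (X * (ev i + ev j)) - inner (ev i - ev j) (X * (ev i - ev j))) / 4) {0..}"
      by (intro has_integral_divide has_integral_diff has_integral_fexp_square[OF a X pX(1) X1 X0])
    have r: "(inner (ev i + ev j) (X * (ev i + ev j)) - inner (ev i - ev j) (X * (ev i - ev j))) / 4 = ent X i j"
    proof -
      have p: "inner (ev i + ev j) (X * (ev i + ev j)) = ent X i i + ent X i j + (ent X j i + ent X j j)"
        and m: "inner (ev i - ev j) (X * (ev i - ev j)) = ent X i i - ent X i j - (ent X j i - ent X j j)"
        by (simp_all only: distrib_left right_diff_distrib inner_add_left inner_add_right inner_diff_left inner_diff_right inner_ev)
      have "ent X j i = ent X i j" using arg_cong[OF pX(2), of "\<lambda>Z. ent Z i j"] by simp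
      then show ?thesis unfolding p m by simp
    qed
    show ?thesis unfolding e by (rule trans[OF integral_unique[OF h] r])
  qed
  have KX: "fs K = X"
  proof (rule fsmat_eqI)
    fix i j
    have "ent X i j = 0" if "\<not> i < n" using arg_cong[OF X0, of "\<lambda>Z. ent Z i j"] that by simp
    moreover have "ent X i j = 0" if "\<not> j < n" using arg_cong[OF X1, of "\<lambda>Z. ent Z i j"] that by simp
    ultimately show "ent (fs K) i j = ent X i j" using ij unfolding K_def mat_integral_def by (cases "i < n \<and> j < n") auto
  qed
  show "fs A * fs K + fs K * tp (fs A) = - Id_n n" "psdq (fs K)" "tp (fs K) = fs K" unfolding KX using X pX by simp_all
  show "K \<in> carrier_mat n n" unfolding K_def mat_integral_def by simp
qed

section \<open>Stability of the balanced truncation\<close>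

locale balanced =
  fixes n r m1 m2 :: nat and a b c S R U1 U2 V1 V2 Sig2 :: fsmat and d :: "nat \<Rightarrow> real" and \<sigma>r s2 :: real
  assumes S: "Id_n n * S = S" "S * Id_n m1 = S" and R: "Id_n n * R = R" "R * Id_n m2 = R"
    and P: "a * (S * tp S) + S * tp S * tp a + b * tp b = 0"
    and Q: "tp a * (R * tp R) + R * tp R * a + c * tp c = 0"
    and U: "tp U1 * U1 = Id_n r" "tp U1 * U2 = 0" "tp U2 * U1 = 0" "U1 * Id_n r = U1" "U1 * tp U1 + U2 * tp U2 = Id_n m1"
    and V: "tp V1 * V1 = Id_n r" "tp V1 * V2 = 0" "tp V2 * V1 = 0" "V1 * Id_n r = V1" "V1 * tp V1 + V2 * tp V2 = Id_n m2"
    and opn_UV: "opn U1 \<le> 1" "opn U2 \<le> 1" "opn V1 \<le> 1" "opn V2 \<le> 1"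
    and GV: "tp S * R * V1 = U1 * Dg r d" "tp S * R * V2 = U2 * Sig2"
    and GU: "tp R * S * U1 = V1 * Dg r d" "tp R * S * U2 = V2 * tp Sig2"
    and d: "\<And>i. i < r \<Longrightarrow> \<sigma>r \<le> d i" and s2: "0 \<le> s2" "s2 < \<sigma>r" "opn Sig2 \<le> s2"
begin

definition J :: fsmat where "J = Dg r (\<lambda>i. 1 / d i)"
definition X1 :: fsmat where "X1 = S * U1"
definition Y1 :: fsmat where "Y1 = R * V1 * J"

abbreviation "ah \<equiv> tp Y1 * a * X1"
abbreviation "bh \<equiv> tp Y1 * b"
abbreviation "ch \<equiv> tp X1 * c"
abbreviation "D2 \<equiv> Dg r (\<lambda>i. d i * d i)"

lemma \<sigma>r_pos: "0 < \<sigma>r" using s2 by linarith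

lemma J_simps [simp]: "tp J = J" "Id_n r * J = J" "J * Id_n r = J"
  by (simp_all add: J_def)

lemma Dg_J: "Dg r d * J = Id_n r" "J * Dg r d = Id_n r"
proof -
  have "d i \<noteq> 0" if "i < r" for i using d[OF that] \<sigma>r_pos by linarith
  then have "Dg r (\<lambda>i. d i * (1 / d i)) = Dg r (\<lambda>i. 1)" "Dg r (\<lambda>i. 1 / d i * d i) = Dg r (\<lambda>i. 1)"
    by (auto intro!: Dg_cong)
  moreover have "Dg r (\<lambda>i. 1) = Id_n r" by (rule fsmat_eqI) auto
  ultimately show "Dg r d * J = Id_n r" "J * Dg r d = Id_n r" unfolding J_def Dg_mult by simp_all
qed

lemma tU: "Id_n r * tp U1 = tp U1" using arg_cong[OF U(4), of tp] by (simp only: tp_mult tp_Id)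
lemma X1_Id: "X1 * Id_n r = X1" "Id_n n * X1 = X1"
  unfolding X1_def by (simp add: mult.assoc U) (simp add: mult.assoc[symmetric] S)

lemma PY1: "S * tp S * Y1 = X1"
proof -
  have "S * tp S * Y1 = S * (tp S * R * V1) * J" unfolding Y1_def by (simp only: mult.assoc)
  also have "\<dots> = S * U1 * (Dg r d * J)" unfolding GV(1) by (simp only: mult.assoc)
  finally show ?thesis unfolding Dg_J X1_def by (simp add: mult.assoc U)
qed

lemma QX1: "R * tp R * X1 = Y1 * D2"
proof -
  have "R * tp R * X1 = R * (tp R * S * U1)" unfolding X1_def by (simp only: mult.assoc)
  also have "\<dots> = R * V1 * (J * Dg r d) * Dg r d" unfolding GU(1) Dg_J by (simp add: mult.assoc)
  also have "\<dots> = Y1 * (Dg r d * Dg r d)" unfolding Y1_def by (simp only: mult.assoc)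
  finally show ?thesis unfolding Dg_mult .
qed

lemma tpPY1: "tp Y1 * (S * tp S) = tp X1" using arg_cong[OF PY1, of tp] by (simp add: mult.assoc)
lemma tpQX1: "tp X1 * (R * tp R) = D2 * tp Y1" using arg_cong[OF QX1, of tp] by (simp add: mult.assoc)

lemma tpY1_S: "tp Y1 * S = tp U1"
proof -
  have "tp Y1 * S = J * tp (tp S * R * V1)" unfolding Y1_def by (simp add: mult.assoc)
  also have "\<dots> = J * Dg r d * tp U1" unfolding GV(1) by (simp add: mult.assoc)
  finally show ?thesis unfolding Dg_J tU .
qed

lemma Y1X1: "tp Y1 * X1 = Id_n r"
  unfolding X1_def mult.assoc[symmetric] tpY1_S U ..

lemma reduced_lyapunov_P: "ah + tp ah + bh * tp bh = 0"
proof -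
  have "tp Y1 * (a * (S * tp S) + S * tp S * tp a + b * tp b) * Y1
      = tp Y1 * a * (S * tp S * Y1) + (tp Y1 * (S * tp S)) * tp a * Y1 + bh * tp bh"
    by (simp add: ring_distribs mult.assoc)
  then show ?thesis unfolding P PY1 tpPY1 by (simp add: mult.assoc)
qed

lemma reduced_lyapunov_Q: "tp ah * D2 + D2 * ah + ch * tp ch = 0"
proof -
  have "tp X1 * (tp a * (R * tp R) + R * tp R * a + c * tp c) * X1
      = tp X1 * tp a * (R * tp R * X1) + (tp X1 * (R * tp R)) * a * X1 + ch * tp ch"
    by (simp add: ring_distribs mult.assoc)
  then show ?thesis unfolding Q QX1 tpQX1 by (simp add: mult.assoc)
qed

lemma eigenspace_range:
  assumes z: "S * tp S * (R * tp R) * z = \<mu> *\<^sub>R z" and l: "\<sigma>r\<^sup>2 \<le> \<mu>"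
  shows "X1 * (tp Y1 * z) = z"
proof -
  have l0: "\<mu> > 0" "s2\<^sup>2 < \<mu>"
  proof -
    have "s2\<^sup>2 < \<sigma>r\<^sup>2" using s2 by (intro power_strict_mono) simp_all
    then show "s2\<^sup>2 < \<mu>" using l by linarith
    then show "\<mu> > 0" using zero_le_power2[of s2] by linarith
  qed
  define w where "w = tp S * (R * tp R) * z"
  have Sw: "S * w = \<mu> *\<^sub>R z" unfolding w_def using z by (simp add: mult.assoc)
  have "tp S * R * (tp R * S * w) = tp S * (R * tp R) * (S * tp S * (R * tp R) * z)" unfolding w_def by (simp only: mult.assoc)
  then have ww: "tp S * R * (tp R * S * w) = \<mu> *\<^sub>R w" unfolding z w_def by simp
  define u where "u = tp U2 * w"
  have e1: "tp U2 * (tp S * R) = Sig2 * tp V2" using arg_cong[OF GU(2), of tp] by (simp add: mult.assoc)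
  have e2: "tp V2 * (tp R * S) = tp Sig2 * tp U2" using arg_cong[OF GV(2), of tp] by (simp add: mult.assoc)
  have "\<mu> *\<^sub>R u = tp U2 * (tp S * R * (tp R * S * w))" unfolding ww u_def by simp
  also have "\<dots> = (tp U2 * (tp S * R)) * (tp R * S * w)" by (simp only: mult.assoc)
  also have "\<dots> = Sig2 * (tp V2 * (tp R * S)) * w" unfolding e1 by (simp only: mult.assoc)
  also have "\<dots> = Sig2 * (tp Sig2 * u)" unfolding e2 u_def by (simp only: mult.assoc)
  finally have "\<mu> * norm u = norm (Sig2 * (tp Sig2 * u))" using l0 by (metis abs_of_pos norm_scaleR)
  also have "\<dots> \<le> s2 * (s2 * norm u)"
  proof -
    have "norm (Sig2 * (tp Sig2 * u)) \<le> opn Sig2 * norm (tp Sig2 * u)" by (rule norm_mult_opn)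
    also have "\<dots> \<le> s2 * (s2 * norm u)"
    proof (rule mult_mono[OF s2(3)])
      have "norm (tp Sig2 * u) \<le> opn (tp Sig2) * norm u" by (rule norm_mult_opn)
      also have "\<dots> \<le> s2 * norm u" using s2 by (intro mult_right_mono) simp_all
      finally show "norm (tp Sig2 * u) \<le> s2 * norm u" .
    qed (use s2 in simp_all)
    finally show ?thesis .
  qed
  finally have "(\<mu> - s2\<^sup>2) * norm u \<le> 0" by (simp add: left_diff_distrib power2_eq_square mult.assoc)
  then have "u = 0" using l0 by (simp add: mult_le_0_iff)
  have "Id_n m1 * w = w" unfolding w_def using arg_cong[OF S(2), of tp] by (simp add: mult.assoc[symmetric])
  then have "w = U1 * (tp U1 * w)" using U(5) \<open>u = 0\<close> unfolding u_def by (metis add.right_neutral distrib_right mult.assoc mult_zero_right)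
  then have "X1 * (tp U1 * w) = \<mu> *\<^sub>R z" using Sw unfolding X1_def by (metis mult.assoc)
  moreover have "X1 * (tp Y1 * (X1 * (tp U1 * w))) = X1 * (tp U1 * w)"
    using Y1X1 X1_Id(1) by (metis mult.assoc)
  ultimately have "X1 * (tp Y1 * (\<mu> *\<^sub>R z)) = \<mu> *\<^sub>R z" by simp
  then have "\<mu> *\<^sub>R (X1 * (tp Y1 * z)) = \<mu> *\<^sub>R z" by simp
  then show ?thesis using l0 by simp
qed

text \<open>On the imaginary axis the eigenspaces of the reduced matrix are invariant under the squared
  singular values; a common eigenvector would lift to an eigenvector of the full matrix.\<close>

definition IE :: "real \<Rightarrow> fsmat \<Rightarrow> fsmat \<Rightarrow> bool" where
  "IE y X Y \<longleftrightarrow> Id_n r * X = X \<and> Id_n r * Y = Y \<and> ah * X = - (y *\<^sub>R Y) \<and> ah * Y = y *\<^sub>R X"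

lemma add3_eq_0: "(x::fsmat) + (y + z) = 0 \<Longrightarrow> x = - y - z"
proof -
  assume "x + (y + z) = 0"
  then have "x + (y + z) - y - z = - y - z" by simp
  then show ?thesis by simp
qed

lemma inner_self_sq: "inner X (B * tp B * X) = (norm (tp B * X))\<^sup>2"
  by (simp only: power2_norm_eq_inner inner_left_mult tp_simps mult.assoc)

lemma two_squares_zero: "(norm (A :: fsmat))\<^sup>2 + (norm (B :: fsmat))\<^sup>2 = 0 \<Longrightarrow> A = 0 \<and> B = 0"
  by (simp add: sum_power2_eq_zero_iff)

lemma inner_lyapunov_P: "2 * inner X (ah * X) + (norm (tp bh * X))\<^sup>2 = 0"
proof -
  have "inner X ((ah + tp ah + bh * tp bh) * X) = inner X (ah * X) + inner X (tp ah * X) + inner X (bh * tp bh * X)"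
    by (simp only: distrib_right inner_add_right)
  moreover have "inner X (tp ah * X) = inner X (ah * X)" by (metis inner_commute inner_left_mult)
  ultimately show ?thesis unfolding reduced_lyapunov_P inner_self_sq by simp
qed

lemma inner_lyapunov_Q: "2 * inner (D2 * X) (ah * X) + (norm (tp ch * X))\<^sup>2 = 0"
proof -
  have "inner X ((tp ah * D2 + D2 * ah + ch * tp ch) * X) = inner X (tp ah * (D2 * X)) + inner X (D2 * (ah * X)) + inner X (ch * tp ch * X)"
    by (simp only: distrib_right inner_add_right mult.assoc)
  moreover have "inner X (D2 * (ah * X)) = inner (D2 * X) (ah * X)" by (simp only: inner_left_mult tp_Dg)
  moreover have "inner X (tp ah * (D2 * X)) = inner (D2 * X) (ah * X)" by (metis inner_commute inner_left_mult)
  ultimately show ?thesis unfolding reduced_lyapunov_Q inner_self_sq by simp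
qed

lemma IE_zero:
  assumes "IE y X Y" shows "tp bh * X = 0" "tp bh * Y = 0" "tp ch * X = 0" "tp ch * Y = 0" "IE y (D2 * X) (D2 * Y)"
proof -
  have h: "ah * X = - (y *\<^sub>R Y)" "ah * Y = y *\<^sub>R X" using assms by (simp_all add: IE_def)
  have ex: "2 * inner Z (ah * Z) + (norm (tp bh * Z))\<^sup>2 = 0" for Z by (rule inner_lyapunov_P)
  have "(norm (tp bh * X))\<^sup>2 + (norm (tp bh * Y))\<^sup>2 = 0"
    using ex[of X] ex[of Y] unfolding h by (simp add: inner_commute)
  then show b0: "tp bh * X = 0" "tp bh * Y = 0" using two_squares_zero by blast+
  have sym: "inner (D2 * X) Y = inner (D2 * Y) X" using inner_left_mult[of D2 X Y] by (simp add: inner_commute)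
  have "(norm (tp ch * X))\<^sup>2 + (norm (tp ch * Y))\<^sup>2 = 0"
    using inner_lyapunov_Q[of X] inner_lyapunov_Q[of Y] sym unfolding h by simp
  then show c0: "tp ch * X = 0" "tp ch * Y = 0" using two_squares_zero by blast+
  have q: "tp ah * (D2 * Z) = - (D2 * (ah * Z)) - ch * (tp ch * Z)" for Z
  proof -
    have "(tp ah * D2 + D2 * ah + ch * tp ch) * Z = 0" unfolding reduced_lyapunov_Q by simp
    then have "tp ah * (D2 * Z) + (D2 * (ah * Z) + ch * (tp ch * Z)) = 0" by (simp only: distrib_right mult.assoc add.assoc)
    then show ?thesis by (rule add3_eq_0)
  qed
  define W Z where "W = D2 * X" and "Z = D2 * Y"
  have t: "tp ah * W = y *\<^sub>R Z" "tp ah * Z = - (y *\<^sub>R W)"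
    unfolding W_def Z_def q c0 h by simp_all
  have ti: "inner K (ah * K) = inner K (tp ah * K)" for K by (metis inner_commute inner_left_mult)
  have "(norm (tp bh * W))\<^sup>2 + (norm (tp bh * Z))\<^sup>2 = 0"
    using ex[of W] ex[of Z] unfolding ti t by (simp add: inner_commute)
  then have b1: "tp bh * W = 0" "tp bh * Z = 0" using two_squares_zero by blast+
  have p: "ah * K = - (tp ah * K) - bh * (tp bh * K)" for K
  proof -
    have "(ah + tp ah + bh * tp bh) * K = 0" unfolding reduced_lyapunov_P by simp
    then have "ah * K + (tp ah * K + bh * (tp bh * K)) = 0" by (simp only: distrib_right mult.assoc add.assoc)
    then show ?thesis by (rule add3_eq_0)
  qed
  have "ah * W = - (y *\<^sub>R Z)" "ah * Z = y *\<^sub>R W" unfolding p[of W] p[of Z] b1 t by simp_all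
  then show "IE y (D2 * X) (D2 * Y)" unfolding IE_def W_def[symmetric] Z_def[symmetric]
    by (simp add: W_def Z_def mult.assoc[symmetric])
qed

definition rows :: "fsmat \<Rightarrow> fsmat \<Rightarrow> nat set" where "rows X Y = {i. i < r \<and> (\<exists>j. ent X i j \<noteq> 0 \<or> ent Y i j \<noteq> 0)}"

lemma ent_Dg_mult: "ent (Dg r f * X) i j = (if i < r then f i * ent X i j else 0)"
proof -
  have "ent (Dg r f * X) i j = (\<Sum>k<r. ent (Dg r f) i k * ent X k j)"
    by (rule ent_times) (simp add: Dg_def bounded_by_fs)
  also have "\<dots> = (\<Sum>k<r. if k = i then (if i < r then f i * ent X i j else 0) else 0)"
    by (rule sum.cong) auto
  finally show ?thesis by simp
qed

lemma IE_eigenvector: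
  assumes "IE y X Y" "X \<noteq> 0 \<or> Y \<noteq> 0"
  obtains X' Y' \<mu> where "IE y X' Y'" "X' \<noteq> 0 \<or> Y' \<noteq> 0" "D2 * X' = \<mu> *\<^sub>R X'" "D2 * Y' = \<mu> *\<^sub>R Y'" "\<sigma>r\<^sup>2 \<le> \<mu>"
proof -
  define Pr where "Pr p = (IE y (fst p) (snd p) \<and> (fst p \<noteq> 0 \<or> snd p \<noteq> 0))" for p
  have "Pr (X, Y)" using assms by (simp add: Pr_def)
  then obtain p where p: "Pr p" "\<And>q. Pr q \<Longrightarrow> card (rows (fst p) (snd p)) \<le> card (rows (fst q) (snd q))"
    using ex_has_least_nat[of Pr "(X, Y)" "\<lambda>p. card (rows (fst p) (snd p))"] by blast
  obtain X' Y' where XY: "p = (X', Y')" by (cases p)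
  have i: "IE y X' Y'" and nz: "X' \<noteq> 0 \<or> Y' \<noteq> 0" using p(1) by (simp_all add: Pr_def XY)
  have I: "Id_n r * X' = X'" "Id_n r * Y' = Y'" using i by (simp_all add: IE_def)
  obtain i0 j0 where ij: "ent X' i0 j0 \<noteq> 0 \<or> ent Y' i0 j0 \<noteq> 0"
    using nz fsmat_eqI[of X' 0] fsmat_eqI[of Y' 0] by (metis ent_simps(1))
  have "ent (Id_n r * X') i0 j0 \<noteq> 0 \<or> ent (Id_n r * Y') i0 j0 \<noteq> 0" using ij I by simp
  then have i0: "i0 < r" unfolding ent_Id_mult by presburger
  have i0r: "i0 \<in> rows X' Y'" unfolding rows_def using i0 ij by blast
  define \<mu> where "\<mu> = d i0 * d i0"
  define X'' Y'' where "X'' = D2 * X' - \<mu> *\<^sub>R X'" and "Y'' = D2 * Y' - \<mu> *\<^sub>R Y'"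
  have "IE y X'' Y''"
    using i IE_zero(5)[OF i] unfolding IE_def X''_def Y''_def by (simp add: right_diff_distrib scaleR_right_diff_distrib mult.commute)
  moreover have "rows X'' Y'' \<subset> rows X' Y'"
  proof -
    have "ent X'' k l = (d k * d k - \<mu>) * ent X' k l" "ent Y'' k l = (d k * d k - \<mu>) * ent Y' k l" if "k < r" for k l
      using that unfolding X''_def Y''_def by (simp_all add: ent_Dg_mult left_diff_distrib)
    then have "rows X'' Y'' \<subseteq> rows X' Y'" "i0 \<notin> rows X'' Y''" unfolding rows_def \<mu>_def by auto
    then show ?thesis using i0r by blast
  qed
  moreover have "finite (rows X' Y')" unfolding rows_def by simp
  ultimately have "\<not> Pr (X'', Y'')" using p(2)[of "(X'', Y'')"] psubset_card_mono[of "rows X' Y'" "rows X'' Y''"] unfolding XY by auto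
  then have "X'' = 0" "Y'' = 0" using \<open>IE y X'' Y''\<close> by (simp_all add: Pr_def)
  then have "D2 * X' = \<mu> *\<^sub>R X'" "D2 * Y' = \<mu> *\<^sub>R Y'" by (simp_all add: X''_def Y''_def)
  moreover have "\<sigma>r\<^sup>2 \<le> \<mu>" unfolding \<mu>_def power2_eq_square using d[OF i0] \<sigma>r_pos by (intro mult_mono) simp_all
  ultimately show ?thesis using that i nz by blast
qed

lemma IE_lift:
  assumes i: "IE y X Y" and l: "D2 * X = \<mu> *\<^sub>R X" "\<sigma>r\<^sup>2 \<le> \<mu>" and bc: "tp bh * X = 0" "tp ch * X = 0"
  shows "a * (X1 * X) = X1 * (ah * X)"
proof -
  define z where "z = a * (X1 * X)"
  define t where "t = tp a * (Y1 * X)"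
  have "(a * (S * tp S) + S * tp S * tp a + b * tp b) * (Y1 * X) = 0" unfolding P by simp
  moreover have "(a * (S * tp S) + S * tp S * tp a + b * tp b) * (Y1 * X)
      = a * (S * tp S * Y1 * X) + S * tp S * t + b * (tp bh * X)"
    unfolding t_def by (simp add: distrib_right mult.assoc)
  ultimately have 1: "z = - (S * tp S * t)" unfolding PY1 bc z_def by (simp add: eq_neg_iff_add_eq_0)
  have "(tp a * (R * tp R) + R * tp R * a + c * tp c) * (X1 * X) = 0" unfolding Q by simp
  moreover have "(tp a * (R * tp R) + R * tp R * a + c * tp c) * (X1 * X)
      = tp a * (R * tp R * X1 * X) + R * tp R * z + c * (tp ch * X)"
    unfolding z_def by (simp add: distrib_right mult.assoc)
  ultimately have "tp a * (Y1 * D2 * X) + R * tp R * z = 0" unfolding QX1 bc by simp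
  then have "R * tp R * z = - (tp a * (Y1 * (D2 * X)))" by (simp add: eq_neg_iff_add_eq_0 add.commute mult.assoc)
  then have 2: "R * tp R * z = - (\<mu> *\<^sub>R t)" unfolding l t_def by simp
  have "S * tp S * (R * tp R) * z = S * tp S * (R * tp R * z)" by (simp only: mult.assoc)
  also have "\<dots> = \<mu> *\<^sub>R z" unfolding 2 by (subst 1) simp
  finally have "X1 * (tp Y1 * z) = z" by (rule eigenspace_range[OF _ l(2)])
  then show ?thesis unfolding z_def by (simp add: mult.assoc)
qed

theorem reduced_stable:
  assumes st: "stb n a" shows "stb r ah"
  unfolding stb_def
proof (intro allI impI, elim conjE)
  fix x y X Y
  assume h: "Id_n r * X = X" "Id_n r * Y = Y" "X \<noteq> 0 \<or> Y \<noteq> 0" "ah * X = x *\<^sub>R X - y *\<^sub>R Y" "ah * Y = x *\<^sub>R Y + y *\<^sub>R X"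
  have n0: "inner X X + inner Y Y > 0" using h(3) by (metis add_nonneg_pos add_pos_nonneg inner_ge_zero inner_gt_zero_iff)
  have "2 * inner X (ah * X) + 2 * inner Y (ah * Y) \<le> 0"
    using inner_lyapunov_P[of X] inner_lyapunov_P[of Y] zero_le_power2[of "norm (tp bh * X)"] zero_le_power2[of "norm (tp bh * Y)"] by linarith
  then have "2 * (x * (inner X X + inner Y Y)) \<le> 0"
    unfolding h(4,5) by (simp add: inner_diff_right inner_add_right inner_commute algebra_simps del: dot_square_norm)
  then have x0: "x \<le> 0" using n0 by (simp add: mult_le_0_iff del: dot_square_norm)
  show "x < 0"
  proof (rule ccontr)
    assume "\<not> x < 0"
    then have "x = 0" using x0 by simp
    then have "IE y X Y" using h by (simp add: IE_def)
    then obtain X' Y' \<mu> where e: "IE y X' Y'" "X' \<noteq> 0 \<or> Y' \<noteq> 0" "D2 * X' = \<mu> *\<^sub>R X'" "D2 * Y' = \<mu> *\<^sub>R Y'" "\<sigma>r\<^sup>2 \<le> \<mu>"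
      by (rule IE_eigenvector[OF _ h(3)])
    note z = IE_zero[OF e(1)]
    have I: "Id_n r * X' = X'" "Id_n r * Y' = Y'" and ev: "ah * X' = - (y *\<^sub>R Y')" "ah * Y' = y *\<^sub>R X'" using e(1) by (simp_all add: IE_def)
    have e': "IE (- y) Y' X'" using e(1) by (simp add: IE_def)
    have "a * (X1 * X') = 0 *\<^sub>R (X1 * X') - y *\<^sub>R (X1 * Y')"
      unfolding IE_lift[OF e(1,3,5) z(1,3)] ev by simp
    moreover have "a * (X1 * Y') = 0 *\<^sub>R (X1 * Y') + y *\<^sub>R (X1 * X')"
      unfolding IE_lift[OF e'(1) e(4,5) z(2,4)] ev by simp
    moreover have "X1 * X' \<noteq> 0 \<or> X1 * Y' \<noteq> 0"
    proof (rule ccontr)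
      assume "\<not> ?thesis"
      then have "tp Y1 * (X1 * X') = 0" "tp Y1 * (X1 * Y') = 0" by simp_all
      then have "X' = 0" "Y' = 0" unfolding mult.assoc[symmetric] Y1X1 I by simp_all
      then show False using e(2) by simp
    qed
    moreover have "Id_n n * (X1 * X') = X1 * X'" "Id_n n * (X1 * Y') = X1 * Y'" unfolding mult.assoc[symmetric] X1_Id by simp_all
    ultimately have "(0::real) < 0" using stbD[OF st] by blast
    then show False by simp
  qed
qed

end

section \<open>Perturbation of the singular subspaces\<close>

lemma assoc_eq: "X * Y = Z \<Longrightarrow> X * (Y * W) = Z * (W :: fsmat)"
  by (simp add: mult.assoc[symmetric])

lemma Dg_one: "Dg n (\<lambda>i. 1) = Id_n n" by (rule fsmat_eqI) auto

lemma opn_Dg_le: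
  assumes "\<And>i. i < n \<Longrightarrow> \<bar>f i\<bar> \<le> c" "0 \<le> c" shows "opn (Dg n f) \<le> c"
proof (rule opn_leI[OF assms(2)])
  fix X
  have "(norm (Dg n f * X))\<^sup>2 = inner X (Dg n (\<lambda>i. f i * f i) * X)"
    unfolding Dg_mult[symmetric] by (simp only: power2_norm_eq_inner inner_left_mult tp_Dg mult.assoc)
  also have "\<dots> \<le> (\<Sum>i<n. c\<^sup>2 * (1 * (norm (ev i * tp (ev i) * X))\<^sup>2))"
    unfolding inner_Dg
  proof (rule sum_mono)
    fix i assume "i \<in> {..<n}"
    then have "\<bar>f i\<bar>\<^sup>2 \<le> c\<^sup>2" using assms(1) by (intro power_mono) simp_all
    then have "f i * f i \<le> c\<^sup>2" by (simp add: power2_eq_square)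
    then show "f i * f i * (norm (ev i * tp (ev i) * X))\<^sup>2 \<le> c\<^sup>2 * (1 * (norm (ev i * tp (ev i) * X))\<^sup>2)"
      unfolding mult_1 by (rule mult_right_mono) simp
  qed
  also have "\<dots> = c\<^sup>2 * inner X (Id_n n * X)" unfolding Dg_one[symmetric] inner_Dg sum_distrib_left ..
  also have "\<dots> \<le> c\<^sup>2 * (norm X)\<^sup>2"
  proof (rule mult_left_mono)
    have "inner X (Id_n n * X) \<le> norm X * norm (Id_n n * X)" by (rule norm_cauchy_schwarz)
    also have "\<dots> \<le> norm X * norm X" by (intro mult_left_mono norm_Id_mult_le) simp
    finally show "inner X (Id_n n * X) \<le> (norm X)\<^sup>2" by (simp only: power2_eq_square)
  qed simp
  finally have "(norm (Dg n f * X))\<^sup>2 \<le> (c * norm X)\<^sup>2" by (simp only: power_mult_distrib)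
  then show "norm (Dg n f * X) \<le> c * norm X" by (rule power2_le_imp_le) (simp add: assms(2))
qed

lemma norm_add_mult_sq: "(norm (X + tp B * Y))\<^sup>2 = (norm X)\<^sup>2 + 2 * inner (B * X) Y + (norm (tp B * Y))\<^sup>2"
proof -
  have "inner X (tp B * Y) = inner (B * X) Y" by (simp only: inner_left_mult)
  then show ?thesis by (simp only: power2_norm_eq_inner inner_add_left inner_add_right inner_commute[of "tp B * Y" X])
qed

lemma inv_sqrt_bounds:
  assumes C: "tp c = c" "psdq c" "Id_n r * c = c" and T: "c * T = Id_n r" "T * c = Id_n r" "tp T = T" "T * T = Id_n r + tp g * g"
    and g: "opn g \<le> \<gamma>"
  shows "opn c \<le> 1" "opn (Id_n r - c) \<le> \<gamma>\<^sup>2"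
    and "Id_n r * X = X \<Longrightarrow> (norm X)\<^sup>2 \<le> (1 + \<gamma>\<^sup>2) * (norm (c * X))\<^sup>2"
    and "c * (Id_n r + tp g * g) * c = Id_n r" "c * Id_n r = c"
proof -
  show cI: "c * Id_n r = c" using arg_cong[OF C(3), of tp] by (simp only: tp_mult tp_Id C(1))
  have "c * (T * T) * c = (c * T) * (T * c)" by (simp only: mult.assoc)
  then show e: "c * (Id_n r + tp g * g) * c = Id_n r" unfolding T by simp
  have ns: "(norm (c * X))\<^sup>2 + (norm (g * (c * X)))\<^sup>2 = (norm (Id_n r * X))\<^sup>2" for X
  proof -
    have "inner X (Id_n r * X) = inner X (c * (Id_n r * (c * X))) + inner X (c * (tp g * (g * (c * X))))"
      by (subst e[symmetric]) (simp only: distrib_left distrib_right mult.assoc inner_add_right)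
    also have "\<dots> = inner X (c * (c * X)) + inner X (c * (tp g * (g * (c * X))))" using C(3) by (simp only: mult.assoc[symmetric])
    also have "\<dots> = inner (c * X) (c * X) + inner (g * (c * X)) (g * (c * X))"
      by (simp only: inner_left_mult C)
    also have "inner X (Id_n r * X) = inner (Id_n r * X) (Id_n r * X)"
      by (simp only: inner_left_mult tp_Id mult.assoc[symmetric] Id_mult_Id min.idem)
    finally show ?thesis by (simp only: power2_norm_eq_inner)
  qed
  have le: "norm (c * X) \<le> norm X" for X
  proof -
    have "(norm (c * X))\<^sup>2 \<le> (norm (Id_n r * X))\<^sup>2" using ns[of X] zero_le_power2[of "norm (g * (c * X))"] by linarith
    also have "\<dots> \<le> (norm X)\<^sup>2" by (intro power_mono norm_Id_mult_le) simp
    finally show ?thesis by (rule power2_le_imp_le) simp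
  qed
  show c1: "opn c \<le> 1" by (rule opn_leI) (use le in simp_all)
  have \<gamma>: "0 \<le> \<gamma>" using g opn_ge_0[of g] by linarith
  show "(norm X)\<^sup>2 \<le> (1 + \<gamma>\<^sup>2) * (norm (c * X))\<^sup>2" if "Id_n r * X = X" for X
  proof -
    have "norm (g * (c * X)) \<le> opn g * norm (c * X)" by (rule norm_mult_opn)
    also have "\<dots> \<le> \<gamma> * norm (c * X)" using g by (rule mult_right_mono) simp
    finally have "(norm (g * (c * X)))\<^sup>2 \<le> (\<gamma> * norm (c * X))\<^sup>2" by (rule power_mono) simp
    then show ?thesis using ns[of X] unfolding that by (simp add: power_mult_distrib distrib_right)
  qed
  show "opn (Id_n r - c) \<le> \<gamma>\<^sup>2"
  proof (rule opn_leI)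
    fix X
    define y where "y = (Id_n r - c) * X"
    have Iy: "Id_n r * y = y" unfolding y_def by (simp add: mult.assoc[symmetric] right_diff_distrib C)
    have "(norm y)\<^sup>2 \<le> (norm (y + tp c * y))\<^sup>2"
    proof -
      have "0 \<le> inner (c * y) y" using C(2) unfolding psdq_def by (simp add: inner_commute)
      then show ?thesis unfolding norm_add_mult_sq using zero_le_power2[of "norm (tp c * y)"] by linarith
    qed
    then have "norm y \<le> norm (y + c * y)" unfolding C by (rule power2_le_imp_le) simp
    also have "y + c * y = (Id_n r + c) * y" using Iy by (simp add: distrib_right)
    also have "\<dots> = (Id_n r - c * c) * X"
      unfolding y_def mult.assoc[symmetric] by (simp add: algebra_simps C(3) cI)
    also have "Id_n r - c * c = c * tp g * (g * c)"
    proof -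
      have "c * (Id_n r + tp g * g) * c = c * Id_n r * c + c * tp g * (g * c)" by (simp only: distrib_left distrib_right mult.assoc)
      then show ?thesis unfolding e cI by simp
    qed
    also have "norm (c * tp g * (g * c) * X) \<le> (1 * \<gamma>) * (\<gamma> * 1) * norm X"
    proof -
      have "opn (c * tp g * (g * c)) \<le> (1 * \<gamma>) * (\<gamma> * 1)" by (intro opn_mult_le) (simp_all add: c1 g)
      then show ?thesis using norm_mult_opn[of "c * tp g * (g * c)" X] by (meson mult_right_mono norm_ge_zero order_trans)
    qed
    finally show "norm ((Id_n r - c) * X) \<le> \<gamma>\<^sup>2 * norm X" unfolding y_def by (simp add: power2_eq_square)
  qed simp
qed

lemma opn_left_inverse_le:
  assumes "\<And>X. c * norm (B * X) \<le> norm X" "0 < c" shows "opn B \<le> 1 / c"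
  by (rule opn_leI) (use assms in \<open>simp_all add: field_simps\<close>)

lemma opn_sq_leI: assumes "0 \<le> c" "\<And>X. (norm (A * X))\<^sup>2 \<le> c * (norm X)\<^sup>2" shows "opn A \<le> sqrt c"
proof (rule opn_leI)
  fix X
  have "norm (A * X) \<le> sqrt (c * (norm X)\<^sup>2)" using assms(2) by (rule real_le_rsqrt)
  then show "norm (A * X) \<le> sqrt c * norm X" by (simp add: real_sqrt_mult)
qed (use assms in simp)

context balanced begin

lemma opn_J: "opn J \<le> 1 / \<sigma>r"
  unfolding J_def
proof (rule opn_Dg_le)
  fix i assume "i < r"
  then have "\<sigma>r \<le> d i" by (rule d)
  then show "\<bar>1 / d i\<bar> \<le> 1 / \<sigma>r" using \<sigma>r_pos by (simp add: frac_le)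
qed (use \<sigma>r_pos in simp)

lemma norm_Dg_mult_ge: assumes "Id_n r * X = X" shows "\<sigma>r * norm X \<le> norm (Dg r d * X)"
proof -
  have "X = J * (Dg r d * X)" using assms Dg_J(2) by (metis mult.assoc)
  then have "norm X \<le> opn J * norm (Dg r d * X)" using norm_mult_opn[of J "Dg r d * X"] by simp
  also have "\<dots> \<le> 1 / \<sigma>r * norm (Dg r d * X)" by (intro mult_right_mono opn_J) simp
  finally show ?thesis using \<sigma>r_pos by (simp add: field_simps)
qed

lemma opn_mult_Dg_ge: assumes "X * Id_n r = X" shows "\<sigma>r * opn X \<le> opn (X * Dg r d)"
proof -
  have "X = X * Dg r d * J" using assms Dg_J(1) by (metis mult.assoc)
  then have "opn X \<le> opn (X * Dg r d) * (1 / \<sigma>r)" using opn_mult[of "X * Dg r d" J] opn_J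
    by (metis mult_left_mono opn_ge_0 order_trans)
  then show ?thesis using \<sigma>r_pos by (simp add: field_simps)
qed

lemma Dg_eq: "Dg r d = tp U1 * (tp S * R) * V1"
proof -
  have "tp U1 * (tp S * R) * V1 = tp U1 * (tp S * R * V1)" by (simp only: mult.assoc)
  then show ?thesis unfolding GV mult.assoc[symmetric] U by simp
qed

lemma opn_Dg_mult_le: "opn (tp U1 * (tp S * R) * V1) \<le> opn S * opn R"
proof -
  have "opn (tp U1 * (tp S * R) * V1) \<le> 1 * (opn S * opn R) * 1" by (intro opn_mult_le) (simp_all add: opn_UV)
  then show ?thesis by simp
qed

lemma \<sigma>r_le: assumes "0 < r" shows "\<sigma>r \<le> opn S * opn R"
proof -
  have "\<sigma>r * norm (Id_n r) \<le> norm (Dg r d * Id_n r)" by (rule norm_Dg_mult_ge) simp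
  also have "\<dots> \<le> opn (Dg r d) * norm (Id_n r)" by (rule norm_mult_opn)
  also have "\<dots> \<le> opn S * opn R * norm (Id_n r)"
    using opn_Dg_mult_le unfolding Dg_eq by (rule mult_right_mono) simp
  finally show ?thesis using assms by (simp add: norm_Id)
qed

lemma U_complement_norm: "(norm (tp U1 * X))\<^sup>2 + (norm (tp U2 * X))\<^sup>2 \<le> (norm X)\<^sup>2"
proof -
  have "(norm (tp U1 * X))\<^sup>2 + (norm (tp U2 * X))\<^sup>2 = inner X ((U1 * tp U1 + U2 * tp U2) * X)"
    by (simp only: power2_norm_eq_inner inner_left_mult tp_simps distrib_right mult.assoc inner_add_right)
  also have "\<dots> \<le> norm X * norm (Id_n m1 * X)" unfolding U by (rule norm_cauchy_schwarz)
  also have "\<dots> \<le> norm X * norm X" by (intro mult_left_mono norm_Id_mult_le) simp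
  finally show ?thesis by (simp only: power2_eq_square)
qed

end

locale perturbed = balanced +
  fixes NS NR Gm Hm Cu Cv Tu Tv Sc1 :: fsmat and eps e1 e2 \<gamma> :: real
  assumes r_pos: "0 < r"
    and NS: "tp NS = NS" "NS * NS = NS" "Id_n m1 * NS = NS" and NR: "tp NR = NR" "NR * NR = NR" "Id_n m2 * NR = NR"
    and e: "opn (S * NS) \<le> e1" "opn (R * NR) \<le> e2" "e1 * opn R \<le> eps" "e2 * opn S \<le> eps"
    and eps4: "4 * eps < \<sigma>r - s2"
    and \<gamma>: "opn Gm \<le> \<gamma>" "opn Hm \<le> \<gamma>" "\<gamma> < 1"
    and Gm: "tp U2 * (U2 * Gm) = Gm" "Gm * Id_n r = Gm" and Hm: "tp V2 * (V2 * Hm) = Hm" "Hm * Id_n r = Hm"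
    and Sig: "tp U2 * (U2 * Sig2) = Sig2" "tp V2 * (V2 * tp Sig2) = tp Sig2"
    and Cu: "tp Cu = Cu" "psdq Cu" "Id_n r * Cu = Cu" "Cu * Tu = Id_n r" "Tu * Cu = Id_n r" "tp Tu = Tu" "Tu * Tu = Id_n r + tp Gm * Gm"
    and Cv: "tp Cv = Cv" "psdq Cv" "Id_n r * Cv = Cv" "Cv * Tv = Id_n r" "Tv * Cv = Id_n r" "tp Tv = Tv" "Tv * Tv = Id_n r + tp Hm * Hm"
    and Sc1: "Id_n r * Sc1 = Sc1" "Sc1 * Id_n r = Sc1"
    and dec: "(Id_n m1 - NS) * (tp S * R) * (Id_n m2 - NR) * ((V1 - V2 * Hm) * Cv) = (U1 - U2 * Gm) * Cu * Sc1"
    and dec': "(Id_n m2 - NR) * (tp R * S) * (Id_n m1 - NS) * ((U1 - U2 * Gm) * Cu) = (V1 - V2 * Hm) * Cv * tp Sc1"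
begin

abbreviation "Ub \<equiv> U1 - U2 * Gm"
abbreviation "Vb \<equiv> V1 - V2 * Hm"
abbreviation "Uc \<equiv> Ub * Cu"
abbreviation "Vc \<equiv> Vb * Cv"
abbreviation "Gt \<equiv> (Id_n m1 - NS) * (tp S * R) * (Id_n m2 - NR)"

text \<open>Exchanging the two Gramians halves the number of estimates; hence the sign convention
  \<open>Hm = - Omega\<close>.\<close>

lemma swap: "perturbed n r m2 m1 (tp a) c b R S V1 V2 U1 U2 (tp Sig2) d \<sigma>r s2 NR NS Hm Gm Cv Cu Tv Tu (tp Sc1) eps e2 e1 \<gamma>"
proof unfold_locales
  show "tp a * (R * tp R) + R * tp R * tp (tp a) + c * tp c = 0" using Q by simp
  show "tp (tp a) * (S * tp S) + S * tp S * tp a + b * tp b = 0" using P by simp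
  show "Id_n r * tp Sc1 = tp Sc1" using arg_cong[OF Sc1(2), of tp] by (simp only: tp_mult tp_Id)
  show "tp Sc1 * Id_n r = tp Sc1" using arg_cong[OF Sc1(1), of tp] by (simp only: tp_mult tp_Id)
  show "tp R * S * U2 = V2 * tp Sig2" "tp S * R * V2 = U2 * tp (tp Sig2)" using GU GV by simp_all
  show "tp U2 * (U2 * tp (tp Sig2)) = tp (tp Sig2)" using Sig by simp
  show "(Id_n m1 - NS) * (tp S * R) * (Id_n m2 - NR) * ((V1 - V2 * Hm) * Cv) = (U1 - U2 * Gm) * Cu * tp (tp Sc1)"
    using dec by simp
  show "opn (tp Sig2) \<le> s2" using s2 by simp
qed (rule S R U V opn_UV GV GU s2 r_pos NS NR e eps4 \<gamma> Gm Hm Sig Cu Cv dec dec' | erule d)+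

definition "mu = eps / (\<sigma>r - s2)"
definition "aa = eps / \<sigma>r"

lemma e_pos: "0 \<le> e1" "0 \<le> e2" "0 \<le> eps" "0 \<le> \<gamma>"
proof -
  show 1: "0 \<le> e1" "0 \<le> e2" using e opn_ge_0[of "S * NS"] opn_ge_0[of "R * NR"] by linarith+
  have "0 \<le> e1 * opn R" using 1 by simp
  then show "0 \<le> eps" using e(3) by linarith
  show "0 \<le> \<gamma>" using \<gamma>(1) opn_ge_0[of Gm] by linarith
qed

lemma mu: "0 \<le> mu" "mu < 1 / 4" "0 \<le> aa" "aa \<le> mu" and mu_eq: "mu * (\<sigma>r - s2) = eps" "aa * \<sigma>r = eps"
  using e_pos eps4 s2 \<sigma>r_pos unfolding mu_def aa_def by (simp_all add: field_simps frac_le)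

lemma e1_le: "e1 \<le> aa * opn S"
proof -
  have "e1 * \<sigma>r \<le> e1 * (opn S * opn R)" using \<sigma>r_le[OF r_pos] e_pos by (intro mult_left_mono)
  also have "\<dots> = (e1 * opn R) * opn S" by simp
  also have "\<dots> \<le> eps * opn S" using e by (intro mult_right_mono) simp_all
  finally show ?thesis using \<sigma>r_pos unfolding aa_def by (simp add: field_simps)
qed

lemmas Cu_bounds = inv_sqrt_bounds[OF Cu \<gamma>(1)] and Cv_bounds = inv_sqrt_bounds[OF Cv \<gamma>(2)]

lemma NS_mult: "NS * Id_n m1 = NS" "(Id_n m1 - NS) * NS = 0" "NS * (Id_n m1 - NS) = 0"
proof -
  show "NS * Id_n m1 = NS" using arg_cong[OF NS(3), of tp] by (simp only: tp_mult tp_Id NS(1))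
  then show "(Id_n m1 - NS) * NS = 0" "NS * (Id_n m1 - NS) = 0" by (simp_all add: left_diff_distrib right_diff_distrib NS)
qed

lemma tp_Ub_Ub: "tp Ub * Ub = Id_n r + tp Gm * Gm"
  by (simp add: left_diff_distrib right_diff_distrib mult.assoc U U(1-4)[THEN assoc_eq] Gm)

lemma Uc_isometry: "tp Uc * Uc = Id_n r" "Uc * Id_n r = Uc"
proof -
  have "tp Uc * Uc = Cu * (tp Ub * Ub) * Cu" by (simp only: tp_mult Cu mult.assoc)
  then show "tp Uc * Uc = Id_n r" unfolding tp_Ub_Ub Cu_bounds .
  show "Uc * Id_n r = Uc" by (simp only: mult.assoc Cu_bounds)
qed

lemma opn_Uc: "opn Uc \<le> 1" by (rule opn_isometry_le[OF Uc_isometry])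

lemma tpU1_Uc: "tp U1 * Uc = Cu"
  by (simp add: left_diff_distrib right_diff_distrib mult.assoc U U(1-4)[THEN assoc_eq] Cu)

lemma opn_NS: "opn NS \<le> 1"
proof -
  have "opn (NS * tp NS) = (opn NS)\<^sup>2" by (rule opn_mult_tp)
  then have "opn NS * (opn NS - 1) = 0" by (simp add: NS power2_eq_square right_diff_distrib)
  then show ?thesis by auto
qed

lemma opn_NSG: "opn (NS * (tp S * R)) \<le> eps"
proof -
  have "opn (NS * (tp S * R)) = opn (tp (S * NS) * R)" by (simp add: NS mult.assoc)
  also have "\<dots> \<le> e1 * opn R" by (rule opn_mult_le) (simp_all only: opn_tp e order_refl)
  finally show ?thesis using e by linarith
qed

lemmas opn_Vc = perturbed.opn_Uc[OF swap]
lemmas tpV1_Vc = perturbed.tpU1_Uc[OF swap]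
lemmas opn_NRG = perturbed.opn_NSG[OF swap]
lemma opn_GNR: "opn (tp S * R * NR) \<le> eps"
proof -
  have "opn (tp S * R * NR) = opn (tp (NR * (tp R * S)))" by (simp add: NR mult.assoc)
  then show ?thesis using opn_NRG by (simp only: opn_tp)
qed

lemma opn_G_diff: "opn (tp S * R - Gt) \<le> 2 * eps"
proof -
  have t: "Id_n m1 * (tp S * R) = tp S * R" "tp S * R * Id_n m2 = tp S * R"
    using arg_cong[OF S(2), of tp] R(2) by (simp_all add: mult.assoc[symmetric]) (simp add: mult.assoc)
  have "Gt = Id_n m1 * (tp S * R) * Id_n m2 - NS * (tp S * R) * Id_n m2 - (Id_n m1 - NS) * (tp S * R * NR)"
    by (simp add: left_diff_distrib right_diff_distrib mult.assoc)
  then have "tp S * R - Gt = NS * (tp S * R) + (Id_n m1 - NS) * (tp S * R * NR)"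
    unfolding t by (simp add: mult.assoc t[unfolded mult.assoc])
  moreover have "opn (Id_n m1 - NS) \<le> 1"
  proof -
    have "opn ((Id_n m1 - NS) * tp (Id_n m1 - NS)) = (opn (Id_n m1 - NS))\<^sup>2" by (rule opn_mult_tp)
    then have "opn (Id_n m1 - NS) * (opn (Id_n m1 - NS) - 1) = 0"
      by (simp add: NS NS_mult power2_eq_square right_diff_distrib left_diff_distrib)
    then show ?thesis by auto
  qed
  then have "opn ((Id_n m1 - NS) * (tp S * R * NR)) \<le> 1 * eps" using opn_GNR by (intro opn_mult_le)
  ultimately show ?thesis using opn_add_le[OF opn_NSG, of "(Id_n m1 - NS) * (tp S * R * NR)" eps] by simp
qed

lemma tpU1_G: "tp U1 * (tp S * R) = Dg r d * tp V1"
  using arg_cong[OF GU(1), of tp] by (simp add: mult.assoc)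

lemma Sc1_inj:
  assumes X: "Id_n r * X = X" and z: "Sc1 * X = 0" shows "X = 0"
proof (rule ccontr)
  assume "X \<noteq> 0"
  have "Gt * (Vc * X) = 0" using arg_cong[OF dec, of "\<lambda>Y. Y * X"] z by (simp add: mult.assoc)
  then have "tp U1 * ((tp S * R - Gt) * (Vc * X)) = tp U1 * (tp S * R) * (Vc * X)" by (simp add: left_diff_distrib mult.assoc)
  also have "\<dots> = Dg r d * (tp V1 * Vc) * X" unfolding tpU1_G by (simp only: mult.assoc)
  also have "\<dots> = Dg r d * (Cv * X)" unfolding tpV1_Vc by (simp only: mult.assoc)
  finally have eq: "Dg r d * (Cv * X) = tp U1 * ((tp S * R - Gt) * (Vc * X))" ..
  have "\<sigma>r * norm (Cv * X) \<le> norm (Dg r d * (Cv * X))" by (rule norm_Dg_mult_ge) (simp only: mult.assoc[symmetric] Cv)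
  also have "\<dots> \<le> opn (tp U1 * (tp S * R - Gt) * Vc) * norm X"
    unfolding eq using norm_mult_opn[of "tp U1 * (tp S * R - Gt) * Vc" X] by (simp only: mult.assoc)
  also have "\<dots> \<le> (1 * (2 * eps) * 1) * norm X"
    by (intro mult_right_mono opn_mult_le opn_G_diff opn_Vc) (simp_all add: opn_UV)
  finally have 1: "\<sigma>r * norm (Cv * X) \<le> 2 * eps * norm X" by simp
  have "(norm X)\<^sup>2 \<le> (1 + \<gamma>\<^sup>2) * (norm (Cv * X))\<^sup>2" by (rule Cv_bounds(3)[OF X])
  also have "\<dots> \<le> 2\<^sup>2 * (norm (Cv * X))\<^sup>2"
  proof -
    have "\<gamma>\<^sup>2 \<le> 1\<^sup>2" using \<gamma> e_pos by (intro power_mono) simp_all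
    then show ?thesis by (intro mult_right_mono) simp_all
  qed
  finally have "(norm X)\<^sup>2 \<le> (2 * norm (Cv * X))\<^sup>2" by (simp only: power_mult_distrib)
  then have "norm X \<le> 2 * norm (Cv * X)" by (rule power2_le_imp_le) simp
  then have "\<sigma>r * norm X \<le> 4 * eps * norm X" using 1 \<sigma>r_pos mult_left_mono[of "norm X" "2 * norm (Cv * X)" \<sigma>r] by linarith
  then have "\<sigma>r \<le> 4 * eps" using \<open>X \<noteq> 0\<close> by simp
  then show False using eps4 s2 by linarith
qed

end

locale perturbed_inv = perturbed +
  fixes Ji :: fsmat
  assumes Ji: "Sc1 * Ji = Id_n r" "Ji * Sc1 = Id_n r" "Id_n r * Ji = Ji" and \<gamma>_max: "\<gamma> = max (opn Gm) (opn Hm)"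
begin

lemma swap_inv: "perturbed_inv n r m2 m1 (tp a) c b R S V1 V2 U1 U2 (tp Sig2) d \<sigma>r s2 NR NS Hm Gm Cv Cu Tv Tu (tp Sc1) eps e2 e1 \<gamma> (tp Ji)"
proof (rule perturbed_inv.intro[OF swap], unfold_locales)
  show "tp Sc1 * tp Ji = Id_n r" using arg_cong[OF Ji(2), of tp] by (simp only: tp_mult tp_Id)
  show "tp Ji * tp Sc1 = Id_n r" using arg_cong[OF Ji(1), of tp] by (simp only: tp_mult tp_Id)
  have "Ji * Id_n r = Ji * Sc1 * Ji" unfolding Ji(1)[symmetric] by (simp only: mult.assoc)
  then have "Ji * Id_n r = Ji" unfolding Ji(2,3) .
  then show "Id_n r * tp Ji = tp Ji" using arg_cong[of _ _ tp] by (metis tp_mult tp_Id)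
  show "\<gamma> = max (opn Hm) (opn Gm)" unfolding \<gamma>_max by (rule max.commute)
qed

abbreviation "Ub2 \<equiv> U2 + U1 * tp Gm"
abbreviation "\<kappa> \<equiv> sqrt (1 + \<gamma>\<^sup>2)"
abbreviation "G \<equiv> tp S * R"

lemma NS_Uc: "NS * Uc = 0"
proof -
  have "NS * (Uc * Sc1) = NS * (Id_n m1 - NS) * G * (Id_n m2 - NR) * Vc" unfolding dec[symmetric] by (simp only: mult.assoc)
  then have "NS * (Uc * Sc1) * Ji = 0" unfolding NS_mult by simp
  moreover have "NS * (Uc * Sc1) * Ji = NS * (Uc * (Sc1 * Ji))" by (simp only: mult.assoc)
  ultimately show ?thesis unfolding Ji Uc_isometry by simp
qed

lemma NS_Ub: "NS * Ub = 0"
proof -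
  have "NS * Uc * Tu = NS * (Ub * (Cu * Tu))" by (simp only: mult.assoc)
  moreover have "Ub * Id_n r = Ub" by (simp add: left_diff_distrib mult.assoc U Gm)
  ultimately show ?thesis unfolding NS_Uc Cu by simp
qed

lemmas NR_Vc = perturbed_inv.NS_Uc[OF swap_inv] and NR_Vb = perturbed_inv.NS_Ub[OF swap_inv]

lemma G_Id: "Id_n m1 * G = G" "G * Id_n m2 = G"
proof -
  have "Id_n m1 * tp S = tp S" using arg_cong[OF S(2), of tp] by (simp only: tp_mult tp_Id)
  then show "Id_n m1 * G = G" by (simp only: mult.assoc[symmetric])
  show "G * Id_n m2 = G" by (simp only: mult.assoc R)
qed

lemma Gt_mult: "NR * X = 0 \<Longrightarrow> Gt * X = (Id_n m1 - NS) * (G * X)"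
proof -
  assume X: "NR * X = 0"
  have "Gt * X = (Id_n m1 - NS) * (G * Id_n m2 * X) - (Id_n m1 - NS) * (G * (NR * X))"
    by (simp only: right_diff_distrib left_diff_distrib mult.assoc)
  then show ?thesis unfolding G_Id X by simp
qed

text \<open>The residual carries the factor \<open>NS\<close> twice, since \<open>NS * Ub = 0\<close>; this makes the
  perturbations of the truncation matrices quadratic in \<open>mu\<close>.\<close>

lemma decoupling: "Gm * Dg r d - Sig2 * Hm = tp Ub2 * NS * (NS * G) * Vb"
proof -
  have UU: "tp Ub2 * Ub = 0"
    by (simp add: right_diff_distrib distrib_right distrib_left mult.assoc U U(1-4)[THEN assoc_eq] Gm)
  have "Gt * Vb = (Id_n m1 - NS) * (G * Vb)" by (rule Gt_mult[OF NR_Vb])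
  moreover have "Gt * Vb = Ub * (Cu * Sc1 * Tv)"
  proof -
    have "Vb * Id_n r = Vb" by (simp add: left_diff_distrib mult.assoc V Hm)
    then have "Gt * Vb = Gt * Vb * (Cv * Tv)" unfolding Cv by (simp only: mult.assoc)
    also have "\<dots> = Gt * Vc * Tv" by (simp only: mult.assoc)
    finally show ?thesis unfolding dec by (simp only: mult.assoc)
  qed
  ultimately have "tp Ub2 * ((Id_n m1 - NS) * (G * Vb)) = tp Ub2 * Ub * (Cu * Sc1 * Tv)" by (simp only: mult.assoc)
  then have 0: "tp Ub2 * ((Id_n m1 - NS) * (G * Vb)) = 0" unfolding UU by simp
  have "tp Ub2 * NS * (NS * G) * Vb = tp Ub2 * (NS * NS * (G * Vb))" by (simp only: mult.assoc)
  also have "\<dots> = tp Ub2 * (Id_n m1 * G * Vb) - tp Ub2 * ((Id_n m1 - NS) * (G * Vb))"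
    unfolding NS by (simp add: left_diff_distrib right_diff_distrib mult.assoc)
  also have "\<dots> = tp Ub2 * (G * Vb)" unfolding 0 G_Id by simp
  also have "G * Vb = U1 * Dg r d - U2 * Sig2 * Hm"
    using GV by (simp add: right_diff_distrib mult.assoc[symmetric])
  also have "tp Ub2 * (U1 * Dg r d - U2 * Sig2 * Hm) = Gm * Dg r d - Sig2 * Hm"
  proof -
    have "tp U2 * (U2 * (Sig2 * Hm)) = Sig2 * Hm" using Sig(1) by (metis mult.assoc)
    then show ?thesis by (simp add: right_diff_distrib distrib_right mult.assoc U U(1-4)[THEN assoc_eq] Gm)
  qed
  finally show ?thesis ..
qed

lemma opn_Ub: "opn Ub \<le> \<kappa>"
proof (rule opn_sq_leI)
  fix X
  have "(norm (Ub * X))\<^sup>2 = inner X (tp Ub * Ub * X)" by (simp only: power2_norm_eq_inner inner_left_mult mult.assoc)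
  also have "\<dots> = inner X (Id_n r * X) + (norm (Gm * X))\<^sup>2"
    unfolding tp_Ub_Ub by (simp only: distrib_right inner_add_right power2_norm_eq_inner inner_left_mult mult.assoc)
  also have "\<dots> \<le> norm X * norm X + (\<gamma> * norm X)\<^sup>2"
  proof (rule add_mono)
    have "inner X (Id_n r * X) \<le> norm X * norm (Id_n r * X)" by (rule norm_cauchy_schwarz)
    also have "\<dots> \<le> norm X * norm X" by (intro mult_left_mono norm_Id_mult_le) simp
    finally show "inner X (Id_n r * X) \<le> norm X * norm X" .
    have "norm (Gm * X) \<le> opn Gm * norm X" by (rule norm_mult_opn)
    also have "\<dots> \<le> \<gamma> * norm X" using \<gamma> by (intro mult_right_mono) simp_all
    finally show "(norm (Gm * X))\<^sup>2 \<le> (\<gamma> * norm X)\<^sup>2" by (rule power_mono) simp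
  qed
  finally show "(norm (Ub * X))\<^sup>2 \<le> (1 + \<gamma>\<^sup>2) * (norm X)\<^sup>2" by (simp add: power2_eq_square algebra_simps)
qed simp

lemma opn_Ub2: "opn Ub2 \<le> \<kappa>"
proof -
  have "opn (tp Ub2) \<le> \<kappa>"
  proof (rule opn_sq_leI)
    fix X
    define p q where "p = norm (tp U2 * X)" and "q = norm (tp U1 * X)"
    have "norm (Gm * (tp U1 * X)) \<le> opn Gm * q" unfolding q_def by (rule norm_mult_opn)
    also have "\<dots> \<le> \<gamma> * q" using \<gamma> by (intro mult_right_mono) (simp_all add: q_def)
    finally have "norm (tp Ub2 * X) \<le> p + \<gamma> * q"
      unfolding p_def using norm_triangle_ineq[of "tp U2 * X" "Gm * (tp U1 * X)"] by (simp add: distrib_right mult.assoc)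
    then have "(norm (tp Ub2 * X))\<^sup>2 \<le> (p + \<gamma> * q)\<^sup>2" by (rule power_mono) simp
    also have "\<dots> \<le> (1 + \<gamma>\<^sup>2) * (q\<^sup>2 + p\<^sup>2)"
      using zero_le_power2[of "\<gamma> * p - q"] by (simp add: power2_eq_square algebra_simps)
    also have "\<dots> \<le> (1 + \<gamma>\<^sup>2) * (norm X)\<^sup>2" unfolding p_def q_def by (intro mult_left_mono U_complement_norm) simp
    finally show "(norm (tp Ub2 * X))\<^sup>2 \<le> (1 + \<gamma>\<^sup>2) * (norm X)\<^sup>2" .
  qed simp
  then show ?thesis by (simp only: opn_tp)
qed

lemmas opn_Vb = perturbed_inv.opn_Ub[OF swap_inv]

lemma opn_tp_Ub2: "opn (tp Ub2) \<le> \<kappa>" unfolding opn_tp by (rule opn_Ub2)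

lemma opn_Gm_le: "opn Gm * \<sigma>r \<le> s2 * opn Hm + (1 + \<gamma>\<^sup>2) * eps"
proof -
  have "\<sigma>r * opn Gm \<le> opn (Gm * Dg r d)" by (rule opn_mult_Dg_ge) (rule Gm)
  also have "Gm * Dg r d = Sig2 * Hm + tp Ub2 * NS * (NS * G) * Vb" unfolding decoupling[symmetric] by simp
  also have "opn \<dots> \<le> s2 * opn Hm + \<kappa> * 1 * eps * \<kappa>"
    by (intro opn_add_le opn_mult_le s2 opn_tp_Ub2 opn_NS opn_NSG opn_Vb order_refl)
  also have "\<kappa> * 1 * eps * \<kappa> = (\<kappa> * \<kappa>) * eps" by (simp only: mult_ac mult_1_right)
  also have "\<kappa> * \<kappa> = 1 + \<gamma>\<^sup>2" by simp
  finally show ?thesis by (simp add: mult.commute)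
qed

lemma opn_tpU1_NS: "opn (tp U1 * NS) \<le> aa"
proof -
  have "tp U1 * NS = J * tp V1 * (tp R * S * NS)"
  proof -
    have "J * (tp V1 * (tp R * S)) = J * (Dg r d * tp U1)" using arg_cong[OF GV(1), of tp] by (simp add: mult.assoc)
    also have "\<dots> = tp U1" unfolding mult.assoc[symmetric] Dg_J tU ..
    finally have "J * (tp V1 * (tp R * S)) * NS = tp U1 * NS" by simp
    then show ?thesis by (simp only: mult.assoc)
  qed
  also have "opn \<dots> \<le> 1 / \<sigma>r * 1 * eps"
    by (intro opn_mult_le opn_J perturbed.opn_GNR[OF swap]) (simp add: opn_UV)
  finally show ?thesis by (simp add: aa_def)
qed

lemma opn_q_le:
  "opn (tp R * S * U2 * Gm) * \<sigma>r \<le> s2 * opn (G * V2 * Hm) + (eps + opn (tp R * S * U2 * Gm) * aa) * (eps * \<kappa>)"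
proof -
  define q where "q = tp R * S * U2 * Gm"
  have "\<sigma>r * opn q \<le> opn (q * Dg r d)" unfolding q_def by (rule opn_mult_Dg_ge) (simp add: mult.assoc Gm)
  also have "q * Dg r d = tp R * S * U2 * (Sig2 * Hm + tp Ub2 * NS * (NS * G) * Vb)"
    unfolding decoupling[symmetric] q_def by (simp add: mult.assoc)
  also have "\<dots> = V2 * tp Sig2 * (Sig2 * Hm) + (V2 * tp V2 * (tp R * S * NS) + q * (tp U1 * NS)) * ((NS * G) * Vb)"
  proof -
    have "tp R * S * U2 * tp U2 = V2 * (tp Sig2 * tp U2)" unfolding GU by (simp only: mult.assoc)
    also have "tp Sig2 * tp U2 = tp V2 * (tp R * S)" using arg_cong[OF GV(2), of tp] by (simp add: mult.assoc)
    finally have "tp R * S * U2 * tp Ub2 = V2 * (tp V2 * (tp R * S)) + q * tp U1"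
      unfolding q_def by (simp add: distrib_left mult.assoc)
    then have "tp R * S * U2 * tp Ub2 * (NS * (NS * G) * Vb) = (V2 * (tp V2 * (tp R * S)) + q * tp U1) * (NS * (NS * G) * Vb)" by simp
    then show ?thesis unfolding GU[symmetric] by (simp only: distrib_left distrib_right mult.assoc)
  qed
  also have "opn \<dots> \<le> 1 * s2 * opn (G * V2 * Hm) + (1 * 1 * eps + opn q * aa) * (eps * \<kappa>)"
  proof -
    have "Sig2 * Hm = tp U2 * (U2 * Sig2 * Hm)" using Sig(1) by (metis mult.assoc)
    then have "opn (Sig2 * Hm) \<le> opn (tp U2) * opn (U2 * Sig2 * Hm)" using opn_mult by metis
    also have "\<dots> \<le> 1 * opn (U2 * Sig2 * Hm)" by (intro mult_right_mono) (simp_all add: opn_UV)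
    finally have "opn (Sig2 * Hm) \<le> opn (G * V2 * Hm)" unfolding GV by simp
    then show ?thesis
      by (intro opn_add_le opn_mult_le opn_tpU1_NS opn_NSG opn_Vb order_refl perturbed.opn_GNR[OF swap])
        (simp_all only: opn_UV opn_tp s2)
  qed
  finally show ?thesis unfolding q_def by (simp add: mult.commute)
qed

lemma opn_g_le: "opn (S * U2 * Gm) * \<sigma>r \<le> opn S * opn (G * V2 * Hm) + (e1 + opn S * \<kappa> * aa) * (eps * \<kappa>)"
proof -
  have "\<sigma>r * opn (S * U2 * Gm) \<le> opn (S * U2 * Gm * Dg r d)" by (rule opn_mult_Dg_ge) (simp add: mult.assoc Gm)
  also have "S * U2 * Gm * Dg r d = S * U2 * (Sig2 * Hm + tp Ub2 * NS * (NS * G) * Vb)"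
    unfolding decoupling[symmetric] by (simp add: mult.assoc)
  also have "\<dots> = S * (G * V2 * Hm) + (S * NS - S * Ub * (tp U1 * NS)) * (NS * G * Vb)"
  proof -
    have "U2 * tp Ub2 = Id_n m1 - Ub * tp U1"
    proof -
      have "U2 * tp U2 = Id_n m1 - U1 * tp U1" unfolding U(5)[symmetric] by simp
      then show ?thesis by (simp add: distrib_left left_diff_distrib mult.assoc)
    qed
    then have "S * (U2 * tp Ub2) * (NS * (NS * G) * Vb) = S * (Id_n m1 - Ub * tp U1) * (NS * (NS * G) * Vb)" by simp
    also have "\<dots> = (S * Id_n m1 * NS - S * Ub * (tp U1 * NS)) * (NS * G * Vb)"
      by (simp only: left_diff_distrib right_diff_distrib mult.assoc)
    finally show ?thesis unfolding S GV by (simp only: distrib_left mult.assoc)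
  qed
  also have "opn \<dots> \<le> opn S * opn (G * V2 * Hm) + (e1 + opn S * \<kappa> * aa) * (eps * \<kappa>)"
    by (intro opn_add_le opn_diff_le opn_mult_le opn_tpU1_NS opn_NSG opn_Vb opn_Ub order_refl e)
  finally show ?thesis by (simp add: mult.commute)
qed

lemma \<gamma>_le: "\<gamma> \<le> 5 / 4 * mu"
proof -
  have "\<gamma> * \<sigma>r \<le> s2 * \<gamma> + (1 + \<gamma>\<^sup>2) * eps"
  proof (cases "opn Gm \<le> opn Hm")
    case True
    then have g: "\<gamma> = opn Hm" unfolding \<gamma>_max by simp
    have "s2 * opn Gm \<le> s2 * \<gamma>" using \<gamma> s2 by (intro mult_left_mono) simp_all
    then show ?thesis using perturbed_inv.opn_Gm_le[OF swap_inv] unfolding g by linarith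
  next
    case False
    then have g: "\<gamma> = opn Gm" unfolding \<gamma>_max by simp
    have "s2 * opn Hm \<le> s2 * \<gamma>" using \<gamma> s2 by (intro mult_left_mono) simp_all
    then show ?thesis using opn_Gm_le unfolding g by linarith
  qed
  moreover have "(1 + \<gamma>\<^sup>2) * eps = (1 + \<gamma>\<^sup>2) * mu * (\<sigma>r - s2)" by (simp only: mult.assoc mu_eq)
  moreover have "\<gamma> * (\<sigma>r - s2) = \<gamma> * \<sigma>r - s2 * \<gamma>" by (simp add: right_diff_distrib)
  ultimately have "\<gamma> * (\<sigma>r - s2) \<le> (1 + \<gamma>\<^sup>2) * mu * (\<sigma>r - s2)" by linarith
  then have 1: "\<gamma> \<le> (1 + \<gamma>\<^sup>2) * mu" using s2 by simp
  have "\<gamma>\<^sup>2 \<le> 1\<^sup>2" using \<gamma> e_pos by (intro power_mono) simp_all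
  then have "(1 + \<gamma>\<^sup>2) * mu \<le> 2 * mu" using mu by (intro mult_right_mono) simp_all
  then have "\<gamma> \<le> 1 / 2" using 1 mu by linarith
  then have "\<gamma>\<^sup>2 \<le> (1 / 2)\<^sup>2" using e_pos by (intro power_mono) simp_all
  then have "(1 + \<gamma>\<^sup>2) * mu \<le> 5 / 4 * mu" using mu by (intro mult_right_mono) (simp_all add: power2_eq_square)
  then show ?thesis using 1 by linarith
qed

lemma \<kappa>_le: "\<kappa> \<le> 21 / 20" "\<gamma>\<^sup>2 \<le> 25 / 16 * mu\<^sup>2" "0 \<le> \<kappa>"
proof -
  have "\<gamma>\<^sup>2 \<le> (5 / 4 * mu)\<^sup>2" using \<gamma>_le e_pos by (intro power_mono) simp_all
  then show g: "\<gamma>\<^sup>2 \<le> 25 / 16 * mu\<^sup>2" by (simp add: power_mult_distrib power2_eq_square)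
  have "mu\<^sup>2 \<le> (1 / 4)\<^sup>2" using mu by (intro power_mono) simp_all
  then have "1 + \<gamma>\<^sup>2 \<le> (21 / 20)\<^sup>2" using g by (simp add: power2_eq_square)
  then have "\<kappa> \<le> sqrt ((21 / 20)\<^sup>2)" by (rule real_sqrt_le_mono)
  then show "\<kappa> \<le> 21 / 20" unfolding real_sqrt_abs by simp
  show "0 \<le> \<kappa>" by (intro real_sqrt_ge_zero add_nonneg_nonneg) simp_all
qed

lemma mult_quarter: "0 \<le> x \<Longrightarrow> x * mu \<le> x / 4" "0 \<le> x \<Longrightarrow> x * aa \<le> x * mu" "0 \<le> x \<Longrightarrow> x * aa \<le> x / 4"
proof -
  assume x: "0 \<le> x"
  show 1: "x * mu \<le> x / 4" using mult_left_mono[of mu "1 / 4" x] mu x by simp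
  show 2: "x * aa \<le> x * mu" using mu x by (intro mult_left_mono)
  show "x * aa \<le> x / 4" using 1 2 by linarith
qed

lemma opn_pq_le: "opn (tp R * S * U2 * Gm) \<le> 9 / 8 * (eps * mu)" "opn (G * V2 * Hm) \<le> 9 / 8 * (eps * mu)"
proof -
  define t where "t = max (opn (tp R * S * U2 * Gm)) (opn (G * V2 * Hm))"
  have t0: "0 \<le> t" unfolding t_def by (simp add: le_max_iff_disj)
  have ek: "eps * \<kappa> \<le> eps * (21 / 20)" "0 \<le> eps * \<kappa>" by (intro mult_left_mono mult_nonneg_nonneg \<kappa>_le e_pos)+
  have main: "x * \<sigma>r \<le> s2 * t + (eps + t * aa) * (eps * (21 / 20))"
    if "0 \<le> x" "x \<le> t" "0 \<le> y" "y \<le> t" "x * \<sigma>r \<le> s2 * y + (eps + x * aa) * (eps * \<kappa>)" for x y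
  proof -
    have "s2 * y \<le> s2 * t" using that s2 by (intro mult_left_mono)
    moreover have "(eps + x * aa) * (eps * \<kappa>) \<le> (eps + t * aa) * (eps * (21 / 20))"
    proof (rule mult_mono[OF _ ek(1) _ ek(2)])
      show "eps + x * aa \<le> eps + t * aa" using mult_right_mono[OF that(2) mu(3)] by simp
      show "0 \<le> eps + t * aa" using e_pos t0 mu by simp
    qed
    ultimately show ?thesis using that by linarith
  qed
  have "t * \<sigma>r \<le> s2 * t + (eps + t * aa) * (eps * (21 / 20))"
  proof (cases "opn (tp R * S * U2 * Gm) \<le> opn (G * V2 * Hm)")
    case True
    then have "t = opn (G * V2 * Hm)" unfolding t_def by simp
    then show ?thesis using main[OF _ _ _ _ perturbed_inv.opn_q_le[OF swap_inv]] True by simp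
  next
    case False
    then have "t = opn (tp R * S * U2 * Gm)" unfolding t_def by simp
    then show ?thesis using main[OF _ _ _ _ opn_q_le] False by simp
  qed
  moreover have "(eps + t * aa) * (eps * (21 / 20)) \<le> (21 / 20) * (eps * eps) + (21 / 20) * (1 / 16) * (t * (\<sigma>r - s2))"
  proof -
    have "t * aa * eps \<le> t * (1 / 4) * ((\<sigma>r - s2) / 4)"
      using mu eps4 t0 e_pos by (intro mult_mono) simp_all
    then show ?thesis by (simp add: algebra_simps)
  qed
  moreover have "t * (\<sigma>r - s2) = t * \<sigma>r - s2 * t" by (simp add: right_diff_distrib)
  moreover have "D * (299 / 320) \<le> E" if "x \<le> y + z" "z \<le> E + 21 / 20 * (1 / 16) * D" "D = x - y" for D E x y z :: real
    using that by linarith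
  ultimately have 1: "t * (\<sigma>r - s2) * (299 / 320) \<le> 21 / 20 * (eps * eps)" by blast
  have "t * (299 / 320) * (\<sigma>r - s2) = t * (\<sigma>r - s2) * (299 / 320)" by (simp only: mult_ac)
  also note 1
  also have "21 / 20 * (eps * eps) = 21 / 20 * (eps * mu) * (\<sigma>r - s2)" by (simp only: mult.assoc mu_eq)
  finally have "t * (299 / 320) * (\<sigma>r - s2) \<le> 21 / 20 * (eps * mu) * (\<sigma>r - s2)" .
  then have "t * (299 / 320) \<le> 21 / 20 * (eps * mu)" by (rule mult_right_le_imp_le) (use s2 in simp)
  moreover have "0 \<le> eps * mu" using e_pos mu by simp
  ultimately have "t \<le> 9 / 8 * (eps * mu)" by (simp add: field_simps)
  then show "opn (tp R * S * U2 * Gm) \<le> 9 / 8 * (eps * mu)" "opn (G * V2 * Hm) \<le> 9 / 8 * (eps * mu)"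
    unfolding t_def by simp_all
qed

lemma opn_SU2_le: "opn (S * U2 * Gm) \<le> 82 / 25 * mu\<^sup>2 * opn S"
proof -
  have A: "opn S * opn (G * V2 * Hm) \<le> opn S * (9 / 8 * (eps * mu))" by (intro mult_left_mono opn_pq_le) simp
  have ek: "eps * \<kappa> \<le> eps * (21 / 20)" using \<kappa>_le e_pos by (intro mult_left_mono) simp_all
  have "opn S * \<kappa> * aa \<le> opn S * (21 / 20) * aa" using \<kappa>_le mu by (intro mult_right_mono mult_left_mono) simp_all
  then have "e1 + opn S * \<kappa> * aa \<le> opn S * (41 / 20) * aa" using e1_le by (simp add: algebra_simps)
  then have B: "(e1 + opn S * \<kappa> * aa) * (eps * \<kappa>) \<le> opn S * (41 / 20) * aa * (eps * (21 / 20))"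
  proof (rule mult_mono[OF _ ek])
    show "0 \<le> opn S * (41 / 20) * aa" "0 \<le> eps * \<kappa>" using mu by (simp, intro mult_nonneg_nonneg \<kappa>_le e_pos)
  qed
  have "opn S * (41 / 20) * aa * (eps * (21 / 20)) \<le> opn S * (41 / 20) * mu * (eps * (21 / 20))"
    using mu e_pos by (intro mult_right_mono mult_left_mono) simp_all
  then have "opn (S * U2 * Gm) * \<sigma>r \<le> opn S * (9 / 8 * (eps * mu)) + opn S * (41 / 20) * mu * (eps * (21 / 20))"
    using opn_g_le A B by linarith
  also have "\<dots> = (9 / 8 + 861 / 400) * (opn S * (eps * mu))" by (simp add: algebra_simps)
  also have "\<dots> \<le> 82 / 25 * (opn S * (eps * mu))" using e_pos mu by (intro mult_right_mono) simp_all
  also have "\<dots> \<le> 82 / 25 * (opn S * (mu * mu * \<sigma>r))"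
  proof -
    have "eps * mu = aa * mu * \<sigma>r" using mu_eq(2) by (metis mult.assoc mult.commute)
    also have "\<dots> \<le> mu * mu * \<sigma>r" using mu \<sigma>r_pos by (intro mult_right_mono) simp_all
    finally show ?thesis by (intro mult_left_mono) simp_all
  qed
  finally have "opn (S * U2 * Gm) * \<sigma>r \<le> (82 / 25 * mu\<^sup>2 * opn S) * \<sigma>r" by (simp add: power2_eq_square mult_ac)
  then show ?thesis using \<sigma>r_pos by simp
qed

definition "X2 = S * Uc"
definition "Y2 = R * Vc * Ji"

lemma opn_X1: "opn X1 \<le> opn S"
  unfolding X1_def using opn_mult_le[OF order_refl opn_UV(1), of S] by simp

lemma opn_Y1: "opn Y1 \<le> opn R / \<sigma>r"
  unfolding Y1_def using opn_mult_le[OF opn_mult_le[OF order_refl opn_UV(3), of R] opn_J] by simp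

lemma opn_I_Cu: "opn (Cu - Id_n r) \<le> 25 / 16 * mu\<^sup>2"
  using Cu_bounds(2) \<kappa>_le(2) unfolding opn_minus_commute[of Cu] by linarith

lemma X_perturbation: "opn (X2 - X1) \<le> 5 * mu\<^sup>2 * opn S"
proof -
  have "X2 - X1 = X1 * (Cu - Id_n r) - S * U2 * Gm * Cu"
    unfolding X2_def X1_def by (simp add: right_diff_distrib left_diff_distrib mult.assoc U)
  also have "opn \<dots> \<le> opn S * (25 / 16 * mu\<^sup>2) + 82 / 25 * mu\<^sup>2 * opn S * 1"
    by (intro opn_diff_le opn_mult_le opn_X1 opn_I_Cu opn_SU2_le Cu_bounds)
  also have "\<dots> \<le> 5 * mu\<^sup>2 * opn S"
    using mult_nonneg_nonneg[OF zero_le_power2[of mu] opn_ge_0[of S]] by (simp add: algebra_simps)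
  finally show ?thesis .
qed

definition "Er = tp U1 * NS * (NS * G) * Vc"

lemma opn_Er: "opn Er \<le> aa * eps"
proof -
  have "opn Er \<le> aa * eps * 1" unfolding Er_def by (intro opn_mult_le opn_tpU1_NS opn_NSG opn_Vc)
  then show ?thesis by simp
qed

lemma Er_eq: "Dg r d * Cv = Cu * Sc1 + Er"
proof -
  have "Gt * Vc = (Id_n m1 - NS) * (G * Vc)" by (rule Gt_mult[OF NR_Vc])
  then have "Uc * Sc1 = (Id_n m1 - NS) * (G * Vc)" unfolding dec .
  then have "tp U1 * (Uc * Sc1) = tp U1 * (Id_n m1 * G * Vc) - tp U1 * (NS * (G * Vc))"
    by (simp add: left_diff_distrib right_diff_distrib mult.assoc)
  moreover have "tp U1 * (Uc * Sc1) = Cu * Sc1" using tpU1_Uc by (metis mult.assoc)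
  moreover have "tp U1 * (Id_n m1 * G * Vc) = tp U1 * G * Vc" unfolding G_Id by (simp only: mult.assoc)
  moreover have "tp U1 * G * Vc = Dg r d * Cv"
  proof -
    have "Dg r d * tp V1 * Vc = Dg r d * (tp V1 * Vc)" by (simp only: mult.assoc)
    then show ?thesis unfolding tpU1_G tpV1_Vc .
  qed
  moreover have "tp U1 * (NS * (G * Vc)) = Er"
  proof -
    have "Er = tp U1 * (NS * NS * (G * Vc))" unfolding Er_def by (simp only: mult.assoc)
    then show ?thesis unfolding NS ..
  qed
  ultimately show ?thesis by simp
qed

lemma opn_Ji: "opn Ji \<le> 9 / 8 / \<sigma>r"
proof -
  have k: "norm X \<le> 21 / 20 * norm (Cv * X)" if "Id_n r * X = X" for X
  proof -
    have "(norm X)\<^sup>2 \<le> (1 + \<gamma>\<^sup>2) * (norm (Cv * X))\<^sup>2" by (rule Cv_bounds(3)[OF that])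
    also have "1 + \<gamma>\<^sup>2 = \<kappa>\<^sup>2" by simp
    finally have "(norm X)\<^sup>2 \<le> (\<kappa> * norm (Cv * X))\<^sup>2" by (simp only: power_mult_distrib)
    then have "norm X \<le> \<kappa> * norm (Cv * X)" by (rule power2_le_imp_le) (intro mult_nonneg_nonneg \<kappa>_le norm_ge_zero)
    also have "\<dots> \<le> 21 / 20 * norm (Cv * X)" using \<kappa>_le by (intro mult_right_mono) simp_all
    finally show ?thesis .
  qed
  have "8 / 9 * \<sigma>r * norm (Ji * X) \<le> norm X" for X
  proof -
    define w where "w = Ji * X"
    have w: "Id_n r * w = w" unfolding w_def mult.assoc[symmetric] Ji ..
    have "20 / 21 * norm w \<le> norm (Cv * w)" using k[OF w] by simp
    then have "\<sigma>r * (20 / 21 * norm w) \<le> \<sigma>r * norm (Cv * w)" using \<sigma>r_pos by (intro mult_left_mono) simp_all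
    also have "\<dots> \<le> norm (Dg r d * (Cv * w))" by (rule norm_Dg_mult_ge) (simp only: mult.assoc[symmetric] Cv)
    also have "Dg r d * (Cv * w) = Cu * (Sc1 * w) + Er * w" using Er_eq by (metis distrib_right mult.assoc)
    also have "norm \<dots> \<le> norm (Sc1 * w) + aa * eps * norm w"
    proof (rule norm_triangle_le[OF add_mono])
      have "norm (Cu * (Sc1 * w)) \<le> opn Cu * norm (Sc1 * w)" by (rule norm_mult_opn)
      also have "\<dots> \<le> 1 * norm (Sc1 * w)" by (intro mult_right_mono Cu_bounds) simp
      finally show "norm (Cu * (Sc1 * w)) \<le> norm (Sc1 * w)" by simp
      have "norm (Er * w) \<le> opn Er * norm w" by (rule norm_mult_opn)
      also have "\<dots> \<le> aa * eps * norm w" by (intro mult_right_mono opn_Er) simp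
      finally show "norm (Er * w) \<le> aa * eps * norm w" .
    qed
    also have "Sc1 * w = Id_n r * X" unfolding w_def mult.assoc[symmetric] Ji ..
    also have "norm (Id_n r * X) + aa * eps * norm w \<le> norm X + \<sigma>r / 16 * norm w"
    proof (rule add_mono[OF norm_Id_mult_le mult_right_mono])
      have "aa * eps \<le> 1 / 4 * (\<sigma>r / 4)" using mu eps4 s2 e_pos by (intro mult_mono) simp_all
      then show "aa * eps \<le> \<sigma>r / 16" by simp
    qed simp
    finally have "\<sigma>r * norm w * (20 / 21) \<le> norm X + \<sigma>r * norm w * (1 / 16)" by (simp add: mult_ac)
    moreover have "0 \<le> \<sigma>r * norm w" using \<sigma>r_pos by simp
    ultimately have "8 / 9 * (\<sigma>r * norm w) \<le> norm X" by linarith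
    then show ?thesis unfolding w_def by simp
  qed
  then have "opn Ji \<le> 1 / (8 / 9 * \<sigma>r)" by (rule opn_left_inverse_le) (use \<sigma>r_pos in simp)
  then show ?thesis by simp
qed

lemma opn_Er_Ji: "opn (Er * Ji) \<le> 9 / 8 * mu\<^sup>2"
proof -
  have "opn (Er * Ji) \<le> aa * eps * (9 / 8 / \<sigma>r)" by (intro opn_mult_le opn_Er opn_Ji)
  also have "\<dots> = aa * aa * (9 / 8)" unfolding aa_def using \<sigma>r_pos by (simp add: field_simps)
  also have "\<dots> \<le> mu * mu * (9 / 8)" using mu by (intro mult_mono) simp_all
  finally show ?thesis by (simp add: power2_eq_square)
qed

lemma mu_sq: "mu\<^sup>2 \<le> 1 / 16"
  using power_mono[of mu "1 / 4" 2] mu by (simp add: power2_eq_square)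

lemma Y_perturbation: "opn (Y2 - Y1) \<le> 31 / 5 * mu\<^sup>2 * (opn R / \<sigma>r)"
proof -
  have "J * (Cu + Er * Ji) = Cv * Ji"
  proof -
    have "J * (Dg r d * Cv) * Ji = J * (Cu * Sc1 + Er) * Ji" unfolding Er_eq ..
    moreover have "J * (Dg r d * Cv) * Ji = Cv * Ji" unfolding mult.assoc[symmetric] Dg_J Cv ..
    moreover have "J * (Cu * Sc1 + Er) * Ji = J * (Cu * (Sc1 * Ji) + Er * Ji)" by (simp only: distrib_left distrib_right mult.assoc)
    ultimately show ?thesis unfolding Ji Cu_bounds by simp
  qed
  then have "Y2 - Y1 = R * (V1 - V2 * Hm) * (J * (Cu + Er * Ji)) - R * V1 * J" unfolding Y2_def Y1_def by (simp only: mult.assoc)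
  also have "\<dots> = Y1 * ((Cu - Id_n r) + Er * Ji) - R * V2 * Hm * J * (Cu + Er * Ji)"
  proof -
    have "Y1 * Id_n r = Y1" unfolding Y1_def by (simp add: mult.assoc)
    then show ?thesis
      by (simp add: Y1_def left_diff_distrib right_diff_distrib distrib_left distrib_right mult.assoc)
  qed
  also have "opn \<dots> \<le> opn R / \<sigma>r * (25 / 16 * mu\<^sup>2 + 9 / 8 * mu\<^sup>2) + 82 / 25 * mu\<^sup>2 * opn R * (1 / \<sigma>r) * (1 + 9 / 8 * (1 / 16))"
  proof (rule opn_diff_le[OF opn_mult_le[OF opn_Y1] opn_mult_le[OF opn_mult_le[OF _ opn_J]]])
    show "opn (Cu - Id_n r + Er * Ji) \<le> 25 / 16 * mu\<^sup>2 + 9 / 8 * mu\<^sup>2" by (rule opn_add_le[OF opn_I_Cu opn_Er_Ji])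
    show "opn (R * V2 * Hm) \<le> 82 / 25 * mu\<^sup>2 * opn R" by (rule perturbed_inv.opn_SU2_le[OF swap_inv])
    have "opn (Er * Ji) \<le> 9 / 8 * (1 / 16)" using opn_Er_Ji mu_sq by linarith
    then show "opn (Cu + Er * Ji) \<le> 1 + 9 / 8 * (1 / 16)" by (rule opn_add_le[OF Cu_bounds(1)])
  qed
  also have "\<dots> = (43 / 16 + 82 / 25 * (137 / 128)) * (mu\<^sup>2 * (opn R / \<sigma>r))" by (simp add: algebra_simps)
  also have "\<dots> \<le> 31 / 5 * (mu\<^sup>2 * (opn R / \<sigma>r))" using \<sigma>r_pos by (intro mult_right_mono) simp_all
  finally show ?thesis by simp
qed

lemma reduced_perturbation:
  "opn (tp Y2 * a * X2 - tp Y1 * a * X1) \<le> 14 * mu\<^sup>2 * (opn S * (opn R / \<sigma>r)) * opn a"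
proof -
  define \<theta> where "\<theta> = opn R / \<sigma>r"
  have \<theta>: "0 \<le> \<theta>" unfolding \<theta>_def using \<sigma>r_pos by simp
  have "opn (Y1 + (Y2 - Y1)) \<le> \<theta> + 31 / 5 * (1 / 16) * \<theta>"
  proof (rule opn_add_le)
    have "31 / 5 * mu\<^sup>2 * \<theta> \<le> 31 / 5 * (1 / 16) * \<theta>" using mu_sq \<theta> by (intro mult_right_mono mult_left_mono) simp_all
    then show "opn (Y2 - Y1) \<le> 31 / 5 * (1 / 16) * \<theta>" using Y_perturbation unfolding \<theta>_def by linarith
    show "opn Y1 \<le> \<theta>" unfolding \<theta>_def by (rule opn_Y1)
  qed
  then have Y2: "opn (tp Y2) \<le> 111 / 80 * \<theta>" by simp
  have dY: "opn (tp (Y2 - Y1)) \<le> 31 / 5 * mu\<^sup>2 * \<theta>" unfolding opn_tp \<theta>_def by (rule Y_perturbation)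
  have "tp Y2 * a * X2 - tp Y1 * a * X1 = tp (Y2 - Y1) * a * X1 + tp Y2 * a * (X2 - X1)"
    by (simp add: left_diff_distrib right_diff_distrib)
  also have "opn \<dots> \<le> 31 / 5 * mu\<^sup>2 * \<theta> * opn a * opn S + 111 / 80 * \<theta> * opn a * (5 * mu\<^sup>2 * opn S)"
    by (intro opn_add_le opn_mult_le order_refl opn_X1 X_perturbation Y2 dY)
  also have "\<dots> = (31 / 5 + 111 / 16) * (mu\<^sup>2 * (opn S * \<theta>) * opn a)" by (simp add: algebra_simps)
  also have "\<dots> \<le> 14 * (mu\<^sup>2 * (opn S * \<theta>) * opn a)" using \<theta> by (intro mult_right_mono) simp_all
  finally show ?thesis unfolding \<theta>_def by simp
qed

end

section \<open>Perturbation of Gramian factors\<close>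

lemma lyapunov_le:
  assumes A: "A \<in> carrier_mat n n" "stable A"
    and K: "Id_n n * K = K" "K * Id_n n = K" "fs A * K + K * tp (fs A) = - Id_n n"
    and W: "Id_n n * W = W" "W * Id_n n = W" "fs A * W + W * tp (fs A) + N = 0"
    and N: "\<And>X. inner X (N * X) \<le> c * (norm X)\<^sup>2" and c: "0 \<le> c"
  shows "inner X (W * X) \<le> c * opn K * (norm X)\<^sup>2"
proof -
  have a: "Id_n n * fs A = fs A" "tp (fs A) * Id_n n = tp (fs A)" using A by simp_all
  have Ne: "N = - (fs A * W + W * tp (fs A))" using W(3) unfolding add_eq_0_iff .
  have "Id_n n * (fs A * W + W * tp (fs A)) * Id_n n = (Id_n n * fs A) * (W * Id_n n) + (Id_n n * W) * (tp (fs A) * Id_n n)"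
    by (simp only: distrib_left distrib_right mult.assoc)
  then have "Id_n n * (fs A * W + W * tp (fs A)) * Id_n n = fs A * W + W * tp (fs A)" unfolding W a .
  then have NI: "Id_n n * N * Id_n n = N" unfolding Ne by (simp only: mult_minus_left mult_minus_right)
  have "psdq (c *\<^sub>R K - W)"
  proof (rule lyapunov_psdq[OF A])
    show "Id_n n * (c *\<^sub>R K - W) = c *\<^sub>R K - W" "(c *\<^sub>R K - W) * Id_n n = c *\<^sub>R K - W"
      by (simp_all add: left_diff_distrib right_diff_distrib K W)
    have "fs A * (c *\<^sub>R K - W) + (c *\<^sub>R K - W) * tp (fs A) = c *\<^sub>R (fs A * K + K * tp (fs A)) - (fs A * W + W * tp (fs A))"
      by (simp add: left_diff_distrib right_diff_distrib scaleR_right_distrib)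
    then show "fs A * (c *\<^sub>R K - W) + (c *\<^sub>R K - W) * tp (fs A) + (c *\<^sub>R Id_n n - N) = 0"
      unfolding K Ne by simp
    show "psdq (c *\<^sub>R Id_n n - N)"
      unfolding psdq_def
    proof
      fix X
      define Y where "Y = Id_n n * X"
      have "inner X (N * X) = inner X (Id_n n * (N * Y))" by (subst NI[symmetric]) (simp only: mult.assoc Y_def)
      also have "\<dots> = inner Y (N * Y)" unfolding Y_def by (simp only: inner_left_mult tp_Id)
      finally have 1: "inner X (N * X) \<le> c * (norm Y)\<^sup>2" using N[of Y] by simp
      have "(norm Y)\<^sup>2 = inner X (Id_n n * X)"
        unfolding Y_def by (simp only: power2_norm_eq_inner inner_left_mult tp_Id mult.assoc[symmetric] Id_mult_Id min.idem)
      moreover have "inner X ((c *\<^sub>R Id_n n - N) * X) = c * inner X (Id_n n * X) - inner X (N * X)"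
        by (simp add: left_diff_distrib inner_diff_right)
      ultimately show "0 \<le> inner X ((c *\<^sub>R Id_n n - N) * X)" using 1 by simp
    qed
  qed
  then have "0 \<le> inner X ((c *\<^sub>R K - W) * X)" unfolding psdq_def by blast
  then have "inner X (W * X) \<le> c * inner X (K * X)" by (simp add: left_diff_distrib inner_diff_right)
  also have "\<dots> \<le> c * (opn K * (norm X)\<^sup>2)"
  proof (rule mult_left_mono[OF _ c])
    have "inner X (K * X) \<le> norm X * norm (K * X)" by (rule norm_cauchy_schwarz)
    also have "\<dots> \<le> norm X * (opn K * norm X)" by (intro mult_left_mono norm_mult_opn) simp
    finally show "inner X (K * X) \<le> opn K * (norm X)\<^sup>2" by (simp add: power2_eq_square mult_ac)
  qed
  finally show ?thesis by simp
qed

lemma inner_mult_le: "inner X (N * X) \<le> opn N * (norm X)\<^sup>2"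
proof -
  have "inner X (N * X) \<le> norm X * norm (N * X)" by (rule norm_cauchy_schwarz)
  also have "\<dots> \<le> norm X * (opn N * norm X)" by (intro mult_left_mono norm_mult_opn) simp
  finally show ?thesis by (simp add: power2_eq_square mult_ac)
qed

text \<open>The cross Gramian \<open>S1 * tp S2\<close> turns the difference of two Gramian factors into the solution of
  a Lyapunov equation, which is compared with \<open>K\<close>.\<close>

lemma gfac_perturbation:
  assumes A: "A \<in> carrier_mat n n" "stable A"
    and K: "Id_n n * K = K" "K * Id_n n = K" "fs A * K + K * tp (fs A) = - Id_n n"
    and S1: "gfac n (fs A) b1 S1" and S2: "gfac n a2 b2 S2"
    and x: "fs A * (S1 * tp S2) + S1 * tp S2 * tp a2 + b1 * tp b2 = 0"
    and \<sigma>: "opn S1 \<le> \<sigma>"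
  defines "\<omega> \<equiv> opn (S2 - S1)" and "y \<equiv> opn K * opn (a2 - fs A)"
  shows "\<omega>\<^sup>2 * (3 / 4 - 2 * y) \<le> 4 * \<sigma>\<^sup>2 * y\<^sup>2 + opn K * (opn (b2 - b1))\<^sup>2"
proof -
  define Z where "Z = S2 - S1"
  define \<Delta> where "\<Delta> = a2 - fs A"
  define W where "W = Z * tp Z"
  define M where "M = \<Delta> * S1 * tp Z"
  define N where "N = \<Delta> * W + tp (\<Delta> * W) + (M + tp M) + (b2 - b1) * tp (b2 - b1)"
  have IZ: "Id_n n * Z = Z" using S1 S2 unfolding Z_def gfac_def by (simp add: right_diff_distrib)
  have s1: "fs A * (S1 * tp S1) + S1 * tp S1 * tp (fs A) + b1 * tp b1 = 0" using S1 unfolding gfac_def by blast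
  have s2: "a2 * (S2 * tp S2) + S2 * tp S2 * tp a2 + b2 * tp b2 = 0" using S2 unfolding gfac_def by blast
  have x': "a2 * (S2 * tp S1) + S2 * tp S1 * tp (fs A) + b2 * tp b1 = 0"
    using arg_cong[OF x, of tp] by (simp add: mult.assoc add_ac)
  have tW: "tp W = W" unfolding W_def by simp
  have "fs A * W + W * tp (fs A) + N = 0"
  proof -
    have "fs A * W + W * tp (fs A) + N
      = (a2 * (S2 * tp S2) + S2 * tp S2 * tp a2 + b2 * tp b2)
        - (fs A * (S1 * tp S2) + S1 * tp S2 * tp a2 + b1 * tp b2)
        - (a2 * (S2 * tp S1) + S2 * tp S1 * tp (fs A) + b2 * tp b1)
        + (fs A * (S1 * tp S1) + S1 * tp S1 * tp (fs A) + b1 * tp b1)"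
      unfolding N_def M_def W_def \<Delta>_def Z_def
      by (simp add: left_diff_distrib right_diff_distrib mult.assoc)
    then show ?thesis unfolding s1 s2 x x' by simp
  qed
  moreover have WI: "Id_n n * W = W" "W * Id_n n = W" unfolding W_def by (rule gfac_Id[OF IZ])+
  define c where "c = 2 * opn \<Delta> * \<omega>\<^sup>2 + 2 * opn \<Delta> * \<sigma> * \<omega> + (opn (b2 - b1))\<^sup>2"
  have \<sigma>0: "0 \<le> \<sigma>" using \<sigma> opn_ge_0[of S1] by linarith
  have \<omega>0: "0 \<le> \<omega>" unfolding \<omega>_def by simp
  have \<omega>Z: "\<omega> = opn Z" unfolding \<omega>_def Z_def ..
  have c0: "0 \<le> c" unfolding c_def using \<sigma>0 \<omega>0 by simp
  have "opn N \<le> c"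
  proof -
    have W: "opn W = \<omega>\<^sup>2" unfolding W_def \<omega>Z by (rule opn_mult_tp)
    have DW: "opn (\<Delta> * W) \<le> opn \<Delta> * \<omega>\<^sup>2" using opn_mult[of \<Delta> W] unfolding W .
    have M: "opn M \<le> opn \<Delta> * \<sigma> * \<omega>" unfolding M_def \<omega>Z by (intro opn_mult_le \<sigma> order_refl) simp
    have "opn N \<le> (opn \<Delta> * \<omega>\<^sup>2 + opn \<Delta> * \<omega>\<^sup>2) + (opn \<Delta> * \<sigma> * \<omega> + opn \<Delta> * \<sigma> * \<omega>) + (opn (b2 - b1))\<^sup>2"
      unfolding N_def
    proof (intro opn_add_le DW M)
      show "opn (tp (\<Delta> * W)) \<le> opn \<Delta> * \<omega>\<^sup>2" "opn (tp M) \<le> opn \<Delta> * \<sigma> * \<omega>" unfolding opn_tp by (rule DW, rule M)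
      show "opn ((b2 - b1) * tp (b2 - b1)) \<le> (opn (b2 - b1))\<^sup>2" unfolding opn_mult_tp ..
    qed
    then show ?thesis unfolding c_def by (simp add: mult_ac)
  qed
  then have "inner X (N * X) \<le> c * (norm X)\<^sup>2" for X
    using inner_mult_le[of X N] by (meson mult_right_mono order_trans zero_le_power2)
  ultimately have le: "inner X (W * X) \<le> c * opn K * (norm X)\<^sup>2" for X
    using c0 by (intro lyapunov_le[OF A K WI])
  have "opn (tp Z) \<le> sqrt (c * opn K)"
  proof (rule opn_sq_leI)
    fix X
    have "(norm (tp Z * X))\<^sup>2 = inner X (W * X)" unfolding W_def by (simp only: power2_norm_eq_inner inner_left_mult tp_simps mult.assoc)
    then show "(norm (tp Z * X))\<^sup>2 \<le> c * opn K * (norm X)\<^sup>2" using le[of X] by simp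
  qed (use c0 in simp)
  then have "\<omega>\<^sup>2 \<le> (sqrt (c * opn K))\<^sup>2" unfolding \<omega>Z by (intro power_mono) simp_all
  also have "\<dots> = c * opn K" using c0 by simp
  also have "\<dots> = 2 * y * \<omega>\<^sup>2 + 2 * (\<sigma> * y) * \<omega> + opn K * (opn (b2 - b1))\<^sup>2"
    unfolding c_def y_def \<Delta>_def by (simp add: algebra_simps)
  also have "2 * (\<sigma> * y) * \<omega> \<le> 4 * (\<sigma> * y)\<^sup>2 + \<omega>\<^sup>2 / 4"
    using zero_le_power2[of "2 * (\<sigma> * y) - \<omega> / 2"] by (simp add: power2_eq_square algebra_simps)
  finally show ?thesis by (simp add: power_mult_distrib right_diff_distrib mult_ac)
qed

lemma stable_perturbation:
  assumes At: "At \<in> carrier_mat n n" and K: "psdq K" "tp K = K" "opn K * opn (fs At - a) < 1 / 2" "a * K + K * tp a = - Id_n n"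
  shows "stable At"
proof -
  define \<Delta> where "\<Delta> = fs At - a"
  define y where "y = opn K * opn \<Delta>"
  have y: "y < 1 / 2" unfolding y_def \<Delta>_def by (rule K)
  have y0: "0 \<le> y" unfolding y_def by simp
  have At': "At\<^sup>T \<in> carrier_mat n n" using At by simp
  have e: "2 * inner (K * X) (tp (fs At) * X) \<le> - (1 - 2 * y) * (norm X)\<^sup>2" if "Id_n n * X = X" for X
  proof -
    have "inner X ((fs At * K + K * tp (fs At)) * X) = inner X (fs At * (K * X)) + inner X (K * (tp (fs At) * X))"
      by (simp only: distrib_right inner_add_right mult.assoc)
    also have "inner X (K * (tp (fs At) * X)) = inner (K * X) (tp (fs At) * X)" by (simp only: inner_left_mult K)
    also have "inner X (fs At * (K * X)) = inner (K * X) (tp (fs At) * X)" by (metis inner_commute inner_left_mult tp_simps(1))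
    also have "fs At * K + K * tp (fs At) = (\<Delta> * K + tp (\<Delta> * K)) - Id_n n"
    proof -
      have "fs At * K + K * tp (fs At) = (a * K + K * tp a) + (\<Delta> * K + tp (\<Delta> * K))"
        unfolding \<Delta>_def by (simp add: left_diff_distrib right_diff_distrib K(2))
      then show ?thesis unfolding K(4) by simp
    qed
    finally have "2 * inner (K * X) (tp (fs At) * X) = inner X ((\<Delta> * K + tp (\<Delta> * K)) * X) - inner X X"
      using that by (simp add: left_diff_distrib inner_diff_right)
    also have "inner X ((\<Delta> * K + tp (\<Delta> * K)) * X) \<le> opn (\<Delta> * K + tp (\<Delta> * K)) * (norm X)\<^sup>2" by (rule inner_mult_le)
    also have "opn (\<Delta> * K + tp (\<Delta> * K)) * (norm X)\<^sup>2 \<le> (2 * y) * (norm X)\<^sup>2"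
    proof (rule mult_right_mono)
      have "opn (\<Delta> * K) \<le> y" unfolding y_def using opn_mult[of \<Delta> K] by (simp add: mult.commute)
      then show "opn (\<Delta> * K + tp (\<Delta> * K)) \<le> 2 * y" using opn_add_le[of "\<Delta> * K" y "tp (\<Delta> * K)" y] unfolding opn_tp by simp
    qed simp
    also have "(2 * y) * (norm X)\<^sup>2 - inner X X = - (1 - 2 * y) * (norm X)\<^sup>2"
      by (simp add: dot_square_norm left_diff_distrib)
    finally show ?thesis by simp
  qed
  have "stb n (fs At\<^sup>T)"
    unfolding stb_def
  proof (intro allI impI, elim conjE)
    fix x z X Y
    assume h: "Id_n n * X = X" "Id_n n * Y = Y" "X \<noteq> 0 \<or> Y \<noteq> 0" "fs At\<^sup>T * X = x *\<^sub>R X - z *\<^sub>R Y" "fs At\<^sup>T * Y = x *\<^sub>R Y + z *\<^sub>R X"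
    have s: "inner (K * X) Y = inner (K * Y) X" using inner_left_mult[of K X Y] by (simp add: K inner_commute)
    have "2 * inner (K * X) (tp (fs At) * X) + 2 * inner (K * Y) (tp (fs At) * Y) = 2 * x * (inner (K * X) X + inner (K * Y) Y)"
      unfolding h(4,5)[unfolded fs_transpose] by (simp add: inner_diff_right inner_add_right s algebra_simps)
    moreover have "2 * inner (K * X) (tp (fs At) * X) + 2 * inner (K * Y) (tp (fs At) * Y) \<le> - (1 - 2 * y) * ((norm X)\<^sup>2 + (norm Y)\<^sup>2)"
      using e[OF h(1)] e[OF h(2)] by (simp add: distrib_left)
    moreover have "- (1 - 2 * y) * ((norm X)\<^sup>2 + (norm Y)\<^sup>2) < 0"
    proof -
      have "(norm X)\<^sup>2 + (norm Y)\<^sup>2 > 0" using h(3) by (metis add_nonneg_pos add_pos_nonneg zero_le_power2 zero_less_norm_iff zero_less_power)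
      then show ?thesis using y by (simp add: mult_less_0_iff)
    qed
    ultimately have "2 * x * (inner (K * X) X + inner (K * Y) Y) < 0" by linarith
    moreover have "0 \<le> inner (K * X) X + inner (K * Y) Y" using K(1) unfolding psdq_def by (simp add: inner_commute)
    ultimately show "x < 0" by (smt (verit, best) mult_nonneg_nonneg)
  qed
  then have "stable At\<^sup>T" using stable_iff_stb[OF At'] by simp
  then show ?thesis using stable_transpose[OF At'] by simp
qed

lemma perturbation_arith:
  fixes \<omega> \<eta> y a e :: real
  assumes "0 \<le> \<eta>" "\<eta> < 1 / 2" "y \<le> 7 / 16 * \<eta>" "0 \<le> \<omega>" "\<omega> * (3 / 4 - 2 * y) \<le> a * \<eta>\<^sup>2 + e" "0 \<le> a" "0 \<le> e"
  shows "(1 - 2 * \<eta>) * \<omega> \<le> 16 / 5 * (a * (\<eta> / 8) + e)"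
proof -
  have "\<omega> * (5 / 16) \<le> \<omega> * (3 / 4 - 2 * y)" using assms by (intro mult_left_mono) simp_all
  then have "\<omega> * (5 / 16) \<le> a * \<eta>\<^sup>2 + e" using assms(5) by (rule order_trans)
  then have "\<omega> \<le> 16 / 5 * (a * \<eta>\<^sup>2 + e)" by (simp add: field_simps)
  then have "(1 - 2 * \<eta>) * \<omega> \<le> (1 - 2 * \<eta>) * (16 / 5 * (a * \<eta>\<^sup>2 + e))" using assms by (intro mult_left_mono) simp_all
  also have "\<dots> = 16 / 5 * (a * (\<eta> * (\<eta> * (1 - 2 * \<eta>))) + (1 - 2 * \<eta>) * e)" by (simp add: power2_eq_square field_simps)
  also have "\<dots> \<le> 16 / 5 * (a * (\<eta> * (1 / 8)) + 1 * e)"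
  proof (intro mult_left_mono add_mono mult_right_mono)
    show "\<eta> * (1 - 2 * \<eta>) \<le> 1 / 8" using zero_le_power2[of "\<eta> - 1 / 4"] by (simp add: power2_eq_square algebra_simps)
  qed (use assms in simp_all)
  finally show ?thesis by simp
qed

lemma truncation_difference:
  assumes A1: "A1 \<in> carrier_mat r r" "stable A1" and A2: "A2 \<in> carrier_mat r r" and r: "0 < r"
    and B: "B1 \<in> carrier_mat r m" "B2 \<in> carrier_mat r m" and C: "C1 \<in> carrier_mat r p" "C2 \<in> carrier_mat r p"
    and K1: "fs A1 * K1 + K1 * tp (fs A1) = - Id_n r" "psdq K1" "tp K1 = K1" "Id_n r * K1 = K1" "K1 * Id_n r = K1"
    and K2: "tp (fs A1) * K2 + K2 * fs A1 = - Id_n r" "Id_n r * K2 = K2" "K2 * Id_n r = K2"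
    and gP: "gfac r (fs A1) (fs B1) (Id_n r)" and gQ: "gfac r (tp (fs A1)) (fs C1) D" and \<sigma>: "opn D \<le> \<sigma>"
    and y: "y1 = opn K1 * opn (fs A2 - fs A1)" "y2 = opn K2 * opn (fs A2 - fs A1)" "y1 < 1 / 2"
    and G: "G1 = transfer_fun A1 B1 C1" "G2 = transfer_fun A2 B2 C2"
  obtains wc wo where "stable A2" "0 \<le> wc" "0 \<le> wo"
    "wc\<^sup>2 * (3 / 4 - 2 * y1) \<le> 4 * y1\<^sup>2 + opn K1 * (opn (fs B2 - fs B1))\<^sup>2"
    "wo\<^sup>2 * (3 / 4 - 2 * y2) \<le> 4 * \<sigma>\<^sup>2 * y2\<^sup>2 + opn K2 * (opn (fs C2 - fs C1))\<^sup>2"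
    "hankel_norm (\<lambda>s. G1 s + - G2 s) \<le> \<sigma> * wc + wo * (1 + wc)"
    "h2_norm (\<lambda>s. G1 s + - G2 s) \<le> sqrt (min r m) * (\<sigma> * opn (fs B2 - fs B1) + wo * opn (fs B2))"
proof -
  have st: "stable A2" by (rule stable_perturbation[OF A2 K1(2,3) _ K1(1)]) (use y in simp)
  have C2: "- C2 \<in> carrier_mat r p" using C by simp
  obtain S1 S2 R1 R2 where f:
    "gfac (r + r) (fs (block_diag A1 A2)) (fs (B1 @\<^sub>r B2)) (S1 + Sh r r * S2)"
    "gfac (r + r) (tp (fs (block_diag A1 A2))) (fs (C1 @\<^sub>r - C2)) (R1 + Sh r r * R2)"
    "gfac r (fs A1) (fs B1) S1" "gfac r (fs A2) (fs B2) S2"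
    "fs A1 * (S1 * tp S2) + S1 * tp S2 * tp (fs A2) + fs B1 * tp (fs B2) = 0"
    "gfac r (tp (fs A1)) (fs C1) R1" "gfac r (tp (fs A2)) (fs (- C2)) R2"
    "tp (fs A1) * (R1 * tp R2) + R1 * tp R2 * fs A2 + fs C1 * tp (fs (- C2)) = 0"
    "tp (R1 + Sh r r * R2) * (S1 + Sh r r * S2) = tp R1 * S1 + tp R2 * S2"
    "tp (R1 + Sh r r * R2) * fs (B1 @\<^sub>r B2) = tp R1 * fs B1 + tp R2 * fs B2"
    by (rule parallel_factors[OF A1 A2 st B C(1) C2])
  have A1t: "A1\<^sup>T \<in> carrier_mat r r" "stable A1\<^sup>T" using A1 stable_transpose by simp_all
  have "S1 * tp S1 = Id_n r * tp (Id_n r)" by (rule gfac_unique[OF A1 f(3) gP])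
  then have "(opn S1)\<^sup>2 = (opn (Id_n r))\<^sup>2" unfolding opn_mult_tp[symmetric] by simp
  then have "opn S1 = opn (Id_n r)" by (rule power2_eq_imp_eq) simp_all
  then have oS1: "opn S1 \<le> 1" using opn_Id_le by simp
  have "R1 * tp R1 = D * tp D" by (rule gfac_unique[OF A1t]) (use f(6) gQ in simp_all)
  then have "(opn R1)\<^sup>2 = (opn D)\<^sup>2" unfolding opn_mult_tp[symmetric] by simp
  then have "opn R1 = opn D" by (rule power2_eq_imp_eq) simp_all
  then have oR1: "opn R1 \<le> \<sigma>" using \<sigma> by simp
  define wc where "wc = opn (S2 - S1)"
  define wo where "wo = opn (R1 + R2)"
  have 1: "wc\<^sup>2 * (3 / 4 - 2 * y1) \<le> 4 * 1\<^sup>2 * y1\<^sup>2 + opn K1 * (opn (fs B2 - fs B1))\<^sup>2"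
    unfolding wc_def y by (rule gfac_perturbation[OF A1 K1(4,5,1) f(3-5) oS1])
  have 2: "wo\<^sup>2 * (3 / 4 - 2 * y2) \<le> 4 * \<sigma>\<^sup>2 * y2\<^sup>2 + opn K2 * (opn (fs C2 - fs C1))\<^sup>2"
  proof -
    have g2: "gfac r (tp (fs A2)) (fs C2) (- R2)" using f(7) unfolding gfac_def by simp
    have x: "fs A1\<^sup>T * (R1 * tp (- R2)) + R1 * tp (- R2) * tp (tp (fs A2)) + fs C1 * tp (fs C2) = 0"
    proof -
      have "fs A1\<^sup>T * (R1 * tp (- R2)) + R1 * tp (- R2) * tp (tp (fs A2)) + fs C1 * tp (fs C2)
        = - (tp (fs A1) * (R1 * tp R2) + R1 * tp R2 * fs A2 + fs C1 * tp (fs (- C2)))" by simp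
      then show ?thesis unfolding f(8) by simp
    qed
    have k: "fs A1\<^sup>T * K2 + K2 * tp (fs A1\<^sup>T) = - Id_n r" using K2(1) by simp
    have g1: "gfac r (fs A1\<^sup>T) (fs C1) R1" using f(6) by simp
    have "opn (tp (fs A2) - fs A1\<^sup>T) = opn (tp (fs A2 - fs A1))" by simp
    then have "opn (tp (fs A2) - fs A1\<^sup>T) = opn (fs A2 - fs A1)" unfolding opn_tp .
    moreover have "opn (- R2 - R1) = wo"
    proof -
      have "- R2 - R1 = - (R1 + R2)" by simp
      then show ?thesis unfolding wo_def by (simp only: opn_minus)
    qed
    ultimately show ?thesis using gfac_perturbation[OF A1t K2(2,3) k g1 g2 x oR1] unfolding y by simp
  qed
  have S2: "opn S2 \<le> 1 + wc" using opn_triangle[of S1 "S2 - S1"] oS1 unfolding wc_def by simp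
  have nr: "tp R1 * X + tp R2 * Y = tp R1 * (X - Y) + tp (R1 + R2) * Y" for X Y
    by (simp add: right_diff_distrib distrib_right)
  have r1: "stable_realization G1 A1 B1 C1" and r2: "stable_realization G2 A2 B2 C2"
    unfolding stable_realization_def G using A1 A2 B C r st by auto
  have d: "dim_col B1 = dim_col B2" "dim_col C1 = dim_col (- C2)" using B C by auto
  note nm = norms_of_factors[OF stable_realization_add[OF r1 stable_realization_uminus[OF r2] d] block_diag_carrier[OF A1(1) A2] f(1,2)]
  have "hankel_norm (\<lambda>s. G1 s + - G2 s) \<le> \<sigma> * wc + wo * (1 + wc)"
    unfolding nm f(9) nr
  proof (intro opn_add_le opn_mult_le S2)
    show "opn (tp R1) \<le> \<sigma>" "opn (S1 - S2) \<le> wc" "opn (tp (R1 + R2)) \<le> wo"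
      unfolding opn_tp wc_def wo_def using oR1 opn_minus_commute[of S1 S2] by simp_all
  qed
  moreover have "h2_norm (\<lambda>s. G1 s + - G2 s) \<le> sqrt (min r m) * (\<sigma> * opn (fs B2 - fs B1) + wo * opn (fs B2))"
  proof -
    have bI: "Id_n r * fs B2 = fs B2" "fs B2 * Id_n m = fs B2" "Id_n r * fs B1 = fs B1" "fs B1 * Id_n m = fs B1" using B by simp_all
    have e1: "norm (tp R1 * (fs B1 - fs B2)) \<le> \<sigma> * (sqrt (min r m) * opn (fs B2 - fs B1))"
    proof -
      have "norm (tp R1 * (fs B1 - fs B2)) \<le> opn (tp R1) * norm (fs B1 - fs B2)" by (rule norm_mult_opn)
      also have "\<dots> \<le> \<sigma> * (sqrt (min r m) * opn (fs B1 - fs B2))"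
      proof (intro mult_mono norm_le_min)
        show "0 \<le> \<sigma>" using oR1 opn_ge_0[of R1] by linarith
      qed (use oR1 bI in \<open>simp_all add: right_diff_distrib left_diff_distrib\<close>)
      finally show ?thesis unfolding opn_minus_commute[of "fs B1"] .
    qed
    have e2: "norm (tp (R1 + R2) * fs B2) \<le> wo * (sqrt (min r m) * opn (fs B2))"
    proof -
      have "norm (tp (R1 + R2) * fs B2) \<le> opn (tp (R1 + R2)) * norm (fs B2)" by (rule norm_mult_opn)
      also have "\<dots> \<le> wo * (sqrt (min r m) * opn (fs B2))"
        unfolding opn_tp wo_def by (intro mult_left_mono norm_le_min bI) simp
      finally show ?thesis .
    qed
    have "norm (tp R1 * (fs B1 - fs B2) + tp (R1 + R2) * fs B2)
        \<le> \<sigma> * (sqrt (min r m) * opn (fs B2 - fs B1)) + wo * (sqrt (min r m) * opn (fs B2))"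
      by (rule norm_triangle_le[OF add_mono[OF e1 e2]])
    then show ?thesis unfolding nm f(10) nr by (simp add: algebra_simps)
  qed
  moreover have "0 \<le> wc" "0 \<le> wo" unfolding wc_def wo_def by simp_all
  ultimately show ?thesis using that[of wc wo] st 1 2 by simp
qed

section \<open>The error bound\<close>

lemma square_bound_arith:
  fixes wc wo s z \<sigma> :: real
  assumes "0 \<le> wc" "0 \<le> wo" "0 \<le> \<sigma>" "wc\<^sup>2 \<le> s / 2" "wo\<^sup>2 \<le> z / 2"
  shows "\<sigma> * wc + wo * (1 + wc) \<le> sqrt (2 * \<sigma>\<^sup>2 * s + 2 * z + s * z)"
proof (rule real_le_rsqrt)
  have sz: "0 \<le> s" "0 \<le> z" using assms(4,5) zero_le_power2[of wc] zero_le_power2[of wo] by linarith+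
  have sq: "(x + y)\<^sup>2 \<le> 2 * x\<^sup>2 + 2 * y\<^sup>2" for x y :: real
    using zero_le_power2[of "x - y"] by (simp add: power2_eq_square algebra_simps)
  have "(\<sigma> * wc + wo * (1 + wc))\<^sup>2 \<le> 2 * (\<sigma> * wc)\<^sup>2 + 2 * (wo * (1 + wc))\<^sup>2" by (rule sq)
  also have "\<dots> = 2 * \<sigma>\<^sup>2 * wc\<^sup>2 + 2 * wo\<^sup>2 * (1 + wc)\<^sup>2" by (simp add: power_mult_distrib)
  also have "\<dots> \<le> 2 * \<sigma>\<^sup>2 * s + 2 * (z / 2) * (2 + s)"
  proof (rule add_mono)
    show "2 * \<sigma>\<^sup>2 * wc\<^sup>2 \<le> 2 * \<sigma>\<^sup>2 * s" using assms sz by (intro mult_left_mono) simp_all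
    have "(1 + wc)\<^sup>2 \<le> 2 + s" using sq[of 1 wc] assms by simp
    then show "2 * wo\<^sup>2 * (1 + wc)\<^sup>2 \<le> 2 * (z / 2) * (2 + s)" using assms sz by (intro mult_mono) simp_all
  qed
  also have "\<dots> = 2 * \<sigma>\<^sup>2 * s + 2 * z + s * z" by (simp add: algebra_simps)
  finally show "(\<sigma> * wc + wo * (1 + wc))\<^sup>2 \<le> 2 * \<sigma>\<^sup>2 * s + 2 * z + s * z" .
qed

context perturbed_inv begin

abbreviation "\<theta> \<equiv> opn R / \<sigma>r"

lemma \<theta>_ge_0: "0 \<le> \<theta>" using \<sigma>r_pos by simp

lemma truncation_bounds:
  assumes cA: "Ah \<in> carrier_mat r r" "At \<in> carrier_mat r r" and cB: "Bh \<in> carrier_mat r m" "Bt \<in> carrier_mat r m"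
    and cC: "Ch \<in> carrier_mat r p" "Ct \<in> carrier_mat r p" and stA: "stable Ah"
    and f: "fs Ah = tp Y1 * a * X1" "fs At = tp Y2 * a * X2" "fs Bh = tp Y1 * b" "fs Bt = tp Y2 * b" "fs Ch = tp X1 * c" "fs Ct = tp X2 * c"
    and \<sigma>1: "\<And>i. i < r \<Longrightarrow> d i \<le> \<sigma>1"
    and K1: "K1 = mat_integral {0..} r r (\<lambda>t. mat_exp (t \<cdot>\<^sub>m Ah) * mat_exp (t \<cdot>\<^sub>m Ah\<^sup>T))"
    and K2: "K2 = mat_integral {0..} r r (\<lambda>t. mat_exp (t \<cdot>\<^sub>m Ah\<^sup>T) * mat_exp (t \<cdot>\<^sub>m Ah))"
    and \<epsilon>: "8 * (opn S * \<theta>) * mu \<le> \<epsilon>a" "6 * \<theta> * mu \<le> \<epsilon>b" "12 * \<theta>\<^sup>2 * mu \<le> \<epsilon>b2" "4 * (opn S)\<^sup>2 * mu \<le> \<epsilon>c2"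
    and \<eta>: "\<eta>1 = opn a * opn (fs K1) * \<epsilon>a" "\<eta>2 = opn a * opn (fs K2) * \<epsilon>a" "\<eta>1 < 1 / 2" "\<eta>2 < 1 / 2"
    and \<xi>: "0 \<le> \<xi>1" "\<xi>2 = opn (fs K1) / (1 - 2 * \<eta>1) * ((opn b)\<^sup>2 * \<epsilon>b2 + 2 * opn a * \<epsilon>a)"
    and \<zeta>: "0 \<le> \<zeta>1" "\<zeta>2 = opn (fs K2) / (1 - 2 * \<eta>2) * ((opn c)\<^sup>2 * \<epsilon>c2 + 2 * opn a * \<epsilon>a)"
    and G: "G1 = transfer_fun Ah Bh Ch" "G2 = transfer_fun At Bt Ct"
  shows "stable At"
    "hankel_norm (\<lambda>s. G1 s + - G2 s) \<le> sqrt (2 * \<sigma>1\<^sup>2 * (\<xi>1 + \<xi>2) + 2 * (\<zeta>1 + \<zeta>2) + (\<xi>1 + \<xi>2) * (\<zeta>1 + \<zeta>2))"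
    "h2_norm (\<lambda>s. G1 s + - G2 s) \<le> sqrt (min r m) * sqrt (\<sigma>1\<^sup>2 * (opn (fs Bh) + opn (fs Bt)) * opn b * \<epsilon>b
      + (2 * opn (fs Bh) * opn (fs Bt) * \<zeta>1 + (opn (fs Bt))\<^sup>2 * \<zeta>2))"
proof -
  define k1 where "k1 = opn (fs K1)"
  define k2 where "k2 = opn (fs K2)"
  define \<alpha> where "\<alpha> = opn a"
  define \<Delta> where "\<Delta> = opn (fs At - fs Ah)"
  define y1 where "y1 = k1 * \<Delta>"
  define y2 where "y2 = k2 * \<Delta>"
  have pos: "0 \<le> k1" "0 \<le> k2" "0 \<le> \<alpha>" "0 \<le> \<Delta>" unfolding k1_def k2_def \<alpha>_def \<Delta>_def by simp_all
  have \<sigma>1r: "\<sigma>r \<le> \<sigma>1" using d[OF r_pos] \<sigma>1[OF r_pos] by linarith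
  have \<sigma>1p: "0 < \<sigma>1" using \<sigma>1r \<sigma>r_pos by linarith
  have cAt: "Ah\<^sup>T \<in> carrier_mat r r" "stable Ah\<^sup>T" using cA stA stable_transpose by simp_all
  note g1 = gramian_integral[OF cA(1) stA, folded K1]
  have K2': "K2 = mat_integral {0..} r r (\<lambda>t. mat_exp (t \<cdot>\<^sub>m Ah\<^sup>T) * mat_exp (t \<cdot>\<^sub>m (Ah\<^sup>T)\<^sup>T))" unfolding K2 by simp
  note g2 = gramian_integral[OF cAt, folded K2']
  have g2': "tp (fs Ah) * fs K2 + fs K2 * fs Ah = - Id_n r" using g2(1) by simp
  have IK: "Id_n r * fs K1 = fs K1" "fs K1 * Id_n r = fs K1" "Id_n r * fs K2 = fs K2" "fs K2 * Id_n r = fs K2"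
    using g1(4) g2(4) by simp_all
  have Ia: "Id_n r * fs Ah = fs Ah" "fs Ah * Id_n r = fs Ah" "Id_n r * tp (fs Ah) = tp (fs Ah)" using cA by simp_all
  have gP: "gfac r (fs Ah) (fs Bh) (Id_n r)"
    unfolding gfac_def using reduced_lyapunov_P Ia unfolding f(1)[symmetric] f(3)[symmetric] by simp
  have gQ: "gfac r (tp (fs Ah)) (fs Ch) (Dg r d)"
    unfolding gfac_def using reduced_lyapunov_Q unfolding f(1)[symmetric] f(5)[symmetric] by (simp add: Dg_mult)
  have oD: "opn (Dg r d) \<le> \<sigma>1"
  proof (rule opn_Dg_le)
    fix i assume "i < r"
    then show "\<bar>d i\<bar> \<le> \<sigma>1" using d[of i] \<sigma>1[of i] \<sigma>r_pos by linarith
  qed (use \<sigma>1p in simp)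
  have D: "\<Delta> \<le> 14 * mu\<^sup>2 * (opn S * \<theta>) * \<alpha>" unfolding \<Delta>_def \<alpha>_def f(1,2) by (rule reduced_perturbation)
  have "14 * mu\<^sup>2 * (opn S * \<theta>) * \<alpha> = 7 / 4 * mu * (8 * (opn S * \<theta>) * mu) * \<alpha>" by (simp add: power2_eq_square)
  also have "\<dots> \<le> 7 / 4 * mu * \<epsilon>a * \<alpha>" using mu pos \<epsilon> by (intro mult_right_mono mult_left_mono) simp_all
  finally have D': "\<Delta> \<le> 7 / 4 * mu * \<epsilon>a * \<alpha>" using D by linarith
  have \<epsilon>a: "0 \<le> \<epsilon>a"
  proof -
    have "0 \<le> 8 * (opn S * \<theta>) * mu" using mu \<sigma>r_pos by simp
    then show ?thesis using \<epsilon>(1) by linarith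
  qed
  have \<eta>0: "0 \<le> \<eta>1" "0 \<le> \<eta>2" unfolding \<eta> using \<epsilon>a by simp_all
  have y0: "0 \<le> y1" "0 \<le> y2" unfolding y1_def y2_def using pos by simp_all
  have yb: "y1 \<le> 7 / 4 * mu * \<eta>1" "y2 \<le> 7 / 4 * mu * \<eta>2"
  proof -
    have "k1 * \<Delta> \<le> k1 * (7 / 4 * mu * \<epsilon>a * \<alpha>)" "k2 * \<Delta> \<le> k2 * (7 / 4 * mu * \<epsilon>a * \<alpha>)" by (rule mult_left_mono[OF D' pos(1)] mult_left_mono[OF D' pos(2)])+
    then show "y1 \<le> 7 / 4 * mu * \<eta>1" "y2 \<le> 7 / 4 * mu * \<eta>2"
      unfolding y1_def y2_def \<eta> k1_def k2_def \<alpha>_def by (simp_all add: mult_ac)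
  qed
  have m4: "mu * x \<le> x / 4" if "0 \<le> x" for x using mult_quarter(1)[OF that] by (simp add: mult.commute)
  have y7: "y1 \<le> 7 / 16 * \<eta>1" "y2 \<le> 7 / 16 * \<eta>2" using yb m4[OF \<eta>0(1)] m4[OF \<eta>0(2)] by linarith+
  have y12: "y1 < 1 / 2" using y7 \<eta> by linarith
  obtain wc wo where w: "stable At" "0 \<le> wc" "0 \<le> wo"
    "wc\<^sup>2 * (3 / 4 - 2 * y1) \<le> 4 * y1\<^sup>2 + opn (fs K1) * (opn (fs Bt - fs Bh))\<^sup>2"
    "wo\<^sup>2 * (3 / 4 - 2 * y2) \<le> 4 * (opn (Dg r d))\<^sup>2 * y2\<^sup>2 + opn (fs K2) * (opn (fs Ct - fs Ch))\<^sup>2"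
    "hankel_norm (\<lambda>s. G1 s + - G2 s) \<le> opn (Dg r d) * wc + wo * (1 + wc)"
    "h2_norm (\<lambda>s. G1 s + - G2 s) \<le> sqrt (min r m) * (opn (Dg r d) * opn (fs Bt - fs Bh) + wo * opn (fs Bt))"
    by (rule truncation_difference[OF cA(1) stA cA(2) r_pos cB cC g1(1-3) IK(1,2) g2' IK(3,4) gP gQ order_refl
        y1_def[unfolded k1_def \<Delta>_def] y2_def[unfolded k2_def \<Delta>_def] y12 G])
  show "stable At" by (rule w)
  define \<beta> where "\<beta> = opn b"
  define \<chi> where "\<chi> = opn c"
  have dB: "opn (fs Bt - fs Bh) \<le> 31 / 5 * mu\<^sup>2 * \<theta> * \<beta>"
  proof -
    have "fs Bt - fs Bh = tp (Y2 - Y1) * b" unfolding f by (simp add: left_diff_distrib)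
    moreover have "opn (tp (Y2 - Y1)) \<le> 31 / 5 * mu\<^sup>2 * \<theta>" unfolding opn_tp by (rule Y_perturbation)
    ultimately show ?thesis unfolding \<beta>_def using opn_mult_le[OF _ order_refl] by metis
  qed
  have dC: "opn (fs Ct - fs Ch) \<le> 5 * mu\<^sup>2 * opn S * \<chi>"
  proof -
    have "fs Ct - fs Ch = tp (X2 - X1) * c" unfolding f by (simp add: left_diff_distrib)
    moreover have "opn (tp (X2 - X1)) \<le> 5 * mu\<^sup>2 * opn S" unfolding opn_tp by (rule X_perturbation)
    ultimately show ?thesis unfolding \<chi>_def using opn_mult_le[OF _ order_refl] by metis
  qed
  have \<beta>0: "0 \<le> \<beta>" "0 \<le> \<chi>" unfolding \<beta>_def \<chi>_def by simp_all
  have mu4: "(mu\<^sup>2)\<^sup>2 \<le> mu / 64"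
  proof -
    have "mu\<^sup>2 * mu\<^sup>2 \<le> 1 / 16 * (mu * (1 / 4))"
    proof (intro mult_mono mu_sq)
      show "mu\<^sup>2 \<le> mu * (1 / 4)" unfolding power2_eq_square using mu by (intro mult_left_mono) simp_all
    qed (use mu in simp_all)
    then show ?thesis by (simp add: power2_eq_square)
  qed
  define M where "M = k1 * (\<theta> * \<beta>)\<^sup>2"
  define \<Lambda> where "\<Lambda> = k2 * (opn S * \<chi>)\<^sup>2"
  have MLp: "0 \<le> M" "0 \<le> \<Lambda>" unfolding M_def \<Lambda>_def using pos by simp_all
  have kB: "k1 * (opn (fs Bt - fs Bh))\<^sup>2 \<le> 5 / 8 * (mu * M)"
  proof -
    have "(opn (fs Bt - fs Bh))\<^sup>2 \<le> (31 / 5 * mu\<^sup>2 * \<theta> * \<beta>)\<^sup>2" by (intro power_mono dB) simp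
    also have "\<dots> = 961 / 25 * (mu\<^sup>2)\<^sup>2 * (\<theta> * \<beta>)\<^sup>2" by (simp add: power_mult_distrib power2_eq_square)
    also have "\<dots> \<le> 961 / 25 * (mu / 64) * (\<theta> * \<beta>)\<^sup>2" by (intro mult_right_mono mult_left_mono mu4) simp_all
    finally have "k1 * (opn (fs Bt - fs Bh))\<^sup>2 \<le> k1 * (961 / 25 * (mu / 64) * (\<theta> * \<beta>)\<^sup>2)" using pos by (intro mult_left_mono)
    also have "\<dots> = 961 / 1600 * (mu * M)" unfolding M_def by (simp add: field_simps)
    also have "\<dots> \<le> 5 / 8 * (mu * M)" using MLp mu by (intro mult_right_mono) simp_all
    finally show ?thesis .
  qed
  have kC: "k2 * (opn (fs Ct - fs Ch))\<^sup>2 \<le> 25 / 64 * (mu * \<Lambda>)"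
  proof -
    have "(opn (fs Ct - fs Ch))\<^sup>2 \<le> (5 * mu\<^sup>2 * opn S * \<chi>)\<^sup>2" by (intro power_mono dC) simp
    also have "\<dots> = 25 * (mu\<^sup>2)\<^sup>2 * (opn S * \<chi>)\<^sup>2" by (simp add: power_mult_distrib power2_eq_square)
    also have "\<dots> \<le> 25 * (mu / 64) * (opn S * \<chi>)\<^sup>2" by (intro mult_right_mono mult_left_mono mu4) simp_all
    finally have "k2 * (opn (fs Ct - fs Ch))\<^sup>2 \<le> k2 * (25 * (mu / 64) * (opn S * \<chi>)\<^sup>2)" using pos by (intro mult_left_mono)
    also have "\<dots> = 25 / 64 * (mu * \<Lambda>)" unfolding \<Lambda>_def by (simp add: field_simps)
    finally show ?thesis .
  qed
  have \<sigma>\<Lambda>: "(opn (Dg r d))\<^sup>2 \<le> \<Lambda>"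
  proof -
    have "inner X (Dg r d * Dg r d * X) \<le> (opn (fs Ch))\<^sup>2 * opn (fs K2) * (norm X)\<^sup>2" for X
    proof (rule lyapunov_le[OF cAt IK(3,4) g2(1)])
      show "fs Ah\<^sup>T * (Dg r d * Dg r d) + Dg r d * Dg r d * tp (fs Ah\<^sup>T) + fs Ch * tp (fs Ch) = 0"
        using gQ unfolding gfac_def by simp
      show "inner Y (fs Ch * tp (fs Ch) * Y) \<le> (opn (fs Ch))\<^sup>2 * (norm Y)\<^sup>2" for Y
        unfolding opn_mult_tp[symmetric] by (rule inner_mult_le)
    qed (simp_all add: Dg_mult)
    moreover have "(norm (Dg r d * X))\<^sup>2 = inner X (Dg r d * Dg r d * X)" for X
      by (simp only: power2_norm_eq_inner inner_left_mult tp_Dg mult.assoc)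
    ultimately have "opn (Dg r d) \<le> sqrt ((opn (fs Ch))\<^sup>2 * opn (fs K2))" by (intro opn_sq_leI) simp_all
    then have "(opn (Dg r d))\<^sup>2 \<le> (sqrt ((opn (fs Ch))\<^sup>2 * opn (fs K2)))\<^sup>2" by (intro power_mono) simp_all
    also have "\<dots> = (opn (fs Ch))\<^sup>2 * k2" unfolding k2_def by simp
    also have "\<dots> \<le> (opn S * \<chi>)\<^sup>2 * k2"
    proof (intro mult_right_mono power_mono pos)
      have "opn (tp X1) \<le> opn S" unfolding opn_tp by (rule opn_X1)
      then show "opn (fs Ch) \<le> opn S * \<chi>" unfolding f \<chi>_def by (rule opn_mult_le) simp
    qed simp
    finally show ?thesis unfolding \<Lambda>_def by (simp add: mult.commute)
  qed
  have wc: "wc\<^sup>2 \<le> \<xi>2 / 2"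
  proof -
    have "y1\<^sup>2 \<le> (7 / 16 * \<eta>1)\<^sup>2" by (intro power_mono y7 y0)
    then have "4 * y1\<^sup>2 \<le> 49 / 64 * \<eta>1\<^sup>2" by (simp add: power_mult_distrib power2_eq_square)
    then have "wc\<^sup>2 * (3 / 4 - 2 * y1) \<le> 49 / 64 * \<eta>1\<^sup>2 + 5 / 8 * (mu * M)" using w(4) kB unfolding k1_def by linarith
    then have "(1 - 2 * \<eta>1) * wc\<^sup>2 \<le> 16 / 5 * (49 / 64 * (\<eta>1 / 8) + 5 / 8 * (mu * M))"
      by (rule perturbation_arith[OF \<eta>0(1) \<eta>(3) y7(1) zero_le_power2]) (use MLp mu in simp_all)
    also have "\<dots> \<le> 6 * (mu * M) + \<eta>1" using MLp mu \<eta>0 mult_nonneg_nonneg[of mu M] by simp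
    also have "6 * (mu * M) \<le> k1 * \<beta>\<^sup>2 * \<epsilon>b2 / 2"
    proof -
      have "k1 * \<beta>\<^sup>2 * (12 * \<theta>\<^sup>2 * mu) \<le> k1 * \<beta>\<^sup>2 * \<epsilon>b2" using pos \<epsilon> by (intro mult_left_mono) simp_all
      moreover have "6 * (mu * (k * (x * z))) \<le> k * z * e / 2" if "k * z * (12 * x * mu) \<le> k * z * e" for k x z e
        using that by (simp add: mult_ac)
      ultimately show ?thesis unfolding M_def power_mult_distrib by blast
    qed
    also have "k1 * \<beta>\<^sup>2 * \<epsilon>b2 / 2 + \<eta>1 = (1 - 2 * \<eta>1) * (\<xi>2 / 2)"
    proof -
      have "(1 - 2 * \<eta>1) * \<xi>2 = k1 * (\<beta>\<^sup>2 * \<epsilon>b2 + 2 * \<alpha> * \<epsilon>a)"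
        unfolding \<xi> k1_def \<alpha>_def \<beta>_def using \<eta>(3) by (simp add: field_simps)
      then show ?thesis unfolding \<eta> k1_def \<alpha>_def by (simp add: field_simps)
    qed
    finally show ?thesis using \<eta> by simp
  qed
  have wo: "wo\<^sup>2 \<le> \<zeta>2 / 2"
  proof -
    have "y2\<^sup>2 \<le> (7 / 4 * mu * \<eta>2)\<^sup>2" by (intro power_mono yb y0)
    also have "\<dots> = 49 / 16 * (mu * mu) * \<eta>2\<^sup>2" by (simp add: power_mult_distrib power2_eq_square)
    also have "\<dots> \<le> 49 / 16 * (mu * (1 / 4)) * \<eta>2\<^sup>2" using mu by (intro mult_right_mono mult_left_mono) simp_all
    finally have "4 * (opn (Dg r d))\<^sup>2 * y2\<^sup>2 \<le> 4 * \<Lambda> * (49 / 16 * (mu * (1 / 4)) * \<eta>2\<^sup>2)"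
      using \<sigma>\<Lambda> MLp by (intro mult_mono) simp_all
    also have "\<dots> = 49 / 16 * (mu * \<Lambda>) * \<eta>2\<^sup>2" by simp
    finally have "wo\<^sup>2 * (3 / 4 - 2 * y2) \<le> 49 / 16 * (mu * \<Lambda>) * \<eta>2\<^sup>2 + 25 / 64 * (mu * \<Lambda>)"
      using w(5) kC unfolding k2_def by linarith
    then have "(1 - 2 * \<eta>2) * wo\<^sup>2 \<le> 16 / 5 * (49 / 16 * (mu * \<Lambda>) * (\<eta>2 / 8) + 25 / 64 * (mu * \<Lambda>))"
      by (rule perturbation_arith[OF \<eta>0(2) \<eta>(4) y7(2) zero_le_power2]) (use MLp mu in simp_all)
    also have "\<dots> \<le> 16 / 5 * (49 / 16 * (mu * \<Lambda>) * (1 / 16) + 25 / 64 * (mu * \<Lambda>))"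
    proof -
      have "49 / 16 * (mu * \<Lambda>) * (\<eta>2 / 8) \<le> 49 / 16 * (mu * \<Lambda>) * (1 / 16)"
        by (intro mult_left_mono) (use \<eta>(4) MLp mu in simp_all)
      then show ?thesis by simp
    qed
    also have "\<dots> \<le> 2 * (mu * \<Lambda>)" using MLp mu mult_nonneg_nonneg[of mu \<Lambda>] by simp
    also have "\<dots> \<le> k2 * \<chi>\<^sup>2 * \<epsilon>c2 / 2"
    proof -
      have "k2 * \<chi>\<^sup>2 * (4 * (opn S)\<^sup>2 * mu) \<le> k2 * \<chi>\<^sup>2 * \<epsilon>c2" using pos \<epsilon> by (intro mult_left_mono) simp_all
      then show ?thesis unfolding \<Lambda>_def by (simp add: power_mult_distrib mult_ac)
    qed
    also have "\<dots> \<le> k2 * \<chi>\<^sup>2 * \<epsilon>c2 / 2 + \<eta>2" using \<eta>0 by simp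
    also have "k2 * \<chi>\<^sup>2 * \<epsilon>c2 / 2 + \<eta>2 = (1 - 2 * \<eta>2) * (\<zeta>2 / 2)"
    proof -
      have "(1 - 2 * \<eta>2) * \<zeta>2 = k2 * (\<chi>\<^sup>2 * \<epsilon>c2 + 2 * \<alpha> * \<epsilon>a)"
        unfolding \<zeta> k2_def \<alpha>_def \<chi>_def using \<eta>(4) by (simp add: field_simps)
      then show ?thesis unfolding \<eta> k2_def \<alpha>_def by (simp add: field_simps)
    qed
    finally show ?thesis using \<eta> by simp
  qed
  have "hankel_norm (\<lambda>s. G1 s + - G2 s) \<le> \<sigma>1 * wc + wo * (1 + wc)"
    using w(6) mult_right_mono[OF oD w(2)] by linarith
  also have "\<dots> \<le> sqrt (2 * \<sigma>1\<^sup>2 * (\<xi>1 + \<xi>2) + 2 * (\<zeta>1 + \<zeta>2) + (\<xi>1 + \<xi>2) * (\<zeta>1 + \<zeta>2))"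
    by (rule square_bound_arith[OF w(2,3)]) (use \<sigma>1p wc wo \<xi>(1) \<zeta>(1) in simp_all)
  finally show "hankel_norm (\<lambda>s. G1 s + - G2 s) \<le> sqrt (2 * \<sigma>1\<^sup>2 * (\<xi>1 + \<xi>2) + 2 * (\<zeta>1 + \<zeta>2) + (\<xi>1 + \<xi>2) * (\<zeta>1 + \<zeta>2))" .
  define h where "h = opn (fs Bh)"
  define t where "t = opn (fs Bt)"
  define q where "q = opn (fs Bt - fs Bh)"
  have hq: "0 \<le> h" "0 \<le> t" "0 \<le> q" unfolding h_def t_def q_def by simp_all
  have q1: "q \<le> h + t" unfolding h_def t_def q_def using opn_diff_triangle[of "fs Bt" "fs Bh"] by simp
  have q2: "2 * q \<le> \<beta> * \<epsilon>b"
  proof -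
    have "mu\<^sup>2 \<le> mu / 4" using mult_quarter(1)[OF mu(1)] by (simp add: power2_eq_square)
    then have "31 / 5 * mu\<^sup>2 * \<theta> * \<beta> \<le> 31 / 5 * (mu / 4) * \<theta> * \<beta>" using \<theta>_ge_0 \<beta>0 by (intro mult_right_mono mult_left_mono) simp_all
    then have "2 * q \<le> 2 * (31 / 5 * (mu / 4) * \<theta> * \<beta>)" using dB unfolding q_def by linarith
    also have "\<dots> = 31 / 10 * (\<theta> * mu * \<beta>)" by simp
    also have "\<dots> \<le> 6 * (\<theta> * mu * \<beta>)" using \<theta>_ge_0 \<beta>0 mu by (intro mult_right_mono mult_nonneg_nonneg) simp_all
    also have "\<dots> = 6 * \<theta> * mu * \<beta>" by simp
    also have "\<dots> \<le> \<epsilon>b * \<beta>" by (intro mult_right_mono \<epsilon> \<beta>0)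
    finally show ?thesis by (simp add: mult.commute)
  qed
  have "\<sigma>1 * q + wo * t \<le> sqrt (\<sigma>1\<^sup>2 * (h + t) * \<beta> * \<epsilon>b + (2 * h * t * \<zeta>1 + t\<^sup>2 * \<zeta>2))"
  proof (rule real_le_rsqrt)
    have "(\<sigma>1 * q + wo * t)\<^sup>2 \<le> 2 * (\<sigma>1 * q)\<^sup>2 + 2 * (wo * t)\<^sup>2"
      using zero_le_power2[of "\<sigma>1 * q - wo * t"] by (simp add: power2_eq_square algebra_simps)
    also have "\<dots> = \<sigma>1\<^sup>2 * (q * (2 * q)) + t\<^sup>2 * (2 * wo\<^sup>2)" by (simp add: power2_eq_square)
    also have "\<dots> \<le> \<sigma>1\<^sup>2 * ((h + t) * (\<beta> * \<epsilon>b)) + t\<^sup>2 * \<zeta>2"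
    proof (rule add_mono[OF mult_left_mono mult_left_mono])
      show "q * (2 * q) \<le> (h + t) * (\<beta> * \<epsilon>b)" by (rule mult_mono[OF q1 q2]) (use hq in simp_all)
      show "2 * wo\<^sup>2 \<le> \<zeta>2" using wo by simp
    qed simp_all
    also have "\<dots> \<le> \<sigma>1\<^sup>2 * (h + t) * \<beta> * \<epsilon>b + (2 * h * t * \<zeta>1 + t\<^sup>2 * \<zeta>2)"
    proof -
      have "0 \<le> 2 * h * t * \<zeta>1" using hq \<zeta>(1) by simp
      then show ?thesis by (simp add: mult.assoc)
    qed
    finally show "(\<sigma>1 * q + wo * t)\<^sup>2 \<le> \<sigma>1\<^sup>2 * (h + t) * \<beta> * \<epsilon>b + (2 * h * t * \<zeta>1 + t\<^sup>2 * \<zeta>2)" .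
  qed
  moreover have "opn (Dg r d) * q \<le> \<sigma>1 * q" by (intro mult_right_mono oD hq)
  ultimately have "opn (Dg r d) * q + wo * t \<le> sqrt (\<sigma>1\<^sup>2 * (h + t) * \<beta> * \<epsilon>b + (2 * h * t * \<zeta>1 + t\<^sup>2 * \<zeta>2))" by linarith
  then have "sqrt (min r m) * (opn (Dg r d) * q + wo * t) \<le> sqrt (min r m) * sqrt (\<sigma>1\<^sup>2 * (h + t) * \<beta> * \<epsilon>b + (2 * h * t * \<zeta>1 + t\<^sup>2 * \<zeta>2))"
    by (rule mult_left_mono) simp
  then show "h2_norm (\<lambda>s. G1 s + - G2 s) \<le> sqrt (min r m) * sqrt (\<sigma>1\<^sup>2 * (opn (fs Bh) + opn (fs Bt)) * opn b * \<epsilon>b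
      + (2 * opn (fs Bh) * opn (fs Bt) * \<zeta>1 + (opn (fs Bt))\<^sup>2 * \<zeta>2))"
    using w(7) unfolding h_def t_def q_def \<beta>_def by (rule order_trans[rotated])
qed

end

lemma append_cols_gram:
  assumes St: "St \<in> carrier_mat n k" and E: "E \<in> carrier_mat n l"
  defines "s \<equiv> fs (St @\<^sub>c E)"
  shows "Id_n n * s = s" "s * Id_n (k + l) = s" "s * Id_n k = fs St" "s * Sh k l = fs E"
    "s * tp s = fs St * tp (fs St) + fs E * tp (fs E)" "opn (s * (Id_n (k + l) - Id_n k)) \<le> opn (fs E)"
proof -
  have d: "dim_row St = n" "dim_col St = k" "dim_row E = n" "dim_col E = l" using St E by auto
  have s: "s = fs St + fs E * tp (Sh k l)" unfolding s_def using fs_append_cols[of St E] d by simp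
  have z: "fs St * Sh k l = 0" "tp (Sh k l) * tp (fs St) = 0"
  proof -
    show z1: "fs St * Sh k l = 0" using d by (intro fs_Sh) simp
    show "tp (Sh k l) * tp (fs St) = 0" using arg_cong[OF z1, of tp] by (simp only: tp_mult tp_simps)
  qed
  show 0: "Id_n n * s = s" unfolding s using d by (simp add: distrib_left mult.assoc[symmetric])
  show 1: "s * Id_n (k + l) = s" unfolding s using d by (simp add: distrib_right mult.assoc)
  show 2: "s * Id_n k = fs St" unfolding s using d by (simp add: distrib_right mult.assoc)
  show 3: "s * Sh k l = fs E" unfolding s using d z by (simp add: distrib_right mult.assoc)
  have k: "Id_n (k + l) = Id_n k * tp (Id_n k) + Sh k l * tp (Sh k l)" by simp
  have "s * tp s = s * Id_n (k + l) * tp s" unfolding 1 ..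
  also have "\<dots> = (s * Id_n k) * tp (s * Id_n k) + (s * Sh k l) * tp (s * Sh k l)"
    unfolding k by (simp only: distrib_left distrib_right mult.assoc tp_mult)
  finally show "s * tp s = fs St * tp (fs St) + fs E * tp (fs E)" unfolding 2 3 .
  have "s * (Id_n (k + l) - Id_n k) = fs E * tp (Sh k l)" unfolding Sh_tp_Sh[symmetric] 3[symmetric] by (simp only: mult.assoc)
  moreover have "opn (fs E * tp (Sh k l)) \<le> opn (fs E) * 1"
    by (rule opn_mult_le[OF order_refl]) (simp only: opn_tp, rule opn_isometry_le[of _ l], simp_all)
  ultimately show "opn (s * (Id_n (k + l) - Id_n k)) \<le> opn (fs E)" by simp
qed

lemma orth_blocks:
  assumes U1: "U1 \<in> carrier_mat m r" and U2: "U2 \<in> carrier_mat m (m - r)" and r: "r \<le> m" and o: "orth_mat (U1 @\<^sub>c U2)"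
  defines "u \<equiv> fs (U1 @\<^sub>c U2)" and "sh \<equiv> Sh r (m - r)"
  shows "tp u * u = Id_n m" "u * Id_n m = u" "u * Id_n r = fs U1" "u * sh = fs U2"
    "tp (fs U1) * fs U1 = Id_n r" "tp (fs U1) * fs U2 = 0" "tp (fs U2) * fs U1 = 0" "tp (fs U2) * fs U2 = Id_n (m - r)"
    "fs U1 * Id_n r = fs U1" "fs U1 * tp (fs U1) + fs U2 * tp (fs U2) = Id_n m" "opn (fs U1) \<le> 1" "opn (fs U2) \<le> 1"
proof -
  note g = append_cols_gram[OF U1 U2, folded u_def sh_def]
  have rm: "r + (m - r) = m" using r by simp
  have cU: "U1 @\<^sub>c U2 \<in> carrier_mat m m" unfolding append_cols_def using U1 U2 r by auto
  have o': "(U1 @\<^sub>c U2)\<^sup>T * (U1 @\<^sub>c U2) = 1\<^sub>m m" "(U1 @\<^sub>c U2) * (U1 @\<^sub>c U2)\<^sup>T = 1\<^sub>m m" using o cU unfolding orth_mat_def by auto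
  show uu: "tp u * u = Id_n m" using arg_cong[OF o'(1), of fs] cU unfolding u_def by (simp add: fs_mult)
  have uu': "u * tp u = Id_n m" using arg_cong[OF o'(2), of fs] cU unfolding u_def by (simp add: fs_mult)
  show uI: "u * Id_n m = u" using g(2) unfolding rm .
  show u1: "u * Id_n r = fs U1" and u2: "u * sh = fs U2" using g(3,4) .
  have sh: "tp sh * sh = Id_n (m - r)" "Id_n r * sh = 0" "tp sh * Id_n r = 0" "Id_n m * sh = sh" "Id_n m * Id_n r = Id_n r"
    unfolding sh_def using r by (simp_all add: Id_mult_Id_le)
  have e: "tp (u * x) * (u * z) = tp x * (Id_n m * z)" for x z
  proof -
    have "tp (u * x) * (u * z) = tp x * (tp u * u) * z" by (simp only: tp_mult mult.assoc)
    then show ?thesis unfolding uu by (simp only: mult.assoc)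
  qed
  show a: "tp (fs U1) * fs U1 = Id_n r" "tp (fs U1) * fs U2 = 0" "tp (fs U2) * fs U1 = 0" "tp (fs U2) * fs U2 = Id_n (m - r)"
    unfolding u1[symmetric] u2[symmetric] e using sh by simp_all
  show i1: "fs U1 * Id_n r = fs U1" using U1 by simp
  show "fs U1 * tp (fs U1) + fs U2 * tp (fs U2) = Id_n m" using g(5) uu' by simp
  show "opn (fs U1) \<le> 1" by (rule opn_isometry_le[OF a(1) i1])
  show "opn (fs U2) \<le> 1" by (rule opn_isometry_le[OF a(4)]) (use U2 in simp)
qed

lemma svd_blocks:
  fixes u v D :: fsmat
  assumes v: "tp v * v = Id_n k" and u: "u * Id_n l = u" and D: "tp D = D" "D * Id_n k = D" "Id_n l * D = D"
    "D * Id_n r = Dg r d" and r: "r \<le> l" "r \<le> k"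
  shows "u * D * tp v * (v * Id_n r) = u * Id_n r * Dg r d"
    "u * D * tp v * (v * Sh r (k - r)) = u * Sh r (l - r) * (tp (Sh r (l - r)) * D * Sh r (k - r))"
proof -
  have vv: "u * D * tp v * (v * x) = u * (D * x)" for x
  proof -
    have "u * D * tp v * (v * x) = u * (D * (tp v * v)) * x" by (simp only: mult.assoc)
    then show ?thesis unfolding v D by (simp only: mult.assoc)
  qed
  show "u * D * tp v * (v * Id_n r) = u * Id_n r * Dg r d" unfolding vv D by (simp add: mult.assoc)
  have "Id_n r * D = Dg r d" using arg_cong[OF D(4), of tp] by (simp only: tp_mult tp_Id D(1) tp_Dg)
  then have "Id_n r * (D * Sh r (k - r)) = Dg r d * (Id_n r * Sh r (k - r))" by (simp only: mult.assoc[symmetric] Id_Dg)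
  then have z: "Id_n r * (D * Sh r (k - r)) = 0" by simp
  have "u * Sh r (l - r) * (tp (Sh r (l - r)) * D * Sh r (k - r)) = u * ((Id_n l - Id_n r) * (D * Sh r (k - r)))"
  proof -
    have "Sh r (l - r) * tp (Sh r (l - r)) = Id_n l - Id_n r" using r by simp
    then show ?thesis by (metis mult.assoc)
  qed
  also have "\<dots> = u * (Id_n l * D * Sh r (k - r))" unfolding left_diff_distrib z by (simp only: mult.assoc diff_zero)
  finally show "u * D * tp v * (v * Sh r (k - r)) = u * Sh r (l - r) * (tp (Sh r (l - r)) * D * Sh r (k - r))"
    unfolding vv D ..
qed

lemma opn_trailing_le:
  assumes "0 \<le> c" "\<And>i. r \<le> i \<Longrightarrow> i < k \<Longrightarrow> \<bar>d i\<bar> \<le> c"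
  shows "opn (X * Dg k d * Sh r (k - r)) \<le> opn X * c"
proof -
  have Dm: "Dg k d * Sh r (k - r) = Dg k (\<lambda>i. if i < r then 0 else d i) * Sh r (k - r)"
    by (rule fsmat_eqI) auto
  have "opn (Dg k (\<lambda>i. if i < r then 0 else d i)) \<le> c" by (rule opn_Dg_le) (use assms in auto)
  moreover have "opn (Sh r (k - r)) \<le> 1" by (rule opn_isometry_le[of _ "k - r"]) simp_all
  ultimately have "opn (X * (Dg k (\<lambda>i. if i < r then 0 else d i) * Sh r (k - r))) \<le> opn X * (c * 1)" by (intro opn_mult_le order_refl)
  then show ?thesis unfolding mult.assoc Dm by simp
qed

lemma decomposition_mult:
  fixes u1 u2 v1 v2 s1 s2 :: fsmat
  assumes v: "tp v1 * v1 = Id_n r" "tp v2 * v1 = 0" and s: "s1 * Id_n r = s1"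
  shows "(u1 * s1 * tp v1 + u2 * s2 * tp v2) * v1 = u1 * s1"
proof -
  have "(u1 * s1 * tp v1 + u2 * s2 * tp v2) * v1 = u1 * (s1 * (tp v1 * v1)) + u2 * (s2 * (tp v2 * v1))"
    by (simp only: distrib_right mult.assoc)
  then show ?thesis unfolding v s by simp
qed

lemma norm2_gram: "norm2 (E * E\<^sup>T) = (opn (fs E))\<^sup>2"
  by (simp add: norm2_eq_opn fs_mult opn_mult_tp)

lemma transfer_fun_carrier:
  assumes "B \<in> carrier_mat n m" "C \<in> carrier_mat k p" shows "transfer_fun A B C s \<in> carrier_mat p m"
  unfolding transfer_fun_def by (rule carrier_matI) (use assms in simp_all)

theorem theorem4p4:
  fixes n m p r rt1 rt2 p1 p2 m1 m2 :: nat
    and A B C P Q St Rt Pt Qt E F S R G Gt :: "real mat"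
    and U U1 U2 V V1 V2 Sigma Sigma1 :: "real mat"
    and Omega Gamma Uc1 Uc2 Vc1 Vc2 Sc1 Sc2 :: "real mat"
    and X1 Y1 Xt1 Yt1 Ah Bh Ch Atl Btl Ctl K1 K2 :: "real mat"
    and \<sigma> :: "nat \<Rightarrow> real"
    and \<epsilon>1 \<epsilon>2 \<epsilon> \<delta> \<delta>u \<sigma>u \<epsilon>x \<epsilon>y \<epsilon>a \<epsilon>b \<epsilon>c \<epsilon>b2 \<epsilon>c2 :: real
    and \<eta>1 \<eta>2 \<xi>1 \<xi>2 \<zeta>1 \<zeta>2 \<epsilon>dH \<epsilon>d2 :: real
    and H Hbt Htbt :: "complex \<Rightarrow> complex mat"
  (* the system and its Gramians *)
  assumes A: "A \<in> carrier_mat n n" and B: "B \<in> carrier_mat n m" and C: "C \<in> carrier_mat n p"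
    and "stable A" and "controllable A B" and "observable A C"
    and P: "P \<in> carrier_mat n n" "pos_def P" "A * P + P * A\<^sup>T + B * B\<^sup>T = 0\<^sub>m n n"
    and Q: "Q \<in> carrier_mat n n" "pos_def Q" "A\<^sup>T * Q + Q * A + C * C\<^sup>T = 0\<^sub>m n n"
  assumes "H = transfer_fun A B C"
  (* the approximate Gramians *)
  assumes St: "St \<in> carrier_mat n rt1" and Rt: "Rt \<in> carrier_mat n rt2"
  assumes "Pt = St * St\<^sup>T" and "Qt = Rt * Rt\<^sup>T"
  assumes "psd Pt" and "psd (P - Pt)" and "psd Qt" and "psd (Q - Qt)"
    and "norm2 (P - Pt) \<le> \<epsilon>1" and "norm2 (Q - Qt) \<le> \<epsilon>2"
    and E: "E \<in> carrier_mat n p1" and F: "F \<in> carrier_mat n p2"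
    and "P = Pt + E * E\<^sup>T" and "Q = Qt + F * F\<^sup>T"
  assumes "m1 = rt1 + p1" and "m2 = rt2 + p2"
  assumes "m1 \<ge> m2" and "1 \<le> r" and "r \<le> n" and "r \<le> rt1" and "r \<le> rt2"
  assumes "S = St @\<^sub>c E" and "R = Rt @\<^sub>c F"
    and "G = S\<^sup>T * R"
    and "Gt = four_block_mat (St\<^sup>T * Rt) (0\<^sub>m rt1 p2) (0\<^sub>m p1 rt2) (0\<^sub>m p1 p2)"
  (* the singular value decomposition of G *)
  assumes U1: "U1 \<in> carrier_mat m1 r" and U2: "U2 \<in> carrier_mat m1 (m1 - r)"
    and V1: "V1 \<in> carrier_mat m2 r" and V2: "V2 \<in> carrier_mat m2 (m2 - r)"
  assumes "U = U1 @\<^sub>c U2" and "V = V1 @\<^sub>c V2"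
    and "Sigma = rect_diag m1 m2 \<sigma>" and "Sigma1 = rect_diag r r \<sigma>"
  assumes "orth_mat U" and "orth_mat V"
    and "\<And>i j. 1 \<le> i \<Longrightarrow> i \<le> j \<Longrightarrow> j \<le> m2 \<Longrightarrow> \<sigma> j \<le> \<sigma> i"
    and "\<And>i. 1 \<le> i \<Longrightarrow> i \<le> m2 \<Longrightarrow> 0 \<le> \<sigma> i"
    and "\<And>i. i > m2 \<Longrightarrow> \<sigma> i = 0"
    and "G = U * Sigma * V\<^sup>T"
  (* the standing assumption *)
  assumes "\<epsilon> = max (sqrt (norm2 P * \<epsilon>2)) (sqrt (norm2 Q * \<epsilon>1)) + sqrt (\<epsilon>1 * \<epsilon>2)"
    and "\<delta> = \<sigma> r - \<sigma> (r + 1)" and "\<delta>u = \<delta> - 2 * \<epsilon>" and "\<sigma>u = \<sigma> r - \<epsilon>"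
  assumes "\<delta>u > 0" and "\<epsilon> / \<delta>u < 1 / 2"
  (* the decomposition of Gt *)
  assumes Omega: "Omega \<in> carrier_mat (m2 - r) r" and Gamma: "Gamma \<in> carrier_mat (m1 - r) r"
    and "max (norm2 Omega) (norm2 Gamma) \<le> 2 * \<epsilon> / \<delta>u"
  assumes "Uc1 = (U1 - U2 * Gamma) * inv_sqrt (1\<^sub>m r + Gamma\<^sup>T * Gamma)"
    and "Uc2 = (U1 * Gamma\<^sup>T + U2) * inv_sqrt (1\<^sub>m (m1 - r) + Gamma * Gamma\<^sup>T)"
    and "Vc1 = (V1 + V2 * Omega) * inv_sqrt (1\<^sub>m r + Omega\<^sup>T * Omega)"
    and "Vc2 = (- (V1 * Omega\<^sup>T) + V2) * inv_sqrt (1\<^sub>m (m2 - r) + Omega * Omega\<^sup>T)"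
  assumes "Sc1 \<in> carrier_mat r r" and "Sc2 \<in> carrier_mat (m1 - r) (m2 - r)"
    and "Gt = (Uc1 @\<^sub>c Uc2) * block_diag Sc1 Sc2 * (Vc1 @\<^sub>c Vc2)\<^sup>T"
  (* exact and approximate balanced truncation *)
  assumes "X1 = S * U1" and "Y1 = R * V1 * mat_inv Sigma1"
    and "Xt1 = (St @\<^sub>c 0\<^sub>m n (m1 - rt1)) * Uc1"
    and "Yt1 = (Rt @\<^sub>c 0\<^sub>m n (m2 - rt2)) * Vc1 * mat_inv Sc1"
    and "Ah = Y1\<^sup>T * A * X1" and "Bh = Y1\<^sup>T * B" and "Ch = X1\<^sup>T * C"
    and "Atl = Yt1\<^sup>T * A * Xt1" and "Btl = Yt1\<^sup>T * B" and "Ctl = Xt1\<^sup>T * C"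
    and "Hbt = transfer_fun Ah Bh Ch" and "Htbt = transfer_fun Atl Btl Ctl"
  (* the error constants *)
  assumes "\<epsilon>x = sqrt \<epsilon>1 + sqrt (norm2 P) * (2 * \<epsilon> / \<delta>u)"
    and "\<epsilon>y = sqrt \<epsilon>2 / \<sigma> r
           + sqrt (norm2 Q) / \<sigma> r * (1 + \<delta>u / (2 * \<sigma>u) + 2 * \<sigma> 1 / \<sigma>u) * (2 * \<epsilon> / \<delta>u)"
    and "\<epsilon>a = sqrt (norm2 P) * \<epsilon>y + sqrt (norm2 Q) / \<sigma> r * \<epsilon>x"
    and "\<epsilon>b = \<epsilon>y" and "\<epsilon>c = \<epsilon>x"
    and "\<epsilon>b2 = sqrt (norm2 Q) * (1 / \<sigma>u + 1 / \<sigma> r) * \<epsilon>y"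
    and "\<epsilon>c2 = 2 * sqrt (norm2 P) * \<epsilon>x"
    and "K1 = mat_integral {0..} r r (\<lambda>t. mat_exp (t \<cdot>\<^sub>m Ah) * mat_exp (t \<cdot>\<^sub>m Ah\<^sup>T))"
    and "K2 = mat_integral {0..} r r (\<lambda>t. mat_exp (t \<cdot>\<^sub>m Ah\<^sup>T) * mat_exp (t \<cdot>\<^sub>m Ah))"
    and "\<eta>1 = norm2 A * norm2 K1 * \<epsilon>a" and "\<eta>2 = norm2 A * norm2 K2 * \<epsilon>a"
    and "\<xi>1 = norm2 K1 / (1 - \<eta>1) * (norm2 Bh * norm2 B * \<epsilon>b + norm2 A * \<epsilon>a)"
    and "\<xi>2 = norm2 K1 / (1 - 2 * \<eta>1) * (norm2 (B * B\<^sup>T) * \<epsilon>b2 + 2 * norm2 A * \<epsilon>a)"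
    and "\<zeta>1 = norm2 K2 / (1 - \<eta>2) * (norm2 Ch * norm2 C * \<epsilon>c + norm2 A * \<epsilon>a)"
    and "\<zeta>2 = norm2 K2 / (1 - 2 * \<eta>2) * (norm2 (C * C\<^sup>T) * \<epsilon>c2 + 2 * norm2 A * \<epsilon>a)"
    and "\<epsilon>dH = sqrt (2 * (\<sigma> 1)\<^sup>2 * (\<xi>1 + \<xi>2) + 2 * (\<zeta>1 + \<zeta>2) + (\<xi>1 + \<xi>2) * (\<zeta>1 + \<zeta>2))"
    and "\<epsilon>d2 = sqrt (real (min r m)) *
           sqrt ((\<sigma> 1)\<^sup>2 * (norm2 Bh + norm2 Btl) * norm2 B * \<epsilon>b
             + (2 * norm2 (Bh\<^sup>T) * norm2 Btl * \<zeta>1 + (norm2 (Btl\<^sup>T))\<^sup>2 * \<zeta>2))"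
  assumes "\<eta>1 < 1 / 2" and "\<eta>2 < 1 / 2"
  shows "hankel_norm (\<lambda>s. H s - Htbt s) \<le> hankel_norm (\<lambda>s. H s - Hbt s) + \<epsilon>dH
       \<and> h2_norm (\<lambda>s. H s - Htbt s) \<le> h2_norm (\<lambda>s. H s - Hbt s) + \<epsilon>d2"
proof -
  define a b c where "a = fs A" and "b = fs B" and "c = fs C"
  define s q where "s = fs S" and "q = fs R"
  define u v where "u = fs U" and "v = fs V"
  define gm om where "gm = fs Gamma" and "om = - fs Omega"
  define d where "d i = \<sigma> (Suc i)" for i
  have rm: "r \<le> m1" "r \<le> m2" using assms by linarith+
  have cS: "S \<in> carrier_mat n m1" "R \<in> carrier_mat n m2"
    unfolding \<open>S = St @\<^sub>c E\<close> \<open>R = Rt @\<^sub>c F\<close> append_cols_def \<open>m1 = rt1 + p1\<close> \<open>m2 = rt2 + p2\<close> using St Rt E F by auto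
  note gS = append_cols_gram[OF St E, folded \<open>S = St @\<^sub>c E\<close> \<open>m1 = rt1 + p1\<close> s_def]
  note gR = append_cols_gram[OF Rt F, folded \<open>R = Rt @\<^sub>c F\<close> \<open>m2 = rt2 + p2\<close> q_def]
  have fP: "fs P = s * tp s"
    unfolding gS(5) \<open>P = Pt + E * E\<^sup>T\<close> \<open>Pt = St * St\<^sup>T\<close> using St E by (simp add: fs_add fs_mult)
  have fQ: "fs Q = q * tp q"
    unfolding gR(5) \<open>Q = Qt + F * F\<^sup>T\<close> \<open>Qt = Rt * Rt\<^sup>T\<close> using Rt F by (simp add: fs_add fs_mult)
  have oS: "opn s = sqrt (norm2 P)" unfolding norm2_eq_opn fP opn_mult_tp by simp
  have oR: "opn q = sqrt (norm2 Q)" unfolding norm2_eq_opn fQ opn_mult_tp by simp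
  have "P - Pt = E * E\<^sup>T" "Q - Qt = F * F\<^sup>T"
    unfolding \<open>P = Pt + E * E\<^sup>T\<close> \<open>Q = Qt + F * F\<^sup>T\<close> \<open>Pt = St * St\<^sup>T\<close> \<open>Qt = Rt * Rt\<^sup>T\<close> using St E Rt F by (auto intro!: eq_matI)
  then have "(opn (fs E))\<^sup>2 \<le> \<epsilon>1" "(opn (fs F))\<^sup>2 \<le> \<epsilon>2" using \<open>norm2 (P - Pt) \<le> \<epsilon>1\<close> \<open>norm2 (Q - Qt) \<le> \<epsilon>2\<close> by (simp_all add: norm2_gram)
  note oEF = this
  have oE: "opn (fs E) \<le> sqrt \<epsilon>1" "opn (fs F) \<le> sqrt \<epsilon>2"
    by (rule real_le_rsqrt[OF oEF(1)], rule real_le_rsqrt[OF oEF(2)])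
  have e12: "0 \<le> \<epsilon>1" "0 \<le> \<epsilon>2"
    using oEF zero_le_power2[of "opn (fs E)"] zero_le_power2[of "opn (fs F)"] by linarith+
  have ePQ: "sqrt \<epsilon>1 * opn q \<le> \<epsilon>" "sqrt \<epsilon>2 * opn s \<le> \<epsilon>"
  proof -
    have "0 \<le> sqrt (\<epsilon>1 * \<epsilon>2)" using e12 by simp
    then have "sqrt (norm2 Q * \<epsilon>1) \<le> \<epsilon>" "sqrt (norm2 P * \<epsilon>2) \<le> \<epsilon>"
      unfolding \<open>\<epsilon> = max (sqrt (norm2 P * \<epsilon>2)) (sqrt (norm2 Q * \<epsilon>1)) + sqrt (\<epsilon>1 * \<epsilon>2)\<close> by linarith+
    then show "sqrt \<epsilon>1 * opn q \<le> \<epsilon>" "sqrt \<epsilon>2 * opn s \<le> \<epsilon>" unfolding oS oR by (simp_all add: real_sqrt_mult mult.commute)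
  qed
  have \<epsilon>0: "0 \<le> \<epsilon>" using ePQ(1) e12 opn_ge_0[of q] by (meson mult_nonneg_nonneg order_trans real_sqrt_ge_zero)
  have eps4: "4 * \<epsilon> < \<sigma> r - \<sigma> (r + 1)"
    using \<open>\<epsilon> / \<delta>u < 1 / 2\<close> \<open>\<delta>u > 0\<close> unfolding \<open>\<delta>u = \<delta> - 2 * \<epsilon>\<close> \<open>\<delta> = \<sigma> r - \<sigma> (r + 1)\<close> by (simp add: field_simps)
  have mono: "\<sigma> j \<le> \<sigma> i" if "1 \<le> i" "i \<le> j" "j \<le> m2" for i j using assms that by blast
  have s20: "0 \<le> \<sigma> (r + 1)"
  proof (cases "r + 1 \<le> m2")
    case True
    then show ?thesis using \<open>\<And>i. 1 \<le> i \<Longrightarrow> i \<le> m2 \<Longrightarrow> 0 \<le> \<sigma> i\<close>[of "r + 1"] by simp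
  next
    case False
    then show ?thesis using \<open>\<And>i. i > m2 \<Longrightarrow> \<sigma> i = 0\<close>[of "r + 1"] by simp
  qed
  have fA: "Id_n n * a = a" "a * Id_n n = a" "Id_n n * tp a = tp a" unfolding a_def using A by simp_all
  have lP: "a * (s * tp s) + s * tp s * tp a + b * tp b = 0"
    using arg_cong[OF P(3), of fs] A B P(1) unfolding fP[symmetric] a_def b_def by (simp add: fs_add fs_mult)
  have lQ: "tp a * (q * tp q) + q * tp q * a + c * tp c = 0"
    using arg_cong[OF Q(3), of fs] A C Q(1) unfolding fQ[symmetric] a_def c_def by (simp add: fs_add fs_mult)
  note bU = orth_blocks[OF U1 U2 rm(1) \<open>orth_mat U\<close>[unfolded \<open>U = U1 @\<^sub>c U2\<close>], folded \<open>U = U1 @\<^sub>c U2\<close> u_def]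
  note bV = orth_blocks[OF V1 V2 rm(2) \<open>orth_mat V\<close>[unfolded \<open>V = V1 @\<^sub>c V2\<close>], folded \<open>V = V1 @\<^sub>c V2\<close> v_def]
  have cU: "U \<in> carrier_mat m1 m1" "V \<in> carrier_mat m2 m2"
    unfolding \<open>U = U1 @\<^sub>c U2\<close> \<open>V = V1 @\<^sub>c V2\<close> append_cols_def using U1 U2 V1 V2 rm by auto
  have fSig: "fs Sigma = Dg m2 d" unfolding \<open>Sigma = rect_diag m1 m2 \<sigma>\<close> rect_diag_def d_def
    by (rule fsmat_eqI) (use \<open>m1 \<ge> m2\<close> in auto)
  have cSig: "Sigma \<in> carrier_mat m1 m2" unfolding \<open>Sigma = rect_diag m1 m2 \<sigma>\<close> rect_diag_def by simp
  have fG: "tp s * q = u * Dg m2 d * tp v"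
  proof -
    have "fs G = tp s * q" unfolding \<open>G = S\<^sup>T * R\<close> s_def q_def using cS by (simp add: fs_mult)
    moreover have "fs G = u * Dg m2 d * tp v" unfolding \<open>G = U * Sigma * V\<^sup>T\<close> fSig[symmetric] u_def v_def using cU cSig by (simp add: fs_mult mult.assoc)
    ultimately show ?thesis by simp
  qed
  have fG': "tp q * s = v * Dg m2 d * tp u" using arg_cong[OF fG, of tp] by (simp add: mult.assoc)
  have DI: "Id_n m1 * Dg m2 d = Dg m2 d" "Dg m2 d * Id_n m1 = Dg m2 d" "Dg m2 d * Id_n r = Dg r d"
    by (rule fsmat_eqI; use \<open>m1 \<ge> m2\<close> rm in auto)+
  define S2 where "S2 = tp (Sh r (m1 - r)) * Dg m2 d * Sh r (m2 - r)"
  have GV: "tp s * q * fs V1 = fs U1 * Dg r d" "tp s * q * fs V2 = fs U2 * S2"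
    using svd_blocks[OF bV(1) bU(2) tp_Dg Id_Dg(2) DI(1,3) rm] unfolding fG S2_def bU(3,4) bV(3,4) .
  have GU: "tp q * s * fs U1 = fs V1 * Dg r d" "tp q * s * fs U2 = fs V2 * tp S2"
    using svd_blocks[OF bU(1) bV(2) tp_Dg DI(2) Id_Dg(1) DI(3) rm(2,1)] unfolding fG' S2_def bU(3,4) bV(3,4) by (simp_all add: mult.assoc)
  have oS2: "opn S2 \<le> \<sigma> (r + 1)"
  proof -
    have "opn S2 \<le> opn (tp (Sh r (m1 - r))) * \<sigma> (r + 1)" unfolding S2_def
    proof (rule opn_trailing_le[OF s20])
      fix i assume i: "r \<le> i" "i < m2"
      then have "0 \<le> \<sigma> (Suc i)" "\<sigma> (Suc i) \<le> \<sigma> (r + 1)" using mono[of "r + 1" "Suc i"] \<open>\<And>i. 1 \<le> i \<Longrightarrow> i \<le> m2 \<Longrightarrow> 0 \<le> \<sigma> i\<close>[of "Suc i"] by simp_all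
      then show "\<bar>d i\<bar> \<le> \<sigma> (r + 1)" unfolding d_def by simp
    qed
    also have "\<dots> \<le> 1 * \<sigma> (r + 1)" using s20
      by (intro mult_right_mono) (simp_all only: opn_tp, rule opn_isometry_le[of _ "m1 - r"], simp_all)
    finally show ?thesis by simp
  qed
  have g1: "norm2 Gamma < 1" "norm2 Omega < 1"
  proof -
    have "2 * \<epsilon> / \<delta>u = 2 * (\<epsilon> / \<delta>u)" by simp
    then have "2 * \<epsilon> / \<delta>u < 1" using \<open>\<epsilon> / \<delta>u < 1 / 2\<close> by linarith
    then show "norm2 Gamma < 1" "norm2 Omega < 1" using \<open>max (norm2 Omega) (norm2 Gamma) \<le> 2 * \<epsilon> / \<delta>u\<close> by linarith+
  qed
  have Ig: "Id_n (m1 - r) * gm = gm" "gm * Id_n r = gm" "Id_n (m2 - r) * om = om" "om * Id_n r = om"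
    unfolding gm_def om_def using Gamma Omega by simp_all
  define Cu Cv where "Cu = fs (inv_sqrt (1\<^sub>m r + Gamma\<^sup>T * Gamma))" and "Cv = fs (inv_sqrt (1\<^sub>m r + Omega\<^sup>T * Omega))"
  have cC: "inv_sqrt (1\<^sub>m r + Gamma\<^sup>T * Gamma) \<in> carrier_mat r r" "inv_sqrt (1\<^sub>m r + Omega\<^sup>T * Omega) \<in> carrier_mat r r"
    by (rule inv_sqrt_one_plus(1)[OF Gamma], rule inv_sqrt_one_plus(1)[OF Omega])
  obtain Tu where Tu: "tp Cu = Cu" "psdq Cu" "Cu * Tu = Id_n r" "Tu * Cu = Id_n r" "tp Tu = Tu" "Tu * Tu = Id_n r + tp gm * gm"
    using inv_sqrt_one_plus(2)[OF Gamma] unfolding Let_def Cu_def[symmetric] gm_def[symmetric] by blast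
  obtain Tv where Tv: "tp Cv = Cv" "psdq Cv" "Cv * Tv = Id_n r" "Tv * Cv = Id_n r" "tp Tv = Tv" "Tv * Tv = Id_n r + tp om * om"
    using inv_sqrt_one_plus(2)[OF Omega] unfolding Let_def Cv_def[symmetric] om_def by auto
  have ICu: "Id_n r * Cu = Cu" "Id_n r * Cv = Cv" unfolding Cu_def Cv_def using cC by simp_all
  have cC2: "inv_sqrt (1\<^sub>m (m1 - r) + Gamma * Gamma\<^sup>T) \<in> carrier_mat (m1 - r) (m1 - r)"
    "inv_sqrt (1\<^sub>m (m2 - r) + Omega * Omega\<^sup>T) \<in> carrier_mat (m2 - r) (m2 - r)"
    using inv_sqrt_one_plus(1)[of "Gamma\<^sup>T" r "m1 - r"] inv_sqrt_one_plus(1)[of "Omega\<^sup>T" r "m2 - r"] Gamma Omega by simp_all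
  define Cu2 Cv2 where "Cu2 = fs (inv_sqrt (1\<^sub>m (m1 - r) + Gamma * Gamma\<^sup>T))" and "Cv2 = fs (inv_sqrt (1\<^sub>m (m2 - r) + Omega * Omega\<^sup>T))"
  have fc: "fs Uc1 = (fs U1 - fs U2 * gm) * Cu" "fs Vc1 = (fs V1 - fs V2 * om) * Cv"
    "fs Uc2 = (fs U1 * tp gm + fs U2) * Cu2" "fs Vc2 = (fs V1 * tp om + fs V2) * Cv2"
    unfolding \<open>Uc1 = (U1 - U2 * Gamma) * inv_sqrt (1\<^sub>m r + Gamma\<^sup>T * Gamma)\<close>
      \<open>Vc1 = (V1 + V2 * Omega) * inv_sqrt (1\<^sub>m r + Omega\<^sup>T * Omega)\<close>
      \<open>Uc2 = (U1 * Gamma\<^sup>T + U2) * inv_sqrt (1\<^sub>m (m1 - r) + Gamma * Gamma\<^sup>T)\<close>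
      \<open>Vc2 = (- (V1 * Omega\<^sup>T) + V2) * inv_sqrt (1\<^sub>m (m2 - r) + Omega * Omega\<^sup>T)\<close>
      gm_def om_def Cu_def Cv_def Cu2_def Cv2_def
    using U1 U2 V1 V2 Gamma Omega cC cC2 by (simp_all add: fs_mult fs_minus fs_add)
  have cUc: "Uc1 \<in> carrier_mat m1 r" "Vc1 \<in> carrier_mat m2 r" "Uc2 \<in> carrier_mat m1 (m1 - r)" "Vc2 \<in> carrier_mat m2 (m2 - r)"
    unfolding \<open>Uc1 = (U1 - U2 * Gamma) * inv_sqrt (1\<^sub>m r + Gamma\<^sup>T * Gamma)\<close>
      \<open>Vc1 = (V1 + V2 * Omega) * inv_sqrt (1\<^sub>m r + Omega\<^sup>T * Omega)\<close>
      \<open>Uc2 = (U1 * Gamma\<^sup>T + U2) * inv_sqrt (1\<^sub>m (m1 - r) + Gamma * Gamma\<^sup>T)\<close>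
      \<open>Vc2 = (- (V1 * Omega\<^sup>T) + V2) * inv_sqrt (1\<^sub>m (m2 - r) + Omega * Omega\<^sup>T)\<close>
    by (rule mult_carrier_mat[OF minus_carrier_mat[OF mult_carrier_mat[OF U2 Gamma]] cC(1)]
        mult_carrier_mat[OF add_carrier_mat[OF mult_carrier_mat[OF V2 Omega]] cC(2)]
        mult_carrier_mat[OF add_carrier_mat[OF U2] cC2(1)] mult_carrier_mat[OF add_carrier_mat[OF V2] cC2(2)])+
  have iso: "tp ((x1 - x2 * g) * C0) * ((x1 - x2 * g) * C0) = Id_n r" "tp ((x1 * tp g + x2) * C2) * ((x1 - x2 * g) * C0) = 0"
    if x: "tp x1 * x1 = Id_n r" "tp x1 * x2 = 0" "tp x2 * x1 = 0" "tp x2 * x2 = Id_n l" and g: "Id_n l * g = g" "g * Id_n r = g"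
      and C0: "tp C0 = C0" "psdq C0" "Id_n r * C0 = C0" "C0 * T = Id_n r" "T * C0 = Id_n r" "tp T = T" "T * T = Id_n r + tp g * g"
    for x1 x2 g C0 C2 T l
  proof -
    have g': "Id_n r * tp g = tp g" using arg_cong[OF g(2), of tp] by (simp only: tp_mult tp_Id)
    have "tp (x1 - x2 * g) * (x1 - x2 * g) = Id_n r + tp g * g" "tp (x1 * tp g + x2) * (x1 - x2 * g) = 0"
      by (simp_all add: left_diff_distrib right_diff_distrib distrib_right mult.assoc x x[THEN assoc_eq] g g')
    moreover have "tp ((x1 - x2 * g) * C0) * ((x1 - x2 * g) * C0) = C0 * (tp (x1 - x2 * g) * (x1 - x2 * g)) * C0"
      "tp ((x1 * tp g + x2) * C2) * ((x1 - x2 * g) * C0) = tp C2 * (tp (x1 * tp g + x2) * (x1 - x2 * g)) * C0"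
      by (simp_all only: tp_mult C0(1) mult.assoc)
    ultimately show "tp ((x1 - x2 * g) * C0) * ((x1 - x2 * g) * C0) = Id_n r" "tp ((x1 * tp g + x2) * C2) * ((x1 - x2 * g) * C0) = 0"
      using inv_sqrt_bounds(4)[OF C0 order_refl] by simp_all
  qed
  note isoU = iso[OF bU(5-8) Ig(1,2) Tu(1,2) ICu(1) Tu(3-6), folded fc(1)]
  note isoV = iso[OF bV(5-8) Ig(3,4) Tv(1,2) ICu(2) Tv(3-6), folded fc(2)]
  have "fs Gt = tp (fs St) * fs Rt"
    unfolding \<open>Gt = four_block_mat (St\<^sup>T * Rt) (0\<^sub>m rt1 p2) (0\<^sub>m p1 rt2) (0\<^sub>m p1 p2)\<close> using St Rt by (simp add: fs_four_block fs_mult)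
  also have "\<dots> = (Id_n m1 - (Id_n m1 - Id_n rt1)) * (tp s * q) * (Id_n m2 - (Id_n m2 - Id_n rt2))"
    unfolding gS(3)[symmetric] gR(3)[symmetric] by (simp add: mult.assoc)
  finally have fGt: "fs Gt = (Id_n m1 - (Id_n m1 - Id_n rt1)) * (tp s * q) * (Id_n m2 - (Id_n m2 - Id_n rt2))" .
  have Gt1: "fs Gt = fs Uc1 * fs Sc1 * tp (fs Vc1) + fs Uc2 * fs Sc2 * tp (fs Vc2)"
  proof -
    have ap: "(Uc1 @\<^sub>c Uc2) \<in> carrier_mat m1 m1" "(Vc1 @\<^sub>c Vc2) \<in> carrier_mat m2 m2" "block_diag Sc1 Sc2 \<in> carrier_mat m1 m2"
      using cUc rm \<open>Sc1 \<in> carrier_mat r r\<close> \<open>Sc2 \<in> carrier_mat (m1 - r) (m2 - r)\<close> unfolding append_cols_def block_diag_def by auto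
    note gU = append_cols_gram[OF cUc(1,3)] and gV = append_cols_gram[OF cUc(2,4)]
    have fb: "fs (block_diag Sc1 Sc2) = fs Sc1 + Sh r (m1 - r) * fs Sc2 * tp (Sh r (m2 - r))"
      using \<open>Sc1 \<in> carrier_mat r r\<close> \<open>Sc2 \<in> carrier_mat (m1 - r) (m2 - r)\<close> by (simp add: fs_block_diag)
    have sI: "fs Sc1 = Id_n r * fs Sc1 * Id_n r" using \<open>Sc1 \<in> carrier_mat r r\<close> by simp
    have "fs Gt = fs (Uc1 @\<^sub>c Uc2) * fs (block_diag Sc1 Sc2) * tp (fs (Vc1 @\<^sub>c Vc2))"
      unfolding \<open>Gt = (Uc1 @\<^sub>c Uc2) * block_diag Sc1 Sc2 * (Vc1 @\<^sub>c Vc2)\<^sup>T\<close> using ap by (simp add: fs_mult mult.assoc)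
    also have "\<dots> = (fs (Uc1 @\<^sub>c Uc2) * Id_n r) * fs Sc1 * tp (fs (Vc1 @\<^sub>c Vc2) * Id_n r)
        + (fs (Uc1 @\<^sub>c Uc2) * Sh r (m1 - r)) * fs Sc2 * tp (fs (Vc1 @\<^sub>c Vc2) * Sh r (m2 - r))"
      unfolding fb by (subst sI) (simp only: distrib_left distrib_right mult.assoc tp_mult tp_Id)
    finally show ?thesis unfolding gU(3,4) gV(3,4) .
  qed
  have Is: "Id_n r * fs Sc1 = fs Sc1" "fs Sc1 * Id_n r = fs Sc1" "tp (fs Sc1) * Id_n r = tp (fs Sc1)" using \<open>Sc1 \<in> carrier_mat r r\<close> by simp_all
  have dec: "fs Gt * fs Vc1 = fs Uc1 * fs Sc1"
    unfolding Gt1 by (rule decomposition_mult[OF isoV(1) _ Is(2)]) (unfold fc(4), rule isoV(2))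
  have tGt: "tp (fs Gt) = fs Vc1 * tp (fs Sc1) * tp (fs Uc1) + fs Vc2 * tp (fs Sc2) * tp (fs Uc2)" unfolding Gt1 by (simp add: mult.assoc)
  have dec': "tp (fs Gt) * fs Uc1 = fs Vc1 * tp (fs Sc1)"
    unfolding tGt by (rule decomposition_mult[OF isoU(1) _ Is(3)]) (unfold fc(3), rule isoU(2))
  interpret bt: perturbed n r m1 m2 a b c s q "fs U1" "fs U2" "fs V1" "fs V2" S2 d "\<sigma> r" "\<sigma> (r + 1)"
    "Id_n m1 - Id_n rt1" "Id_n m2 - Id_n rt2" gm om Cu Cv Tu Tv "fs Sc1" \<epsilon> "sqrt \<epsilon>1" "sqrt \<epsilon>2" "max (opn gm) (opn om)"
  proof unfold_locales
    show "\<sigma> r \<le> d i" if "i < r" for i unfolding d_def using mono[of "Suc i" r] that rm by simp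
    show "\<sigma> (r + 1) < \<sigma> r" using eps4 \<epsilon>0 by linarith
    show "0 < r" using \<open>1 \<le> r\<close> by simp
    have rt: "rt1 \<le> m1" "rt2 \<le> m2" using \<open>m1 = rt1 + p1\<close> \<open>m2 = rt2 + p2\<close> by simp_all
    show "(Id_n m1 - Id_n rt1) * (Id_n m1 - Id_n rt1) = Id_n m1 - Id_n rt1" "(Id_n m2 - Id_n rt2) * (Id_n m2 - Id_n rt2) = Id_n m2 - Id_n rt2"
      "Id_n m1 * (Id_n m1 - Id_n rt1) = Id_n m1 - Id_n rt1" "Id_n m2 * (Id_n m2 - Id_n rt2) = Id_n m2 - Id_n rt2"
      using rt by (simp_all add: left_diff_distrib right_diff_distrib Id_mult_Id_le)
    show "opn (s * (Id_n m1 - Id_n rt1)) \<le> sqrt \<epsilon>1" "opn (q * (Id_n m2 - Id_n rt2)) \<le> sqrt \<epsilon>2" using gS(6) gR(6) oE by linarith+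
    show "max (opn gm) (opn om) < 1" using g1 unfolding norm2_eq_opn gm_def om_def by simp
    show "tp (fs U2) * (fs U2 * gm) = gm" "tp (fs V2) * (fs V2 * om) = om" unfolding mult.assoc[symmetric] bU(8) bV(8) by (rule Ig)+
    show "tp (fs U2) * (fs U2 * S2) = S2" "tp (fs V2) * (fs V2 * tp S2) = tp S2"
      unfolding mult.assoc[symmetric] bU(8) bV(8) S2_def by (simp_all add: mult.assoc[symmetric])
    show "(Id_n m1 - (Id_n m1 - Id_n rt1)) * (tp s * q) * (Id_n m2 - (Id_n m2 - Id_n rt2)) * ((fs V1 - fs V2 * om) * Cv)
        = (fs U1 - fs U2 * gm) * Cu * fs Sc1"
      unfolding fGt[symmetric] fc(1,2)[symmetric] by (rule dec)
    have "tp (fs Gt) = (Id_n m2 - (Id_n m2 - Id_n rt2)) * (tp q * s) * (Id_n m1 - (Id_n m1 - Id_n rt1))"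
      unfolding fGt by (simp add: mult.assoc)
    then show "(Id_n m2 - (Id_n m2 - Id_n rt2)) * (tp q * s) * (Id_n m1 - (Id_n m1 - Id_n rt1)) * ((fs U1 - fs U2 * gm) * Cu)
        = (fs V1 - fs V2 * om) * Cv * tp (fs Sc1)"
      using dec' unfolding fc(1,2)[symmetric] by simp
  qed (rule gS gR lP lQ bU bV GV GU s20 oS2 ePQ eps4 Ig Tu Tv ICu Is max.cobounded1 max.cobounded2 | simp)+
  obtain Bi where Bi: "Bi \<in> carrier_mat r r" "Sc1 * Bi = 1\<^sub>m r" "Bi * Sc1 = 1\<^sub>m r"
    by (rule fs_inverse_of_inj[OF \<open>Sc1 \<in> carrier_mat r r\<close> bt.Sc1_inj])
  have Ib: "mat_inv Sc1 = Bi" by (rule mat_inv_eqI[OF \<open>Sc1 \<in> carrier_mat r r\<close> Bi(1,2)])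
  interpret bt: perturbed_inv n r m1 m2 a b c s q "fs U1" "fs U2" "fs V1" "fs V2" S2 d "\<sigma> r" "\<sigma> (r + 1)"
    "Id_n m1 - Id_n rt1" "Id_n m2 - Id_n rt2" gm om Cu Cv Tu Tv "fs Sc1" \<epsilon> "sqrt \<epsilon>1" "sqrt \<epsilon>2" "max (opn gm) (opn om)" "fs Bi"
  proof unfold_locales
    show "fs Sc1 * fs Bi = Id_n r" "fs Bi * fs Sc1 = Id_n r"
      using arg_cong[OF Bi(2), of fs] arg_cong[OF Bi(3), of fs] Bi(1) \<open>Sc1 \<in> carrier_mat r r\<close> by (simp_all add: fs_mult)
    show "Id_n r * fs Bi = fs Bi" using Bi(1) by simp
  qed simp
  have fSig1: "fs Sigma1 = Dg r d" "Sigma1 \<in> carrier_mat r r"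
    unfolding \<open>Sigma1 = rect_diag r r \<sigma>\<close> rect_diag_def d_def Dg_def by simp_all
  define Jm where "Jm = to_mat r r bt.J"
  have fJ: "fs Jm = bt.J" "Jm \<in> carrier_mat r r" unfolding Jm_def by (rule fs_to_mat) simp_all
  have IJ: "mat_inv Sigma1 = Jm"
  proof (rule mat_inv_eqI[OF fSig1(2) fJ(2)], rule fs_inject[of _ r r])
    show "fs (Sigma1 * Jm) = fs (1\<^sub>m r)" using fSig1 fJ bt.Dg_J(1) by (simp add: fs_mult)
  qed (use fSig1 fJ in simp_all)
  have cX: "X1 \<in> carrier_mat n r" "Y1 \<in> carrier_mat n r"
    unfolding \<open>X1 = S * U1\<close> \<open>Y1 = R * V1 * mat_inv Sigma1\<close> IJ
    by (rule mult_carrier_mat[OF cS(1) U1], rule mult_carrier_mat[OF mult_carrier_mat[OF cS(2) V1] fJ(2)])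
  have fX1: "fs X1 = bt.X1"
  proof -
    have "fs X1 = s * fs U1" unfolding \<open>X1 = S * U1\<close> s_def using cS U1 by (simp add: fs_mult)
    then show ?thesis unfolding bt.X1_def .
  qed
  have fY1: "fs Y1 = bt.Y1"
  proof -
    have "fs Y1 = q * fs V1 * fs Jm" unfolding \<open>Y1 = R * V1 * mat_inv Sigma1\<close> q_def IJ using cS V1 fJ(2) by (simp add: fs_mult mult.assoc)
    then show ?thesis unfolding bt.Y1_def fJ(1) .
  qed
  have pad: "fs (X @\<^sub>c 0\<^sub>m n k) = fs X" if "X \<in> carrier_mat n l" for X :: "real mat" and k l using that by (simp add: fs_append_cols)
  have rt: "rt1 \<le> m1" "rt2 \<le> m2" using \<open>m1 = rt1 + p1\<close> \<open>m2 = rt2 + p2\<close> by simp_all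
  have cp: "(St @\<^sub>c 0\<^sub>m n (m1 - rt1)) \<in> carrier_mat n m1" "(Rt @\<^sub>c 0\<^sub>m n (m2 - rt2)) \<in> carrier_mat n m2"
    unfolding append_cols_def using St Rt rt by auto
  have drop: "x * Id_n k * w = x * w" if "x * Id_n l = x" "(Id_n l - Id_n k) * w = 0" for x w k l
  proof -
    have "x * w = x * Id_n l * w" unfolding that ..
    also have "\<dots> = x * Id_n k * w + x * ((Id_n l - Id_n k) * w)" by (simp add: left_diff_distrib right_diff_distrib mult.assoc)
    finally show ?thesis unfolding that by simp
  qed
  have fXt1: "fs Xt1 = bt.X2" "Xt1 \<in> carrier_mat n r"
  proof -
    have "fs Xt1 = fs St * fs Uc1" unfolding \<open>Xt1 = (St @\<^sub>c 0\<^sub>m n (m1 - rt1)) * Uc1\<close> using cp cUc(1) pad[OF St] by (simp add: fs_mult)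
    also have "\<dots> = s * fs Uc1" unfolding gS(3)[symmetric] by (rule drop[OF gS(2)]) (unfold fc(1), rule bt.NS_Uc)
    finally show "fs Xt1 = bt.X2" unfolding bt.X2_def fc(1) .
    show "Xt1 \<in> carrier_mat n r" unfolding \<open>Xt1 = (St @\<^sub>c 0\<^sub>m n (m1 - rt1)) * Uc1\<close> by (rule mult_carrier_mat[OF cp(1) cUc(1)])
  qed
  have fYt1: "fs Yt1 = bt.Y2" "Yt1 \<in> carrier_mat n r"
  proof -
    have "fs Yt1 = fs Rt * fs Vc1 * fs Bi" unfolding \<open>Yt1 = (Rt @\<^sub>c 0\<^sub>m n (m2 - rt2)) * Vc1 * mat_inv Sc1\<close> Ib
      using cp cUc(2) Bi(1) pad[OF Rt] by (simp add: fs_mult mult.assoc)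
    also have "fs Rt * fs Vc1 = q * fs Vc1" unfolding gR(3)[symmetric] by (rule drop[OF gR(2)]) (unfold fc(2), rule bt.NR_Vc)
    finally show "fs Yt1 = bt.Y2" unfolding bt.Y2_def fc(2) .
    show "Yt1 \<in> carrier_mat n r" unfolding \<open>Yt1 = (Rt @\<^sub>c 0\<^sub>m n (m2 - rt2)) * Vc1 * mat_inv Sc1\<close> Ib
      by (rule mult_carrier_mat[OF mult_carrier_mat[OF cp(2) cUc(2)] Bi(1)])
  qed
  note red = \<open>Ah = Y1\<^sup>T * A * X1\<close> \<open>Bh = Y1\<^sup>T * B\<close> \<open>Ch = X1\<^sup>T * C\<close> \<open>Atl = Yt1\<^sup>T * A * Xt1\<close> \<open>Btl = Yt1\<^sup>T * B\<close> \<open>Ctl = Xt1\<^sup>T * C\<close>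
  have tX: "X1\<^sup>T \<in> carrier_mat r n" "Y1\<^sup>T \<in> carrier_mat r n" "Xt1\<^sup>T \<in> carrier_mat r n" "Yt1\<^sup>T \<in> carrier_mat r n"
    using cX fXt1(2) fYt1(2) by simp_all
  have cr: "Ah \<in> carrier_mat r r" "Atl \<in> carrier_mat r r" "Bh \<in> carrier_mat r m" "Btl \<in> carrier_mat r m"
      "Ch \<in> carrier_mat r p" "Ctl \<in> carrier_mat r p"
    unfolding red by (rule mult_carrier_mat[OF mult_carrier_mat[OF tX(2) A] cX(1)] mult_carrier_mat[OF mult_carrier_mat[OF tX(4) A] fXt1(2)]
      mult_carrier_mat[OF tX(2) B] mult_carrier_mat[OF tX(4) B] mult_carrier_mat[OF tX(1) C] mult_carrier_mat[OF tX(3) C])+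
  have fr: "fs Ah = tp bt.Y1 * a * bt.X1" "fs Atl = tp bt.Y2 * a * bt.X2" "fs Bh = tp bt.Y1 * b" "fs Btl = tp bt.Y2 * b"
      "fs Ch = tp bt.X1 * c" "fs Ctl = tp bt.X2 * c"
    unfolding red fX1[symmetric] fY1[symmetric] fXt1(1)[symmetric] fYt1(1)[symmetric] a_def b_def c_def
    using A B C cX fXt1(2) fYt1(2) by (simp_all add: fs_mult mult.assoc)
  have stA: "stable Ah"
  proof -
    have "stb n a" using stable_iff_stb[OF A] \<open>stable A\<close> unfolding a_def by blast
    then have "stb r (fs Ah)" unfolding fr by (rule bt.reduced_stable)
    then show ?thesis using stable_iff_stb[OF cr(1)] by blast
  qed
  have \<sigma>rp: "0 < \<sigma> r" by (rule bt.\<sigma>r_pos)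
  have d1: "d i \<le> \<sigma> 1" if "i < r" for i unfolding d_def using mono[of 1 "Suc i"] that rm by simp
  have \<sigma>1r: "\<sigma> r \<le> \<sigma> 1" using mono[of 1 r] \<open>1 \<le> r\<close> rm by simp
  have \<sigma>u: "0 < \<sigma>u" "\<sigma>u \<le> \<sigma> r" using eps4 \<epsilon>0 s20 unfolding \<open>\<sigma>u = \<sigma> r - \<epsilon>\<close> by linarith+
  note mu0 = bt.mu(1) and \<theta>0 = bt.\<theta>_ge_0
  have mu2: "2 * bt.mu \<le> 2 * \<epsilon> / \<delta>u"
  proof -
    have "\<delta>u \<le> \<sigma> r - \<sigma> (r + 1)" unfolding \<open>\<delta>u = \<delta> - 2 * \<epsilon>\<close> \<open>\<delta> = \<sigma> r - \<sigma> (r + 1)\<close> using \<epsilon>0 by simp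
    then have "\<epsilon> / (\<sigma> r - \<sigma> (r + 1)) \<le> \<epsilon> / \<delta>u" using \<epsilon>0 \<open>\<delta>u > 0\<close> by (intro divide_left_mono) simp_all
    then show ?thesis unfolding bt.mu_def by simp
  qed
  have ex: "2 * opn s * bt.mu \<le> \<epsilon>x"
  proof -
    have "opn s * (2 * bt.mu) \<le> opn s * (2 * \<epsilon> / \<delta>u)" by (intro mult_left_mono mu2) simp
    moreover have "0 \<le> sqrt \<epsilon>1" using e12 by simp
    ultimately show ?thesis unfolding \<open>\<epsilon>x = sqrt \<epsilon>1 + sqrt (norm2 P) * (2 * \<epsilon> / \<delta>u)\<close> oS[symmetric] by linarith
  qed
  have ey: "6 * (opn q / \<sigma> r) * bt.mu \<le> \<epsilon>y"
  proof -
    have "2 \<le> 2 * \<sigma> 1 / \<sigma>u" using \<sigma>u \<sigma>1r by (simp add: field_simps)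
    moreover have "0 \<le> \<delta>u / (2 * \<sigma>u)" using \<sigma>u \<open>\<delta>u > 0\<close> by simp
    ultimately have w: "3 \<le> 1 + \<delta>u / (2 * \<sigma>u) + 2 * \<sigma> 1 / \<sigma>u" by linarith
    have "opn q / \<sigma> r * 3 * (2 * bt.mu) \<le> opn q / \<sigma> r * (1 + \<delta>u / (2 * \<sigma>u) + 2 * \<sigma> 1 / \<sigma>u) * (2 * \<epsilon> / \<delta>u)"
    proof (rule mult_mono[OF mult_left_mono[OF w \<theta>0] mu2])
      show "0 \<le> opn q / \<sigma> r * (1 + \<delta>u / (2 * \<sigma>u) + 2 * \<sigma> 1 / \<sigma>u)"
        by (rule mult_nonneg_nonneg[OF \<theta>0]) (use w in linarith)
      show "0 \<le> 2 * bt.mu" using mu0 by simp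
    qed
    moreover have "0 \<le> sqrt \<epsilon>2 / \<sigma> r" using e12 \<sigma>rp by simp
    ultimately show ?thesis
      unfolding \<open>\<epsilon>y = sqrt \<epsilon>2 / \<sigma> r + sqrt (norm2 Q) / \<sigma> r * (1 + \<delta>u / (2 * \<sigma>u) + 2 * \<sigma> 1 / \<sigma>u) * (2 * \<epsilon> / \<delta>u)\<close> oR[symmetric] by simp
  qed
  have ea: "8 * (opn s * (opn q / \<sigma> r)) * bt.mu \<le> \<epsilon>a"
  proof -
    have "opn s * (6 * (opn q / \<sigma> r) * bt.mu) \<le> opn s * \<epsilon>y" "opn q / \<sigma> r * (2 * opn s * bt.mu) \<le> opn q / \<sigma> r * \<epsilon>x"
      by (rule mult_left_mono[OF ey opn_ge_0], rule mult_left_mono[OF ex \<theta>0])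
    moreover have "8 * (x * t) * k \<le> x * y + t * z" if "x * (6 * t * k) \<le> x * y" "t * (2 * x * k) \<le> t * z" for x t k y z :: real
    proof -
      have "x * (6 * t * k) = 6 * (x * t * k)" "t * (2 * x * k) = 2 * (x * t * k)" "8 * (x * t) * k = 8 * (x * t * k)" by simp_all
      then show ?thesis using that by linarith
    qed
    ultimately show ?thesis unfolding \<open>\<epsilon>a = sqrt (norm2 P) * \<epsilon>y + sqrt (norm2 Q) / \<sigma> r * \<epsilon>x\<close> oS[symmetric] oR[symmetric] by blast
  qed
  have eb2: "12 * (opn q / \<sigma> r)\<^sup>2 * bt.mu \<le> \<epsilon>b2"
  proof -
    have "1 / \<sigma> r \<le> 1 / \<sigma>u" using \<sigma>u by (simp add: frac_le)
    then have "opn q * (2 / \<sigma> r) * (6 * (opn q / \<sigma> r) * bt.mu) \<le> opn q * (1 / \<sigma>u + 1 / \<sigma> r) * \<epsilon>y"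
      using \<sigma>u \<sigma>rp mu0 by (intro mult_mono mult_left_mono ey) simp_all
    then show ?thesis unfolding \<open>\<epsilon>b2 = sqrt (norm2 Q) * (1 / \<sigma>u + 1 / \<sigma> r) * \<epsilon>y\<close> oR[symmetric] by (simp add: power2_eq_square mult_ac)
  qed
  have ec2: "4 * (opn s)\<^sup>2 * bt.mu \<le> \<epsilon>c2"
  proof -
    have "2 * opn s * (2 * opn s * bt.mu) \<le> 2 * opn s * \<epsilon>x" by (intro mult_left_mono ex) simp
    then show ?thesis unfolding \<open>\<epsilon>c2 = 2 * sqrt (norm2 P) * \<epsilon>x\<close> oS[symmetric] by (simp add: power2_eq_square)
  qed
  have eb: "6 * (opn q / \<sigma> r) * bt.mu \<le> \<epsilon>b" using ey unfolding \<open>\<epsilon>b = \<epsilon>y\<close> .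
  have nonneg: "0 \<le> \<epsilon>a" "0 \<le> \<epsilon>b" "0 \<le> \<epsilon>c"
  proof -
    have "0 \<le> 8 * (opn s * (opn q / \<sigma> r)) * bt.mu" "0 \<le> 6 * (opn q / \<sigma> r) * bt.mu" "0 \<le> 2 * opn s * bt.mu"
      by (intro mult_nonneg_nonneg mu0 \<theta>0 opn_ge_0; simp)+
    then show "0 \<le> \<epsilon>a" "0 \<le> \<epsilon>b" "0 \<le> \<epsilon>c" using ea eb ex unfolding \<open>\<epsilon>c = \<epsilon>x\<close> by linarith+
  qed
  have eta: "\<eta>1 = opn a * opn (fs K1) * \<epsilon>a" "\<eta>2 = opn a * opn (fs K2) * \<epsilon>a"
    unfolding \<open>\<eta>1 = norm2 A * norm2 K1 * \<epsilon>a\<close> \<open>\<eta>2 = norm2 A * norm2 K2 * \<epsilon>a\<close> norm2_eq_opn a_def by simp_all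
  have xi: "0 \<le> \<xi>1" "\<xi>2 = opn (fs K1) / (1 - 2 * \<eta>1) * ((opn b)\<^sup>2 * \<epsilon>b2 + 2 * opn a * \<epsilon>a)"
    unfolding \<open>\<xi>1 = norm2 K1 / (1 - \<eta>1) * (norm2 Bh * norm2 B * \<epsilon>b + norm2 A * \<epsilon>a)\<close>
      \<open>\<xi>2 = norm2 K1 / (1 - 2 * \<eta>1) * (norm2 (B * B\<^sup>T) * \<epsilon>b2 + 2 * norm2 A * \<epsilon>a)\<close> norm2_gram
    using nonneg \<open>\<eta>1 < 1 / 2\<close> by (simp_all add: norm2_eq_opn a_def b_def)
  have zeta: "0 \<le> \<zeta>1" "\<zeta>2 = opn (fs K2) / (1 - 2 * \<eta>2) * ((opn c)\<^sup>2 * \<epsilon>c2 + 2 * opn a * \<epsilon>a)"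
    unfolding \<open>\<zeta>1 = norm2 K2 / (1 - \<eta>2) * (norm2 Ch * norm2 C * \<epsilon>c + norm2 A * \<epsilon>a)\<close>
      \<open>\<zeta>2 = norm2 K2 / (1 - 2 * \<eta>2) * (norm2 (C * C\<^sup>T) * \<epsilon>c2 + 2 * norm2 A * \<epsilon>a)\<close> norm2_gram
    using nonneg \<open>\<eta>2 < 1 / 2\<close> by (simp_all add: norm2_eq_opn a_def c_def)
  note tb = bt.truncation_bounds[OF cr stA fr d1
      \<open>K1 = mat_integral {0..} r r (\<lambda>t. mat_exp (t \<cdot>\<^sub>m Ah) * mat_exp (t \<cdot>\<^sub>m Ah\<^sup>T))\<close>
      \<open>K2 = mat_integral {0..} r r (\<lambda>t. mat_exp (t \<cdot>\<^sub>m Ah\<^sup>T) * mat_exp (t \<cdot>\<^sub>m Ah))\<close>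
      ea eb eb2 ec2 eta \<open>\<eta>1 < 1 / 2\<close> \<open>\<eta>2 < 1 / 2\<close> xi zeta \<open>Hbt = transfer_fun Ah Bh Ch\<close> \<open>Htbt = transfer_fun Atl Btl Ctl\<close>]
  have rH: "stable_realization H A B C"
    unfolding stable_realization_def \<open>H = transfer_fun A B C\<close> using A B C \<open>stable A\<close> \<open>1 \<le> r\<close> \<open>r \<le> n\<close> by auto
  have rh: "stable_realization Hbt Ah Bh Ch"
    unfolding stable_realization_def \<open>Hbt = transfer_fun Ah Bh Ch\<close> using cr stA \<open>1 \<le> r\<close> by auto
  have rt: "stable_realization Htbt Atl Btl Ctl"
    unfolding stable_realization_def \<open>Htbt = transfer_fun Atl Btl Ctl\<close> using cr tb(1) \<open>1 \<le> r\<close> by auto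
  have dims: "dim_col B = dim_col Bh" "dim_col C = dim_col (- Ch)" "dim_col Bh = dim_col Btl" "dim_col Ch = dim_col (- Ctl)"
    "dim_col (B @\<^sub>r Bh) = dim_col (Bh @\<^sub>r Btl)" "dim_col (C @\<^sub>r - Ch) = dim_col (Ch @\<^sub>r - Ctl)"
    unfolding append_rows_def using B C cr by auto
  note tri = norms_triangle[OF stable_realization_add[OF rH stable_realization_uminus[OF rh] dims(1,2)]
      stable_realization_add[OF rh stable_realization_uminus[OF rt] dims(3,4)] dims(5,6)]
  have c: "H x \<in> carrier_mat p m" "Hbt x \<in> carrier_mat p m" "Htbt x \<in> carrier_mat p m" for x
    unfolding \<open>H = transfer_fun A B C\<close> \<open>Hbt = transfer_fun Ah Bh Ch\<close> \<open>Htbt = transfer_fun Atl Btl Ctl\<close>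
    by (rule transfer_fun_carrier[OF B C] transfer_fun_carrier[OF cr(3,5)] transfer_fun_carrier[OF cr(4,6)])+
  have e1: "(\<lambda>x. H x + - Hbt x + (Hbt x + - Htbt x)) = (\<lambda>x. H x - Htbt x)"
  proof
    fix x show "H x + - Hbt x + (Hbt x + - Htbt x) = H x - Htbt x" by (rule eq_matI) (use c[of x] in auto)
  qed
  have e2: "(\<lambda>x. H x + - Hbt x) = (\<lambda>x. H x - Hbt x)"
  proof
    fix x show "H x + - Hbt x = H x - Hbt x" by (rule eq_matI) (use c[of x] in auto)
  qed
  have "hankel_norm (\<lambda>x. Hbt x + - Htbt x) \<le> \<epsilon>dH"
    using tb(2) unfolding \<open>\<epsilon>dH = sqrt (2 * (\<sigma> 1)\<^sup>2 * (\<xi>1 + \<xi>2) + 2 * (\<zeta>1 + \<zeta>2) + (\<xi>1 + \<xi>2) * (\<zeta>1 + \<zeta>2))\<close> .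
  moreover have "h2_norm (\<lambda>x. Hbt x + - Htbt x) \<le> \<epsilon>d2"
    using tb(3) unfolding \<open>\<epsilon>d2 = sqrt (real (min r m)) * sqrt ((\<sigma> 1)\<^sup>2 * (norm2 Bh + norm2 Btl) * norm2 B * \<epsilon>b
             + (2 * norm2 (Bh\<^sup>T) * norm2 Btl * \<zeta>1 + (norm2 (Btl\<^sup>T))\<^sup>2 * \<zeta>2))\<close> norm2_eq_opn fs_transpose opn_tp b_def .
  ultimately show ?thesis using tri unfolding e1 e2 by linarith
qed

end
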